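(* Fix a prime $p\geq 3$ and, for $n\ge 1$, let $t^\omega(n,p) := \operatorname{rank}\, \widetilde{\mathrm{H}}_{n-1}\big(|\mathcal{T}^\omega_{2n}(\mathbb{Q})|/\Gamma_{2n}^\omega(p);\mathbb{Z}\big)$. For every $n\geq 1$, $t^\omega(n,p)$ equals $$\sum_{0=m_{-1}<m_0<\dots<m_k\leq n}\left(\prod_{i=0}^{k-1}\left(p^{\binom{m_{i+1}-m_i}{2}}\prod_{j=0}^{m_i-1}\frac{p^{m_{i+1}-j}-1}{p^{m_i-j}-1}\right)\right)\left(\prod_{i=0}^{m_k-1}\frac{p^{2n-2i}-1}{p^{m_k-i}-1}\right)p^{\binom{m_0}{2}+(n-m_k)^2}\left(\frac{p-3}{2}\right)^{k+1},$$ where the sum runs over all $k\ge -1$ and all strictly increasing integer sequences $0=m_{-1}<m_0<\dots<m_k\le n$; the sequence with $k=-1$ (consisting of $m_{-1}=0$ only) contributes the term $p^{n^2}$.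
   Context: $\mathbb{Z}^{2n}$, $\mathbb{Q}^{2n}$ carry the standard symplectic form $\omega$ ($\omega(\vec e_i,\vec e_j)=\omega(\vec f_i,\vec f_j)=0$, $\omega(\vec e_i,\vec f_j)=\delta_{ij}$). $\Gamma_{2n}^\omega(p)=\ker(\mathrm{Sp}_{2n}(\mathbb{Z})\to\mathrm{Sp}_{2n}(\mathbb{Z}/p\mathbb{Z}))$. The symplectic Tits building $\mathcal{T}^\omega_{2n}(\mathbb{Q})$ is the order complex of the poset of proper nonzero isotropic subspaces of $\mathbb{Q}^{2n}$ (subspaces $U$ with $\omega|_U\equiv0$) ordered by inclusion; $|\cdot|$ denotes geometric realization and $|\mathcal{T}^\omega_{2n}(\mathbb{Q})|/\Gamma_{2n}^\omega(p)$ is the topological quotient by the induced action. Empty products equal $1$, and $\left(\frac{p-3}{2}\right)^0=1$ (also when $p=3$). *)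

theory Defs
  imports
    "HOL-Homology.Homology"
    "Jordan_Normal_Form.VS_Connect"
    "HOL-Library.Extended_Nat"
    "HOL-Library.Extended_Real"
begin

unbundle no vec_syntax

text \<open>Coordinates of \<open>R\<^sup>2\<^sup>n\<close> are ordered as \<open>e\<^sub>1, \<dots>, e\<^sub>n, f\<^sub>1, \<dots>, f\<^sub>n\<close>: index \<open>i < n\<close> belongs to
  \<open>e\<close> and index \<open>n + i\<close> to \<open>f\<close>.\<close>

definition symp_form :: "nat \<Rightarrow> 'a::comm_ring_1 Matrix.vec \<Rightarrow> 'a Matrix.vec \<Rightarrow> 'a" where
  "symp_form n v w = (\<Sum>i<n. v $ i * w $ (n + i) - v $ (n + i) * w $ i)"

text \<open>No invertibility condition is needed: preserving the form means \<open>A\<^sup>T J A = J\<close> with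
  \<open>det J = 1\<close>, so such an \<open>A\<close> is automatically invertible over the base ring.\<close>

definition Sp :: "nat \<Rightarrow> 'a::comm_ring_1 mat set" where
  "Sp n = {A \<in> carrier_mat (2 * n) (2 * n).
     \<forall>v \<in> carrier_vec (2 * n). \<forall>w \<in> carrier_vec (2 * n).
       symp_form n (A *\<^sub>v v) (A *\<^sub>v w) = symp_form n v w}"

text \<open>Entries modulo \<open>p\<close> are represented by their residues.\<close>

definition Gamma_omega :: "nat \<Rightarrow> nat \<Rightarrow> int mat set" where
  "Gamma_omega n p = {A \<in> Sp n.
     map_mat (\<lambda>a. a mod int p) A = map_mat (\<lambda>a. a mod int p) (1\<^sub>m (2 * n))}"

definition order_complex :: "'a set set \<Rightarrow> 'a set set set" where
  "order_complex P = {\<sigma>. finite \<sigma> \<and> \<sigma> \<noteq> {} \<and> subset.chain P \<sigma>}"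

text \<open>Points of the realization are given by barycentric coordinates. The realization carries
  the weak (coherent) topology, which for complexes that are not locally finite differs from the
  subspace topology of the product.\<close>

definition closed_simplex :: "'v set \<Rightarrow> ('v \<Rightarrow> real) set" where
  "closed_simplex \<sigma> = {x. (\<forall>v. 0 \<le> x v) \<and> {v. x v \<noteq> 0} \<subseteq> \<sigma> \<and> sum x \<sigma> = 1}"

definition realization :: "'v set set \<Rightarrow> ('v \<Rightarrow> real) topology" where
  "realization K = topology (\<lambda>U. U \<subseteq> (\<Union>\<sigma>\<in>K. closed_simplex \<sigma>) \<and>
     (\<forall>\<sigma>\<in>K. openin (top_of_set (closed_simplex \<sigma>)) (closed_simplex \<sigma> \<inter> U)))"

lemma openin_realization:
  "openin (realization K) U \<longleftrightarrow> U \<subseteq> (\<Union>\<sigma>\<in>K. closed_simplex \<sigma>) \<and>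
     (\<forall>\<sigma>\<in>K. openin (top_of_set (closed_simplex \<sigma>)) (closed_simplex \<sigma> \<inter> U))"
proof -
  have "istopology (\<lambda>U. U \<subseteq> (\<Union>\<sigma>\<in>K. closed_simplex \<sigma>) \<and>
     (\<forall>\<sigma>\<in>K. openin (top_of_set (closed_simplex \<sigma>)) (closed_simplex \<sigma> \<inter> U)))"
    unfolding istopology_def
  proof (intro conjI allI impI ballI)
    fix S T \<sigma>
    assume "S \<subseteq> (\<Union>\<sigma>\<in>K. closed_simplex \<sigma>) \<and>
      (\<forall>\<sigma>\<in>K. openin (top_of_set (closed_simplex \<sigma>)) (closed_simplex \<sigma> \<inter> S))"
      "T \<subseteq> (\<Union>\<sigma>\<in>K. closed_simplex \<sigma>) \<and>
      (\<forall>\<sigma>\<in>K. openin (top_of_set (closed_simplex \<sigma>)) (closed_simplex \<sigma> \<inter> T))" "\<sigma> \<in> K"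
    then have "openin (top_of_set (closed_simplex \<sigma>))
        ((closed_simplex \<sigma> \<inter> S) \<inter> (closed_simplex \<sigma> \<inter> T))"
      by - (rule openin_Int; simp)
    moreover have "(closed_simplex \<sigma> \<inter> S) \<inter> (closed_simplex \<sigma> \<inter> T) = closed_simplex \<sigma> \<inter> (S \<inter> T)"
      by blast
    ultimately show "openin (top_of_set (closed_simplex \<sigma>)) (closed_simplex \<sigma> \<inter> (S \<inter> T))"
      by simp
  next
    fix \<K> \<sigma>
    assume "\<forall>U\<in>\<K>. U \<subseteq> (\<Union>\<sigma>\<in>K. closed_simplex \<sigma>) \<and>
      (\<forall>\<sigma>\<in>K. openin (top_of_set (closed_simplex \<sigma>)) (closed_simplex \<sigma> \<inter> U))" "\<sigma> \<in> K"
    then have "openin (top_of_set (closed_simplex \<sigma>)) (\<Union>U\<in>\<K>. closed_simplex \<sigma> \<inter> U)"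
      by (intro openin_Union) auto
    then show "openin (top_of_set (closed_simplex \<sigma>)) (closed_simplex \<sigma> \<inter> \<Union>\<K>)"
      by (simp only: Int_Union)
  qed blast+
  then show ?thesis
    by (simp add: realization_def)
qed

lemma topspace_realization: "topspace (realization K) = (\<Union>\<sigma>\<in>K. closed_simplex \<sigma>)"
proof
  show "topspace (realization K) \<subseteq> (\<Union>\<sigma>\<in>K. closed_simplex \<sigma>)"
    by (rule openin_realization[THEN iffD1, THEN conjunct1]) (rule openin_topspace)
  have "closed_simplex \<sigma> \<inter> (\<Union>\<sigma>\<in>K. closed_simplex \<sigma>) = closed_simplex \<sigma>" if "\<sigma> \<in> K" for \<sigma>
    using that by blast
  then show "(\<Union>\<sigma>\<in>K. closed_simplex \<sigma>) \<subseteq> topspace (realization K)"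
    by (intro openin_subset) (simp add: openin_realization)
qed

text \<open>The map on realizations induced by a simplicial map, extending it affinely over simplices.\<close>

definition realization_map :: "('v \<Rightarrow> 'w) \<Rightarrow> ('v \<Rightarrow> real) \<Rightarrow> ('w \<Rightarrow> real)" where
  "realization_map f x = (\<lambda>w. \<Sum>v | x v \<noteq> 0 \<and> f v = w. x v)"

definition quotient_topology :: "'a topology \<Rightarrow> ('a \<Rightarrow> 'b) \<Rightarrow> 'b topology" where
  "quotient_topology X q = topology (\<lambda>U. U \<subseteq> q ` topspace X \<and>
     openin X {x \<in> topspace X. q x \<in> U})"

lemma openin_quotient_topology:
  "openin (quotient_topology X q) U \<longleftrightarrow>
     U \<subseteq> q ` topspace X \<and> openin X {x \<in> topspace X. q x \<in> U}"
proof -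
  have "istopology (\<lambda>U. U \<subseteq> q ` topspace X \<and> openin X {x \<in> topspace X. q x \<in> U})"
    unfolding istopology_def
  proof (intro conjI allI impI)
    fix S T
    assume "S \<subseteq> q ` topspace X \<and> openin X {x \<in> topspace X. q x \<in> S}"
      "T \<subseteq> q ` topspace X \<and> openin X {x \<in> topspace X. q x \<in> T}"
    then have "openin X ({x \<in> topspace X. q x \<in> S} \<inter> {x \<in> topspace X. q x \<in> T})"
      by (intro openin_Int) auto
    moreover have "{x \<in> topspace X. q x \<in> S} \<inter> {x \<in> topspace X. q x \<in> T}
        = {x \<in> topspace X. q x \<in> S \<inter> T}"
      by blast
    ultimately show "openin X {x \<in> topspace X. q x \<in> S \<inter> T}"
      by simp
  next
    fix \<K>
    assume "\<forall>U\<in>\<K>. U \<subseteq> q ` topspace X \<and> openin X {x \<in> topspace X. q x \<in> U}"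
    then have "openin X (\<Union>U\<in>\<K>. {x \<in> topspace X. q x \<in> U})"
      by (intro openin_Union) auto
    moreover have "(\<Union>U\<in>\<K>. {x \<in> topspace X. q x \<in> U}) = {x \<in> topspace X. q x \<in> \<Union>\<K>}"
      by blast
    ultimately show "openin X {x \<in> topspace X. q x \<in> \<Union>\<K>}"
      by simp
  qed blast+
  then show ?thesis
    by (simp add: quotient_topology_def)
qed

lemma quotient_map_quotient_topology: "quotient_map X (quotient_topology X q) q"
proof -
  have "{x \<in> topspace X. q x \<in> q ` topspace X} = topspace X"
    by blast
  then have "openin (quotient_topology X q) (q ` topspace X)"
    by (simp add: openin_quotient_topology)
  moreover have "topspace (quotient_topology X q) \<subseteq> q ` topspace X"
    by (rule openin_quotient_topology[THEN iffD1, THEN conjunct1]) (rule openin_topspace)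
  ultimately have "topspace (quotient_topology X q) = q ` topspace X"
    by (simp add: openin_subset subset_antisym)
  then show ?thesis
    by (auto simp: quotient_map_def openin_quotient_topology)
qed

definition isotropic_subspaces :: "nat \<Rightarrow> rat Matrix.vec set set" where
  "isotropic_subspaces n = {U.
     VectorSpace.subspace class_ring U (module_vec TYPE(rat) (2 * n)) \<and>
     U \<noteq> {0\<^sub>v (2 * n)} \<and> U \<noteq> carrier_vec (2 * n) \<and>
     (\<forall>v \<in> U. \<forall>w \<in> U. symp_form n v w = 0)}"

definition tits_building :: "nat \<Rightarrow> rat Matrix.vec set set set" where
  "tits_building n = order_complex (isotropic_subspaces n)"

definition act_subspace :: "int mat \<Rightarrow> rat Matrix.vec set \<Rightarrow> rat Matrix.vec set" where
  "act_subspace A U = (\<lambda>v. map_mat of_int A *\<^sub>v v) ` U"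

definition Gamma_orbit ::
    "nat \<Rightarrow> nat \<Rightarrow> (rat Matrix.vec set \<Rightarrow> real) \<Rightarrow> (rat Matrix.vec set \<Rightarrow> real) set" where
  "Gamma_orbit n p x = {realization_map (act_subspace A) x | A. A \<in> Gamma_omega n p}"

definition building_quotient :: "nat \<Rightarrow> nat \<Rightarrow> (rat Matrix.vec set \<Rightarrow> real) set topology" where
  "building_quotient n p = quotient_topology (realization (tits_building n)) (Gamma_orbit n p)"

definition Z_independent :: "('a, 'b) monoid_scheme \<Rightarrow> 'a set \<Rightarrow> bool" where
  "Z_independent G S \<longleftrightarrow> finite S \<and> S \<subseteq> carrier G \<and>
     (\<forall>c :: 'a \<Rightarrow> int. finprod G (\<lambda>x. x [^]\<^bsub>G\<^esub> c x) S = \<one>\<^bsub>G\<^esub> \<longrightarrow> (\<forall>x\<in>S. c x = 0))"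

definition abelian_rank :: "('a, 'b) monoid_scheme \<Rightarrow> enat" where
  "abelian_rank G = (SUP S \<in> {S. Z_independent G S}. enat (card S))"

definition t_omega :: "nat \<Rightarrow> nat \<Rightarrow> enat" where
  "t_omega n p = abelian_rank (reduced_homology_group (int n - 1) (building_quotient n p))"

text \<open>The list \<open>[m\<^sub>0, \<dots>, m\<^sub>k]\<close> stands for the sequence \<open>0 = m\<^sub>-\<^sub>1 < m\<^sub>0 < \<dots> < m\<^sub>k \<le> n\<close>, so that its
  length is \<open>k + 1\<close> and the empty list is the case \<open>k = -1\<close>.\<close>

definition index_seqs :: "nat \<Rightarrow> nat list set" where
  "index_seqs n = {ms. sorted_wrt (<) (0 # ms) \<and> last (0 # ms) \<le> n}"

lemma finite_index_seqs: "finite (index_seqs n)"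
proof -
  have "set ms \<subseteq> {..n} \<and> distinct ms" if "ms \<in> index_seqs n" for ms
  proof -
    have s: "sorted_wrt (<) (0 # ms)" and l: "last (0 # ms) \<le> n"
      using that by (auto simp: index_seqs_def)
    have "sorted ms" "distinct ms"
      using s by (auto simp: strict_sorted_iff)
    moreover have "x \<le> n" if "x \<in> set ms" for x
      using \<open>sorted ms\<close> l that
      by (cases ms rule: rev_cases) (auto simp: sorted_append split: if_splits)
    ultimately show ?thesis
      by auto
  qed
  then have "index_seqs n \<subseteq> {ms. set ms \<subseteq> {..n} \<and> distinct ms}"
    by blast
  then show ?thesis
    by (rule finite_subset) (simp add: finite_subset_distinct)
qed

end

theory Submission
  imports Defs "HOL-Library.Function_Algebras" "Jordan_Normal_Form.Determinant" "HOL-Number_Theory.Cong"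
begin

text \<open>A rational subspace \<open>U\<close> corresponds to the pure sublattice \<open>U \<inter> \<int>\<^sup>2\<^sup>n\<close>, and reduction modulo \<open>p\<close> sends
  isotropic subspaces of \<open>\<rat>\<^sup>2\<^sup>n\<close> to isotropic subspaces of \<open>(\<int>/p)\<^sup>2\<^sup>n\<close>. Two isotropic lattices with the
  same reduction \<open>V\<close> lie in one orbit of the congruence group if and only if their bases, written
  modulo \<open>p\<close> in a fixed basis of \<open>V\<close>, have the same determinant up to sign; this gives \<open>(p - 1) / 2\<close>
  orbits over each \<open>V\<close>. Since frames that agree modulo \<open>p\<close> are related by the congruence group, chains
  of lattices are classified by the orbits of their members, and every chain of reductions with
  arbitrary labels lifts. Hence the quotient is the finite flag complex whose vertices are the pairs
  \<open>(V, c)\<close> with \<open>V\<close> a nonzero isotropic subspace of \<open>(\<int>/p)\<^sup>2\<^sup>n\<close> and \<open>c < (p - 1) / 2\<close>.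

  The pairs with \<open>c = 0\<close> form the Tits building over the prime field, a wedge of \<open>p\<close> to the power
  \<open>n\<^sup>2\<close> spheres. The remaining vertices are attached in the order of increasing dimension; each one is
  coned off along its link, the join of the inflated interval below \<open>V\<close> and the building of
  \<open>V\<^sup>\<bottom> / V\<close>. Both are spherical, so the ranks add up, and unfolding the resulting recursion over
  \<open>V\<close> produces the sum over index sequences.\<close>

subsection \<open>Ranks of abelian groups\<close>

text \<open>Symplectic groups enter through partial symplectic bases: \<open>psb m k a b\<close>
  treats relations over the integers and modulo \<open>p\<close> at once, and lifting such a basis
  from residues to integers, with a prescribed integral initial part, does the work of surjectivity
  of reduction. The obstacle is that an integral change of basis has determinant 1 or -1. While an
  index is left over, row operations bring prescribed residues into a basis; only the last vector
  stays determined up to a unit, and this unit is the orbit invariant. Strict inclusions therefore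
  matter throughout: a proper sublattice leaves an index over. With p = 2 m + 1 there are m labels;
  the constant (p - 3) / 2 = m - 1 counts the labels other than 0, which are the ones attached to
  the building. Sphericity is recorded as a recipe for building a complex rather than as a statement
  on homology, so that joins are handled by induction over the recipe and exact sequences are used
  in one place only. Finiteness of the target complex reconciles the weak topology of the
  realization with the product topology.\<close>

lemma integer_dependence:
  fixes v :: "'a \<Rightarrow> nat \<Rightarrow> int"
  assumes "finite T" "card T > k"
  shows "\<exists>c. (\<exists>t\<in>T. c t \<noteq> 0) \<and> (\<forall>i<k. (\<Sum>t\<in>T. c t * v t i) = 0)"
  using assms
proof (induction k arbitrary: T v)
  case 0
  then obtain t where "t \<in> T" by fastforce
  then show ?case by (intro exI[of _ "\<lambda>_. 1"]) auto
next
  case (Suc k)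
  show ?case
  proof (cases "\<forall>t\<in>T. v t k = 0")
    case True
    obtain c where c: "\<exists>t\<in>T. c t \<noteq> 0" "\<forall>i<k. (\<Sum>t\<in>T. c t * v t i) = 0"
      using Suc.IH[of T v] Suc.prems by auto
    then show ?thesis using True by (intro exI[of _ c]) (auto simp: less_Suc_eq)
  next
    case False
    then obtain t0 where t0: "t0 \<in> T" "v t0 k \<noteq> 0" by blast
    \<comment> \<open>Fraction-free elimination with pivot \<open>t0\<close>: coordinate
      \<open>k\<close> of every \<open>w t\<close> vanishes, so a relation in the other
      \<open>k\<close> coordinates suffices.\<close>
    define w where "w t i = v t0 k * v t i - v t k * v t0 i" for t i
    have "card (T - {t0}) > k" using Suc.prems t0 by simp
    then obtain c where c: "\<exists>t\<in>T - {t0}. c t \<noteq> 0"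
        "\<forall>i<k. (\<Sum>t\<in>T - {t0}. c t * w t i) = 0"
      using Suc.IH[of "T - {t0}" w] Suc.prems by auto
    \<comment> \<open>Expanding \<open>w\<close> turns a relation among the \<open>w t\<close> into
      one among the \<open>v t\<close>; the pivot receives the collected coefficient.\<close>
    define d where "d t = (if t = t0 then - (\<Sum>t\<in>T - {t0}. c t * v t k) else c t * v t0 k)" for t
    have eq: "(\<Sum>t\<in>T. d t * v t i) = (\<Sum>t\<in>T - {t0}. c t * w t i)" for i
    proof -
      have "(\<Sum>t\<in>T. d t * v t i) = d t0 * v t0 i + (\<Sum>t\<in>T - {t0}. d t * v t i)"
        using Suc.prems t0 by (subst sum.remove[of _ t0]) auto
      also have "(\<Sum>t\<in>T - {t0}. d t * v t i) = (\<Sum>t\<in>T - {t0}. c t * v t0 k * v t i)"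
        by (intro sum.cong) (auto simp: d_def)
      also have "d t0 * v t0 i + \<dots> = (\<Sum>t\<in>T - {t0}. c t * w t i)"
        by (simp add: d_def w_def sum_distrib_left algebra_simps sum_subtractf)
      finally show ?thesis .
    qed
    have "(\<Sum>t\<in>T - {t0}. c t * w t k) = 0" by (simp add: w_def)
    then have "\<forall>i<Suc k. (\<Sum>t\<in>T. d t * v t i) = 0"
      using c by (auto simp: eq less_Suc_eq)
    moreover have "\<exists>t\<in>T. d t \<noteq> 0" using c t0 by (auto simp: d_def)
    ultimately show ?thesis by blast
  qed
qed

text \<open>Turns the multiplicative relation tested by \<open>Z_independent\<close> into a linear
  relation between integer functions of finite support, where elimination applies.\<close>

lemma lookup_hom_finprod:
  fixes h :: "'a \<Rightarrow> 'i \<Rightarrow>\<^sub>0 int"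
  assumes G: "comm_group G" and h: "h \<in> hom G (free_Abelian_group I)"
    and S: "finite S" "S \<subseteq> carrier G"
  shows "h (finprod G (\<lambda>x. x [^]\<^bsub>G\<^esub> (c x :: int)) S) = (\<Sum>x\<in>S. frag_cmul (c x) (h x))"
  using S
proof (induction S rule: finite_induct)
  case empty
  interpret comm_group G by fact
  interpret group_hom G "free_Abelian_group I" h
    using h by (simp add: group_hom_def group_hom_axioms_def)
  show ?case using hom_one by simp
next
  case (insert x F)
  interpret comm_group G by fact
  interpret H: group_hom G "free_Abelian_group I" h
    using h by (simp add: group_hom_def group_hom_axioms_def)
  have "(\<lambda>x. x [^]\<^bsub>G\<^esub> c x) \<in> F \<rightarrow> carrier G" "x [^]\<^bsub>G\<^esub> c x \<in> carrier G" "x \<in> carrier G"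
    using insert.prems by auto
  moreover have "h (x [^]\<^bsub>G\<^esub> c x) = frag_cmul (c x) (h x)"
    using H.hom_int_pow[of x "c x"] \<open>x \<in> carrier G\<close> H.hom_closed[of x] by simp
  ultimately show ?case
    using insert.hyps insert.prems insert.IH by simp
qed

text \<open>The elements pulled back from the standard basis are independent, and
  \<open>integer_dependence\<close> bounds every independent set by the number \<open>k\<close> of
  coordinates.\<close>

lemma abelian_rank_eq:
  assumes G: "comm_group G" and iso: "G \<cong> free_Abelian_group {..<k::nat}"
  shows "abelian_rank G = enat k"
proof -
  interpret comm_group G by fact
  obtain h where h: "h \<in> iso G (free_Abelian_group {..<k})"
    using iso by (auto simp: is_iso_def)
  then have hom: "h \<in> hom G (free_Abelian_group {..<k})"
    and inj: "inj_on h (carrier G)" and im: "h ` carrier G = carrier (free_Abelian_group {..<k})"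
    by (auto simp: iso_iff)
  interpret H: group_hom G "free_Abelian_group {..<k}" h
    using hom by (simp add: group_hom_def group_hom_axioms_def)
  have upper: "card S \<le> k" if S: "Z_independent G S" for S
  proof (rule ccontr)
    assume "\<not> card S \<le> k"
    then obtain c where c: "\<exists>t\<in>S. c t \<noteq> 0"
        "\<forall>i<k. (\<Sum>t\<in>S. c t * Poly_Mapping.lookup (h t) i) = 0"
      using integer_dependence[of S k "\<lambda>t. Poly_Mapping.lookup (h t)"] S
      by (auto simp: Z_independent_def)
    let ?x = "finprod G (\<lambda>x. x [^]\<^bsub>G\<^esub> c x) S"
    have sub: "S \<subseteq> carrier G" "finite S" using S by (auto simp: Z_independent_def)
    have x: "?x \<in> carrier G" using sub by (intro finprod_closed) auto
    have "h ?x = (\<Sum>x\<in>S. frag_cmul (c x) (h x))"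
      using lookup_hom_finprod[OF G hom sub(2,1)] .
    moreover have "Poly_Mapping.lookup (\<Sum>x\<in>S. frag_cmul (c x) (h x)) i = 0" for i
    proof (cases "i < k")
      case True
      then show ?thesis using c by (simp add: lookup_sum)
    next
      case False
      have "Poly_Mapping.lookup (h t) i = 0" if "t \<in> S" for t
        using H.hom_closed[of t] sub that False by (force simp: in_keys_iff)
      then show ?thesis by (simp add: lookup_sum)
    qed
    ultimately have "h ?x = 0" by (simp add: poly_mapping_eqI)
    then have "h ?x = h \<one>\<^bsub>G\<^esub>" using H.hom_one by simp
    then have "?x = \<one>\<^bsub>G\<^esub>" using x inj by (rule_tac inj_onD[OF inj]) auto
    then show False using S c(1) by (auto simp: Z_independent_def)
  qed
  define e where "e i = inv_into (carrier G) h (frag_of i)" for i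
  have e: "e i \<in> carrier G" "h (e i) = frag_of i" if "i < k" for i
    using that im by (auto simp: e_def intro!: inv_into_into f_inv_into_f)
  have inj_e: "inj_on e {..<k}"
    by (rule inj_onI) (metis e(2) frag_of_eq lessThan_iff)
  have "Z_independent G (e ` {..<k})"
    unfolding Z_independent_def
  proof (intro conjI allI impI)
    fix c :: "_ \<Rightarrow> int" assume "(\<Otimes>\<^bsub>G\<^esub>x\<in>e ` {..<k}. x [^]\<^bsub>G\<^esub> c x) = \<one>\<^bsub>G\<^esub>"
    then have "0 = (\<Sum>x\<in>e ` {..<k}. frag_cmul (c x) (h x))"
      using lookup_hom_finprod[OF G hom, of "e ` {..<k}" c] e H.hom_one by auto
    also have "\<dots> = (\<Sum>i<k. frag_cmul (c (e i)) (frag_of i))"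
      using inj_e e by (simp add: sum.reindex)
    finally have z: "0 = (\<Sum>i<k. frag_cmul (c (e i)) (frag_of i))" .
    have "c (e j) = 0" if "j < k" for j
    proof -
      have "Poly_Mapping.lookup (\<Sum>i<k. frag_cmul (c (e i)) (frag_of i)) j
          = c (e j)"
        using that by (simp add: lookup_sum if_distrib[of "\<lambda>x. _ * x"] cong: if_cong)
      then show ?thesis using z by (metis lookup_zero)
    qed
    then show "\<forall>x\<in>e ` {..<k}. c x = 0" by auto
  qed (use e in auto)
  moreover have "card (e ` {..<k}) = k" using inj_e by (simp add: card_image)
  ultimately show ?thesis
    unfolding abelian_rank_def using upper
    by (intro antisym SUP_least) (auto intro!: SUP_upper2)
qed

text \<open>After the second index set is moved to \<open>{k..<k + l}\<close>, the two supports are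
  disjoint, so adding the components is bijective.\<close>

lemma free_Abelian_group_DirProd:
  "free_Abelian_group {..<k} \<times>\<times> free_Abelian_group {..<l} \<cong> free_Abelian_group {..<k + l :: nat}"
proof -
  have "free_Abelian_group {..<l} \<cong> free_Abelian_group {k..<k + l}"
    unfolding isomorphic_free_Abelian_groups by (simp add: eqpoll_iff_card)
  then have "free_Abelian_group {..<k} \<times>\<times> free_Abelian_group {..<l}
      \<cong> free_Abelian_group {..<k} \<times>\<times> free_Abelian_group {k..<k + l}"
    by (simp add: group.DirProd_iso_trans iso_refl)
  also have "\<dots> \<cong> free_Abelian_group {..<k + l}"
  proof -
    have "(\<lambda>(x, y). x + y) \<in> iso (free_Abelian_group {..<k} \<times>\<times> free_Abelian_group {k..<k + l})
        (free_Abelian_group {..<k + l})"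
    proof (rule isoI)
      show "(\<lambda>(x, y). x + y) \<in> hom (free_Abelian_group {..<k} \<times>\<times> free_Abelian_group {k..<k + l})
          (free_Abelian_group {..<k + l})"
      proof (rule homI, goal_cases)
        case (1 x)
        then have "Poly_Mapping.keys (fst x) \<union> Poly_Mapping.keys (snd x) \<subseteq> {..<k + l}" by fastforce
        then show ?case using keys_add[of "fst x" "snd x"] by (auto split: prod.splits)
      qed auto
      show "bij_betw (\<lambda>(x, y). x + y) (carrier (free_Abelian_group {..<k} \<times>\<times> free_Abelian_group {k..<k + l}))
          (carrier (free_Abelian_group {..<k + l}))"
        unfolding bij_betw_def
      proof (intro conjI inj_onI)
        fix u v :: "(nat \<Rightarrow>\<^sub>0 int) \<times> (nat \<Rightarrow>\<^sub>0 int)"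
        assume u: "u \<in> carrier (free_Abelian_group {..<k} \<times>\<times> free_Abelian_group {k..<k + l})"
          and v: "v \<in> carrier (free_Abelian_group {..<k} \<times>\<times> free_Abelian_group {k..<k + l})"
          and eq: "(case u of (x, y) \<Rightarrow> x + y) = (case v of (x, y) \<Rightarrow> x + y)"
        obtain a b a' b' where uv: "u = (a, b)" "v = (a', b')" by fastforce
        have eq': "Poly_Mapping.lookup a i + Poly_Mapping.lookup b i
            = Poly_Mapping.lookup a' i + Poly_Mapping.lookup b' i" for i
          using eq by (metis case_prod_conv lookup_add uv)
        have ks: "Poly_Mapping.keys a \<subseteq> {..<k}" "Poly_Mapping.keys a' \<subseteq> {..<k}"
            "Poly_Mapping.keys b \<subseteq> {k..<k + l}" "Poly_Mapping.keys b' \<subseteq> {k..<k + l}"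
          using u v by (auto simp: uv)
        have z: "i \<ge> k \<Longrightarrow> Poly_Mapping.lookup a i = 0 \<and> Poly_Mapping.lookup a' i = 0"
            "i < k \<Longrightarrow> Poly_Mapping.lookup b i = 0 \<and> Poly_Mapping.lookup b' i = 0" for i
          using ks by (meson in_keys_iff subsetD atLeastLessThan_iff lessThan_iff not_le)+
        have "Poly_Mapping.lookup a i = Poly_Mapping.lookup a' i
            \<and> Poly_Mapping.lookup b i = Poly_Mapping.lookup b' i" for i
          using eq'[of i] z[of i] by (cases "i < k") auto
        then have "a = a'" "b = b'"
          by (auto intro: poly_mapping_eqI)
        then show "u = v" by (simp add: uv)
      next
        show "(\<lambda>(x, y). x + y) ` carrier (free_Abelian_group {..<k} \<times>\<times> free_Abelian_group {k..<k + l})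
            = carrier (free_Abelian_group {..<k + l})"
        proof (intro equalityI subsetI)
          fix c assume "c \<in> carrier (free_Abelian_group {..<k + l})"
          then have "Poly_Mapping.keys c \<subseteq> {..<k} \<union> {k..<k + l}" by auto
          then obtain d e where "Poly_Mapping.keys d \<subseteq> {..<k}" "Poly_Mapping.keys e \<subseteq> {k..<k + l}" "d + e = c"
            using frag_split by blast
          then show "c \<in> (\<lambda>(x, y). x + y) ` carrier (free_Abelian_group {..<k} \<times>\<times> free_Abelian_group {k..<k + l})"
            by (intro image_eqI[of _ _ "(d, e)"]) auto
        next
          fix c assume "c \<in> (\<lambda>(x, y). x + y) ` carrier (free_Abelian_group {..<k} \<times>\<times> free_Abelian_group {k..<k + l})"
          then obtain x y where xy: "c = x + y" "Poly_Mapping.keys x \<subseteq> {..<k}" "Poly_Mapping.keys y \<subseteq> {k..<k + l}"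
            by auto
          then have "Poly_Mapping.keys x \<union> Poly_Mapping.keys y \<subseteq> {..<k + l}" by fastforce
          then show "c \<in> carrier (free_Abelian_group {..<k + l})"
            using xy keys_add[of x y] by auto
        qed
      qed
    qed
    then show ?thesis by (auto simp: is_iso_def)
  qed
  finally show ?thesis .
qed

text \<open>Freeness of \<open>C\<close> splits the sequence: preimages of its basis define a
  section \<open>s\<close>, and \<open>B\<close> is the product of the images of \<open>A\<close>
  and of \<open>s\<close>.\<close>

lemma short_exact_sequence_free:
  assumes ex: "short_exact_sequence C B A g f" and B: "comm_group B"
    and A: "A \<cong> free_Abelian_group {..<k::nat}" and C: "C \<cong> free_Abelian_group {..<l::nat}"
  shows "B \<cong> free_Abelian_group {..<k + l}"
proof -
  interpret B: comm_group B by fact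
  have gh: "group_hom A B f" "group_hom B C g" and ker: "kernel B C g = f ` carrier A"
    and fm: "f \<in> mon A B" and ge: "g \<in> epi B C"
    using short_exact_sequenceD[OF ex] by (auto simp: group_hom_def group_hom_axioms_def)
  interpret f: group_hom A B f by fact
  interpret g: group_hom B C g by fact
  have finj: "inj_on f (carrier A)" and gsurj: "g ` carrier B = carrier C"
    using fm ge by (auto simp: mon_def epi_def)
  obtain h where h: "h \<in> iso C (free_Abelian_group {..<l})" using C by (auto simp: is_iso_def)
  interpret h: group_hom C "free_Abelian_group {..<l}" h
    using h by (auto simp: group_hom_def group_hom_axioms_def iso_iff)
  have hinj: "inj_on h (carrier C)" and him: "h ` carrier C = carrier (free_Abelian_group {..<l})"
    using h by (auto simp: iso_iff)
  have "\<exists>b\<in>carrier B. h (g b) = frag_of i" if "i < l" for i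
  proof -
    have "frag_of i \<in> h ` g ` carrier B" using that by (simp add: gsurj him)
    then show ?thesis by fastforce
  qed
  then obtain b where b: "\<And>i. i < l \<Longrightarrow> b i \<in> carrier B \<and> h (g (b i)) = frag_of i" by metis
  obtain s where s: "s \<in> hom (free_Abelian_group {..<l}) B" "\<And>i. i < l \<Longrightarrow> s (frag_of i) = b i"
    using B.free_Abelian_group_universal[of b "{..<l}"] b by auto
  interpret s: group_hom "free_Abelian_group {..<l}" B s
    using s(1) by (simp add: group_hom_def group_hom_axioms_def)
  have hgs: "h (g (s x)) = x" if "Poly_Mapping.keys x \<subseteq> {..<l}" for x
  proof (rule free_Abelian_group_induct[of x "{..<l}" "\<lambda>x. h (g (s x)) = x"])
    show "h (g (s 0)) = 0" using s.hom_one by simp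
  next
    fix x y :: "nat \<Rightarrow>\<^sub>0 int"
    assume *: "Poly_Mapping.keys x \<subseteq> {..<l}" "Poly_Mapping.keys y \<subseteq> {..<l}"
      "h (g (s x)) = x" "h (g (s y)) = y"
    have "s (x - y) = s (x + (- y))" by simp
    also have "\<dots> = s x \<otimes>\<^bsub>B\<^esub> s (- y)"
      using s.hom_mult[of x "-y"] * by simp
    also have "s (- y) = inv\<^bsub>B\<^esub> s y" using s.hom_inv[of y] * by simp
    finally have "s (x - y) = s x \<otimes>\<^bsub>B\<^esub> inv\<^bsub>B\<^esub> s y" .
    moreover have "s x \<in> carrier B" "s y \<in> carrier B" "h (g (s y)) \<in> carrier (free_Abelian_group {..<l})"
      using * s.hom_closed by auto
    ultimately show "h (g (s (x - y))) = x - y"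
      using * by simp
  next
    fix i assume "i \<in> {..<l}"
    then show "h (g (s (frag_of i))) = frag_of i" using s(2) b by simp
  qed (fact that)
  let ?F = "free_Abelian_group {..<l}"
  have "(\<lambda>(a, c). f a \<otimes>\<^bsub>B\<^esub> s c) \<in> iso (A \<times>\<times> ?F) B"
  proof (rule isoI)
    show "(\<lambda>(a, c). f a \<otimes>\<^bsub>B\<^esub> s c) \<in> hom (A \<times>\<times> ?F) B"
    proof (rule homI, goal_cases)
      case (2 x y)
      then obtain a c a' c' where "x = (a, c)" "y = (a', c')" "a \<in> carrier A" "a' \<in> carrier A"
        "c \<in> carrier ?F" "c' \<in> carrier ?F" by (cases x; cases y) auto
      then show ?case
        using s.hom_mult[of c c'] s.hom_closed[of c] s.hom_closed[of c'] by (simp add: B.m_ac)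
    qed (auto simp: s.hom_closed)
    show "bij_betw (\<lambda>(a, c). f a \<otimes>\<^bsub>B\<^esub> s c) (carrier (A \<times>\<times> ?F)) (carrier B)"
      unfolding bij_betw_def
    proof (intro conjI inj_onI)
      fix u v assume u: "u \<in> carrier (A \<times>\<times> ?F)" and v: "v \<in> carrier (A \<times>\<times> ?F)"
        and eq: "(case u of (a, c) \<Rightarrow> f a \<otimes>\<^bsub>B\<^esub> s c) = (case v of (a, c) \<Rightarrow> f a \<otimes>\<^bsub>B\<^esub> s c)"
      obtain a c a' c' where uv: "u = (a, c)" "v = (a', c')" by fastforce
      have m: "a \<in> carrier A" "a' \<in> carrier A" "c \<in> carrier ?F" "c' \<in> carrier ?F"
        using u v by (auto simp: uv)
      have gf: "g (f x) = \<one>\<^bsub>C\<^esub>" if "x \<in> carrier A" for x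
        using ker that by (auto simp: kernel_def)
      have "h (g (f x \<otimes>\<^bsub>B\<^esub> s y)) = y" if "x \<in> carrier A" "y \<in> carrier ?F" for x y
        using that s.hom_closed[of y] hgs[of y] by (simp add: gf)
      from this[OF m(1,3)] this[OF m(2,4)] have "c = c'" using eq by (simp add: uv)
      moreover have "a = a'"
        using eq \<open>c = c'\<close> m finj s.hom_closed[OF m(3)] by (simp add: uv inj_on_eq_iff)
      ultimately show "u = v" by (simp add: uv)
    next
      show "(\<lambda>(a, c). f a \<otimes>\<^bsub>B\<^esub> s c) ` carrier (A \<times>\<times> ?F) = carrier B"
      proof (intro equalityI subsetI)
        fix x assume x: "x \<in> carrier B"
        let ?c = "h (g x)"
        have c: "?c \<in> carrier ?F" by (rule h.hom_closed[OF g.hom_closed[OF x]])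
        have sc: "s ?c \<in> carrier B" using s.hom_closed[OF c] .
        have "h (g (s ?c)) = h (g x)" using hgs[of ?c] c by simp
        then have "g (s ?c) = g x" using hinj x sc by (auto simp: inj_on_def)
        then have "x \<otimes>\<^bsub>B\<^esub> inv\<^bsub>B\<^esub> s ?c \<in> kernel B C g"
          using x sc by (simp add: kernel_def)
        then obtain a where a: "a \<in> carrier A" "x \<otimes>\<^bsub>B\<^esub> inv\<^bsub>B\<^esub> s ?c = f a" using ker by auto
        then have "x = f a \<otimes>\<^bsub>B\<^esub> s ?c" using x sc by (metis B.inv_solve_right' f.hom_closed)
        then show "x \<in> (\<lambda>(a, c). f a \<otimes>\<^bsub>B\<^esub> s c) ` carrier (A \<times>\<times> ?F)"
          using a c by (intro image_eqI[of _ _ "(a, ?c)"]) auto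
      qed (auto simp: s.hom_closed)
    qed
  qed
  then have "B \<cong> A \<times>\<times> ?F"
    by (metis B.group_axioms DirProd_group f.G.group_axioms group.iso_sym group_free_Abelian_group is_isoI)
  also have "\<dots> \<cong> free_Abelian_group {..<k} \<times>\<times> ?F"
    using A by (simp add: group.DirProd_iso_trans iso_refl f.G.group_axioms)
  also have "\<dots> \<cong> free_Abelian_group {..<k + l}" by (rule free_Abelian_group_DirProd)
  finally show ?thesis .
qed

subsection \<open>Finite flag complexes\<close>

text \<open>The realization of the flag complex of the graph \<open>E\<close> on \<open>S\<close>:
  supports are cliques. It is used with the product topology, which is the correct one for finite
  \<open>S\<close>.\<close>

definition geo :: "('v \<Rightarrow> 'v \<Rightarrow> bool) \<Rightarrow> 'v set \<Rightarrow> ('v \<Rightarrow> real) set" where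
  "geo E S = {x. (\<forall>v. 0 \<le> x v) \<and> (\<forall>v. x v \<noteq> 0 \<longrightarrow> v \<in> S) \<and>
     (\<forall>u v. x u \<noteq> 0 \<longrightarrow> x v \<noteq> 0 \<longrightarrow> u \<noteq> v \<longrightarrow> E u v) \<and> sum x S = 1}"

text \<open>The union of the two supports is again a clique, so the segment runs inside one
  simplex.\<close>

lemma geo_segment:
  assumes "x \<in> geo E S" "y \<in> geo E S" "0 \<le> t" "t \<le> 1"
    and "\<And>u v. x u \<noteq> 0 \<Longrightarrow> y v \<noteq> 0 \<Longrightarrow> u \<noteq> v \<Longrightarrow> E u v \<and> E v u"
  shows "(\<lambda>v. (1 - t) * x v + t * y v) \<in> geo E S"
  unfolding geo_def
proof (intro CollectI conjI allI impI)
  fix v show "0 \<le> (1 - t) * x v + t * y v" using assms(1-4) by (auto simp: geo_def)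
next
  fix v assume "(1 - t) * x v + t * y v \<noteq> 0"
  then have "x v \<noteq> 0 \<or> y v \<noteq> 0" by auto
  then show "v \<in> S" using assms(1,2) by (auto simp: geo_def)
next
  fix u v assume "(1 - t) * x u + t * y u \<noteq> 0" "(1 - t) * x v + t * y v \<noteq> 0" and ne: "u \<noteq> v"
  then have "(x u \<noteq> 0 \<or> y u \<noteq> 0)" "(x v \<noteq> 0 \<or> y v \<noteq> 0)" by auto
  then show "E u v" using assms(1,2,5) ne by (auto simp: geo_def)
next
  have "(\<Sum>v\<in>S. (1 - t) * x v + t * y v) = (1 - t) * sum x S + t * sum y S"
    by (simp add: sum.distrib sum_distrib_left)
  then show "(\<Sum>v\<in>S. (1 - t) * x v + t * y v) = 1" using assms(1,2) by (simp add: geo_def)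
qed

text \<open>All nontrivial homotopies below are straight lines in barycentric coordinates; only the
  range has to be checked.\<close>

lemma homotopic_with_segment:
  fixes f g :: "('u \<Rightarrow> real) \<Rightarrow> ('v \<Rightarrow> real)"
  assumes f: "continuous_on A f" and g: "continuous_on A g"
    and B: "\<And>x t. x \<in> A \<Longrightarrow> 0 \<le> t \<Longrightarrow> t \<le> 1 \<Longrightarrow> (\<lambda>v. (1 - t) * f x v + t * g x v) \<in> B"
  shows "homotopic_with (\<lambda>_. True) (top_of_set A) (top_of_set B) f g"
proof -
  have "continuous_on ({0..1::real} \<times> A) (\<lambda>z. f (snd z))" "continuous_on ({0..1::real} \<times> A) (\<lambda>z. g (snd z))"
    by (auto intro!: continuous_on_compose2[OF f] continuous_on_compose2[OF g] continuous_on_snd continuous_on_id)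
  note cfg = this[THEN continuous_on_product_then_coordinatewise]
  let ?h = "\<lambda>z v. (1 - fst z) * f (snd z) v + fst z * g (snd z) v"
  have "continuous_on ({0..1::real} \<times> A) ?h"
    by (intro continuous_on_coordinatewise_then_product continuous_intros cfg)
  then show ?thesis
    unfolding homotopic_with_def using B
    by (intro exI[of _ ?h]) (auto simp: prod_topology_subtopology_eu)
qed

lemma contractible_segment:
  fixes a :: "'v \<Rightarrow> real"
  assumes "a \<in> A" and "\<And>x t. x \<in> A \<Longrightarrow> 0 \<le> t \<Longrightarrow> t \<le> 1 \<Longrightarrow> (\<lambda>v. (1 - t) * x v + t * a v) \<in> A"
  shows "contractible_space (top_of_set A)"
proof -
  have "homotopic_with (\<lambda>_. True) (top_of_set A) (top_of_set A) id (\<lambda>_. a)"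
    using assms(2) by (intro homotopic_with_segment) auto
  then show ?thesis unfolding contractible_space using assms(1) by auto
qed

lemma geo_vertex:
  assumes "finite S" "a \<in> S"
  shows "(\<lambda>v. if v = a then 1 else 0) \<in> geo E S"
  using assms by (simp add: geo_def)

lemma geo_segment_vertex:
  assumes "finite S" "a \<in> S" "x \<in> geo E S" "0 \<le> t" "t \<le> 1"
    and "\<And>u. x u \<noteq> 0 \<Longrightarrow> u \<noteq> a \<Longrightarrow> E u a \<and> E a u"
  shows "(\<lambda>v. (1 - t) * x v + t * (if v = a then 1 else 0)) \<in> geo E S"
proof (rule geo_segment[OF assms(3) geo_vertex[OF assms(1,2)] assms(4,5)])
  fix u v assume "x u \<noteq> 0" "(if v = a then 1 else 0) \<noteq> (0::real)" "u \<noteq> v"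
  then show "E u v \<and> E v u" using assms(6)[of u] by (cases "v = a") auto
qed

lemma contractible_geo_cone:
  assumes "finite S" "a \<in> S" and cone: "\<And>y. y \<in> S \<Longrightarrow> y \<noteq> a \<Longrightarrow> E a y \<and> E y a"
  shows "contractible_space (top_of_set (geo E S))"
proof (rule contractible_segment)
  fix x :: "'a \<Rightarrow> real" and t :: real
  assume x: "x \<in> geo E S" and t: "0 \<le> t" "t \<le> 1"
  have "E u a \<and> E a u" if "x u \<noteq> 0" "u \<noteq> a" for u
    using x that cone[of u] by (auto simp: geo_def)
  then show "(\<lambda>v. (1 - t) * x v + t * (if v = a then 1 else 0)) \<in> geo E S"
    using assms(1,2) x t by (intro geo_segment_vertex) auto
qed (rule geo_vertex[OF assms(1,2)])

text \<open>\<open>X\<close> is the complex with the new vertex \<open>a\<close>, \<open>N\<close>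
  is \<open>X\<close> without that point, \<open>U\<close> is the open star, \<open>r\<close> the
  radial projection away from \<open>a\<close> and \<open>lk\<close> the link. \<open>N\<close>
  retracts to the old complex and \<open>U \<inter> N\<close> to the link, so excision reduces the
  pair \<open>(X, N)\<close> to the link.\<close>

locale vertex_attachment =
  fixes E :: "'v \<Rightarrow> 'v \<Rightarrow> bool" and S :: "'v set" and a :: 'v
  assumes sym: "E u v \<Longrightarrow> E v u" and fin: "finite S" and notin: "a \<notin> S"
begin

definition "X = geo E (insert a S)"
definition "N = {x \<in> X. x a \<noteq> 1}"
definition "U = {x \<in> X. x a \<noteq> 0}"
definition "lk = {y \<in> S. E a y}"
definition "r x = (\<lambda>v. if v = a then 0 else x v / (1 - x a))" for x :: "'v \<Rightarrow> real"

lemma fin_lk: "finite lk" using fin by (simp add: lk_def)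

lemma le1: "x \<in> X \<Longrightarrow> 0 \<le> x a \<and> x a \<le> 1"
  and sumS: "x \<in> X \<Longrightarrow> sum x S = 1 - x a"
  using fin notin by (auto simp: X_def geo_def) (metis add.commute le_add_same_cancel1 sum_nonneg)

lemma X_adj: "x \<in> X \<Longrightarrow> x u \<noteq> 0 \<Longrightarrow> x v \<noteq> 0 \<Longrightarrow> u \<noteq> v \<Longrightarrow> E u v \<and> E v u"
  unfolding X_def geo_def by blast

lemma geo_S: "geo E S = {x \<in> X. x a = 0}"
  using fin notin by (auto simp: X_def geo_def)

lemma r_in: "x \<in> N \<Longrightarrow> r x \<in> geo E S"
proof -
  assume x: "x \<in> N"
  then have xX: "x \<in> X" and lt: "x a < 1" using le1[of x] by (auto simp: N_def)
  have "sum (r x) S = sum (\<lambda>v. x v / (1 - x a)) S"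
    using notin by (intro sum.cong) (auto simp: r_def)
  also have "\<dots> = 1" using sumS[OF xX] lt by (simp flip: sum_divide_distrib)
  finally have "sum (r x) S = 1" .
  moreover have "0 \<le> r x v" for v using xX lt by (auto simp: r_def X_def geo_def)
  moreover have "r x v \<noteq> 0 \<Longrightarrow> x v \<noteq> 0 \<and> v \<noteq> a" for v by (auto simp: r_def split: if_splits)
  ultimately show "r x \<in> geo E S" using xX by (auto simp: geo_def X_def)
qed

lemma cont_r: "continuous_on N r"
proof (rule continuous_on_coordinatewise_then_product)
  fix i
  have "continuous_on N (\<lambda>x. x i)" "continuous_on N (\<lambda>x. x a)"
    by (rule continuous_on_product_then_coordinatewise, rule continuous_on_id)+
  then show "continuous_on N (\<lambda>x. r x i)"
    unfolding r_def by (cases "i = a") (auto intro!: continuous_intros simp: N_def)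
qed

text \<open>The segment from \<open>r x\<close> to \<open>x\<close> stays in one simplex and never
  reaches the vertex \<open>a\<close>, so \<open>r\<close> is a deformation retraction.\<close>

lemma N_equiv: "top_of_set N homotopy_equivalent_space top_of_set (geo E S)"
  unfolding homotopy_equivalent_space_def
proof (intro exI conjI)
  show "continuous_map (top_of_set N) (top_of_set (geo E S)) r"
    using cont_r r_in by auto
  show "continuous_map (top_of_set (geo E S)) (top_of_set N) id"
    by (auto simp: geo_S N_def)
  have "homotopic_with (\<lambda>_. True) (top_of_set N) (top_of_set N) r id"
  proof (rule homotopic_with_segment)
    fix x t assume x: "x \<in> N" and t: "0 \<le> (t::real)" "t \<le> 1"
    then have xX: "x \<in> X" and lt: "x a < 1" using le1[of x] by (auto simp: N_def)
    have rx: "r x \<in> X" using r_in[OF x] by (simp add: geo_S)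
    have "(\<lambda>v. (1 - t) * r x v + t * x v) \<in> X"
      unfolding X_def
    proof (rule geo_segment)
      fix u v assume "r x u \<noteq> 0" "x v \<noteq> 0" "u \<noteq> v"
      moreover have "x u \<noteq> 0" using \<open>r x u \<noteq> 0\<close> by (auto simp: r_def split: if_splits)
      ultimately show "E u v \<and> E v u" using X_adj[OF xX] by blast
    qed (use xX rx t in \<open>auto simp: X_def\<close>)
    moreover have "t * x a \<noteq> 1" using t lt xX le1[OF xX] by (smt (verit) mult_left_le_one_le)
    ultimately show "(\<lambda>v. (1 - t) * r x v + t * id x v) \<in> N"
      by (simp add: N_def r_def)
  qed (use cont_r in auto)
  then show "homotopic_with (\<lambda>_. True) (top_of_set N) (top_of_set N) (id \<circ> r) id" by simp
  have "r x = x" if "x \<in> geo E S" for x using that by (auto simp: geo_S r_def)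
  then show "homotopic_with (\<lambda>_. True) (top_of_set (geo E S)) (top_of_set (geo E S)) (r \<circ> id) id"
    by (intro homotopic_with_equal) (use cont_r in \<open>auto simp: continuous_on_id\<close>)
qed

lemma contractible_U: "contractible_space (top_of_set U)"
proof (rule contractible_segment)
  fix x :: "'v \<Rightarrow> real" and t :: real
  assume x: "x \<in> U" and t: "0 \<le> t" "t \<le> 1"
  have "E u a \<and> E a u" if "x u \<noteq> 0" "u \<noteq> a" for u
    using X_adj[of x u a] x that by (auto simp: U_def)
  then have "(\<lambda>v. (1 - t) * x v + t * (if v = a then 1 else 0)) \<in> X"
    unfolding X_def using fin x t by (intro geo_segment_vertex) (auto simp: U_def X_def)
  \<comment> \<open>The segment towards the vertex \<open>a\<close> must stay in the open star, that
    is, keep a positive coordinate at \<open>a\<close>.\<close>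
  moreover have "(1 - t) * x a + t \<noteq> 0"
  proof -
    have "0 < x a" using x le1[of x] by (auto simp: U_def)
    then show ?thesis using t by (cases "t = 0") (auto simp: add_nonneg_pos less_imp_neq[symmetric])
  qed
  ultimately show "(\<lambda>v. (1 - t) * x v + t * (if v = a then 1 else 0)) \<in> U"
    by (simp add: U_def)
next
  show "(\<lambda>v. if v = a then 1 else 0) \<in> U"
    using geo_vertex[of "insert a S" a E] fin by (simp add: U_def X_def)
qed

lemma geo_lk: "geo E lk = {x \<in> geo E S. \<forall>v. x v \<noteq> 0 \<longrightarrow> E a v}"
proof -
  have "sum x lk = sum x S" if "\<forall>v. x v \<noteq> 0 \<longrightarrow> v \<in> lk" for x :: "'v \<Rightarrow> real"
    using that fin by (intro sum.mono_neutral_left) (auto simp: lk_def)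
  moreover have "x \<in> geo E lk \<Longrightarrow> \<forall>v. x v \<noteq> 0 \<longrightarrow> v \<in> lk" for x by (auto simp: geo_def)
  ultimately show ?thesis by (auto simp: geo_def lk_def)
qed

text \<open>The punctured star is an open cylinder over the link. The map \<open>j\<close> inserts
  the link at height 1/2, and \<open>r\<close> undoes it.\<close>

lemma link_equiv: "top_of_set (U \<inter> N) homotopy_equivalent_space top_of_set (geo E lk)"
  unfolding homotopy_equivalent_space_def
proof (intro exI conjI)
  define j where "j x = (\<lambda>v. if v = a then 1/2 else x v / 2)" for x :: "'v \<Rightarrow> real"
  have r_lk: "r x \<in> geo E lk" if "x \<in> U \<inter> N" for x
  proof -
    have "E a v" if "r x v \<noteq> 0" for v
    proof -
      have "v \<noteq> a" "x v \<noteq> 0" using that by (auto simp: r_def split: if_splits)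
      then show ?thesis using X_adj[of x a v] \<open>x \<in> U \<inter> N\<close> by (auto simp: U_def)
    qed
    then show ?thesis using that r_in[of x] unfolding geo_lk by auto
  qed
  then show "continuous_map (top_of_set (U \<inter> N)) (top_of_set (geo E lk)) r"
    using cont_r by (auto intro: continuous_on_subset)
  have cj: "continuous_on A j" for A
  proof (rule continuous_on_coordinatewise_then_product)
    fix i
    have "continuous_on A (\<lambda>x. x i)"
      by (rule continuous_on_product_then_coordinatewise, rule continuous_on_id)
    then show "continuous_on A (\<lambda>x. j x i)"
      unfolding j_def by (cases "i = a") (auto intro!: continuous_intros)
  qed
  have j_in: "j x \<in> U \<inter> N" if x: "x \<in> geo E lk" for x
  proof -
    have xS: "x \<in> geo E S" and adj: "\<forall>v. x v \<noteq> 0 \<longrightarrow> E a v" using x by (auto simp: geo_lk)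
    have "x a = 0" using xS notin by (auto simp: geo_def)
    have "(\<Sum>v\<in>S. j x v) = (\<Sum>v\<in>S. x v / 2)" using notin by (intro sum.cong) (auto simp: j_def)
    then have "sum (j x) (insert a S) = 1"
      using xS fin notin by (simp add: geo_def j_def flip: sum_divide_distrib)
    moreover have "j x v \<noteq> 0 \<Longrightarrow> v = a \<or> x v \<noteq> 0" for v by (auto simp: j_def split: if_splits)
    moreover have "E u v" if "j x u \<noteq> 0" "j x v \<noteq> 0" "u \<noteq> v" for u v
    proof (cases "u = a \<or> v = a")
      case True
      then show ?thesis using that adj sym by (auto simp: j_def split: if_splits)
    next
      case False
      then have "x u \<noteq> 0" "x v \<noteq> 0" using that by (auto simp: j_def)
      then show ?thesis using xS that(3) unfolding geo_def by blast
    qed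
    moreover have "0 \<le> j x v" for v using xS by (simp add: geo_def j_def)
    moreover have "x v \<noteq> 0 \<Longrightarrow> v \<in> S" for v using xS by (simp add: geo_def)
    ultimately have "j x \<in> X" unfolding X_def geo_def by blast
    then show ?thesis by (auto simp: U_def N_def j_def)
  qed
  then show "continuous_map (top_of_set (geo E lk)) (top_of_set (U \<inter> N)) j"
    using cj by auto
  have rj: "r (j x) = x" if "x \<in> geo E lk" for x
    using that by (auto simp: geo_lk geo_S r_def j_def)
  show "homotopic_with (\<lambda>_. True) (top_of_set (geo E lk)) (top_of_set (geo E lk)) (r \<circ> j) id"
    using rj j_in cj cont_r r_lk
    by (intro homotopic_with_equal) (auto intro!: continuous_on_compose2[OF cont_r cj])
  show "homotopic_with (\<lambda>_. True) (top_of_set (U \<inter> N)) (top_of_set (U \<inter> N)) (j \<circ> r) id"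
  proof (rule homotopic_with_segment)
    show "continuous_on (U \<inter> N) (j \<circ> r)"
      by (rule continuous_on_compose[OF continuous_on_subset[OF cont_r] cj]) auto
    fix x t assume x: "x \<in> U \<inter> N" and t: "0 \<le> (t::real)" "t \<le> 1"
    let ?y = "j (r x)"
    have y: "?y \<in> U \<inter> N" using r_lk j_in x by blast
    have b: "0 < x a" "x a < 1" using x le1[of x] by (auto simp: U_def N_def)
    have "(\<lambda>v. (1 - t) * ?y v + t * x v) \<in> X"
      unfolding X_def
    proof (rule geo_segment)
      fix u v assume "?y u \<noteq> 0" "x v \<noteq> 0" "u \<noteq> v"
      moreover have "x u \<noteq> 0" using \<open>?y u \<noteq> 0\<close> b by (auto simp: j_def r_def split: if_splits)
      ultimately show "E u v \<and> E v u" using x X_adj[of x u v] by (auto simp: U_def)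
    qed (use x y t in \<open>auto simp: X_def U_def\<close>)
    \<comment> \<open>The height is a convex combination of 1/2 and \<open>x a\<close>, both
      strictly between 0 and 1.\<close>
    moreover have "0 < (1 - t) * (1/2) + t * x a"
      using t b by (cases "t = 0") (auto intro: add_nonneg_pos)
    moreover have "(1 - t) * (1/2) + t * x a < 1"
    proof -
      have "0 < (1 - t) * (1/2) + t * (1 - x a)"
        using t b by (cases "t = 0") (auto intro: add_nonneg_pos)
      moreover have "(1 - t) * (1/2) + t * (1 - x a) + ((1 - t) * (1/2) + t * x a) = 1"
        by (simp add: algebra_simps)
      ultimately show ?thesis by linarith
    qed
    moreover have ya: "?y a = 1/2" by (simp add: j_def)
    ultimately have "(\<lambda>v. (1 - t) * ?y v + t * x v) \<in> X" "(1 - t) * ?y a + t * x a \<noteq> 0"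
        "(1 - t) * ?y a + t * x a \<noteq> 1"
      unfolding ya by linarith+
    then show "(\<lambda>v. (1 - t) * (j \<circ> r) x v + t * id x v) \<in> U \<inter> N"
      by (simp add: U_def N_def)
  qed auto
qed

text \<open>Excision of the closed set where \<open>x a = 0\<close>, the old complex, which lies in
  the open set \<open>N\<close>; what remains of \<open>X\<close> is \<open>U\<close>.\<close>

lemma relative_homology_star:
  "relative_homology_group i (top_of_set X) N \<cong> relative_homology_group i (top_of_set U) N"
proof -
  let ?Z = "{x \<in> X. x a = 0}"
  have cont: "continuous_on X (\<lambda>x. x a)"
    by (rule continuous_on_product_then_coordinatewise, rule continuous_on_id)
  have "closedin (top_of_set X) ?Z"
    using continuous_closedin_preimage_constant[OF cont, of 0] .
  moreover have "closedin (top_of_set X) {x \<in> X. x a = 1}"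
    using continuous_closedin_preimage_constant[OF cont, of 1] .
  then have "openin (top_of_set X) (X - {x \<in> X. x a = 1})" by (simp add: openin_diff)
  moreover have "X - {x \<in> X. x a = 1} = N" by (auto simp: N_def)
  ultimately have "top_of_set X closure_of ?Z = ?Z" "top_of_set X interior_of N = N"
    by (simp_all only: closure_of_closedin interior_of_openin)
  then have "top_of_set X closure_of ?Z \<subseteq> top_of_set X interior_of N"
    by (auto simp: N_def)
  from homology_excision_axiom[OF this, of UNIV i]
  have "relative_homology_group i (subtopology (top_of_set X) (UNIV - ?Z)) (N - ?Z)
      \<cong> relative_homology_group i (subtopology (top_of_set X) UNIV) N"
    by (auto simp: is_iso_def)
  moreover have "subtopology (top_of_set X) (UNIV - ?Z) = top_of_set U"
    by (simp add: subtopology_subtopology U_def) (rule arg_cong[of _ _ "subtopology _"], blast)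
  moreover have "relative_homology_group i (top_of_set U) (N - ?Z) = relative_homology_group i (top_of_set U) N"
  proof -
    have "topspace (top_of_set U) \<inter> (N - ?Z) = topspace (top_of_set U) \<inter> N" by (auto simp: U_def)
    then show ?thesis
      using relative_homology_group_restrict[of i "top_of_set U" "N - ?Z"]
        relative_homology_group_restrict[of i "top_of_set U" N] by simp
  qed
  ultimately have "relative_homology_group i (top_of_set U) N \<cong> relative_homology_group i (top_of_set X) N"
    by simp
  then show ?thesis by (rule group.iso_sym[OF group_relative_homology_group])
qed

end

text \<open>The indices \<open>d\<close> and \<open>k\<close> stand for the reduced homology of a wedge of \<open>k\<close> spheres of dimension
  \<open>d - 1\<close>; the shift accommodates the empty complex.\<close>

inductive spherical :: "('v \<Rightarrow> 'v \<Rightarrow> bool) \<Rightarrow> 'v set \<Rightarrow> nat \<Rightarrow> nat \<Rightarrow> bool" for E where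
  empty: "spherical E {} 0 1"
| cone: "finite S \<Longrightarrow> a \<in> S \<Longrightarrow> (\<And>y. y \<in> S \<Longrightarrow> y \<noteq> a \<Longrightarrow> E a y \<and> E y a) \<Longrightarrow> spherical E S d 0"
| attach: "spherical E S (Suc d) k \<Longrightarrow> a \<notin> S \<Longrightarrow> spherical E {y \<in> S. E a y} d l \<Longrightarrow>
    spherical E (insert a S) (Suc d) (k + l)"

lemma spherical_finite: "spherical E S d k \<Longrightarrow> finite S"
  by (induction rule: spherical.induct) auto

text \<open>Only the rule \<open>empty\<close> yields the empty complex, since \<open>cone\<close>
  has an apex and \<open>attach\<close> a new vertex. Hence the parameters of an empty link are
  forced.\<close>

lemma spherical_empty: "spherical E S d k \<Longrightarrow> S = {} \<Longrightarrow> d = 0 \<and> k = 1"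
  by (induction rule: spherical.induct) auto

lemma trivial_group_free: "trivial_group G \<Longrightarrow> G \<cong> free_Abelian_group {..<0::nat}"
proof -
  assume G: "trivial_group G"
  then interpret group G by (simp add: trivial_group_def)
  have "carrier G = {\<one>\<^bsub>G\<^esub>}" using G by (simp add: trivial_group_def)
  then have "(\<lambda>_. 0) \<in> iso G (free_Abelian_group {..<0::nat})"
    by (intro isoI homI) (auto simp: bij_betw_def)
  then show ?thesis by (auto simp: is_iso_def)
qed

lemma comm_group_reduced_homology: "comm_group (reduced_homology_group i X)"
  unfolding reduced_homology_group_def
  by (intro group.abelian_subgroup_generated) auto

text \<open>The homology of \<open>N\<close> and that of the pair are both concentrated in degree
  \<open>d\<close>, so the long exact sequence shrinks to one short exact sequence in that
  degree.\<close>

lemma (in vertex_attachment) attach_homology: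
  assumes ne: "S \<noteq> {}"
    and S0: "\<And>i. i \<noteq> int d \<Longrightarrow> trivial_group (reduced_homology_group i (top_of_set (geo E S)))"
    and Sd: "reduced_homology_group (int d) (top_of_set (geo E S)) \<cong> free_Abelian_group {..<k::nat}"
    and rel0: "\<And>i. i \<noteq> int d \<Longrightarrow> trivial_group (relative_homology_group i (top_of_set X) N)"
    and reld: "relative_homology_group (int d) (top_of_set X) N \<cong> free_Abelian_group {..<l::nat}"
  shows "\<And>i. i \<noteq> int d \<Longrightarrow> trivial_group (reduced_homology_group i (top_of_set X))"
    and "reduced_homology_group (int d) (top_of_set X) \<cong> free_Abelian_group {..<k + l}"
proof -
  let ?X = "top_of_set X" and ?N = "top_of_set N"
  let ?R = "\<lambda>i. reduced_homology_group i ?X" and ?RN = "\<lambda>i. reduced_homology_group i ?N"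
    and ?H = "\<lambda>i. relative_homology_group i ?X N"
  have sub: "subtopology ?X N = ?N"
    by (simp add: subtopology_subtopology N_def) (rule arg_cong[of _ _ "subtopology _"], blast)
  obtain s where s: "s \<in> S" using ne by blast
  have "(\<lambda>v. if v = s then 1 else 0) \<in> geo E S" by (rule geo_vertex[OF fin s])
  then have tne: "topspace ?X \<inter> N \<noteq> {}" by (auto simp: geo_S N_def)
  have isoN: "?RN i \<cong> reduced_homology_group i (top_of_set (geo E S))" for i
    by (rule homotopy_equivalent_space_imp_isomorphic_reduced_homology_groups[OF N_equiv])
  then have N0: "trivial_group (?RN i)" if "i \<noteq> int d" for i
    using S0[OF that] isomorphic_group_triviality by (metis group_reduced_homology_group)
  have Nd: "?RN (int d) \<cong> free_Abelian_group {..<k}"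
    using isoN Sd iso_trans by blast
  note ex1 = homology_exactness_reduced_1[OF tne, unfolded sub]
  note ex2 = homology_exactness_reduced_2[of _ ?X N, unfolded sub]
  note ex3 = homology_exactness_reduced_3[of _ ?X N, unfolded sub]
  show "trivial_group (?R i)" if i: "i \<noteq> int d" for i
  proof -
    let ?j = "hom_induced i ?X {} ?X N id"
    have "kernel (?R i) (?H i) ?j = hom_induced i ?N {} ?X {} id ` carrier (?RN i)"
      and gh: "group_hom (?R i) (?H i) ?j" and gh2: "group_hom (?RN i) (?R i) (hom_induced i ?N {} ?X {} id)"
      using ex3[of i] by (auto simp: group_hom_def group_hom_axioms_def)
    moreover have "hom_induced i ?N {} ?X {} id ` carrier (?RN i) = {\<one>\<^bsub>?R i\<^esub>}"
      using N0[OF i] group_hom.image_from_trivial_group[OF gh2] by auto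
    moreover have "kernel (?R i) (?H i) ?j = carrier (?R i)"
      using group_hom.kernel_to_trivial_group[OF gh] rel0[OF i] by auto
    ultimately show ?thesis
      by (simp add: trivial_group_def)
  qed
  let ?f = "hom_induced (int d) ?N {} ?X {} id" and ?g = "hom_induced (int d) ?X {} ?X N id"
  have ex: "exact_seq ([?H (int d), ?R (int d), ?RN (int d)], [?g, ?f])" by (rule ex3)
  have f: "group_hom (?RN (int d)) (?R (int d)) ?f" and g: "group_hom (?R (int d)) (?H (int d)) ?g"
    using ex by (auto simp: group_hom_def group_hom_axioms_def)
  \<comment> \<open>Injective because the preceding term, the pair in degree \<open>d + 1\<close>,
    is trivial.\<close>
  have "?f \<in> mon (?RN (int d)) (?R (int d))"
  proof -
    have e: "exact_seq ([?R (int d), ?RN (int d), ?H (int d + 1)], [?f, hom_boundary (int d + 1) ?X N])"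
      using ex2[of "int d + 1"] by simp
    then have "kernel (?RN (int d)) (?R (int d)) ?f = hom_boundary (int d + 1) ?X N ` carrier (?H (int d + 1))"
      and b: "group_hom (?H (int d + 1)) (?RN (int d)) (hom_boundary (int d + 1) ?X N)"
      by (auto simp: group_hom_def group_hom_axioms_def)
    moreover have "hom_boundary (int d + 1) ?X N ` carrier (?H (int d + 1)) = {\<one>\<^bsub>?RN (int d)\<^esub>}"
      using group_hom.image_from_trivial_group[OF b] rel0[of "int d + 1"] by auto
    ultimately show ?thesis
      using f group_hom.trivial_ker_imp_inj[OF f] by (auto simp: mon_def group_hom_def group_hom_axioms_def)
  qed
  \<comment> \<open>Surjective because the following term, \<open>N\<close> in degree
    \<open>d - 1\<close>, is trivial.\<close>
  moreover have "?g \<in> epi (?R (int d)) (?H (int d))"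
  proof -
    have "kernel (?H (int d)) (?RN (int d - 1)) (hom_boundary (int d) ?X N) = ?g ` carrier (?R (int d))"
      and b: "group_hom (?H (int d)) (?RN (int d - 1)) (hom_boundary (int d) ?X N)"
      using ex1[of "int d"] by (auto simp: group_hom_def group_hom_axioms_def)
    moreover have "kernel (?H (int d)) (?RN (int d - 1)) (hom_boundary (int d) ?X N) = carrier (?H (int d))"
      using group_hom.kernel_to_trivial_group[OF b] N0[of "int d - 1"] by auto
    ultimately show ?thesis using g by (auto simp: epi_def group_hom_def group_hom_axioms_def)
  qed
  ultimately have "short_exact_sequence (?H (int d)) (?R (int d)) (?RN (int d)) ?g ?f"
    using ex by (simp add: short_exact_sequence_iff)
  then show "?R (int d) \<cong> free_Abelian_group {..<k + l}"
    by (rule short_exact_sequence_free[OF _ comm_group_reduced_homology Nd reld])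
qed

lemma (in vertex_attachment) link_empty_iff: "U \<inter> N = {} \<longleftrightarrow> lk = {}"
proof -
  have "geo E lk = {} \<longleftrightarrow> lk = {}"
  proof (cases "lk = {}")
    case True
    then show ?thesis by (auto simp: geo_def)
  next
    case False
    then obtain s where "s \<in> lk" by blast
    then show ?thesis using geo_vertex[OF fin_lk, of s E] by auto
  qed
  moreover have "U \<inter> N = {} \<longleftrightarrow> geo E lk = {}"
  proof -
    obtain f g where "continuous_map (top_of_set (U \<inter> N)) (top_of_set (geo E lk)) f"
        "continuous_map (top_of_set (geo E lk)) (top_of_set (U \<inter> N)) g"
      using link_equiv unfolding homotopy_equivalent_space_def by blast
    then have "f \<in> U \<inter> N \<rightarrow> geo E lk" "g \<in> geo E lk \<rightarrow> U \<inter> N"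
      by (auto simp: continuous_map_def)
    then show ?thesis by blast
  qed
  ultimately show ?thesis by simp
qed

text \<open>\<open>U\<close> is contractible, so the boundary map identifies the pair with the
  reduced homology of \<open>U \<inter> N\<close> one degree lower.\<close>

lemma (in vertex_attachment) relative_homology_link:
  assumes "lk \<noteq> {}"
  shows "relative_homology_group i (top_of_set X) N \<cong> reduced_homology_group (i - 1) (top_of_set (geo E lk))"
proof -
  have ne: "topspace (top_of_set U) \<inter> N \<noteq> {}"
    using link_empty_iff assms by simp
  have "subtopology (top_of_set U) N = top_of_set (U \<inter> N)" by (simp add: subtopology_subtopology)
  then have "relative_homology_group i (top_of_set U) N \<cong> reduced_homology_group (i - 1) (top_of_set (U \<inter> N))"
    using isomorphic_group_relative_homology_of_contractible[OF contractible_U ne, of i] by simp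
  also have "\<dots> \<cong> reduced_homology_group (i - 1) (top_of_set (geo E lk))"
    by (rule homotopy_equivalent_space_imp_isomorphic_reduced_homology_groups[OF link_equiv])
  finally show ?thesis by (rule iso_trans[OF relative_homology_star])
qed

text \<open>With an empty link the star is disjoint from \<open>N\<close>, so nothing is divided out
  and the absolute homology of \<open>U\<close> appears.\<close>

lemma (in vertex_attachment) relative_homology_isolated:
  assumes "lk = {}"
  shows "relative_homology_group i (top_of_set X) N \<cong> homology_group i (top_of_set U)"
proof -
  have "U \<inter> N = {}" using link_empty_iff assms by simp
  then have "topspace (top_of_set U) \<inter> N = topspace (top_of_set U) \<inter> {}" by auto
  then have "relative_homology_group i (top_of_set U) N = homology_group i (top_of_set U)"
    using relative_homology_group_restrict[of i "top_of_set U" N] by simp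
  then show ?thesis using relative_homology_star[of i] by simp
qed

text \<open>A new vertex contributes the homology of its link shifted by one. The degrees match
  because the link carries the index \<open>d\<close> and the complex the index
  \<open>Suc d\<close>.\<close>

theorem spherical_homology:
  assumes sym: "\<And>u v. E u v \<Longrightarrow> E v u" and "spherical E S d k" "S \<noteq> {}"
  shows "(\<forall>i. i \<noteq> int d - 1 \<longrightarrow> trivial_group (reduced_homology_group i (top_of_set (geo E S)))) \<and>
    reduced_homology_group (int d - 1) (top_of_set (geo E S)) \<cong> free_Abelian_group {..<k}"
  using assms(2,3)
proof (induction rule: spherical.induct)
  case empty
  then show ?case by simp
next
  case (cone S a d)
  then have "contractible_space (top_of_set (geo E S))" by (intro contractible_geo_cone) auto
  then have triv: "trivial_group (reduced_homology_group i (top_of_set (geo E S)))" for i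
    by (rule trivial_reduced_homology_group_contractible_space)
  show ?case using triv trivial_group_free[OF triv] by blast
next
  case (attach S d k a l)
  interpret vertex_attachment E S a
    using sym attach.hyps spherical_finite by unfold_locales auto
  have lk: "lk = {y \<in> S. E a y}" by (simp add: lk_def)
  have ne: "S \<noteq> {}" using spherical_empty attach.hyps(1) by blast
  have rel: "(\<forall>i. i \<noteq> int d \<longrightarrow> trivial_group (relative_homology_group i (top_of_set X) N)) \<and>
    relative_homology_group (int d) (top_of_set X) N \<cong> free_Abelian_group {..<l}"
  proof (cases "lk = {}")
    case False
    note iso = relative_homology_link[OF False]
    have IH: "\<forall>i. i \<noteq> int d - 1 \<longrightarrow> trivial_group (reduced_homology_group i (top_of_set (geo E lk)))"
      "reduced_homology_group (int d - 1) (top_of_set (geo E lk)) \<cong> free_Abelian_group {..<l}"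
      using attach.IH(2)[folded lk, OF False] by auto
    have "trivial_group (relative_homology_group i (top_of_set X) N)" if "i \<noteq> int d" for i
    proof -
      have "trivial_group (reduced_homology_group (i - 1) (top_of_set (geo E lk)))"
        using IH(1) that by simp
      then show ?thesis using isomorphic_group_triviality[OF iso[of i]] by simp
    qed
    moreover have "relative_homology_group (int d) (top_of_set X) N \<cong> free_Abelian_group {..<l}"
      by (rule iso_trans[OF iso IH(2)])
    ultimately show ?thesis by blast
  next
    case True
    \<comment> \<open>An isolated vertex adds one path component, that is, one to the rank in degree
      0.\<close>
    then have dl: "d = 0" "l = 1" using spherical_empty attach.hyps(3) unfolding lk by blast+
    have iso: "relative_homology_group i (top_of_set X) N \<cong> homology_group i (top_of_set U)" for i
      by (rule relative_homology_isolated[OF True])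
    have "trivial_group (homology_group i (top_of_set U))" if "i \<noteq> 0" for i
      using trivial_reduced_homology_group_contractible_space[OF contractible_U, of i]
        un_reduced_homology_group[OF that, of "top_of_set U"] by simp
    then have triv: "trivial_group (relative_homology_group i (top_of_set X) N)" if "i \<noteq> 0" for i
      using that isomorphic_group_triviality[OF iso[of i]] by simp
    have "homology_group 0 (top_of_set U) \<cong> integer_group"
    proof (rule isomorphic_integer_zeroth_homology_group)
      show "path_connected_space (top_of_set U)"
        by (rule contractible_imp_path_connected_space[OF contractible_U])
      have "(\<lambda>v. if v = a then 1 else 0) \<in> U"
        using geo_vertex[of "insert a S" a E] fin by (simp add: U_def X_def)
      then show "topspace (top_of_set U) \<noteq> {}" by auto
    qed
    moreover have "integer_group \<cong> free_Abelian_group {..<1::nat}"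
      using isomorphic_group_integer_free_Abelian_group_singleton[of "0::nat"] by (simp add: lessThan_Suc)
    ultimately have "relative_homology_group 0 (top_of_set X) N \<cong> free_Abelian_group {..<1::nat}"
      using iso_trans[OF iso] iso_trans by blast
    then show ?thesis using triv unfolding dl by simp
  qed
  show ?case
    using attach_homology[OF ne, of d k l] rel attach.IH(1)[OF ne] unfolding X_def by simp
qed

subsection \<open>Building spherical flag complexes\<close>

text \<open>Induction over the construction of \<open>S\<close>: joining with \<open>T\<close> sends
  cones to cones, and the link of \<open>a\<close> in the join is its old link joined with
  \<open>T\<close>. So ranks multiply and the shifted dimensions add.\<close>

lemma spherical_join:
  assumes "spherical E S d k" "spherical E T e l"
    and adj: "\<And>s t. s \<in> S \<Longrightarrow> t \<in> T \<Longrightarrow> E s t \<and> E t s \<and> s \<noteq> t"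
  shows "spherical E (S \<union> T) (d + e) (k * l)"
  using assms
proof (induction rule: spherical.induct)
  case empty
  then show ?case by simp
next
  case (cone S a d)
  have "spherical E (S \<union> T) (d + e) 0"
    using cone spherical_finite[OF cone.prems(1)] by (intro spherical.cone[of _ a]) auto
  then show ?case by simp
next
  case (attach S d k a m)
  have "spherical E (S \<union> T) (Suc d + e) (k * l)"
    by (rule attach.IH(1)[OF attach.prems(1)]) (use attach.prems(2) in blast)
  then have S: "spherical E (S \<union> T) (Suc (d + e)) (k * l)" by simp
  have notin: "a \<notin> S \<union> T" using attach.hyps attach.prems by blast
  have "{y \<in> S \<union> T. E a y} = {y \<in> S. E a y} \<union> T" using attach.prems by blast
  moreover have "spherical E ({y \<in> S. E a y} \<union> T) (d + e) (m * l)"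
    by (rule attach.IH(2)[OF attach.prems(1)]) (use attach.prems(2) in blast)
  ultimately have L: "spherical E {y \<in> S \<union> T. E a y} (d + e) (m * l)" by simp
  show ?case using spherical.attach[OF S notin L] by (simp add: algebra_simps)
qed

lemma spherical_image:
  assumes "spherical E S d k" "inj_on f S" "\<And>x y. x \<in> S \<Longrightarrow> y \<in> S \<Longrightarrow> E' (f x) (f y) \<longleftrightarrow> E x y"
  shows "spherical E' (f ` S) d k"
  using assms
proof (induction rule: spherical.induct)
  case empty
  then show ?case using spherical.empty[of E'] by simp
next
  case (cone S a d)
  then show ?case by (intro spherical.cone[of _ "f a"]) auto
next
  case (attach S d k a l)
  have S: "spherical E' (f ` S) (Suc d) k"
    by (rule attach.IH(1)) (use attach.prems in \<open>auto simp: inj_on_def\<close>)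
  have a: "f a \<notin> f ` S" using attach.hyps attach.prems(1) by (auto simp: inj_on_def)
  have "spherical E' (f ` {y \<in> S. E a y}) d l"
    by (rule attach.IH(2)) (use attach.prems in \<open>auto simp: inj_on_def\<close>)
  moreover have "f ` {y \<in> S. E a y} = {y \<in> f ` S. E' (f a) y}"
    using attach.prems(2) by auto
  ultimately have L: "spherical E' {y \<in> f ` S. E' (f a) y} d l" by simp
  show ?case using spherical.attach[OF S a L] by simp
qed

text \<open>The vertices of \<open>T\<close> arrive in the order of increasing \<open>h\<close>, so
  the link met on arrival consists of the neighbours in \<open>S\<close> and the neighbours in
  \<open>T\<close> of smaller \<open>h\<close>. Vertices with equal \<open>h\<close> are not
  adjacent and may come in any order.\<close>

lemma spherical_attach_many:
  fixes h :: "'v \<Rightarrow> nat"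
  assumes "finite T" "S \<inter> T = {}" "spherical E S (Suc d) k"
    and link: "\<And>x. x \<in> T \<Longrightarrow> spherical E ({y \<in> S. E x y} \<union> {y \<in> T. E x y \<and> h y < h x}) d (l x)"
    and h: "\<And>x y. x \<in> T \<Longrightarrow> y \<in> T \<Longrightarrow> E x y \<Longrightarrow> h x \<noteq> h y"
  shows "spherical E (S \<union> T) (Suc d) (k + sum l T)"
  using assms
proof (induction "card T" arbitrary: T)
  case 0
  then show ?case by simp
next
  case (Suc n)
  then have ne: "T \<noteq> {}" by auto
  obtain x where x: "x \<in> T" "\<And>y. y \<in> T \<Longrightarrow> h y \<le> h x"
    using Max_in[of "h ` T"] Max_ge[of "h ` T"] Suc.prems(1) ne
    by (smt (verit, best) finite_imageI image_iff image_is_empty)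
  let ?T = "T - {x}"
  \<comment> \<open>\<open>x\<close> has maximal \<open>h\<close>, so it occurs in no link of a
    vertex attached before it.\<close>
  have sub: "{y \<in> ?T. E z y \<and> h y < h z} = {y \<in> T. E z y \<and> h y < h z}" if "z \<in> ?T" for z
    using x(2)[of z] that by auto
  have "spherical E (S \<union> ?T) (Suc d) (k + sum l ?T)"
  proof (rule Suc.hyps(1))
    show "n = card ?T" using Suc.hyps(2) Suc.prems(1) x(1) by simp
    show "spherical E ({y \<in> S. E z y} \<union> {y \<in> ?T. E z y \<and> h y < h z}) d (l z)" if "z \<in> ?T" for z
      using Suc.prems(4)[of z] sub[OF that] that by simp
  qed (use Suc.prems in auto)
  moreover have "x \<notin> S \<union> ?T" using Suc.prems(2) x(1) by blast
  moreover have "h y < h x" if "y \<in> ?T" "E x y" for y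
    using x(2)[of y] Suc.prems(5)[of x y] that x(1) by auto
  then have "{y \<in> S \<union> ?T. E x y} = {y \<in> S. E x y} \<union> {y \<in> T. E x y \<and> h y < h x}" by auto
  then have "spherical E {y \<in> S \<union> ?T. E x y} d (l x)" using Suc.prems(4)[OF x(1)] by simp
  ultimately have "spherical E (insert x (S \<union> ?T)) (Suc d) (k + sum l ?T + l x)"
    by (rule spherical.attach)
  moreover have "insert x (S \<union> ?T) = S \<union> T" using x(1) by auto
  moreover have "k + sum l ?T + l x = k + sum l T"
    using Suc.prems(1) x(1) by (simp add: sum.remove)
  ultimately show ?case by simp
qed

subsection \<open>Integer vectors and subgroups\<close>

definition smul :: "int \<Rightarrow> (nat \<Rightarrow> int) \<Rightarrow> (nat \<Rightarrow> int)" (infixr "*\<^sub>Z" 75) where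
  "c *\<^sub>Z x = (\<lambda>i. c * x i)"

lemma smul_apply [simp]: "(c *\<^sub>Z x) i = c * x i" by (simp add: smul_def)

lemma smul_simps [simp]: "0 *\<^sub>Z x = 0" "1 *\<^sub>Z x = x" "c *\<^sub>Z 0 = 0" "(- 1) *\<^sub>Z x = - x"
  by (auto simp: fun_eq_iff)

lemma smul_smul: "a *\<^sub>Z (b *\<^sub>Z x) = (a * b) *\<^sub>Z x" by (simp add: fun_eq_iff)

lemma smul_add_left: "(a + b) *\<^sub>Z x = a *\<^sub>Z x + b *\<^sub>Z x"
  and smul_diff_left: "(a - b) *\<^sub>Z x = a *\<^sub>Z x - b *\<^sub>Z x"
  and smul_diff_right: "a *\<^sub>Z (x - y) = a *\<^sub>Z x - a *\<^sub>Z y"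
  by (auto simp: fun_eq_iff algebra_simps)

lemma sum_fun_apply: "(\<Sum>i\<in>A. f i) x = (\<Sum>i\<in>A. f i x)"
  by (induction A rule: infinite_finite_induct) auto

text \<open>Vectors are functions vanishing from \<open>N\<close> on, so that the pointwise
  arithmetic of functions is available.\<close>

definition lat :: "nat \<Rightarrow> (nat \<Rightarrow> int) set" where "lat N = {x. \<forall>i\<ge>N. x i = 0}"

definition subgrp :: "(nat \<Rightarrow> int) set \<Rightarrow> bool" where
  "subgrp V \<longleftrightarrow> 0 \<in> V \<and> (\<forall>x\<in>V. \<forall>y\<in>V. x - y \<in> V)"

lemma subgrpD:
  assumes "subgrp V"
  shows "0 \<in> V" "x \<in> V \<Longrightarrow> y \<in> V \<Longrightarrow> x - y \<in> V" "x \<in> V \<Longrightarrow> - x \<in> V"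
    "x \<in> V \<Longrightarrow> y \<in> V \<Longrightarrow> x + y \<in> V" "x \<in> V \<Longrightarrow> c *\<^sub>Z x \<in> V"
proof -
  show z: "0 \<in> V" and d: "x \<in> V \<Longrightarrow> y \<in> V \<Longrightarrow> x - y \<in> V" for x y
    using assms by (auto simp: subgrp_def)
  show m: "x \<in> V \<Longrightarrow> - x \<in> V" for x using d[OF z, of x] by simp
  show a: "x \<in> V \<Longrightarrow> y \<in> V \<Longrightarrow> x + y \<in> V" for x y using d[of x "- y"] m[of y] by simp
  have n: "x \<in> V \<Longrightarrow> int k *\<^sub>Z x \<in> V" for k
    by (induction k) (auto simp: z smul_add_left intro: a)
  show "x \<in> V \<Longrightarrow> c *\<^sub>Z x \<in> V"
  proof (cases "c \<ge> 0")
    case False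
    assume "x \<in> V"
    then have "- (int (nat (- c)) *\<^sub>Z x) \<in> V" by (intro m n)
    moreover have "- (int (nat (- c)) *\<^sub>Z x) = c *\<^sub>Z x" using False by (simp add: fun_eq_iff)
    ultimately show ?thesis by simp
  qed (use n[of "nat c"] in auto)
qed

lemma subgrp_sum: "subgrp V \<Longrightarrow> (\<And>i. i \<in> A \<Longrightarrow> f i \<in> V) \<Longrightarrow> (\<Sum>i\<in>A. f i) \<in> V"
  by (induction A rule: infinite_finite_induct) (auto simp: subgrpD)

lemma subgrp_lat: "subgrp (lat N)" by (auto simp: subgrp_def lat_def)

lemmas lat_simps [simp] = subgrpD[OF subgrp_lat]
lemmas lat_sum = subgrp_sum[OF subgrp_lat]

lemma subgrp_Int: "subgrp V \<Longrightarrow> subgrp W \<Longrightarrow> subgrp (V \<inter> W)" by (auto simp: subgrp_def)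

text \<open>For a subgroup \<open>V\<close>, the subgroup generated by \<open>V\<close> and
  \<open>x\<close>.\<close>

definition adj :: "(nat \<Rightarrow> int) set \<Rightarrow> (nat \<Rightarrow> int) \<Rightarrow> (nat \<Rightarrow> int) set" where
  "adj V x = {v + c *\<^sub>Z x | v c. v \<in> V}"

lemma subgrp_adj: "subgrp V \<Longrightarrow> subgrp (adj V x)"
  unfolding subgrp_def
proof (intro conjI ballI; elim conjE)
  assume "0 \<in> V"
  then show "0 \<in> adj V x" unfolding adj_def by (intro CollectI exI[of _ 0]) auto
next
  fix y z assume V: "\<forall>x\<in>V. \<forall>y\<in>V. x - y \<in> V" and "y \<in> adj V x" "z \<in> adj V x"
  then obtain v c w d where "y = v + c *\<^sub>Z x" "z = w + d *\<^sub>Z x" "v \<in> V" "w \<in> V"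
    by (auto simp: adj_def)
  moreover have "v + c *\<^sub>Z x - (w + d *\<^sub>Z x) = (v - w) + (c - d) *\<^sub>Z x"
    by (simp add: smul_diff_left)
  ultimately show "y - z \<in> adj V x" using V unfolding adj_def by blast
qed

lemma adj_superset: "subgrp V \<Longrightarrow> V \<subseteq> adj V x" "subgrp V \<Longrightarrow> x \<in> adj V x"
proof -
  show "subgrp V \<Longrightarrow> V \<subseteq> adj V x" unfolding adj_def by (auto intro!: exI[of _ "0::int"])
  show "subgrp V \<Longrightarrow> x \<in> adj V x" unfolding adj_def
    by (auto dest: subgrpD(1) intro!: exI[of _ "0::nat \<Rightarrow> int"] exI[of _ "1::int"])
qed

lemma adj_least: "subgrp W \<Longrightarrow> V \<subseteq> W \<Longrightarrow> x \<in> W \<Longrightarrow> adj V x \<subseteq> W"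
  unfolding adj_def by (auto intro!: subgrpD)

subsection \<open>Subspaces over the prime field\<close>

text \<open>A subspace of \<open>(\<int>/p)\<^sup>N\<close> is represented by its preimage in \<open>\<int>\<^sup>N\<close>.\<close>

locale prime_lattice =
  fixes N p :: nat
  assumes prime: "prime p"
begin

text \<open>The preimage of the zero subspace, hence the least of the represented subspaces.\<close>

definition pl where "pl = {x \<in> lat N. \<forall>i. int p dvd x i}"

definition reduced where "reduced = {x \<in> lat N. \<forall>i. 0 \<le> x i \<and> x i < int p}"

definition red where "red x = (\<lambda>i. x i mod int p)" for x :: "nat \<Rightarrow> int"

definition subsp where "subsp V \<longleftrightarrow> subgrp V \<and> V \<subseteq> lat N \<and> pl \<subseteq> V"

text \<open>The order of the quotient of \<open>V\<close> by \<open>pl\<close>: every class has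
  exactly one member in \<open>reduced\<close>.\<close>

definition cd where "cd V = card (V \<inter> reduced)"

lemma p_gt1: "p > 1" using prime by (rule prime_gt_1_nat)

lemma subspD: "subsp V \<Longrightarrow> subgrp V" "subsp V \<Longrightarrow> x \<in> V \<Longrightarrow> x \<in> lat N" "subsp V \<Longrightarrow> x \<in> pl \<Longrightarrow> x \<in> V"
  by (auto simp: subsp_def)

lemma subsp_closed:
  assumes "subsp V"
  shows "0 \<in> V" "x \<in> V \<Longrightarrow> y \<in> V \<Longrightarrow> x - y \<in> V" "x \<in> V \<Longrightarrow> - x \<in> V"
    "x \<in> V \<Longrightarrow> y \<in> V \<Longrightarrow> x + y \<in> V" "x \<in> V \<Longrightarrow> c *\<^sub>Z x \<in> V"
  using subgrpD[OF subspD(1)[OF assms]] by auto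

lemma subsp_lat: "subsp (lat N)" by (auto simp: subsp_def pl_def subgrp_lat)

lemma subgrp_pl: "subgrp pl" by (auto simp: subgrp_def pl_def)

lemma subsp_pl: "subsp pl" using subgrp_pl by (auto simp: subsp_def pl_def)

lemma subsp_Int: "subsp V \<Longrightarrow> subsp W \<Longrightarrow> subsp (V \<inter> W)"
  by (auto simp: subsp_def subgrp_Int)

lemma subsp_adj: "subsp V \<Longrightarrow> x \<in> lat N \<Longrightarrow> subsp (adj V x)"
  unfolding subsp_def using subgrp_adj adj_superset(1) adj_least[OF subgrp_lat] by blast

lemma adj_le: "subsp B \<Longrightarrow> A \<subseteq> B \<Longrightarrow> x \<in> B \<Longrightarrow> adj A x \<subseteq> B"
  using adj_least subspD(1) by blast

lemma adj_ge: "subsp A \<Longrightarrow> A \<subseteq> adj A x" "subsp A \<Longrightarrow> x \<in> adj A x"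
  using adj_superset subspD(1) by blast+

lemma p_smul_pl: "x \<in> lat N \<Longrightarrow> int p *\<^sub>Z x \<in> pl" by (auto simp: pl_def)

text \<open>\<open>c\<close> is invertible modulo \<open>p\<close> and \<open>V\<close> contains
  \<open>p\<close> times every lattice vector; Bezout combines the two multiples of \<open>x\<close>
  to \<open>x\<close> itself.\<close>

lemma coprime_smul_mem:
  assumes V: "subsp V" and x: "x \<in> lat N" and c: "\<not> int p dvd c" and cx: "c *\<^sub>Z x \<in> V"
  shows "x \<in> V"
proof -
  have "coprime c (int p)"
    using c prime by (metis coprime_commute prime_imp_coprime prime_nat_int_transfer)
  then obtain u v where uv: "u * c + v * int p = 1"
    by (metis bezout_int coprime_imp_gcd_eq_1)
  have "x = u *\<^sub>Z (c *\<^sub>Z x) + v *\<^sub>Z (int p *\<^sub>Z x)"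
    by (simp add: smul_smul uv flip: smul_add_left)
  moreover have "u *\<^sub>Z (c *\<^sub>Z x) \<in> V" "v *\<^sub>Z (int p *\<^sub>Z x) \<in> V"
    using V cx subspD(3)[OF V p_smul_pl[OF x]] by (auto intro: subsp_closed)
  ultimately show ?thesis using subsp_closed(4)[OF V] by metis
qed

lemma red_reduced: "x \<in> lat N \<Longrightarrow> red x \<in> reduced"
  using p_gt1 by (auto simp: red_def reduced_def lat_def)

lemma red_diff: "x \<in> lat N \<Longrightarrow> x - red x \<in> pl"
  by (auto simp: red_def pl_def lat_def minus_mod_eq_mult_div)

lemma red_mem_iff: "subsp V \<Longrightarrow> x \<in> lat N \<Longrightarrow> red x \<in> V \<longleftrightarrow> x \<in> V"
proof -
  assume V: "subsp V" and x: "x \<in> lat N"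
  have d: "x - red x \<in> V" using V red_diff[OF x] by (rule subspD)
  show ?thesis
    using subsp_closed(2)[OF V _ d, of x] subsp_closed(4)[OF V _ d, of "red x"] by auto
qed

lemma red_eq_iff: "x \<in> lat N \<Longrightarrow> y \<in> lat N \<Longrightarrow> red x = red y \<longleftrightarrow> x - y \<in> pl"
  unfolding red_def pl_def fun_eq_iff
  by (auto simp: mod_eq_dvd_iff)

lemma red_reduced_eq: "x \<in> reduced \<Longrightarrow> red x = x"
  by (auto simp: red_def reduced_def)

lemma finite_reduced: "finite reduced"
proof -
  have "reduced \<subseteq> {f. (\<forall>x. (x \<in> {..<N} \<longrightarrow> f x \<in> {0..<int p}) \<and> (x \<notin> {..<N} \<longrightarrow> f x = 0))}"
    by (auto simp: reduced_def lat_def)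
  then show ?thesis by (rule finite_subset) (rule finite_set_of_finite_funs, auto)
qed

lemma card_reduced: "card reduced = p ^ N"
proof -
  have "bij_betw (\<lambda>f. \<lambda>i. if i < N then f i else 0) ({..<N} \<rightarrow>\<^sub>E {0..<int p}) reduced"
    by (rule bij_betwI[where g = "\<lambda>f. restrict f {..<N}"])
      (use p_gt1 in \<open>auto simp: reduced_def lat_def PiE_def Pi_def extensional_def fun_eq_iff\<close>)
  then have "card reduced = card ({..<N} \<rightarrow>\<^sub>E {0..<int p})" by (simp add: bij_betw_same_card)
  also have "\<dots> = p ^ N" by (simp add: card_PiE)
  finally show ?thesis .
qed

lemma subsp_eqI:
  assumes "subsp V" "subsp W" "V \<inter> reduced \<subseteq> W"
  shows "V \<subseteq> W"
proof
  fix x assume "x \<in> V"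
  then have "x \<in> lat N" "red x \<in> V" using assms(1) subspD red_mem_iff by auto
  then have "red x \<in> W" using assms(3) red_reduced by auto
  then show "x \<in> W" using red_mem_iff[OF assms(2) \<open>x \<in> lat N\<close>] by simp
qed

lemma finite_subspaces: "finite {V. subsp V}"
proof (rule finite_imageD)
  show "finite ((\<lambda>V. V \<inter> reduced) ` {V. subsp V})"
    by (rule finite_subset[of _ "Pow reduced"]) (auto simp: finite_reduced)
  show "inj_on (\<lambda>V. V \<inter> reduced) {V. subsp V}"
  proof (rule inj_onI)
    fix V W assume "V \<in> {V. subsp V}" "W \<in> {V. subsp V}" "V \<inter> reduced = W \<inter> reduced"
    then show "V = W" using subsp_eqI[of V W] subsp_eqI[of W V] by auto
  qed
qed

text \<open>By \<open>coprime_smul_mem\<close> the multiples of \<open>x\<close> by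
  \<open>0, ..., p - 1\<close> lie in distinct cosets of \<open>V\<close>, and these cosets exhaust
  \<open>adj V x\<close>.\<close>

lemma cd_adj:
  assumes V: "subsp V" and x: "x \<in> lat N" "x \<notin> V"
  shows "cd (adj V x) = p * cd V"
proof -
  let ?f = "\<lambda>(c, v). red (v + c *\<^sub>Z x)"
  have l: "v + c *\<^sub>Z x \<in> lat N" if "v \<in> V" for v c using that V x by (auto dest: subspD)
  have "bij_betw ?f ({0..<int p} \<times> (V \<inter> reduced)) (adj V x \<inter> reduced)"
    unfolding bij_betw_def
  proof (intro conjI inj_onI)
    fix a b assume "a \<in> {0..<int p} \<times> (V \<inter> reduced)" "b \<in> {0..<int p} \<times> (V \<inter> reduced)" "?f a = ?f b"
    moreover obtain c v d w where ab: "a = (c, v)" "b = (d, w)" by fastforce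
    ultimately have cd: "c \<in> {0..<int p}" "d \<in> {0..<int p}" and vw: "v \<in> V" "v \<in> reduced" "w \<in> V" "w \<in> reduced"
      and eq: "red (v + c *\<^sub>Z x) = red (w + d *\<^sub>Z x)" by auto
    have "v + c *\<^sub>Z x - (w + d *\<^sub>Z x) \<in> pl" using eq red_eq_iff[OF l l] vw by blast
    then have e: "(v - w) + (c - d) *\<^sub>Z x \<in> pl" by (simp add: smul_diff_left algebra_simps)
    then have "(v - w) + (c - d) *\<^sub>Z x - (v - w) \<in> V" using vw V by (blast intro: subsp_closed subspD)
    then have "(c - d) *\<^sub>Z x \<in> V" by simp
    then have "int p dvd c - d" using coprime_smul_mem[OF V x(1)] x(2) by blast
    then have "c mod int p = d mod int p" by (simp add: mod_eq_dvd_iff)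
    then have "c = d" using cd by simp
    then have "v - w \<in> pl" using e by simp
    then have "red v = red w" using red_eq_iff vw V by (blast dest: subspD)
    then have "v = w" using vw by (simp add: red_reduced_eq)
    then show "a = b" using ab \<open>c = d\<close> by simp
  next
    show "?f ` ({0..<int p} \<times> (V \<inter> reduced)) = adj V x \<inter> reduced"
    proof (intro equalityI subsetI)
      fix y assume "y \<in> ?f ` ({0..<int p} \<times> (V \<inter> reduced))"
      then obtain c v where cv: "v \<in> V" "y = red (v + c *\<^sub>Z x)" by auto
      then have "v + c *\<^sub>Z x \<in> adj V x" by (auto simp: adj_def)
      then show "y \<in> adj V x \<inter> reduced"
        using cv l red_reduced red_mem_iff[OF subsp_adj[OF V x(1)] l] by auto
    next
      fix y assume y: "y \<in> adj V x \<inter> reduced"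
      then obtain v c where vc: "y = v + c *\<^sub>Z x" "v \<in> V" by (auto simp: adj_def)
      have vl: "v \<in> lat N" using vc V subspD by blast
      \<comment> \<open>Replacing \<open>v\<close> and \<open>c\<close> by their residues changes
        the vector by an element of \<open>pl\<close> only, so its reduced representative is still
        \<open>y\<close>.\<close>
      have "red v + (c mod int p) *\<^sub>Z x \<in> lat N"
        using vl x red_reduced[OF vl] by (auto simp: reduced_def)
      moreover have "y - (red v + (c mod int p) *\<^sub>Z x) \<in> pl"
      proof -
        have "y - (red v + (c mod int p) *\<^sub>Z x) = (v - red v) + (c div int p) *\<^sub>Z (int p *\<^sub>Z x)"
        proof
          fix i
          have "c * x i = (c div int p * int p + c mod int p) * x i" by simp
          also have "\<dots> = c div int p * (int p * x i) + c mod int p * x i"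
            by (simp only: distrib_right mult.assoc)
          finally show "(y - (red v + (c mod int p) *\<^sub>Z x)) i = ((v - red v) + (c div int p) *\<^sub>Z (int p *\<^sub>Z x)) i"
            unfolding vc by simp
        qed
        moreover have "(v - red v) + (c div int p) *\<^sub>Z (int p *\<^sub>Z x) \<in> pl"
          by (intro subgrpD[OF subgrp_pl] red_diff[OF vl] p_smul_pl[OF x(1)])
        ultimately show ?thesis by (simp only:)
      qed
      ultimately have "y = red (red v + (c mod int p) *\<^sub>Z x)"
        using y red_eq_iff[of y] red_reduced_eq[of y] by (auto simp: reduced_def)
      moreover have "red v \<in> V \<inter> reduced" using vc vl V by (simp add: red_mem_iff red_reduced)
      ultimately show "y \<in> ?f ` ({0..<int p} \<times> (V \<inter> reduced))"
        using p_gt1 by (intro image_eqI[of _ _ "(c mod int p, red v)"]) auto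
    qed
  qed
  then have "cd (adj V x) = card ({0..<int p} \<times> (V \<inter> reduced))" unfolding cd_def by (simp add: bij_betw_same_card)
  then show ?thesis by (simp add: cd_def card_cartesian_product)
qed

lemma cd_mono: "A \<subseteq> B \<Longrightarrow> cd A \<le> cd B"
  unfolding cd_def by (rule card_mono) (auto simp: finite_reduced)

lemma cd_psubset: "subsp A \<Longrightarrow> subsp B \<Longrightarrow> A \<subset> B \<Longrightarrow> cd A < cd B"
  unfolding cd_def
  by (rule psubset_card_mono) (use subsp_eqI[of B A] finite_reduced in auto)

lemma cd_pos: "subsp A \<Longrightarrow> cd A > 0"
proof -
  assume "subsp A"
  then have "0 \<in> A \<inter> reduced" using subsp_closed p_gt1 by (auto simp: reduced_def)
  then show ?thesis unfolding cd_def using finite_reduced by (auto simp: card_gt_0_iff)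
qed

text \<open>Vectors of \<open>B\<close> are added one at a time; each multiplies the order by
  \<open>p\<close>, until \<open>B\<close> is reached.\<close>

lemma cd_power: "subsp A \<Longrightarrow> subsp B \<Longrightarrow> A \<subseteq> B \<Longrightarrow> \<exists>k. cd B = cd A * p ^ k"
proof (induction "cd B - cd A" arbitrary: A rule: less_induct)
  case less
  show ?case
  proof (cases "A = B")
    case True
    then show ?thesis by (intro exI[of _ 0]) simp
  next
    case False
    then obtain x where x: "x \<in> B" "x \<notin> A" using less.prems by blast
    then have xl: "x \<in> lat N" using less.prems subspD by blast
    have s: "adj A x \<subseteq> B" "subsp (adj A x)"
      using less.prems x xl adj_le subsp_adj by blast+
    have c: "cd (adj A x) = p * cd A" using less.prems x xl by (intro cd_adj)
    then have "cd A < cd (adj A x)" using cd_pos[OF less.prems(1)] p_gt1 by simp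
    moreover have "cd (adj A x) \<le> cd B" using s cd_mono by blast
    ultimately obtain k where "cd B = cd (adj A x) * p ^ k"
      using less.hyps[of "adj A x"] s less.prems by (meson diff_less_mono2 order_less_le_trans)
    then show ?thesis using c by (intro exI[of _ "Suc k"]) simp
  qed
qed

lemma cd_pl: "cd pl = 1"
proof -
  have "pl \<inter> reduced = {0}"
    using p_gt1 by (auto simp: pl_def reduced_def fun_eq_iff) (metis zdvd_not_zless le_less)
  then show ?thesis by (simp add: cd_def)
qed

lemma cd_lat: "cd (lat N) = p ^ N"
proof -
  have "lat N \<inter> reduced = reduced" by (auto simp: reduced_def)
  then show ?thesis by (simp add: cd_def card_reduced)
qed

text \<open>The dimension over the prime field. The exponent exists by \<open>cd_power\<close> and
  is unique since p > 1.\<close>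

definition dm where "dm V = (SOME d. cd V = p ^ d)"

lemma cd_dm: "subsp V \<Longrightarrow> cd V = p ^ dm V"
proof -
  assume "subsp V"
  then have "\<exists>d. cd V = p ^ d" using cd_power[OF subsp_pl, of V] cd_pl by (auto simp: subsp_def)
  then show ?thesis unfolding dm_def by (rule someI_ex)
qed

lemma dm_eqI: "subsp V \<Longrightarrow> cd V = p ^ d \<Longrightarrow> dm V = d"
  using cd_dm[of V] p_gt1 power_inject_exp by metis

lemma dm_pl [simp]: "dm pl = 0" using cd_pl subsp_pl by (intro dm_eqI) auto
lemma dm_lat [simp]: "dm (lat N) = N" using cd_lat subsp_lat by (intro dm_eqI) auto

lemma dm_psubset: "subsp A \<Longrightarrow> subsp B \<Longrightarrow> A \<subset> B \<Longrightarrow> dm A < dm B"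
  using cd_psubset[of A B] cd_dm p_gt1 by (simp add: power_strict_increasing_iff)

lemma dm_mono: "subsp A \<Longrightarrow> subsp B \<Longrightarrow> A \<subseteq> B \<Longrightarrow> dm A \<le> dm B"
  using dm_psubset[of A B] by (cases "A = B") (auto simp: psubset_eq)

lemma dm_eq_imp_eq: "subsp A \<Longrightarrow> subsp B \<Longrightarrow> A \<subseteq> B \<Longrightarrow> dm B \<le> dm A \<Longrightarrow> A = B"
  using dm_psubset[of A B] by (cases "A = B") (auto simp: psubset_eq)

lemma dm_adj: "subsp V \<Longrightarrow> x \<in> lat N \<Longrightarrow> x \<notin> V \<Longrightarrow> dm (adj V x) = Suc (dm V)"
  using cd_adj cd_dm[of V] subsp_adj by (intro dm_eqI) auto

lemma cover_eq_adj:
  assumes "subsp A" "subsp W" "A \<subseteq> W" "dm W = Suc (dm A)" "x \<in> W" "x \<notin> A"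
  shows "W = adj A x"
proof -
  have x: "x \<in> lat N" using assms subspD by blast
  have "adj A x \<subseteq> W" using assms subspD by (intro adj_least) auto
  then have "adj A x = W"
    using assms x dm_adj[OF assms(1) x] subsp_adj by (intro dm_eq_imp_eq) auto
  then show ?thesis ..
qed

lemma exists_dm:
  assumes "subsp A" "subsp B" "A \<subseteq> B" "dm A \<le> d" "d \<le> dm B"
  shows "\<exists>W. subsp W \<and> A \<subseteq> W \<and> W \<subseteq> B \<and> dm W = d"
  using assms(4,5)
proof (induction d rule: dec_induct)
  case base
  then show ?case using assms by blast
next
  case (step d)
  then obtain W where W: "subsp W" "A \<subseteq> W" "W \<subseteq> B" "dm W = d" by auto
  then have "W \<noteq> B" using step by auto
  then obtain x where x: "x \<in> B" "x \<notin> W" using W by blast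
  have xl: "x \<in> lat N" using x assms subspD by blast
  have "adj W x \<subseteq> B" using W x assms subspD by (intro adj_least) auto
  then show ?case
    using W x xl dm_adj[of W x] subsp_adj[of W x] adj_superset(1)[OF subspD(1)[OF W(1)], of x] by blast
qed

text \<open>Counts the reduced vectors of \<open>B\<close> outside \<open>C\<close>. A cover
  \<open>W\<close> of \<open>A\<close> not contained in \<open>C\<close> meets \<open>C\<close>
  exactly in \<open>A\<close>, and a vector \<open>x\<close> outside \<open>C\<close> lies in the
  single cover \<open>adj A x\<close>. The quotient is kept in multiplied form.\<close>

lemma card_covers:
  assumes A: "subsp A" and B: "subsp B" and C: "subsp C" and sub: "A \<subseteq> C" "C \<subseteq> B"
  defines "K \<equiv> {W. subsp W \<and> A \<subseteq> W \<and> W \<subseteq> B \<and> dm W = Suc (dm A) \<and> \<not> W \<subseteq> C}"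
  shows "real (card K) * (real p ^ Suc (dm A) - real p ^ dm A) = real p ^ dm B - real p ^ dm C"
proof -
  have finK: "finite K" by (rule finite_subset[OF _ finite_subspaces]) (auto simp: K_def)
  have WC: "W \<inter> C = A" if "W \<in> K" for W
  proof -
    have W: "subsp W" "A \<subseteq> W \<inter> C" "W \<inter> C \<subset> W" "dm W = Suc (dm A)"
      using that sub by (auto simp: K_def)
    have "A = W \<inter> C"
      by (rule dm_eq_imp_eq) (use A W subsp_Int[OF W(1) C] dm_psubset[of "W \<inter> C" W] in auto)
    then show ?thesis ..
  qed
  have eq: "(B - C) \<inter> reduced = (\<Union>W\<in>K. (W - A) \<inter> reduced)"
  proof (intro equalityI subsetI)
    fix x assume x: "x \<in> (B - C) \<inter> reduced"
    then have xl: "x \<in> lat N" "x \<notin> A" using B sub subspD by auto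
    have "adj A x \<in> K"
      using x xl A B sub adj_superset[OF subspD(1)[OF A], of x] dm_adj[OF A xl] subsp_adj[OF A xl(1)]
        adj_least[OF subspD(1)[OF B], of A x] unfolding K_def by auto
    moreover have "x \<in> adj A x" using adj_superset(2)[OF subspD(1)[OF A]] .
    ultimately show "x \<in> (\<Union>W\<in>K. (W - A) \<inter> reduced)" using x xl by blast
  next
    fix x assume "x \<in> (\<Union>W\<in>K. (W - A) \<inter> reduced)"
    then obtain W where W: "W \<in> K" "x \<in> W" "x \<notin> A" "x \<in> reduced" by blast
    then show "x \<in> (B - C) \<inter> reduced" using WC[OF W(1)] by (auto simp: K_def)
  qed
  have disj: "V \<inter> W = A" if VW: "V \<in> K" "W \<in> K" "V \<noteq> W" for V W
  proof (rule ccontr)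
    assume "V \<inter> W \<noteq> A"
    then obtain x where x: "x \<in> V" "x \<in> W" "x \<notin> A" using VW by (auto simp: K_def)
    then have "V = adj A x" "W = adj A x"
      using VW A by (simp_all add: K_def cover_eq_adj)
    then show False using VW by simp
  qed
  have "card ((B - C) \<inter> reduced) = (\<Sum>W\<in>K. card ((W - A) \<inter> reduced))"
    unfolding eq
  proof (rule card_UN_disjoint[OF finK]; intro ballI impI)
    fix V W assume "V \<in> K" "W \<in> K" "V \<noteq> W"
    then show "(V - A) \<inter> reduced \<inter> ((W - A) \<inter> reduced) = {}" using disj[of V W] by blast
  qed (simp add: finite_reduced)
  also have "\<dots> = (\<Sum>W\<in>K. p ^ Suc (dm A) - p ^ dm A)"
  proof (rule sum.cong[OF refl])
    fix W assume W: "W \<in> K"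
    have "(W - A) \<inter> reduced = (W \<inter> reduced) - (A \<inter> reduced)" by blast
    moreover have "A \<inter> reduced \<subseteq> W \<inter> reduced" using W by (auto simp: K_def)
    ultimately have "card ((W - A) \<inter> reduced) = cd W - cd A"
      using finite_reduced by (simp add: cd_def card_Diff_subset)
    then show "card ((W - A) \<inter> reduced) = p ^ Suc (dm A) - p ^ dm A"
      using W A cd_dm by (simp add: K_def)
  qed
  also have "\<dots> = card K * (p ^ Suc (dm A) - p ^ dm A)" by simp
  finally have "card K * (p ^ Suc (dm A) - p ^ dm A) = card ((B - C) \<inter> reduced)" by simp
  also have "\<dots> = cd B - cd C"
  proof -
    have "(B - C) \<inter> reduced = (B \<inter> reduced) - (C \<inter> reduced)" by blast
    moreover have "C \<inter> reduced \<subseteq> B \<inter> reduced" using sub by blast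
    ultimately show ?thesis using finite_reduced by (simp add: cd_def card_Diff_subset)
  qed
  also have "\<dots> = p ^ dm B - p ^ dm C" using B C cd_dm by simp
  finally have *: "card K * (p ^ Suc (dm A) - p ^ dm A) = p ^ dm B - p ^ dm C" .
  have "p ^ dm A \<le> p ^ Suc (dm A)" "p ^ dm C \<le> p ^ dm B"
    using p_gt1 dm_mono[OF C B sub(2)] by (auto intro!: power_increasing)
  then show ?thesis using arg_cong[OF *, of real] by (simp add: of_nat_diff)
qed

end

subsection \<open>The symplectic form modulo \<open>p\<close>\<close>

definition sform :: "nat \<Rightarrow> (nat \<Rightarrow> int) \<Rightarrow> (nat \<Rightarrow> int) \<Rightarrow> int" where
  "sform n x y = (\<Sum>i<n. x i * y (n + i) - x (n + i) * y i)"

lemma sform_linear [simp]: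
  "sform n (x + x') y = sform n x y + sform n x' y"
  "sform n (x - x') y = sform n x y - sform n x' y"
  "sform n x (y + y') = sform n x y + sform n x y'"
  "sform n x (y - y') = sform n x y - sform n x y'"
  "sform n (c *\<^sub>Z x) y = c * sform n x y"
  "sform n x (c *\<^sub>Z y) = c * sform n x y"
  "sform n 0 y = 0" "sform n x 0 = 0" "sform n (- x) y = - sform n x y" "sform n x (- y) = - sform n x y"
  by (simp_all add: sform_def algebra_simps sum.distrib sum_subtractf sum_distrib_left sum_negf)

lemma sform_sum:
  "sform n (\<Sum>i\<in>A. f i) y = (\<Sum>i\<in>A. sform n (f i) y)"
  "sform n x (\<Sum>i\<in>A. f i) = (\<Sum>i\<in>A. sform n x (f i))"
  by (induction A rule: infinite_finite_induct) auto

lemma sform_self [simp]: "sform n x x = 0" by (simp add: sform_def)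

lemma sform_commute: "sform n y x = - sform n x y"
  by (simp add: sform_def flip: sum_negf) (intro sum.cong, auto)

definition unitv :: "nat \<Rightarrow> nat \<Rightarrow> int" where "unitv i = (\<lambda>j. if j = i then 1 else 0)"

lemma unitv_lat: "i < N \<Longrightarrow> unitv i \<in> lat N" by (auto simp: unitv_def lat_def)

lemma sform_unitv:
  assumes "i < n"
  shows "sform n x (unitv (n + i)) = x i" "sform n x (unitv i) = - x (n + i)"
  using assms by (auto simp: sform_def unitv_def sum.delta if_distrib[of "\<lambda>c. _ * c"] sum_subtractf
      sum_negf cong: if_cong)

text \<open>Coordinates are, up to sign, values of the form at unit vectors. Nondegeneracy and the
  divisibility argument for primitive vectors rest on this.\<close>

lemma coord_sform:
  assumes "x \<in> lat (2 * n)"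
  shows "x i = (if i < n then sform n x (unitv (n + i))
    else if i < 2 * n then - sform n x (unitv (i - n)) else 0)"
proof -
  consider "i < n" | "n \<le> i" "i < 2 * n" | "2 * n \<le> i" by linarith
  then show ?thesis
    using assms sform_unitv(1)[of i n x] sform_unitv(2)[of "i - n" n x] by cases (auto simp: lat_def)
qed

locale symp = prime_lattice "2 * n" p for n p :: nat
begin

abbreviation \<Lambda> where "\<Lambda> \<equiv> lat (2 * n)"

definition perp where "perp V = {y \<in> \<Lambda>. \<forall>x\<in>V. int p dvd sform n x y}"

lemma dvd_sform_pl: "x \<in> pl \<Longrightarrow> int p dvd sform n x y" "y \<in> pl \<Longrightarrow> int p dvd sform n x y"
proof -
  show x: "int p dvd sform n x y" if "x \<in> pl" for x y
    using that unfolding sform_def pl_def by (auto intro!: dvd_sum dvd_diff dvd_mult2)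
  show "y \<in> pl \<Longrightarrow> int p dvd sform n x y" using x[of y x] sform_commute[of n x y] by simp
qed

lemma nondegenerate:
  assumes "x \<in> \<Lambda>" "\<And>y. y \<in> \<Lambda> \<Longrightarrow> int p dvd sform n x y"
  shows "x \<in> pl"
  unfolding pl_def
proof (intro CollectI conjI allI)
  fix i
  show "int p dvd x i"
    using assms(2)[OF unitv_lat, of "n + i"] assms(2)[OF unitv_lat, of "i - n"]
    by (subst coord_sform[OF assms(1)]) auto
qed fact

lemma subsp_perp: "subsp (perp V)"
  by (auto simp: subsp_def subgrp_def perp_def pl_def dvd_sform_pl)

lemma perp_antimono: "V \<subseteq> W \<Longrightarrow> perp W \<subseteq> perp V" by (auto simp: perp_def)

lemma perp_commute: "x \<in> \<Lambda> \<Longrightarrow> (\<forall>v\<in>V. int p dvd sform n v x) \<longleftrightarrow> (\<forall>v\<in>V. int p dvd sform n x v)"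
  using sform_commute[of n x] by simp

lemma perp_adj: "subsp V \<Longrightarrow> perp (adj V x) = {y \<in> perp V. int p dvd sform n x y}"
proof (intro equalityI subsetI)
  assume V: "subsp V"
  fix y assume y: "y \<in> perp (adj V x)"
  then show "y \<in> {y \<in> perp V. int p dvd sform n x y}"
    using adj_ge[OF V, of x] by (auto simp: perp_def)
qed (auto simp: perp_def adj_def)

lemma perp_pl: "perp pl = \<Lambda>" by (auto simp: perp_def dvd_sform_pl)

lemma perp_lat: "perp \<Lambda> = pl"
proof
  show "perp \<Lambda> \<subseteq> pl"
  proof
    fix x assume x: "x \<in> perp \<Lambda>"
    then show "x \<in> pl"
      using perp_commute[of x \<Lambda>] by (intro nondegenerate) (auto simp: perp_def)
  qed
qed (auto simp: perp_def dvd_sform_pl pl_def)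

lemma solve_mod: "\<not> int p dvd c \<Longrightarrow> \<exists>t. int p dvd b - t * c"
proof -
  assume "\<not> int p dvd c"
  then have "coprime c (int p)"
    using prime by (metis coprime_commute prime_imp_coprime prime_nat_int_transfer)
  then obtain u v where uv: "u * c + v * int p = 1"
    by (metis bezout_int coprime_imp_gcd_eq_1)
  have "b - b * u * c = b * (u * c + v * int p) - b * u * c" by (simp add: uv)
  also have "\<dots> = int p * (b * v)" by (simp add: algebra_simps)
  finally show ?thesis by (intro exI[of _ "b * u"]) simp
qed

text \<open>The functional \<open>sform n x\<close> is nonzero modulo \<open>p\<close> at
  \<open>w\<close>, so a multiple of \<open>w\<close> moves any vector of \<open>W\<close> into the
  kernel, which therefore has codimension one.\<close>

lemma split_functional:
  assumes W: "subsp W" and w: "w \<in> W" "\<not> int p dvd sform n x w"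
  shows "W = adj {y \<in> W. int p dvd sform n x y} w" "subsp {y \<in> W. int p dvd sform n x y}"
    "dm W = Suc (dm {y \<in> W. int p dvd sform n x y})"
proof -
  let ?K = "{y \<in> W. int p dvd sform n x y}"
  have "subgrp ?K" unfolding subgrp_def
    using subsp_closed[OF W] by auto
  then show K: "subsp ?K" using W dvd_sform_pl(2) by (auto simp: subsp_def)
  show eq: "W = adj ?K w"
  proof
    show "W \<subseteq> adj ?K w"
    proof
      fix y assume y: "y \<in> W"
      obtain t where t: "int p dvd sform n x y - t * sform n x w"
        using solve_mod[OF w(2)] by blast
      have "y = (y - t *\<^sub>Z w) + t *\<^sub>Z w" by simp
      moreover have "y - t *\<^sub>Z w \<in> ?K" using t y w W by (auto intro: subsp_closed)
      ultimately show "y \<in> adj ?K w" unfolding adj_def by blast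
    qed
    show "adj ?K w \<subseteq> W" using W w by (intro adj_le) auto
  qed
  have "w \<in> \<Lambda>" "w \<notin> ?K" using w W by (auto dest: subspD)
  then show "dm W = Suc (dm ?K)" using dm_adj[OF K, of w] eq by simp
qed

lemma dm_perp_step:
  assumes "subsp V"
  shows "dm (perp V) \<le> Suc (dm (perp (adj V x)))"
proof (cases "\<exists>y\<in>perp V. \<not> int p dvd sform n x y")
  case True
  then obtain y where "y \<in> perp V" "\<not> int p dvd sform n x y" by blast
  then show ?thesis using split_functional(3)[OF subsp_perp] by (simp add: perp_adj[OF assms])
next
  case False
  then have "perp (adj V x) = perp V" by (auto simp: perp_adj[OF assms])
  then show ?thesis by simp
qed

text \<open>Adding one vector raises the dimension by one and lowers that of the complement by at
  most one, so the sum cannot decrease.\<close>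

lemma dm_perp_le:
  assumes "subsp A" "subsp B" "A \<subseteq> B"
  shows "dm (perp A) + dm A \<le> dm (perp B) + dm B"
  using assms
proof (induction "dm B - dm A" arbitrary: A)
  case 0
  then have "A = B" by (intro dm_eq_imp_eq) auto
  then show ?case by simp
next
  case (Suc k)
  then have "A \<noteq> B" by auto
  then obtain x where x: "x \<in> B" "x \<notin> A" using Suc.prems by blast
  then have xl: "x \<in> \<Lambda>" using Suc.prems subspD by blast
  have d: "dm (adj A x) = Suc (dm A)" using dm_adj[OF Suc.prems(1) xl x(2)] .
  have "dm (perp (adj A x)) + dm (adj A x) \<le> dm (perp B) + dm B"
    using Suc.hyps(2) Suc.prems x d xl adj_le subsp_adj by (intro Suc.hyps(1)) auto
  then show ?case using dm_perp_step[OF Suc.prems(1), of x] d by simp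
qed

text \<open>The sum of the two dimensions is monotone in \<open>A\<close> and equals
  \<open>2 * n\<close> at both ends, \<open>pl\<close> and the full lattice, hence in
  between.\<close>

lemma dm_perp: "subsp A \<Longrightarrow> dm (perp A) + dm A = 2 * n"
proof -
  assume A: "subsp A"
  have "dm (perp A) + dm A \<le> 2 * n"
    using dm_perp_le[OF A subsp_lat] A subspD(2) by (auto simp: perp_lat)
  moreover have "2 * n \<le> dm (perp A) + dm A"
    using dm_perp_le[OF subsp_pl A] A subspD(3) by (auto simp: perp_pl)
  ultimately show ?thesis by simp
qed

definition isotropic where "isotropic W \<longleftrightarrow> subsp W \<and> W \<subseteq> perp W"

lemma isotropic_subsp: "isotropic W \<Longrightarrow> subsp W" by (simp add: isotropic_def)

lemma isotropic_dm: "isotropic W \<Longrightarrow> dm W \<le> n"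
  using dm_perp[of W] dm_mono[of W "perp W"] subsp_perp[of W] by (simp add: isotropic_def)

lemma isotropic_mono: "isotropic W \<Longrightarrow> subsp V \<Longrightarrow> V \<subseteq> W \<Longrightarrow> isotropic V"
  unfolding isotropic_def using perp_antimono by blast

lemma isotropic_pl: "isotropic pl" by (auto simp: isotropic_def subsp_pl perp_pl) (auto simp: pl_def)

text \<open>The form is alternating, so \<open>x\<close> is orthogonal to itself and only its
  orthogonality to \<open>A\<close> has to be assumed.\<close>

lemma isotropic_adj: "isotropic A \<Longrightarrow> x \<in> perp A \<Longrightarrow> isotropic (adj A x)"
proof -
  assume A: "isotropic A" and x: "x \<in> perp A"
  have sA: "subsp A" using A by (rule isotropic_subsp)
  have xl: "x \<in> \<Lambda>" using x by (simp add: perp_def)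
  have xA: "int p dvd sform n x a" if "a \<in> A" for a
    using x that sform_commute[of n x a] by (auto simp: perp_def)
  have "A \<subseteq> perp (adj A x)" using A xA unfolding perp_adj[OF sA] isotropic_def by blast
  moreover have "x \<in> perp (adj A x)" using x unfolding perp_adj[OF sA] by simp
  ultimately have "adj A x \<subseteq> perp (adj A x)" using subsp_perp adj_le by blast
  then show ?thesis using subsp_adj[OF sA xl] by (simp add: isotropic_def)
qed

end

subsection \<open>Counting subspaces\<close>

text \<open>The number of \<open>i\<close>-dimensional subspaces of a \<open>b\<close>-dimensional
  space over the prime field. For \<open>b < i\<close> a factor with exponent 0 in the numerator
  makes it vanish.\<close>

definition gauss_binomial :: "nat \<Rightarrow> nat \<Rightarrow> nat \<Rightarrow> real" where
  "gauss_binomial p b i = (\<Prod>j<i. (real p ^ (b - j) - 1) / (real p ^ (i - j) - 1))"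

text \<open>The number of \<open>i\<close>-dimensional isotropic subspaces of a symplectic space of
  dimension \<open>2 * g\<close> over the prime field.\<close>

definition isotropic_count :: "nat \<Rightarrow> nat \<Rightarrow> nat \<Rightarrow> real" where
  "isotropic_count p g i = (\<Prod>j<i. (real p ^ (2 * g - 2 * j) - 1) / (real p ^ (i - j) - 1))"

lemma gauss_binomial_Suc:
  "gauss_binomial p b (Suc i) = (real p ^ b - 1) / (real p ^ Suc i - 1) * gauss_binomial p (b - 1) i"
  unfolding gauss_binomial_def by (subst prod.lessThan_Suc_shift) simp

lemma isotropic_count_Suc:
  "isotropic_count p g (Suc i) = (real p ^ (2 * g) - 1) / (real p ^ Suc i - 1) * isotropic_count p (g - 1) i"
  unfolding isotropic_count_def by (subst prod.lessThan_Suc_shift) (simp add: diff_mult_distrib2 diff_diff_add)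

lemma card_pairs:
  assumes "finite A" "finite B"
  shows "(\<Sum>x\<in>A. card {y \<in> B. R x y}) = (\<Sum>y\<in>B. card {x \<in> A. R x y})"
  using sum.swap_restrict[OF assms, of "\<lambda>_ _. 1::nat" R] by simp

text \<open>Related pairs are counted from both sides. The ratio \<open>r / q\<close> is the number
  of partners in \<open>A\<close> of one element of \<open>B\<close>; it is kept in multiplied
  form.\<close>

lemma double_count:
  fixes g q r :: real
  assumes fin: "finite A" "finite B"
    and A: "\<And>x. x \<in> A \<Longrightarrow> real (card {y \<in> B. R x y}) = g"
    and B: "\<And>y. y \<in> B \<Longrightarrow> real (card {x \<in> A. R x y}) * q = r"
  shows "real (card B) * r = real (card A) * q * g"
proof -
  have "real (card B) * r = (\<Sum>y\<in>B. real (card {x \<in> A. R x y}) * q)" using B by simp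
  also have "\<dots> = real (\<Sum>y\<in>B. card {x \<in> A. R x y}) * q" by (simp add: sum_distrib_right)
  also have "\<dots> = real (\<Sum>x\<in>A. card {y \<in> B. R x y}) * q" by (simp only: card_pairs[OF fin])
  also have "\<dots> = real (card A) * q * g" using A by simp
  finally show ?thesis .
qed

context prime_lattice
begin

definition "cl_interval A B = {W. subsp W \<and> A \<subseteq> W \<and> W \<subseteq> B}"

lemma finite_cl_interval: "finite (cl_interval A B)"
  by (rule finite_subset[OF _ finite_subspaces]) (auto simp: cl_interval_def)

lemma real_p: "real p > 1" using p_gt1 by simp

lemma card_lines:
  assumes "subsp A" "subsp B" "A \<subseteq> B"
  shows "real (card {L \<in> cl_interval A B. dm L = Suc (dm A)}) * (real p - 1) = real p ^ (dm B - dm A) - 1"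
proof -
  have "{L \<in> cl_interval A B. dm L = Suc (dm A)}
      = {W. subsp W \<and> A \<subseteq> W \<and> W \<subseteq> B \<and> dm W = Suc (dm A) \<and> \<not> W \<subseteq> A}"
    by (auto simp: cl_interval_def)
  then have "real (card {L \<in> cl_interval A B. dm L = Suc (dm A)}) * (real p ^ Suc (dm A) - real p ^ dm A)
      = real p ^ dm B - real p ^ dm A"
    using card_covers[OF assms(1,2,1) order_refl assms(3)] by simp
  moreover have "real p ^ dm B = real p ^ dm A * real p ^ (dm B - dm A)"
    using dm_mono[OF assms] by (simp flip: power_add)
  ultimately have "real p ^ dm A * (real (card {L \<in> cl_interval A B. dm L = Suc (dm A)}) * (real p - 1))
      = real p ^ dm A * (real p ^ (dm B - dm A) - 1)"
    by (simp add: algebra_simps)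
  then show ?thesis using real_p by simp
qed

text \<open>The lines off a hyperplane form an affine space. These are the vertices that will carry
  homology, so this power of \<open>p\<close> is the source of the ranks of the buildings.\<close>

lemma card_complement_lines:
  assumes "subsp A" "subsp B" "subsp H" "A \<subseteq> H" "H \<subseteq> B" "dm B = Suc (dm H)"
  shows "card {L. subsp L \<and> A \<subseteq> L \<and> L \<subseteq> B \<and> dm L = Suc (dm A) \<and> \<not> L \<subseteq> H} = p ^ (dm H - dm A)"
proof -
  let ?K = "{L. subsp L \<and> A \<subseteq> L \<and> L \<subseteq> B \<and> dm L = Suc (dm A) \<and> \<not> L \<subseteq> H}"
  have "real p ^ dm H = real p ^ dm A * real p ^ (dm H - dm A)"
    using dm_mono[OF assms(1,3,4)] by (simp flip: power_add)
  then have "real p ^ dm A * (real p - 1) * real (card ?K) = real p ^ dm A * (real p - 1) * real p ^ (dm H - dm A)"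
    using card_covers[OF assms(1,2,3,4,5)] assms(6) by (simp add: algebra_simps)
  then have "real (card ?K) = real p ^ (dm H - dm A)" using real_p by simp
  then show ?thesis by (simp flip: of_nat_power)
qed

text \<open>Pairs of a line above \<open>A\<close> and a subspace containing it: the induction
  hypothesis counts above the line, \<open>card_lines\<close> inside the subspace.\<close>

lemma card_cl_interval:
  assumes "subsp A" "subsp B" "A \<subseteq> B"
  shows "real (card {W \<in> cl_interval A B. dm W = dm A + i}) = gauss_binomial p (dm B - dm A) i"
  using assms
proof (induction i arbitrary: A)
  case 0
  have "W = A" if "W \<in> cl_interval A B" "dm W = dm A" for W
    using that 0 dm_eq_imp_eq[of A W] by (simp add: cl_interval_def)
  then have "{W \<in> cl_interval A B. dm W = dm A + 0} = {A}"
    using 0 by (auto simp: cl_interval_def)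
  then show ?case by (simp add: gauss_binomial_def)
next
  case (Suc i)
  let ?L = "{L \<in> cl_interval A B. dm L = Suc (dm A)}" and ?W = "{W \<in> cl_interval A B. dm W = dm A + Suc i}"
  have fin: "finite ?L" "finite ?W" using finite_cl_interval by auto
  have "real (card ?W) * (real p ^ Suc i - 1)
      = real (card ?L) * (real p - 1) * gauss_binomial p (dm B - dm A - 1) i"
  proof (rule double_count[OF fin, of "(\<subseteq>)"])
    fix L assume L: "L \<in> ?L"
    then have "{W \<in> ?W. L \<subseteq> W} = {W \<in> cl_interval L B. dm W = dm L + i}"
      by (auto simp: cl_interval_def)
    then show "real (card {W \<in> ?W. L \<subseteq> W}) = gauss_binomial p (dm B - dm A - 1) i"
      using Suc.IH[of L] L Suc.prems by (simp add: cl_interval_def)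
  next
    fix W assume W: "W \<in> ?W"
    then have "{L \<in> ?L. L \<subseteq> W} = {L \<in> cl_interval A W. dm L = Suc (dm A)}"
      by (auto simp: cl_interval_def)
    then show "real (card {L \<in> ?L. L \<subseteq> W}) * (real p - 1) = real p ^ Suc i - 1"
      using card_lines[of A W] W Suc.prems by (simp add: cl_interval_def)
  qed
  also have "\<dots> = (real p ^ (dm B - dm A) - 1) * gauss_binomial p (dm B - dm A - 1) i"
    using card_lines[OF Suc.prems] by simp
  finally have "real (card ?W) * (real p ^ Suc i - 1)
      = (real p ^ (dm B - dm A) - 1) * gauss_binomial p (dm B - dm A - 1) i" .
  moreover have "real p ^ Suc i > 1" using real_p by (intro one_less_power) auto
  ultimately show ?case unfolding gauss_binomial_Suc by (simp add: field_simps)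
qed

end

section \<open>Counting isotropic subspaces\<close>

context symp
begin

definition "isotropic_above A = {W. isotropic W \<and> A \<subset> W}"

lemma finite_isotropic: "finite {W. isotropic W \<and> P W}"
  by (rule finite_subset[OF _ finite_subspaces]) (auto simp: isotropic_def)

text \<open>Covers of \<open>A\<close> arise by adding one vector, and by
  \<open>isotropic_adj\<close> this vector only has to lie in \<open>perp A\<close>.\<close>

lemma isotropic_cover_iff:
  assumes "isotropic A"
  shows "isotropic L \<and> A \<subseteq> L \<and> dm L = Suc (dm A) \<longleftrightarrow> subsp L \<and> A \<subseteq> L \<and> L \<subseteq> perp A \<and> dm L = Suc (dm A)"
proof (intro iffI; elim conjE; intro conjI)
  assume "isotropic L" "A \<subseteq> L"
  then show "L \<subseteq> perp A" using perp_antimono[of A L] by (auto simp: isotropic_def)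
next
  assume L: "subsp L" "A \<subseteq> L" "L \<subseteq> perp A" "dm L = Suc (dm A)"
  then have "A \<noteq> L" by auto
  then obtain x where x: "x \<in> L" "x \<notin> A" using L by blast
  then have "L = adj A x" using L assms cover_eq_adj[of A L x] by (simp add: isotropic_def)
  then show "isotropic L" using isotropic_adj[OF assms, of x] x L by blast
qed (auto simp: isotropic_def)

text \<open>The double count of \<open>card_cl_interval\<close>, except that the admissible lines
  above \<open>A\<close> are those of \<open>perp A\<close> modulo \<open>A\<close>, a space of
  dimension \<open>2 * (n - dm A)\<close>.\<close>

lemma card_isotropic:
  assumes "isotropic A"
  shows "real (card {W. isotropic W \<and> A \<subseteq> W \<and> dm W = dm A + i}) = isotropic_count p (n - dm A) i"
  using assms
proof (induction i arbitrary: A)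
  case 0
  have "W = A" if "isotropic W" "A \<subseteq> W" "dm W = dm A" for W
    using that 0 dm_eq_imp_eq[of A W] by (simp add: isotropic_def)
  then have "{W. isotropic W \<and> A \<subseteq> W \<and> dm W = dm A + 0} = {A}"
    using 0 by auto
  then show ?case by (simp add: isotropic_count_def)
next
  case (Suc i)
  have sA: "subsp A" using Suc.prems by (rule isotropic_subsp)
  let ?L = "{L. isotropic L \<and> A \<subseteq> L \<and> dm L = Suc (dm A)}"
    and ?W = "{W. isotropic W \<and> A \<subseteq> W \<and> dm W = dm A + Suc i}"
  have fin: "finite ?L" "finite ?W" using finite_isotropic by auto
  have "real (card ?W) * (real p ^ Suc i - 1)
      = real (card ?L) * (real p - 1) * isotropic_count p (n - dm A - 1) i"
  proof (rule double_count[OF fin, of "(\<subseteq>)"])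
    fix L assume L: "L \<in> ?L"
    then have "{W \<in> ?W. L \<subseteq> W} = {W. isotropic W \<and> L \<subseteq> W \<and> dm W = dm L + i}"
      by auto
    then show "real (card {W \<in> ?W. L \<subseteq> W}) = isotropic_count p (n - dm A - 1) i"
      using Suc.IH[of L] L by simp
  next
    fix W assume W: "W \<in> ?W"
    then have "{L \<in> ?L. L \<subseteq> W} = {L \<in> cl_interval A W. dm L = Suc (dm A)}"
      using isotropic_mono[of W] by (auto simp: cl_interval_def isotropic_subsp)
    then show "real (card {L \<in> ?L. L \<subseteq> W}) * (real p - 1) = real p ^ Suc i - 1"
      using card_lines[of A W] W sA by (simp add: isotropic_subsp)
  qed
  also have "real (card ?L) * (real p - 1) = real p ^ (2 * (n - dm A)) - 1"
  proof -
    have "?L = {L \<in> cl_interval A (perp A). dm L = Suc (dm A)}"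
      using isotropic_cover_iff[OF Suc.prems] by (auto simp: cl_interval_def)
    moreover have "dm (perp A) - dm A = 2 * (n - dm A)"
      using dm_perp[OF sA] by simp
    ultimately show ?thesis
      using card_lines[OF sA subsp_perp, of A] Suc.prems by (simp add: isotropic_def)
  qed
  finally have "real (card ?W) * (real p ^ Suc i - 1)
      = (real p ^ (2 * (n - dm A)) - 1) * isotropic_count p (n - dm A - 1) i" .
  moreover have "real p ^ Suc i > 1" using real_p by (intro one_less_power) auto
  ultimately show ?case unfolding isotropic_count_Suc by (simp add: field_simps)
qed

end

subsection \<open>The Solomon--Tits theorem\<close>

text \<open>The comparability graph: its flag complex is the order complex.\<close>

definition incident :: "'a set \<Rightarrow> 'a set \<Rightarrow> bool" where
  "incident V W \<longleftrightarrow> V \<subset> W \<or> W \<subset> V"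

context prime_lattice
begin

definition "op_interval A B = {W. subsp W \<and> A \<subset> W \<and> W \<subset> B}"

lemma finite_op_interval: "finite (op_interval A B)"
  by (rule finite_subset[OF _ finite_subspaces]) (auto simp: op_interval_def)

text \<open>A vector of \<open>W\<close> outside \<open>H\<close> generates \<open>B\<close> over
  \<open>H\<close>, and the same vector generates \<open>W\<close> over
  \<open>W \<inter> H\<close>.\<close>

lemma hyperplane_section:
  assumes "subsp H" "subsp B" "H \<subseteq> B" "dm B = Suc (dm H)" "subsp W" "W \<subseteq> B" "\<not> W \<subseteq> H"
  shows "dm W = Suc (dm (W \<inter> H))"
proof -
  obtain x where x: "x \<in> W" "x \<notin> H" using assms by blast
  have xl: "x \<in> lat N" using x assms subspD by blast
  have B: "B = adj H x" using assms x by (intro cover_eq_adj) auto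
  have s: "subsp (W \<inter> H)" using assms subsp_Int by blast
  have "W \<subseteq> adj (W \<inter> H) x"
  proof
    fix w assume w: "w \<in> W"
    then obtain h c where h: "w = h + c *\<^sub>Z x" "h \<in> H" using B assms(6) by (auto simp: adj_def)
    then have "h = w - c *\<^sub>Z x" by simp
    then have "h \<in> W" using w x assms(5) subsp_closed by metis
    then show "w \<in> adj (W \<inter> H) x" using h by (auto simp: adj_def)
  qed
  moreover have "adj (W \<inter> H) x \<subseteq> W" using assms x by (intro adj_le) auto
  ultimately have "W = adj (W \<inter> H) x" by blast
  moreover have "x \<notin> W \<inter> H" using x by blast
  ultimately show ?thesis using dm_adj[OF s xl] by simp
qed

lemma dm_incident: "subsp V \<Longrightarrow> subsp W \<Longrightarrow> incident V W \<Longrightarrow> dm V \<noteq> dm W"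
  using dm_psubset[of V W] dm_psubset[of W V] unfolding incident_def by fastforce

text \<open>Fix a hyperplane \<open>H\<close> of \<open>B\<close> above \<open>A\<close>. The
  subspaces inside \<open>H\<close> form a cone with apex \<open>H\<close>. The others are attached
  by decreasing dimension; the link of \<open>W\<close> is a cone with apex
  \<open>W \<inter> H\<close>, unless this intersection is \<open>A\<close>. In that case
  \<open>W\<close> is a line complementary to \<open>H\<close>, and its link is the interval from
  \<open>W\<close> to \<open>B\<close>.\<close>

theorem spherical_interval:
  assumes "subsp A" "subsp B" "A \<subset> B" "dm B = dm A + Suc j"
  shows "spherical incident (op_interval A B) j (p ^ (Suc j choose 2))"
  using assms
proof (induction j arbitrary: A)
  case 0
  have "False" if "subsp W" "A \<subset> W" "W \<subset> B" for W
    using dm_psubset[of A W] dm_psubset[of W B] 0 that by simp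
  then have "op_interval A B = {}" by (auto simp: op_interval_def)
  then show ?case using spherical.empty[of incident] by (simp add: binomial_eq_0)
next
  case (Suc j)
  obtain H where H: "subsp H" "A \<subseteq> H" "H \<subseteq> B" "dm H = dm A + Suc j"
    using exists_dm[OF Suc.prems(1,2), of "dm A + Suc j"] Suc.prems by auto
  have AH: "A \<subset> H" using H by auto
  have HB: "H \<subset> B" "dm B = Suc (dm H)" using H Suc.prems by auto
  let ?S = "{W \<in> op_interval A B. W \<subseteq> H}" and ?T = "{W \<in> op_interval A B. \<not> W \<subseteq> H}"
  \<comment> \<open>Only the complementary lines contribute; each adds the rank of a shorter
    interval.\<close>
  let ?l = "\<lambda>W. if dm W = Suc (dm A) then p ^ (Suc j choose 2) else 0"
  have S: "spherical incident ?S (Suc j) 0"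
  proof (rule spherical.cone[of _ H])
    show "finite ?S" using finite_op_interval[of A B] by (rule rev_finite_subset) blast
    show "H \<in> ?S" using H(1) AH HB by (simp add: op_interval_def)
    show "incident H V \<and> incident V H" if "V \<in> ?S" "V \<noteq> H" for V
      using that by (simp add: incident_def psubset_eq)
  qed
  have "spherical incident (?S \<union> ?T) (Suc j) (0 + sum ?l ?T)"
  proof (rule spherical_attach_many[where h = "\<lambda>W. dm B - dm W", OF _ _ S])
    fix W assume "W \<in> ?T"
    then have W: "subsp W" "A \<subset> W" "W \<subset> B" "\<not> W \<subseteq> H" by (auto simp: op_interval_def)
    let ?K = "{V \<in> ?S. incident W V} \<union> {V \<in> ?T. incident W V \<and> dm B - dm V < dm B - dm W}"
    have less: "dm W < dm B" using W Suc.prems dm_psubset by blast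
    have K: "?K = {V. subsp V \<and> A \<subset> V \<and> V \<subseteq> W \<inter> H} \<union> op_interval W B"
    proof (intro equalityI subsetI)
      fix V assume "V \<in> ?K"
      then show "V \<in> {V. subsp V \<and> A \<subset> V \<and> V \<subseteq> W \<inter> H} \<union> op_interval W B"
      proof
        assume "V \<in> {V \<in> ?S. incident W V}"
        then have V: "subsp V" "A \<subset> V" "V \<subseteq> H" "W \<subset> V \<or> V \<subset> W"
          by (simp_all add: op_interval_def incident_def)
        then have "V \<subseteq> W" using W(4) by blast
        then show ?thesis using V by simp
      next
        assume "V \<in> {V \<in> ?T. incident W V \<and> dm B - dm V < dm B - dm W}"
        then have V: "subsp V" "V \<subset> B" "W \<subset> V \<or> V \<subset> W" "dm B - dm V < dm B - dm W"
          by (simp_all add: op_interval_def incident_def)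
        then have "\<not> V \<subset> W" using dm_psubset[OF V(1) W(1)] by linarith
        then show ?thesis using V by (simp add: op_interval_def)
      qed
    next
      fix V assume "V \<in> {V. subsp V \<and> A \<subset> V \<and> V \<subseteq> W \<inter> H} \<union> op_interval W B"
      then show "V \<in> ?K"
      proof
        assume "V \<in> op_interval W B"
        then have V: "subsp V" "W \<subset> V" "V \<subset> B" by (simp_all add: op_interval_def)
        then have "dm W < dm V" "A \<subset> V" "\<not> V \<subseteq> H" using W dm_psubset[of W V] by blast+
        then show "V \<in> ?K" using V less by (simp add: incident_def op_interval_def diff_less_mono2)
      next
        assume "V \<in> {V. subsp V \<and> A \<subset> V \<and> V \<subseteq> W \<inter> H}"
        then have V: "subsp V" "A \<subset> V" "V \<subseteq> W" "V \<subseteq> H" by simp_all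
        then have "V \<subset> W" "V \<subset> B" using W(4) HB(1) by blast+
        then show "V \<in> ?K" using V by (simp add: incident_def op_interval_def)
      qed
    qed
    have sec: "dm W = Suc (dm (W \<inter> H))" using W H HB Suc.prems by (intro hyperplane_section[of H B]) auto
    have sWH: "subsp (W \<inter> H)" using W H subsp_Int by blast
    show "spherical incident ?K j (?l W)"
    proof (cases "dm W = Suc (dm A)")
      case True
      then have "A = W \<inter> H" using sec sWH W H Suc.prems by (intro dm_eq_imp_eq) auto
      then have "?K = op_interval W B" unfolding K by auto
      then show ?thesis using Suc.IH[of W] True W Suc.prems by simp
    next
      case False
      then have "A \<noteq> W \<inter> H" using sec by auto
      then have "A \<subset> W \<inter> H" using W H by auto
      then have "spherical incident ?K j 0"
        unfolding K using W sWH finite_subspaces finite_op_interval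
        by (intro spherical.cone[of _ "W \<inter> H"]) (auto simp: incident_def op_interval_def)
      then show ?thesis using False by simp
    qed
  next
    fix V W assume "V \<in> ?T" "W \<in> ?T" "incident V W"
    then have "subsp V" "subsp W" "V \<subset> B" "W \<subset> B" "dm V \<noteq> dm W"
      using dm_incident by (simp_all add: op_interval_def)
    then show "dm B - dm V \<noteq> dm B - dm W"
      using dm_psubset[of V B] dm_psubset[of W B] Suc.prems(2) by simp
  qed (use finite_op_interval in auto)
  moreover have "?S \<union> ?T = op_interval A B" by blast
  moreover have "sum ?l ?T = p ^ (Suc (Suc j) choose 2)"
  proof -
    have "{W \<in> ?T. dm W = Suc (dm A)} = {L. subsp L \<and> A \<subseteq> L \<and> L \<subseteq> B \<and> dm L = Suc (dm A) \<and> \<not> L \<subseteq> H}"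
    proof -
      have "A \<noteq> L" "L \<noteq> B" if "dm L = Suc (dm A)" for L using that Suc.prems by auto
      then show ?thesis by (auto simp: op_interval_def psubset_eq)
    qed
    then have "card {W \<in> ?T. dm W = Suc (dm A)} = p ^ Suc j"
      using card_complement_lines[of A B H] H HB Suc.prems by simp
    moreover have "sum ?l ?T = card {W \<in> ?T. dm W = Suc (dm A)} * p ^ (Suc j choose 2)"
      using finite_op_interval by (simp add: sum.If_cases Int_def)
    \<comment> \<open>Pascal's rule for the exponent: \<open>Suc j\<close> from the number of lines
      and \<open>Suc j choose 2\<close> from each link.\<close>
    ultimately show ?thesis by (simp add: numeral_2_eq_2 power_add)
  qed
  ultimately show ?case by simp
qed

end

section \<open>Sphericity of the poset of isotropic subspaces\<close>

context symp
begin

lemma isotropic_aboveD: "W \<in> isotropic_above A \<Longrightarrow> isotropic W" "W \<in> isotropic_above A \<Longrightarrow> A \<subset> W"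
  "W \<in> isotropic_above A \<Longrightarrow> subsp W"
  by (auto simp: isotropic_above_def isotropic_subsp)

lemma finite_isotropic_above: "finite (isotropic_above A)"
  unfolding isotropic_above_def by (rule finite_isotropic)

text \<open>Fix a line \<open>U\<close> above \<open>A\<close> inside \<open>perp A\<close>. The
  subspaces containing \<open>U\<close> form a cone; those orthogonal to \<open>U\<close> but not
  containing it have a conical link with apex \<open>W + U\<close>. A \<open>W\<close> not
  orthogonal to \<open>U\<close> meets \<open>perp U\<close> in a hyperplane of \<open>W\<close>,
  again an apex unless \<open>W\<close> is itself a line above \<open>A\<close>. Only these lines
  contribute.\<close>

theorem spherical_isotropic_above:
  assumes "isotropic A" "dm A + j = n"
  shows "spherical incident (isotropic_above A) j (p ^ (j ^ 2))"
  using assms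
proof (induction j arbitrary: A)
  case 0
  have False if W: "W \<in> isotropic_above A" for W
    using dm_psubset[of A W] isotropic_dm[of W] isotropic_aboveD[OF W] 0 isotropic_subsp by fastforce
  then have "isotropic_above A = {}" by blast
  then show ?case using spherical.empty[of incident] by simp
next
  case (Suc j)
  have sA: "subsp A" and iA: "A \<subseteq> perp A" using Suc.prems by (auto simp: isotropic_def)
  have dA: "dm (perp A) = dm A + 2 * Suc j" using dm_perp[OF sA] Suc.prems by simp
  then have "A \<noteq> perp A" by auto
  then obtain u where u: "u \<in> perp A" "u \<notin> A" using iA by blast
  have ul: "u \<in> \<Lambda>" using u by (simp add: perp_def)
  define U where "U = adj A u"
  have U: "isotropic U" "subsp U" "A \<subset> U" "u \<in> U" "dm U = Suc (dm A)"
    using isotropic_adj[OF Suc.prems(1) u(1)] adj_ge[OF sA, of u] u(2) dm_adj[OF sA ul u(2)]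
    by (auto simp: U_def isotropic_subsp)
  have pU: "perp U = {y \<in> perp A. int p dvd sform n u y}" unfolding U_def by (rule perp_adj[OF sA])
  have leU: "U \<subseteq> W \<longleftrightarrow> u \<in> W" if "subsp W" "A \<subseteq> W" for W
    using that adj_le[of W A u] U(4) by (auto simp: U_def)
  let ?P = "isotropic_above A"
  let ?S0 = "{W \<in> ?P. U \<subseteq> W}" and ?S1 = "{W \<in> ?P. \<not> U \<subseteq> W \<and> W \<subseteq> perp U}"
    and ?S2 = "{W \<in> ?P. \<not> W \<subseteq> perp U}"
  have S0: "spherical incident ?S0 (Suc j) 0"
  proof (rule spherical.cone[of _ U])
    show "finite ?S0" using finite_isotropic_above[of A] by (rule rev_finite_subset) blast
    show "U \<in> ?S0" using U by (simp add: isotropic_above_def)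
    show "incident U V \<and> incident V U" if "V \<in> ?S0" "V \<noteq> U" for V
      using that by (simp add: incident_def psubset_eq)
  qed
  \<comment> \<open>By increasing dimension: a link member contains \<open>W\<close> and
    \<open>U\<close>, hence \<open>adj W u\<close>, or it is smaller than \<open>W\<close>. In both
    cases it is comparable with the apex.\<close>
  have "spherical incident (?S0 \<union> ?S1) (Suc j) (0 + (\<Sum>_\<in>?S1. 0))"
  proof (rule spherical_attach_many[where h = dm, OF _ _ S0])
    fix W assume W1: "W \<in> ?S1"
    then have W: "isotropic W" "subsp W" "A \<subset> W" "\<not> U \<subseteq> W" "W \<subseteq> perp U"
      by (simp_all add: isotropic_above_def isotropic_subsp)
    have uW: "u \<notin> W" using leU W by blast
    have upW: "u \<in> perp W"
      using W(5) ul sform_commute[of n u] unfolding pU by (auto simp: perp_def)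
    let ?M = "adj W u"
    have M: "isotropic ?M" "subsp ?M" "W \<subset> ?M" "u \<in> ?M"
      using isotropic_adj[OF W(1) upW] adj_ge[OF W(2), of u] uW by (auto simp: isotropic_subsp)
    have UM: "U \<subseteq> ?M" using leU[of ?M] M W by blast
    let ?K = "{V \<in> ?S0. incident W V} \<union> {V \<in> ?S1. incident W V \<and> dm V < dm W}"
    show "spherical incident ?K j 0"
    proof (rule spherical.cone[of _ ?M])
      show "finite ?K" using finite_isotropic_above[of A] by (rule rev_finite_subset) blast
      have "A \<subset> ?M" using M W by blast
      then show "?M \<in> ?K" using M UM by (simp add: isotropic_above_def incident_def)
      fix V assume "V \<in> ?K" and ne: "V \<noteq> ?M"
      then have "V \<subset> ?M \<or> ?M \<subset> V"
      proof (elim disjE UnE)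
        assume "V \<in> {V \<in> ?S0. incident W V}"
        then have V: "subsp V" "U \<subseteq> V" "W \<subset> V \<or> V \<subset> W"
          by (simp_all add: isotropic_above_def isotropic_subsp incident_def)
        then have "W \<subseteq> V" "u \<in> V" using W(4) U(4) by blast+
        then show ?thesis using adj_le[OF V(1)] ne by blast
      next
        assume "V \<in> {V \<in> ?S1. incident W V \<and> dm V < dm W}"
        then have V: "subsp V" "W \<subset> V \<or> V \<subset> W" "dm V < dm W"
          by (simp_all add: isotropic_above_def isotropic_subsp incident_def)
        then have "V \<subset> W" using dm_psubset[OF W(2) V(1)] by linarith
        then show ?thesis using M(3) by blast
      qed
      then show "incident ?M V \<and> incident V ?M" by (auto simp: incident_def)
    qed
  next
    show "dm V \<noteq> dm W" if "V \<in> ?S1" "W \<in> ?S1" "incident V W" for V W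
      using that dm_incident[of V W] by (simp add: isotropic_above_def isotropic_subsp)
    show "finite ?S1" using finite_isotropic_above[of A] by (rule rev_finite_subset) blast
  qed blast
  moreover have "?S0 \<union> ?S1 = {W \<in> ?P. W \<subseteq> perp U}"
    using perp_antimono by (auto simp: isotropic_above_def isotropic_def)
  ultimately have S01: "spherical incident {W \<in> ?P. W \<subseteq> perp U} (Suc j) 0" by simp
  let ?S = "{W \<in> ?P. W \<subseteq> perp U}"
  let ?l = "\<lambda>W. if dm W = Suc (dm A) then p ^ (j ^ 2) else 0"
  \<comment> \<open>By decreasing dimension: the subspaces below \<open>W\<close> that are already
    present are those orthogonal to \<open>U\<close>.\<close>
  have "spherical incident (?S \<union> ?S2) (Suc j) (0 + sum ?l ?S2)"
  proof (rule spherical_attach_many[where h = "\<lambda>W. n - dm W", OF _ _ S01])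
    fix W assume "W \<in> ?S2"
    then have W: "isotropic W" "subsp W" "A \<subset> W" "\<not> W \<subseteq> perp U"
      by (simp_all add: isotropic_above_def isotropic_subsp)
    have WpA: "W \<subseteq> perp A" using W perp_antimono[of A W] by (auto simp: isotropic_def)
    let ?M = "{y \<in> W. int p dvd sform n u y}"
    have MU: "?M = W \<inter> perp U" using WpA by (auto simp: pU)
    obtain w where w: "w \<in> W" "\<not> int p dvd sform n u w" using W(4) WpA by (auto simp: pU)
    note M = split_functional(2,3)[OF W(2) w]
    have "int p dvd sform n u a" if "a \<in> A" for a
      using u(1) that sform_commute[of n u a] by (simp add: perp_def)
    then have AM: "A \<subseteq> ?M" using W(3) by blast
    have less: "dm W \<le> n" using isotropic_dm W by blast
    let ?K = "{V \<in> ?S. incident W V} \<union> {V \<in> ?S2. incident W V \<and> n - dm V < n - dm W}"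
    have K: "?K = {V \<in> ?P. V \<subseteq> ?M} \<union> isotropic_above W"
    proof (intro equalityI subsetI)
      fix V assume "V \<in> ?K"
      then show "V \<in> {V \<in> ?P. V \<subseteq> ?M} \<union> isotropic_above W"
      proof
        assume "V \<in> {V \<in> ?S. incident W V}"
        then have V: "V \<in> ?P" "V \<subseteq> perp U" "W \<subset> V \<or> V \<subset> W" by (simp_all add: incident_def)
        then have "V \<subseteq> ?M" using W(4) unfolding MU by blast
        then show ?thesis using V by simp
      next
        assume "V \<in> {V \<in> ?S2. incident W V \<and> n - dm V < n - dm W}"
        then have V: "isotropic V" "subsp V" "W \<subset> V \<or> V \<subset> W" "n - dm V < n - dm W"
          by (simp_all add: incident_def isotropic_above_def isotropic_subsp)
        then have "\<not> V \<subset> W" using dm_psubset[OF V(2) W(2)] by linarith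
        then show ?thesis using V by (simp add: isotropic_above_def)
      qed
    next
      fix V assume "V \<in> {V \<in> ?P. V \<subseteq> ?M} \<union> isotropic_above W"
      then show "V \<in> ?K"
      proof
        assume "V \<in> {V \<in> ?P. V \<subseteq> ?M}"
        then have V: "V \<in> ?P" "V \<subseteq> W" "V \<subseteq> perp U" by (auto simp: MU)
        then have "V \<subset> W" using W(4) by blast
        then show "V \<in> ?K" using V by (simp add: incident_def)
      next
        assume "V \<in> isotropic_above W"
        then have V: "isotropic V" "subsp V" "W \<subset> V" by (simp_all add: isotropic_above_def isotropic_subsp)
        then have "A \<subset> V" "\<not> V \<subseteq> perp U" "dm W < dm V" "dm V \<le> n"
          using W dm_psubset[of W V] isotropic_dm by blast+
        then show "V \<in> ?K" using V by (simp add: incident_def isotropic_above_def diff_less_mono2)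
      qed
    qed
    show "spherical incident ?K j (?l W)"
    proof (cases "dm W = Suc (dm A)")
      case True
      then have "A = ?M" using M AM sA by (intro dm_eq_imp_eq) auto
      then have "{V \<in> ?P. V \<subseteq> ?M} = {}" by (auto simp: isotropic_above_def)
      then have "?K = isotropic_above W" unfolding K by blast
      moreover have "spherical incident (isotropic_above W) j (p ^ (j ^ 2))"
        using True Suc.prems(2) by (intro Suc.IH W) simp
      ultimately show ?thesis using True by simp
    next
      case False
      then have ne: "A \<noteq> ?M" using M by auto
      have "isotropic ?M" using isotropic_mono[OF W(1) M(1)] by blast
      then have MP: "?M \<in> ?P" using AM ne by (auto simp: isotropic_above_def)
      have "spherical incident ?K j 0"
        unfolding K
      proof (rule spherical.cone[of _ ?M])
        show "finite ({V \<in> ?P. V \<subseteq> ?M} \<union> isotropic_above W)"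
          using finite_isotropic_above by simp
        show "?M \<in> {V \<in> ?P. V \<subseteq> ?M} \<union> isotropic_above W" using MP by simp
        fix V assume "V \<in> {V \<in> ?P. V \<subseteq> ?M} \<union> isotropic_above W" and ne: "V \<noteq> ?M"
        then have "V \<subset> ?M \<or> ?M \<subset> V"
        proof (elim UnE)
          assume "V \<in> isotropic_above W"
          then have "W \<subset> V" by (rule isotropic_aboveD)
          then show ?thesis by blast
        qed blast
        then show "incident ?M V \<and> incident V ?M" unfolding incident_def by blast
      qed
      then show ?thesis using False by simp
    qed
  next
    fix V W assume "V \<in> ?S2" "W \<in> ?S2" "incident V W"
    then have "isotropic V" "isotropic W" "dm V \<noteq> dm W"
      using dm_incident by (simp_all add: isotropic_above_def isotropic_subsp)
    then show "n - dm V \<noteq> n - dm W" using isotropic_dm[of V] isotropic_dm[of W] by linarith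
  next
    show "finite ?S2" using finite_isotropic_above[of A] by (rule rev_finite_subset) blast
  qed blast
  moreover have "?S \<union> ?S2 = ?P" by blast
  moreover have "sum ?l ?S2 = p ^ (Suc j ^ 2)"
  proof -
    have ApU: "A \<subseteq> perp U" "perp U \<subseteq> perp A"
      using U perp_antimono[of A U] by (auto simp: isotropic_def)
    have dU: "dm (perp A) = Suc (dm (perp U))" using dm_perp[OF U(2)] dm_perp[OF sA] U(5) by simp
    have "{W \<in> ?S2. dm W = Suc (dm A)}
        = {L. subsp L \<and> A \<subseteq> L \<and> L \<subseteq> perp A \<and> dm L = Suc (dm A) \<and> \<not> L \<subseteq> perp U}"
    proof -
      have "A \<noteq> L" if "dm L = Suc (dm A)" for L using that by auto
      then have "W \<in> ?S2 \<and> dm W = Suc (dm A) \<longleftrightarrow>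
          (isotropic W \<and> A \<subseteq> W \<and> dm W = Suc (dm A)) \<and> \<not> W \<subseteq> perp U" for W
        by (auto simp: isotropic_above_def psubset_eq)
      then show ?thesis unfolding isotropic_cover_iff[OF Suc.prems(1)] by auto
    qed
    then have "card {W \<in> ?S2. dm W = Suc (dm A)} = p ^ (dm (perp U) - dm A)"
      using card_complement_lines[OF sA subsp_perp subsp_perp ApU dU] by simp
    \<comment> \<open>The contributing lines are those of \<open>perp A\<close> off the hyperplane
      \<open>perp U\<close>; the exponent is the difference of the squares of \<open>Suc j\<close>
      and \<open>j\<close>.\<close>
    moreover have "dm (perp U) - dm A = 2 * j + 1" using dU dA by simp
    moreover have "sum ?l ?S2 = card {W \<in> ?S2. dm W = Suc (dm A)} * p ^ (j ^ 2)"
      using finite_isotropic_above by (simp add: sum.If_cases Int_def)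
    ultimately have "sum ?l ?S2 = p ^ (2 * j + 1 + j ^ 2)" by (simp only: power_add)
    moreover have "2 * j + 1 + j ^ 2 = Suc j ^ 2" by (simp add: power2_eq_square)
    ultimately show ?thesis by (simp only:)
  qed
  ultimately show ?case by simp
qed

end

subsection \<open>Inflated buildings\<close>

text \<open>Labels are ignored and no set is incident with itself, so the copies of one subspace are
  pairwise non-adjacent.\<close>

abbreviation inflated_incident :: "'a set \<times> 'b \<Rightarrow> 'a set \<times> 'b \<Rightarrow> bool" where
  "inflated_incident x y \<equiv> incident (fst x) (fst y)"

text \<open>The copies with label 0 form \<open>P\<close>. When a further copy of \<open>W\<close>
  is attached, all labels are present below \<open>W\<close> but only label 0 above it, so each of
  the \<open>m - 1\<close> further copies adds the product of the two ranks.\<close>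

lemma spherical_inflate:
  fixes h :: "'a set \<Rightarrow> nat"
  assumes fin: "finite P" and P: "spherical incident P (Suc d) k" and m: "m \<ge> 1"
    and h: "\<And>V W. V \<in> P \<Longrightarrow> W \<in> P \<Longrightarrow> V \<subset> W \<Longrightarrow> h V < h W"
    and below: "\<And>W. W \<in> P \<Longrightarrow> spherical inflated_incident ({V \<in> P. V \<subset> W} \<times> {..<m}) (a W) (f W)"
    and above: "\<And>W. W \<in> P \<Longrightarrow> spherical incident {V \<in> P. W \<subset> V} (b W) (g W)"
    and d: "\<And>W. W \<in> P \<Longrightarrow> a W + b W = d"
  shows "spherical inflated_incident (P \<times> {..<m}) (Suc d) (k + (m - 1) * (\<Sum>W\<in>P. f W * g W))"
proof -
  let ?E = "inflated_incident :: 'a set \<times> nat \<Rightarrow> 'a set \<times> nat \<Rightarrow> bool"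
  let ?i = "\<lambda>W. (W, 0::nat)"
  let ?T = "P \<times> {1..<m}" and ?l = "\<lambda>(W, c). f W * g W"
  have img: "spherical ?E (?i ` Q) e l" if "spherical incident Q e l" for Q e l
    using that by (rule spherical_image) (auto simp: inj_on_def)
  have "spherical ?E (?i ` P \<union> ?T) (Suc d) (k + sum ?l ?T)"
  proof (rule spherical_attach_many[where h = "h \<circ> fst", OF _ _ img[OF P]])
    show "finite ?T" using fin by simp
    show "?i ` P \<inter> ?T = {}" by auto
    show "(h \<circ> fst) x \<noteq> (h \<circ> fst) y" if "x \<in> ?T" "y \<in> ?T" "?E x y" for x y
    proof -
      have "fst x \<in> P" "fst y \<in> P" using that by auto
      then show ?thesis using h[of "fst x" "fst y"] h[of "fst y" "fst x"] that(3)
        unfolding incident_def by (elim disjE) simp_all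
    qed
    fix x assume x: "x \<in> ?T"
    let ?W = "fst x"
    have W: "?W \<in> P" using x by auto
    let ?B = "{V \<in> P. V \<subset> ?W} \<times> {..<m}" and ?A = "?i ` {V \<in> P. ?W \<subset> V}"
    let ?K = "{y \<in> ?i ` P. ?E x y} \<union> {y \<in> ?T. ?E x y \<and> (h \<circ> fst) y < (h \<circ> fst) x}"
    have lt: "h V < h ?W" if "V \<in> P" "V \<subset> ?W" for V using h that W by blast
    have gt: "\<not> h V < h ?W" if "V \<in> P" "?W \<subset> V" for V using h[of ?W V] that W by simp
    have "?K = ?B \<union> ?A"
    proof (intro equalityI subsetI)
      fix y assume "y \<in> ?K"
      then show "y \<in> ?B \<union> ?A"
      proof
        assume "y \<in> {y \<in> ?i ` P. ?E x y}"
        then obtain V where V: "y = (V, 0)" "V \<in> P" "incident ?W V" by auto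
        then show ?thesis using m unfolding incident_def by (elim disjE) simp_all
      next
        assume "y \<in> {y \<in> ?T. ?E x y \<and> (h \<circ> fst) y < (h \<circ> fst) x}"
        then have y: "fst y \<in> P" "snd y < m" "incident ?W (fst y)" "h (fst y) < h ?W" by auto
        then have "fst y \<subset> ?W" using gt[of "fst y"] unfolding incident_def by blast
        then show ?thesis using y by (simp add: mem_Times_iff)
      qed
    next
      fix y assume "y \<in> ?B \<union> ?A"
      then show "y \<in> ?K"
      proof
        assume "y \<in> ?B"
        then have y: "fst y \<in> P" "snd y < m" "fst y \<subset> ?W" by (simp_all add: mem_Times_iff)
        then have E: "h (fst y) < h ?W" "?E x y" using lt[OF y(1,3)] by (simp_all add: incident_def)
        show ?thesis
        proof (cases "snd y = 0")
          case True
          then have "y = ?i (fst y)" by (simp add: prod_eq_iff)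
          then have "y \<in> ?i ` P" using y(1) by (rule image_eqI)
          then show ?thesis using E by simp
        next
          case False
          then show ?thesis using E y by (simp add: mem_Times_iff)
        qed
      next
        assume "y \<in> ?A"
        then obtain V where "y = (V, 0)" "V \<in> P" "?W \<subset> V" by blast
        then show ?thesis by (simp add: incident_def)
      qed
    qed
    moreover have "spherical ?E (?B \<union> ?A) (a ?W + b ?W) (f ?W * g ?W)"
    proof (rule spherical_join[OF below[OF W] img[OF above[OF W]]])
      fix s t assume "s \<in> ?B" "t \<in> ?A"
      then have "fst s \<subset> ?W" "t \<in> ?A" by (simp_all add: mem_Times_iff)
      moreover obtain V where "t = (V, 0)" "?W \<subset> V" using \<open>t \<in> ?A\<close> by blast
      ultimately have lt: "fst s \<subset> fst t" by (simp add: psubset_trans)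
      then have "s \<noteq> t" by (cases "s = t") simp_all
      then show "?E s t \<and> ?E t s \<and> s \<noteq> t" using lt by (simp add: incident_def)
    qed
    ultimately show "spherical ?E ?K d (?l x)" using d[OF W] by (simp add: case_prod_unfold)
  qed
  moreover have "?i ` P \<union> ?T = P \<times> {..<m}"
  proof (intro equalityI subsetI)
    fix x assume "x \<in> P \<times> {..<m}"
    then show "x \<in> ?i ` P \<union> ?T" by (cases x; cases "snd x = 0") auto
  qed (use m in auto)
  moreover have "sum ?l ?T = (m - 1) * (\<Sum>W\<in>P. f W * g W)"
    by (simp add: sum.cartesian_product[symmetric] sum_distrib_left)
  ultimately show ?thesis by simp
qed

text \<open>The rank of the inflated poset of proper nonzero subspaces of a
  \<open>j\<close>-dimensional space, with \<open>s\<close> labels besides 0. The summand at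
  \<open>i\<close> belongs to the \<open>i\<close>-dimensional subspaces: their number, the extra
  labels, the inflated part below and the ordinary interval above.\<close>

fun inflated_rank :: "nat \<Rightarrow> real \<Rightarrow> nat \<Rightarrow> real" where
  "inflated_rank p s j = real p ^ (j choose 2) +
     (\<Sum>i\<in>{1..<j}. gauss_binomial p j i * s * inflated_rank p s i * real p ^ ((j - i) choose 2))"

declare inflated_rank.simps [simp del]

lemma sum_by_rank:
  fixes \<phi> :: "nat \<Rightarrow> real"
  assumes "finite P" "finite I" "\<And>W. W \<in> P \<Longrightarrow> r W \<in> I"
  shows "(\<Sum>W\<in>P. \<phi> (r W)) = (\<Sum>i\<in>I. real (card {W \<in> P. r W = i}) * \<phi> i)"
proof -
  have "(\<Sum>W\<in>P. \<phi> (r W)) = (\<Sum>i\<in>I. \<Sum>W\<in>{W \<in> P. r W = i}. \<phi> (r W))"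
    using assms by (intro sum.group[symmetric]) auto
  also have "\<dots> = (\<Sum>i\<in>I. real (card {W \<in> P. r W = i}) * \<phi> i)"
    by (intro sum.cong) auto
  finally show ?thesis .
qed

context prime_lattice
begin

text \<open>The lower parts are inflated and need the induction hypothesis; the upper parts carry
  label 0 only and are covered by \<open>spherical_interval\<close>.\<close>

theorem spherical_inflated_interval:
  assumes "subsp B" "dm B = Suc j" "m \<ge> 1"
  shows "\<exists>k. spherical inflated_incident (op_interval pl B \<times> {..<m}) j k \<and>
    real k = inflated_rank p (real m - 1) (Suc j)"
  using assms(1,2)
proof (induction j arbitrary: B rule: less_induct)
  case (less j)
  have plB: "pl \<subset> B" using less.prems subspD(3) by (metis dm_pl nat.distinct(1) psubsetI subsetI)
  note base = spherical_interval[OF subsp_pl less.prems(1) plB, of j]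
  show ?case
  proof (cases j)
    case 0
    have False if "W \<in> op_interval pl B" for W
      using that dm_psubset[of pl W] dm_psubset[of W B] less.prems 0 subsp_pl
      by (simp add: op_interval_def)
    then have "op_interval pl B = {}" by blast
    then show ?thesis
      using spherical.empty[of inflated_incident] 0
      by (intro exI[of _ 1]) (simp add: inflated_rank.simps[of _ _ "Suc 0"] binomial_eq_0)
  next
    case (Suc d)
    let ?P = "op_interval pl B"
    have W: "subsp W" "pl \<subset> W" "W \<subset> B" "0 < dm W" "dm W \<le> j" if "W \<in> ?P" for W
      using that dm_psubset[of pl W] dm_psubset[of W B] subsp_pl less.prems by (auto simp: op_interval_def)
    have "\<exists>k. spherical inflated_incident (op_interval pl W \<times> {..<m}) (dm W - 1) k \<and>
        real k = inflated_rank p (real m - 1) (dm W)" if "W \<in> ?P" for W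
      using less.IH[of "dm W - 1" W] W[OF that] by auto
    then obtain f where f: "\<And>W. W \<in> ?P \<Longrightarrow>
        spherical inflated_incident (op_interval pl W \<times> {..<m}) (dm W - 1) (f W) \<and>
        real (f W) = inflated_rank p (real m - 1) (dm W)" by metis
    define g where "g W = p ^ ((Suc j - dm W) choose 2)" for W
    have below: "{V \<in> ?P. V \<subset> W} = op_interval pl W" and above: "{V \<in> ?P. W \<subset> V} = op_interval W B"
      if "W \<in> ?P" for W
      using W(2,3)[OF that] by (auto simp: op_interval_def)
    have "spherical inflated_incident (?P \<times> {..<m}) (Suc d)
        (p ^ (Suc j choose 2) + (m - 1) * (\<Sum>W\<in>?P. f W * g W))"
    proof (rule spherical_inflate[where h = dm and a = "\<lambda>W. dm W - 1" and b = "\<lambda>W. j - dm W"])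
      show "spherical incident ?P (Suc d) (p ^ (Suc j choose 2))" using base less.prems Suc by simp
      fix V assume V: "V \<in> ?P"
      show "spherical incident {U \<in> ?P. V \<subset> U} (j - dm V) (g V)"
        unfolding above[OF V] using spherical_interval[of V B "j - dm V"] W[OF V] less.prems
        by (simp add: g_def Suc_diff_le)
      show "dm V - 1 + (j - dm V) = d" using W(4,5)[OF V] Suc by simp
      show "spherical inflated_incident ({U \<in> ?P. U \<subset> V} \<times> {..<m}) (dm V - 1) (f V)"
        unfolding below[OF V] using f[OF V] by blast
      show "dm V < dm W'" if "W' \<in> ?P" "V \<subset> W'" for W'
        using that dm_psubset[OF W(1)[OF V] W(1)] by blast
    qed (use finite_op_interval assms(3) in auto)
    moreover have "real (p ^ (Suc j choose 2) + (m - 1) * (\<Sum>W\<in>?P. f W * g W)) = inflated_rank p (real m - 1) (Suc j)"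
    proof -
      let ?\<phi> = "\<lambda>i. inflated_rank p (real m - 1) i * real p ^ ((Suc j - i) choose 2)"
      have "real (\<Sum>W\<in>?P. f W * g W) = (\<Sum>W\<in>?P. ?\<phi> (dm W))"
        using f by (simp add: g_def)
      also have "\<dots> = (\<Sum>i\<in>{1..<Suc j}. real (card {W \<in> ?P. dm W = i}) * ?\<phi> i)"
        by (rule sum_by_rank) (use finite_op_interval W(4,5) in \<open>auto simp: Suc_le_eq less_Suc_eq_le\<close>)
      also have "\<dots> = (\<Sum>i\<in>{1..<Suc j}. gauss_binomial p (Suc j) i * ?\<phi> i)"
      proof (rule sum.cong[OF refl])
        fix i assume i: "i \<in> {1..<Suc j}"
        have "pl \<noteq> V" "V \<noteq> B" if "dm V = i" for V using that i less.prems by auto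
        then have "{W \<in> ?P. dm W = i} = {W \<in> cl_interval pl B. dm W = dm pl + i}"
          by (auto simp: op_interval_def cl_interval_def psubset_eq)
        then show "real (card {W \<in> ?P. dm W = i}) * ?\<phi> i = gauss_binomial p (Suc j) i * ?\<phi> i"
          using card_cl_interval[OF subsp_pl less.prems(1), of i] plB less.prems by simp
      qed
      finally have e: "real (\<Sum>W\<in>?P. f W * g W) = (\<Sum>i\<in>{1..<Suc j}. gauss_binomial p (Suc j) i * ?\<phi> i)" .
      have "real (p ^ (Suc j choose 2) + (m - 1) * (\<Sum>W\<in>?P. f W * g W))
          = real p ^ (Suc j choose 2) + (real m - 1) * real (\<Sum>W\<in>?P. f W * g W)"
        by (simp only: of_nat_add of_nat_mult of_nat_power of_nat_diff[OF assms(3)] of_nat_1)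
      also have "\<dots> = inflated_rank p (real m - 1) (Suc j)"
        unfolding e by (subst inflated_rank.simps, simp only: sum_distrib_left)
          (intro arg_cong2[of _ _ _ _ "(+)"] refl sum.cong, simp only: mult_ac)
      finally show ?thesis .
    qed
    ultimately show ?thesis using Suc by blast
  qed
qed

end

text \<open>Below a member all subspaces are isotropic, so the lower parts are inflated intervals;
  above it lie the isotropic posets of \<open>spherical_isotropic_above\<close>.\<close>

theorem (in symp) spherical_inflated_isotropic:
  assumes n: "n \<ge> 1" and m: "m \<ge> 1"
  shows "\<exists>k. spherical inflated_incident (isotropic_above pl \<times> {..<m}) n k \<and>
    real k = real p ^ (n ^ 2) + (\<Sum>i\<in>{1..n}. isotropic_count p n i * (real m - 1) *
      inflated_rank p (real m - 1) i * real p ^ ((n - i) ^ 2))"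
proof -
  let ?P = "isotropic_above pl"
  obtain d where d: "n = Suc d" using n by (cases n) auto
  have W: "isotropic W" "subsp W" "pl \<subset> W" "0 < dm W" "dm W \<le> n" if "W \<in> ?P" for W
    using isotropic_aboveD[OF that] dm_psubset[of pl W] subsp_pl isotropic_dm by auto
  have "\<exists>k. spherical inflated_incident (op_interval pl W \<times> {..<m}) (dm W - 1) k \<and>
      real k = inflated_rank p (real m - 1) (dm W)" if "W \<in> ?P" for W
  proof -
    have "dm W = Suc (dm W - 1)" using W(4)[OF that] by simp
    from spherical_inflated_interval[OF W(2)[OF that] this m] this show ?thesis by metis
  qed
  then obtain f where f: "\<And>W. W \<in> ?P \<Longrightarrow>
      spherical inflated_incident (op_interval pl W \<times> {..<m}) (dm W - 1) (f W) \<and>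
      real (f W) = inflated_rank p (real m - 1) (dm W)" by metis
  define g where "g W = p ^ ((n - dm W) ^ 2)" for W
  have below: "{V \<in> ?P. V \<subset> W} = op_interval pl W" if "W \<in> ?P" for W
  proof -
    have "isotropic V \<longleftrightarrow> subsp V" if "V \<subset> W" for V
      using that isotropic_mono[OF W(1)[OF \<open>W \<in> ?P\<close>]] isotropic_subsp by blast
    then show ?thesis unfolding isotropic_above_def op_interval_def by blast
  qed
  have above: "{V \<in> ?P. W \<subset> V} = isotropic_above W" if "W \<in> ?P" for W
    using W(3)[OF that] unfolding isotropic_above_def by blast
  have "spherical inflated_incident (?P \<times> {..<m}) (Suc d) (p ^ (n ^ 2) + (m - 1) * (\<Sum>W\<in>?P. f W * g W))"
  proof (rule spherical_inflate[where h = dm and a = "\<lambda>W. dm W - 1" and b = "\<lambda>W. n - dm W"])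
    show "spherical incident ?P (Suc d) (p ^ (n ^ 2))"
      using spherical_isotropic_above[OF isotropic_pl, of n] by (simp flip: d)
    fix V assume V: "V \<in> ?P"
    show "spherical incident {U \<in> ?P. V \<subset> U} (n - dm V) (g V)"
      unfolding above[OF V] g_def using W[OF V] by (intro spherical_isotropic_above) auto
    show "dm V - 1 + (n - dm V) = d" using W(4,5)[OF V] d by simp
    show "spherical inflated_incident ({U \<in> ?P. U \<subset> V} \<times> {..<m}) (dm V - 1) (f V)"
      unfolding below[OF V] using f[OF V] by blast
    show "dm V < dm W'" if "W' \<in> ?P" "V \<subset> W'" for W'
      using that dm_psubset[OF W(2)[OF V] W(2)] by blast
  qed (use finite_isotropic_above m in auto)
  moreover have "real (p ^ (n ^ 2) + (m - 1) * (\<Sum>W\<in>?P. f W * g W)) = real p ^ (n ^ 2) +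
      (\<Sum>i\<in>{1..n}. isotropic_count p n i * (real m - 1) *
      inflated_rank p (real m - 1) i * real p ^ ((n - i) ^ 2))"
  proof -
    let ?\<phi> = "\<lambda>i. inflated_rank p (real m - 1) i * real p ^ ((n - i) ^ 2)"
    have "real (\<Sum>W\<in>?P. f W * g W) = (\<Sum>W\<in>?P. ?\<phi> (dm W))"
      using f by (simp add: g_def)
    also have "\<dots> = (\<Sum>i\<in>{1..n}. real (card {W \<in> ?P. dm W = i}) * ?\<phi> i)"
      by (rule sum_by_rank) (use finite_isotropic_above W(4,5) in \<open>auto simp: Suc_le_eq\<close>)
    also have "\<dots> = (\<Sum>i\<in>{1..n}. isotropic_count p n i * ?\<phi> i)"
    proof (rule sum.cong[OF refl])
      fix i assume i: "i \<in> {1..n}"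
      have "pl \<noteq> V" if "dm V = i" for V using that i by auto
      then have "{W \<in> ?P. dm W = i} = {W. isotropic W \<and> pl \<subseteq> W \<and> dm W = dm pl + i}"
        by (auto simp: isotropic_above_def psubset_eq)
      then show "real (card {W \<in> ?P. dm W = i}) * ?\<phi> i = isotropic_count p n i * ?\<phi> i"
        using card_isotropic[OF isotropic_pl, of i] by simp
    qed
    finally have e: "real (\<Sum>W\<in>?P. f W * g W) = (\<Sum>i\<in>{1..n}. isotropic_count p n i * ?\<phi> i)" .
    have "real (p ^ (n ^ 2) + (m - 1) * (\<Sum>W\<in>?P. f W * g W))
        = real p ^ (n ^ 2) + (real m - 1) * real (\<Sum>W\<in>?P. f W * g W)"
      by (simp only: of_nat_add of_nat_mult of_nat_power of_nat_diff[OF m] of_nat_1)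
    also have "\<dots> = real p ^ (n ^ 2) + (\<Sum>i\<in>{1..n}. isotropic_count p n i * (real m - 1) *
      inflated_rank p (real m - 1) i * real p ^ ((n - i) ^ 2))"
      unfolding e sum_distrib_left
      by (intro arg_cong2[of _ _ _ _ "(+)"] refl sum.cong, simp only: mult_ac)
    finally show ?thesis .
  qed
  ultimately show ?thesis using d by blast
qed

subsection \<open>Partial symplectic bases\<close>

context symp
begin

text \<open>Relations hold modulo \<open>m\<close>; the case \<open>m = 0\<close> is that of exact equality.\<close>

definition psb :: "int \<Rightarrow> nat \<Rightarrow> (nat \<Rightarrow> nat \<Rightarrow> int) \<Rightarrow> (nat \<Rightarrow> nat \<Rightarrow> int) \<Rightarrow> bool" where
  "psb m k a b \<longleftrightarrow> (\<forall>i<k. a i \<in> \<Lambda> \<and> b i \<in> \<Lambda>) \<and>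
     (\<forall>i<k. \<forall>j<k. m dvd sform n (a i) (a j) \<and> m dvd sform n (b i) (b j) \<and>
        m dvd sform n (a i) (b j) - (if i = j then 1 else 0))"

text \<open>Orthogonal projection away from the hyperbolic pairs; its values are orthogonal to them
  modulo the same \<open>m\<close> for which the pairs satisfy their relations.\<close>

definition proj where
  "proj k a b x = x - (\<Sum>i<k. sform n x (b i) *\<^sub>Z a i - sform n x (a i) *\<^sub>Z b i)"

lemma psb_lat: "psb m k a b \<Longrightarrow> i < k \<Longrightarrow> a i \<in> \<Lambda>" "psb m k a b \<Longrightarrow> i < k \<Longrightarrow> b i \<in> \<Lambda>"
  by (auto simp: psb_def)

lemma psbD:
  assumes "psb m k a b" "i < k" "j < k"
  shows "m dvd sform n (a i) (a j)" "m dvd sform n (b i) (b j)"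
    "m dvd sform n (a i) (b j) - (if i = j then 1 else 0)"
  using assms by (auto simp: psb_def)

lemma psb_exact:
  assumes "psb 0 k a b" "i < k" "j < k"
  shows "sform n (a i) (a j) = 0" "sform n (b i) (b j) = 0" "sform n (a i) (b j) = (if i = j then 1 else 0)"
    "sform n (b i) (a j) = (if i = j then -1 else 0)"
  using psbD[OF assms] sform_commute[of n "b i" "a j"] psbD[OF assms(1,3,2)] by auto

lemma psb_dvd: "psb m k a b \<Longrightarrow> q dvd m \<Longrightarrow> psb q k a b"
  unfolding psb_def by (meson dvd_trans)

lemma psb_prefix: "psb m k a b \<Longrightarrow> j \<le> k \<Longrightarrow> psb m j a b"
  unfolding psb_def by auto

lemma psb_change:
  assumes "psb m k a b" "\<And>i. i < k \<Longrightarrow> a' i = a i" "\<And>i. i < k \<Longrightarrow> b' i = b i"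
  shows "psb m k a' b'"
  using assms by (auto simp: psb_def)

lemma proj_lat: "psb m k a b \<Longrightarrow> x \<in> \<Lambda> \<Longrightarrow> proj k a b x \<in> \<Lambda>"
  unfolding proj_def using psb_lat by (intro lat_simps lat_sum) auto

lemma sum_delta_lt: "j < k \<Longrightarrow> (\<Sum>i<k::nat. c i * (if i = j then 1 else 0)) = (c j :: int)"
  by (subst sum.remove[of _ j]) auto

lemma proj_orth:
  assumes P: "psb m k a b" and j: "j < k"
  shows "m dvd sform n (proj k a b x) (a j)" "m dvd sform n (proj k a b x) (b j)"
proof -
  let ?\<delta> = "\<lambda>i. if i = j then 1 else (0::int)"
  let ?A = "\<lambda>i. sform n x (b i) * sform n (a i) (a j) + sform n x (a i) * (sform n (a j) (b i) - ?\<delta> i)"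
  have "(\<Sum>i<k. sform n x (b i) * sform n (a i) (a j) - sform n x (a i) * sform n (b i) (a j))
      = (\<Sum>i<k. ?A i + sform n x (a i) * ?\<delta> i)"
    by (intro sum.cong refl) (simp add: sform_commute[of n "b _" "a j"] algebra_simps)
  also have "\<dots> = (\<Sum>i<k. ?A i) + sform n x (a j)"
    by (simp only: sum.distrib sum_delta_lt[OF j])
  finally have "sform n (proj k a b x) (a j) = - (\<Sum>i<k. ?A i)"
    by (simp add: proj_def sform_sum)
  moreover have "m dvd ?A i" if "i < k" for i
    using psbD(1)[OF P that j] psbD(3)[OF P j that] by (intro dvd_add dvd_mult) (auto simp: eq_commute)
  ultimately show "m dvd sform n (proj k a b x) (a j)"
    by (metis (no_types, lifting) dvd_minus_iff dvd_sum lessThan_iff)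
  let ?B = "\<lambda>i. sform n x (b i) * (sform n (a i) (b j) - ?\<delta> i) - sform n x (a i) * sform n (b i) (b j)"
  have "(\<Sum>i<k. sform n x (b i) * sform n (a i) (b j) - sform n x (a i) * sform n (b i) (b j))
      = (\<Sum>i<k. ?B i + sform n x (b i) * ?\<delta> i)"
    by (intro sum.cong refl) (simp add: algebra_simps)
  also have "\<dots> = (\<Sum>i<k. ?B i) + sform n x (b j)"
    by (simp only: sum.distrib sum_delta_lt[OF j])
  finally have "sform n (proj k a b x) (b j) = - (\<Sum>i<k. ?B i)"
    by (simp add: proj_def sform_sum)
  moreover have "m dvd ?B i" if "i < k" for i
    by (rule dvd_diff[OF dvd_mult dvd_mult]) (use psbD(2)[OF P that j] psbD(3)[OF P that j] in auto)
  ultimately show "m dvd sform n (proj k a b x) (b j)"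
    by (metis (no_types, lifting) dvd_minus_iff dvd_sum lessThan_iff)
qed

lemma proj_orth_exact:
  assumes "psb 0 k a b" "j < k"
  shows "sform n (proj k a b x) (a j) = 0" "sform n (proj k a b x) (b j) = 0"
    "sform n (a j) (proj k a b x) = 0" "sform n (b j) (proj k a b x) = 0"
  using proj_orth[OF assms, of x] sform_commute[of n "a j" "proj k a b x"]
    sform_commute[of n "b j" "proj k a b x"] by auto

lemma sform_proj_right:
  "sform n x (proj k a b y) = sform n x y
    - (\<Sum>i<k. sform n y (b i) * sform n x (a i) - sform n y (a i) * sform n x (b i))"
  by (simp add: proj_def sform_sum)

lemma sform_proj:
  assumes "\<And>i. i < k \<Longrightarrow> m dvd sform n x (a i) \<and> m dvd sform n x (b i)"
  shows "m dvd sform n x (proj k a b y) - sform n x y"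
  using assms by (simp add: sform_proj_right) (intro dvd_sum dvd_diff dvd_mult, auto)

lemma psb_extend:
  assumes P: "psb m k a b" and xy: "x \<in> \<Lambda>" "y \<in> \<Lambda>" "m dvd sform n x y - 1"
    and orth: "\<And>i. i < k \<Longrightarrow> m dvd sform n x (a i) \<and> m dvd sform n x (b i) \<and>
      m dvd sform n y (a i) \<and> m dvd sform n y (b i)"
  shows "psb m (Suc k) (a(k := x)) (b(k := y))"
proof -
  have "m dvd sform n (a i) x \<and> m dvd sform n (b i) x \<and> m dvd sform n (a i) y \<and> m dvd sform n (b i) y"
    if "i < k" for i
    using orth[OF that] sform_commute[of n "a i"] sform_commute[of n "b i"] by simp
  then show ?thesis using P xy orth by (auto simp: psb_def less_Suc_eq)
qed

text \<open>Each new \<open>a k\<close> is independent of the earlier ones modulo \<open>p\<close>,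
  since \<open>b k\<close> pairs to 0 with those and to 1 with \<open>a k\<close>.\<close>

lemma psb_isotropic:
  assumes "psb (int p) k a b"
  shows "\<exists>V. isotropic V \<and> dm V = k \<and> (\<forall>y\<in>\<Lambda>. (\<forall>i<k. int p dvd sform n (a i) y) \<longrightarrow> y \<in> perp V) \<and>
    (\<forall>i<k. a i \<in> V) \<and> (\<forall>W. subsp W \<longrightarrow> (\<forall>i<k. a i \<in> W) \<longrightarrow> V \<subseteq> W)"
  using assms
proof (induction k)
  case 0
  show ?case
    using isotropic_pl subspD(3) by (intro exI[of _ pl]) (auto simp: perp_pl)
next
  case (Suc k)
  then obtain V where V: "isotropic V" "dm V = k"
    "\<And>y. y \<in> \<Lambda> \<Longrightarrow> (\<forall>i<k. int p dvd sform n (a i) y) \<Longrightarrow> y \<in> perp V"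
    "\<forall>i<k. a i \<in> V" "\<And>W. subsp W \<Longrightarrow> (\<forall>i<k. a i \<in> W) \<Longrightarrow> V \<subseteq> W"
    using psb_prefix[of "int p" "Suc k" a b k] by auto
  have sV: "subsp V" using V isotropic_subsp by blast
  have al: "a k \<in> \<Lambda>" "b k \<in> \<Lambda>" using psb_lat[OF Suc.prems] by auto
  have "a k \<in> perp V" using V(3)[OF al(1)] psbD(1)[OF Suc.prems] by auto
  moreover have "int p dvd sform n (a i) (b k)" if "i < k" for i
    using psbD(3)[OF Suc.prems, of i k] that by simp
  then have bk: "b k \<in> perp V" using V(3)[OF al(2)] by blast
  have "\<not> int p dvd sform n (a k) (b k)"
  proof
    assume "int p dvd sform n (a k) (b k)"
    then have "int p dvd sform n (a k) (b k) - (sform n (a k) (b k) - 1)"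
      by (rule dvd_diff) (use psbD(3)[OF Suc.prems, of k k] in simp)
    then show False using p_gt1 by simp
  qed
  then have "a k \<notin> V" using bk by (auto simp: perp_def)
  ultimately have W: "isotropic (adj V (a k))" "dm (adj V (a k)) = Suc k"
    using isotropic_adj[OF V(1)] dm_adj[OF sV al(1)] V(2) by auto
  have "y \<in> perp (adj V (a k))" if "y \<in> \<Lambda>" "\<forall>i<Suc k. int p dvd sform n (a i) y" for y
    using V(3)[OF that(1)] that(2) by (simp add: perp_adj[OF sV])
  moreover have "\<forall>i<Suc k. a i \<in> adj V (a k)"
    using V(4) adj_ge[OF sV, of "a k"] by (auto simp: less_Suc_eq)
  moreover have "adj V (a k) \<subseteq> W" if "subsp W" "\<forall>i<Suc k. a i \<in> W" for W
    using V(5)[OF that(1)] that adj_le[OF that(1)] by auto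
  ultimately show ?case using W by blast
qed

lemma psb_le: "psb (int p) k a b \<Longrightarrow> k \<le> n"
  using psb_isotropic[of k a b] isotropic_dm by blast

lemma psb_exact_le: "psb 0 k a b \<Longrightarrow> k \<le> n"
  by (rule psb_le[OF psb_dvd[of 0]]) simp_all

text \<open>The values of \<open>sform n x\<close> form an ideal. Its positive generator
  \<open>g\<close> divides every coordinate, as these are values at unit vectors, and is itself a
  value, which becomes 1 after division by \<open>g\<close>.\<close>

lemma primitive_part:
  assumes x: "x \<in> \<Lambda>" "x \<noteq> 0"
  obtains g x0 y where "x = g *\<^sub>Z x0" "g \<noteq> 0" "x0 \<in> \<Lambda>" "y \<in> \<Lambda>" "sform n x0 y = 1"
proof -
  let ?I = "{sform n x y | y. y \<in> \<Lambda>}"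
  have mem: "sform n x y \<in> ?I" if "y \<in> \<Lambda>" for y using that by blast
  define P where "P k \<longleftrightarrow> k > 0 \<and> int k \<in> ?I" for k :: nat
  obtain i where i: "x i \<noteq> 0" using x(2) by (auto simp: fun_eq_iff)
  have coord: "x i \<in> ?I" for i
  proof -
    consider "i < n" | "n \<le> i" "i < 2 * n" | "2 * n \<le> i" by linarith
    then show ?thesis
    proof cases
      case 1
      then show ?thesis using coord_sform[OF x(1), of i] unitv_lat[of "n + i" "2 * n"] by auto
    next
      case 2
      then have "x i = sform n x (- unitv (i - n))" using coord_sform[OF x(1), of i] by simp
      moreover have "- unitv (i - n) \<in> \<Lambda>" using unitv_lat[of "i - n" "2 * n"] 2 by simp
      ultimately show ?thesis by blast
    next
      case 3
      then have "x i = sform n x 0" using x(1) by (simp add: lat_def)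
      moreover have "0 \<in> \<Lambda>" by simp
      ultimately show ?thesis by blast
    qed
  qed
  have neg: "- c \<in> ?I" if "c \<in> ?I" for c
  proof -
    obtain y where "y \<in> \<Lambda>" "c = sform n x y" using \<open>c \<in> ?I\<close> by blast
    then have "- y \<in> \<Lambda>" "- c = sform n x (- y)" by simp_all
    then show ?thesis by blast
  qed
  have "int (nat \<bar>x i\<bar>) \<in> ?I" using coord[of i] neg[OF coord[of i]] by (cases "x i \<ge> 0") auto
  then have ex: "P (nat \<bar>x i\<bar>)" using i by (simp add: P_def)
  define g where "g = (LEAST k. P k)"
  have "P g" unfolding g_def using ex by (rule LeastI)
  then obtain y where y: "g > 0" "y \<in> \<Lambda>" "int g = sform n x y" by (auto simp: P_def)
  have gdvd: "int g dvd c" if "c \<in> ?I" for c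
  proof -
    obtain z where z: "z \<in> \<Lambda>" "c = sform n x z" using \<open>c \<in> ?I\<close> by blast
    have e: "c mod int g = sform n x (z - (c div int g) *\<^sub>Z y)"
      by (simp add: minus_div_mult_eq_mod flip: z(2) y(3))
    have "z - (c div int g) *\<^sub>Z y \<in> \<Lambda>" using z(1) y(2) by simp
    then have m: "c mod int g \<in> ?I" by (subst e) (rule mem)
    have "c mod int g = 0"
    proof (rule ccontr)
      assume "c mod int g \<noteq> 0"
      moreover have "0 \<le> c mod int g" using y(1) by simp
      ultimately have nat: "nat (c mod int g) > 0" "int (nat (c mod int g)) = c mod int g" by linarith+
      then have "P (nat (c mod int g))" unfolding P_def using m nat by (simp only: simp_thms)
      then have "g \<le> nat (c mod int g)" unfolding g_def by (rule Least_le)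
      moreover have "c mod int g < int g" using y(1) by simp
      ultimately show False using nat(2) by linarith
    qed
    then show ?thesis by auto
  qed
  define x0 where "x0 = (\<lambda>i. x i div int g)"
  have x0: "x = int g *\<^sub>Z x0" using gdvd[OF coord] by (auto simp: x0_def fun_eq_iff)
  have "int g * sform n x0 y = int g" using y(3) by (simp add: x0)
  then have s: "sform n x0 y = 1" using y(1) by simp
  have l: "x0 \<in> \<Lambda>" using x(1) by (auto simp: x0_def lat_def)
  show ?thesis by (rule that[OF x0 _ l y(2) s]) (use y(1) in simp)
qed

text \<open>A Gram-Schmidt procedure inside an isotropic subgroup, run with \<open>m = 0\<close> for
  lattices and with \<open>m = int p\<close> for subspaces. For a nonzero vector,
  \<open>prim\<close> supplies one that has a dual and loses none of the orthogonality relations.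
  The procedure ends because a frame modulo \<open>p\<close> has at most \<open>n\<close>
  pairs.\<close>

lemma psb_greedy:
  assumes V: "subgrp V" "V \<subseteq> \<Lambda>" and iso: "\<And>x y. x \<in> V \<Longrightarrow> y \<in> V \<Longrightarrow> m dvd sform n x y"
    and m: "int p dvd m"
    and prim: "\<And>x. x \<in> V \<Longrightarrow> \<not> (\<forall>i. m dvd x i) \<Longrightarrow> \<exists>x'\<in>V. \<exists>y\<in>\<Lambda>. m dvd sform n x' y - 1 \<and>
      (\<forall>z. m dvd sform n x z \<longrightarrow> m dvd sform n x' z)"
    and P: "psb m k a b" "\<And>i. i < k \<Longrightarrow> a i \<in> V"
  shows "\<exists>d a' b'. k \<le> d \<and> psb m d a' b' \<and> (\<forall>i<k. a' i = a i \<and> b' i = b i) \<and> (\<forall>i<d. a' i \<in> V) \<and>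
    (\<forall>x\<in>V. \<forall>t. m dvd (x - (\<Sum>i<d. sform n x (b' i) *\<^sub>Z a' i)) t)"
  using P
proof (induction "n - k" arbitrary: k a b rule: less_induct)
  case less
  have kn: "k \<le> n" using psb_le psb_dvd[OF less.prems(1) m] by blast
  show ?case
  proof (cases "\<exists>x\<in>V. (\<forall>i<k. m dvd sform n x (b i)) \<and> \<not> (\<forall>i. m dvd x i)")
    case True
    then obtain x where x: "x \<in> V" "\<And>i. i < k \<Longrightarrow> m dvd sform n x (b i)" "\<not> (\<forall>i. m dvd x i)" by blast
    obtain x' y where x': "x' \<in> V" "y \<in> \<Lambda>" "m dvd sform n x' y - 1"
      "\<And>z. m dvd sform n x z \<Longrightarrow> m dvd sform n x' z" using prim[OF x(1,3)] by blast
    \<comment> \<open>Projecting the dual does not change its pairing with \<open>x'\<close> modulo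
      \<open>m\<close>, because \<open>x'\<close> is already orthogonal to the frame.\<close>
    let ?y = "proj k a b y"
    have o: "m dvd sform n x' (a i) \<and> m dvd sform n x' (b i)" if "i < k" for i
      using that x' x(2) iso less.prems(2) by blast
    have "m dvd (sform n x' ?y - sform n x' y) + (sform n x' y - 1)"
      using sform_proj[of k m x' a b y] o x'(3) by (intro dvd_add) auto
    then have "m dvd sform n x' ?y - 1" by simp
    then have ext: "psb m (Suc k) (a(k := x')) (b(k := ?y))"
      using less.prems(1) x' V(2) proj_lat[OF less.prems(1) x'(2)] o proj_orth[OF less.prems(1)]
      by (intro psb_extend) auto
    have "n - Suc k < n - k" using psb_le[OF psb_dvd[OF ext m]] by simp
    moreover have "(a(k := x')) i \<in> V" if "i < Suc k" for i using that x'(1) less.prems(2) by (auto simp: less_Suc_eq)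
    ultimately obtain d a' b' where d: "Suc k \<le> d" "psb m d a' b'"
      "\<forall>i<Suc k. a' i = (a(k := x')) i \<and> b' i = (b(k := ?y)) i" "\<forall>i<d. a' i \<in> V"
      "\<forall>x\<in>V. \<forall>t. m dvd (x - (\<Sum>i<d. sform n x (b' i) *\<^sub>Z a' i)) t"
      using less.hyps[OF _ ext] by blast
    then have "k \<le> d" "\<forall>i<k. a' i = a i \<and> b' i = b i" by auto
    then show ?thesis using d by blast
  next
    case False
    have "m dvd (x - (\<Sum>i<k. sform n x (b i) *\<^sub>Z a i)) t" if x: "x \<in> V" for x t
    proof -
      \<comment> \<open>The remainder is orthogonal to all \<open>b i\<close> modulo
        \<open>m\<close>, so it vanishes modulo \<open>m\<close> because no further pair can be
        found.\<close>
      let ?x = "x - (\<Sum>i<k. sform n x (b i) *\<^sub>Z a i)"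
      have "?x \<in> V" using x less.prems(2) by (intro subgrpD[OF V(1)] subgrp_sum[OF V(1)]) auto
      moreover have "m dvd sform n ?x (b j)" if j: "j < k" for j
      proof -
        let ?\<delta> = "\<lambda>i. if i = j then 1 else (0::int)"
        have "sform n ?x (b j) = - (\<Sum>i<k. sform n x (b i) * (sform n (a i) (b j) - ?\<delta> i))"
          using j by (simp add: sform_sum sum_subtractf right_diff_distrib sum_delta_lt)
        moreover have "m dvd (\<Sum>i<k. sform n x (b i) * (sform n (a i) (b j) - ?\<delta> i))"
          using psbD(3)[OF less.prems(1) _ j] by (intro dvd_sum dvd_mult) auto
        ultimately show ?thesis by simp
      qed
      ultimately show ?thesis using False by blast
    qed
    then show ?thesis using less.prems by blast
  qed
qed

lemma psb_exact_sform:
  assumes P: "psb 0 d a b" and j: "j < d"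
  shows "sform n (\<Sum>i<d. c i *\<^sub>Z a i) (b j) = c j"
proof -
  have "sform n (\<Sum>i<d. c i *\<^sub>Z a i) (b j) = (\<Sum>i<d. c i * (if i = j then 1 else 0))"
    using psb_exact(3)[OF P _ j] by (simp add: sform_sum)
  then show ?thesis using sum_delta_lt[OF j] by simp
qed

text \<open>While \<open>k < n\<close>, some vector has a nonzero projection off the pairs; its
  primitive part and a projected dual form the next pair.\<close>

lemma psb_extend_full:
  assumes "psb 0 k a b"
  shows "\<exists>a' b'. psb 0 n a' b' \<and> (\<forall>i<k. a' i = a i \<and> b' i = b i)"
  using assms
proof (induction "n - k" arbitrary: k a b)
  case 0
  then have "k = n" using psb_exact_le[OF 0(2)] by simp
  then show ?case using 0 by blast
next
  case (Suc r)
  have kn: "k < n" using Suc.hyps(2) by simp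
  have "\<exists>x\<in>\<Lambda>. proj k a b x \<noteq> 0"
  proof (rule ccontr)
    assume "\<not> (\<exists>x\<in>\<Lambda>. proj k a b x \<noteq> 0)"
    then have z: "proj k a b x = 0" if "x \<in> \<Lambda>" for x using that by blast
    \<comment> \<open>Otherwise the \<open>2 * k\<close> frame vectors would generate the lattice,
      but modulo \<open>p\<close> they span dimension at most \<open>2 * k < 2 * n\<close>.\<close>
    have gen: "\<exists>V. subsp V \<and> dm V \<le> 2 * j \<and> (\<forall>i<j. a i \<in> V \<and> b i \<in> V)" if "j \<le> k" for j
      using that
    proof (induction j)
      case 0
      show ?case using subsp_pl by (intro exI[of _ pl]) simp
    next
      case (Suc j)
      then obtain V where V: "subsp V" "dm V \<le> 2 * j" "\<forall>i<j. a i \<in> V \<and> b i \<in> V" by auto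
      have l: "a j \<in> \<Lambda>" "b j \<in> \<Lambda>" using psb_lat[OF \<open>psb 0 k a b\<close>] Suc.prems by auto
      have step: "dm (adj U x) \<le> Suc (dm U)" if "subsp U" "x \<in> \<Lambda>" for U x
      proof (cases "x \<in> U")
        case True
        then have "adj U x = U" using that adj_le[of U U x] adj_ge[of U x] by auto
        then show ?thesis by simp
      qed (use that dm_adj in simp)
      let ?V1 = "adj V (a j)"
      let ?V2 = "adj ?V1 (b j)"
      have s: "subsp ?V1" "subsp ?V2" using V(1) l subsp_adj by blast+
      have "V \<subseteq> ?V2" "a j \<in> ?V2" "b j \<in> ?V2"
        using adj_ge[OF V(1), of "a j"] adj_ge[OF s(1), of "b j"] by blast+
      moreover have "dm ?V2 \<le> 2 * Suc j"
        using step[OF V(1) l(1)] step[OF s(1) l(2)] V(2) by simp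
      ultimately show ?case using s(2) V(3) by (intro exI[of _ ?V2]) (auto simp: less_Suc_eq)
    qed
    obtain V where V: "subsp V" "dm V \<le> 2 * k" "\<forall>i<k. a i \<in> V \<and> b i \<in> V" using gen[of k] by auto
    have "\<Lambda> \<subseteq> V"
    proof
      fix x assume "x \<in> \<Lambda>"
      then have "x = (\<Sum>i<k. sform n x (b i) *\<^sub>Z a i - sform n x (a i) *\<^sub>Z b i)"
        using z[of x] by (simp add: proj_def)
      moreover have "\<dots> \<in> V" using V by (intro subgrp_sum subspD(1) subsp_closed) auto
      ultimately show "x \<in> V" by simp
    qed
    then have "2 * n \<le> dm V" using dm_mono[OF subsp_lat V(1)] by simp
    then show False using V(2) kn by simp
  qed
  then obtain z where z: "z \<in> \<Lambda>" "proj k a b z \<noteq> 0" by blast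
  have zl: "proj k a b z \<in> \<Lambda>" using proj_lat[OF Suc.prems z(1)] .
  obtain g x y where x: "proj k a b z = g *\<^sub>Z x" "g \<noteq> 0" "x \<in> \<Lambda>" "y \<in> \<Lambda>" "sform n x y = 1"
    using primitive_part[OF zl z(2)] .
  have o: "sform n x (a i) = 0" "sform n x (b i) = 0" if "i < k" for i
    using proj_orth_exact(1,2)[OF Suc.prems that, of z] x(1,2) by simp_all
  let ?y = "proj k a b y"
  have "sform n x ?y = 1" using o x(5) by (simp add: sform_proj_right)
  moreover have "?y \<in> \<Lambda>" using proj_lat[OF Suc.prems x(4)] .
  ultimately have ext: "psb 0 (Suc k) (a(k := x)) (b(k := ?y))"
    using x o proj_orth_exact[OF Suc.prems] by (intro psb_extend[OF Suc.prems]) auto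
  have "r = n - Suc k" using Suc.hyps(2) by simp
  then obtain a' b' where "psb 0 n a' b'" "\<forall>i<Suc k. a' i = (a(k := x)) i \<and> b' i = (b(k := ?y)) i"
    using Suc.hyps(1)[OF _ ext] by blast
  then show ?case by (intro exI[of _ a'] exI[of _ b']) auto
qed

text \<open>The primitive part of a nonzero \<open>x\<close> would extend the frame to
  \<open>Suc n\<close> pairs, against \<open>psb_exact_le\<close>.\<close>

lemma psb_full_orth:
  assumes "psb 0 n a b" "x \<in> \<Lambda>" "\<And>i. i < n \<Longrightarrow> sform n x (a i) = 0 \<and> sform n x (b i) = 0"
  shows "x = 0"
proof (rule ccontr)
  assume "x \<noteq> 0"
  obtain g x0 y where x0: "x = g *\<^sub>Z x0" "g \<noteq> 0" "x0 \<in> \<Lambda>" "y \<in> \<Lambda>" "sform n x0 y = 1"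
    using primitive_part[OF assms(2) \<open>x \<noteq> 0\<close>] .
  have o: "sform n x0 (a i) = 0" "sform n x0 (b i) = 0" if "i < n" for i
    using assms(3)[OF that] x0(1,2) by simp_all
  have "sform n x0 (proj n a b y) = 1" using o x0(5) by (simp add: sform_proj_right)
  then have "psb 0 (Suc n) (a(n := x0)) (b(n := proj n a b y))"
    using x0 o proj_orth_exact[OF assms(1)] proj_lat[OF assms(1)] by (intro psb_extend[OF assms(1)]) auto
  then show False using psb_exact_le by fastforce
qed

lemma psb_full_expand:
  assumes P: "psb 0 n a b" and x: "x \<in> \<Lambda>"
  shows "x = (\<Sum>i<n. sform n x (b i) *\<^sub>Z a i - sform n x (a i) *\<^sub>Z b i)"
proof -
  have "proj n a b x = 0"
    by (rule psb_full_orth[OF P proj_lat[OF P x]]) (use proj_orth_exact[OF P] in auto)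
  then show ?thesis by (simp add: proj_def)
qed

lemma psb_cong:
  assumes P: "psb (int p) k a b" and l: "\<And>i. i < k \<Longrightarrow> a' i \<in> \<Lambda> \<and> b' i \<in> \<Lambda>"
    and c: "\<And>i. i < k \<Longrightarrow> a' i - a i \<in> pl \<and> b' i - b i \<in> pl"
  shows "psb (int p) k a' b'"
proof -
  have d: "int p dvd sform n x' y' - sform n x y" if "x' - x \<in> pl" "y' - y \<in> pl" for x x' y y'
  proof -
    have "sform n x' y' - sform n x y = sform n (x' - x) y' + sform n x (y' - y)" by simp
    then show ?thesis using dvd_sform_pl that by (metis dvd_add)
  qed
  have t: "int p dvd s' - e" if "int p dvd s' - s" "int p dvd s - e" for s s' e :: int
    using dvd_add[OF that] by simp
  show ?thesis
    unfolding psb_def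
  proof (intro conjI allI impI)
    fix i j assume ij: "i < k" "j < k"
    note ci = c[OF ij(1)] and cj = c[OF ij(2)]
    show "int p dvd sform n (a' i) (a' j)"
      using t[OF d, of "a' i" "a i" "a' j" "a j" 0] psbD(1)[OF P ij] ci cj by simp
    show "int p dvd sform n (b' i) (b' j)"
      using t[OF d, of "b' i" "b i" "b' j" "b j" 0] psbD(2)[OF P ij] ci cj by simp
    show "int p dvd sform n (a' i) (b' j) - (if i = j then 1 else 0)"
      by (rule t[OF d psbD(3)[OF P ij]]) (use ci cj in auto)
  qed (use l in auto)
qed

lemma proj_cong:
  assumes "psb m k a b" "x \<in> \<Lambda>" "\<And>i. i < k \<Longrightarrow> int p dvd sform n x (a i) \<and> int p dvd sform n x (b i)"
  shows "proj k a b x - x \<in> pl"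
proof -
  have s: "c *\<^sub>Z y \<in> pl" if "int p dvd c" "y \<in> \<Lambda>" for c y
    using that by (auto simp: pl_def)
  have "(\<Sum>i<k. sform n x (b i) *\<^sub>Z a i - sform n x (a i) *\<^sub>Z b i) \<in> pl"
    using assms psb_lat[OF assms(1)] by (intro subgrp_sum subgrp_pl subgrpD[OF subgrp_pl] s) auto
  then have "- (\<Sum>i<k. sform n x (b i) *\<^sub>Z a i - sform n x (a i) *\<^sub>Z b i) \<in> pl"
    by (rule subgrpD(3)[OF subgrp_pl])
  then show ?thesis by (simp add: proj_def)
qed

lemma sform_cong:
  assumes "x' - x \<in> pl" "y' - y \<in> pl"
  shows "int p dvd sform n x' y' - sform n x y"
proof -
  have "sform n x' y' - sform n x y = sform n (x' - x) y' + sform n x (y' - y)" by simp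
  then show ?thesis using dvd_sform_pl assms by (metis dvd_add)
qed

text \<open>If \<open>w = g x\<close> with \<open>x\<close> primitive, \<open>\<omega>(x, h) = 1\<close> and \<open>g\<close> prime to \<open>p\<close>, then \<open>g x + p h\<close> is a
  primitive vector congruent to \<open>w\<close>.\<close>

lemma psb_lift_step:
  assumes P: "psb (int p) k a b" and Q: "psb 0 j a b" and jk: "j < k"
  shows "\<exists>x y. x \<in> \<Lambda> \<and> y \<in> \<Lambda> \<and> x - a j \<in> pl \<and> y - b j \<in> pl \<and> psb 0 (Suc j) (a(j := x)) (b(j := y))"
proof -
  note l = psb_lat[OF P]
  let ?\<pi> = "proj j a b"
  define w where "w = ?\<pi> (a j)"
  have oa: "int p dvd sform n (a j) (a i) \<and> int p dvd sform n (a j) (b i)" if "i < j" for i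
    using psbD(1)[OF P jk, of i] psbD(3)[OF P jk, of i] that jk by simp
  have ob: "int p dvd sform n (b j) (a i) \<and> int p dvd sform n (b j) (b i)" if "i < j" for i
    using psbD(2)[OF P jk, of i] psbD(3)[OF P _ jk, of i] that jk sform_commute[of n "b j" "a i"] by simp
  have wl: "w \<in> \<Lambda>" unfolding w_def by (rule proj_lat[OF Q l(1)[OF jk]])
  have wa: "w - a j \<in> pl" unfolding w_def by (rule proj_cong[OF Q l(1)[OF jk] oa])
  define z where "z = ?\<pi> (b j)"
  have zl: "z \<in> \<Lambda>" unfolding z_def by (rule proj_lat[OF Q l(2)[OF jk]])
  have zb: "z - b j \<in> pl" unfolding z_def by (rule proj_cong[OF Q l(2)[OF jk] ob])
  have ab1: "int p dvd sform n (a j) (b j) - 1" using psbD(3)[OF P jk jk] by simp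
  have wpl: "w \<notin> pl"
  proof
    assume "w \<in> pl"
    then have "int p dvd sform n w (b j)" by (rule dvd_sform_pl)
    moreover have "int p dvd sform n w (b j) - sform n (a j) (b j)"
      using sform_cong[OF wa, of "b j" "b j"] subgrpD(1)[OF subgrp_pl] by simp
    ultimately have "int p dvd sform n w (b j) - (sform n w (b j) - sform n (a j) (b j))"
      by (rule dvd_diff)
    then have "int p dvd sform n (a j) (b j)" by simp
    then have "int p dvd sform n (a j) (b j) - (sform n (a j) (b j) - 1)" using ab1 by (rule dvd_diff)
    then show False using p_gt1 by simp
  qed
  then have "w \<noteq> 0" using subgrpD(1)[OF subgrp_pl] by auto
  then obtain g x0 h where x0: "w = g *\<^sub>Z x0" "g \<noteq> 0" "x0 \<in> \<Lambda>" "h \<in> \<Lambda>" "sform n x0 h = 1"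
    using primitive_part[OF wl] by blast
  have o0: "sform n x0 (a i) = 0" "sform n x0 (b i) = 0" if "i < j" for i
    using proj_orth_exact(1,2)[OF Q that, of "a j"] x0(1,2) unfolding w_def[symmetric] by simp_all
  define h' where "h' = ?\<pi> h"
  have h': "h' \<in> \<Lambda>" "sform n x0 h' = 1" "sform n h' x0 = -1"
    using proj_lat[OF Q x0(4)] o0 x0(5) sform_commute[of n h' x0] by (simp_all add: h'_def sform_proj_right)
  have "\<not> int p dvd g" using wpl x0(1,3) by (auto simp: pl_def)
  then obtain \<alpha> where "int p dvd 1 - \<alpha> * g" using solve_mod by blast
  then obtain \<beta> where \<beta>: "1 - \<alpha> * g = int p * \<beta>" unfolding dvd_def by blast
  define x where "x = w + int p *\<^sub>Z h'"
  \<comment> \<open>A dual of \<open>x\<close>: the pairing is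
    \<open>\<alpha> * g + int p * \<beta>\<close>, which is 1 by the choice of
    \<open>\<beta>\<close>.\<close>
  define y where "y = \<alpha> *\<^sub>Z h' - \<beta> *\<^sub>Z x0"
  have xl: "x \<in> \<Lambda>" and yl: "y \<in> \<Lambda>" using wl h' x0 by (simp_all add: x_def y_def)
  have "sform n x y = \<alpha> * g + int p * \<beta>"
    by (simp add: x_def y_def x0(1) h' algebra_simps)
  then have xy: "sform n x y = 1" using \<beta> by simp
  have xa: "x - a j \<in> pl"
  proof -
    have "x - a j = (w - a j) + int p *\<^sub>Z h'" by (simp add: x_def)
    then show ?thesis using wa p_smul_pl[OF h'(1)] subgrpD(4)[OF subgrp_pl] by metis
  qed
  have ox: "sform n x (a i) = 0" "sform n x (b i) = 0" and oy: "sform n y (a i) = 0" "sform n y (b i) = 0"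
    and oz: "sform n z (a i) = 0" "sform n z (b i) = 0" if "i < j" for i
    using o0[OF that] proj_orth_exact(1,2)[OF Q that] by (simp_all add: x_def y_def z_def h'_def x0(1))
  have "int p dvd (sform n x z - sform n (a j) (b j)) + (sform n (a j) (b j) - 1)"
    using sform_cong[OF xa zb] ab1 by (rule dvd_add)
  then obtain t where t: "sform n x z - 1 = int p * t" by auto
  \<comment> \<open>\<open>z\<close> is congruent to \<open>b j\<close> and pairs with
    \<open>x\<close> to \<open>1 + int p * t\<close>; subtracting a multiple of \<open>int p\<close>
    times the dual \<open>y\<close> removes the surplus within the class of
    \<open>b j\<close>.\<close>
  define y' where "y' = z - (int p * t) *\<^sub>Z y"
  have y'l: "y' \<in> \<Lambda>" using zl yl by (simp add: y'_def)
  have "sform n x y' = 1" using t xy by (simp add: y'_def)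
  moreover have "y' - b j \<in> pl"
  proof -
    have "y' - b j = (z - b j) - int p *\<^sub>Z (t *\<^sub>Z y)" by (simp add: y'_def smul_smul)
    then show ?thesis using zb p_smul_pl[of "t *\<^sub>Z y"] yl subgrpD(2)[OF subgrp_pl] by (metis lat_simps(5))
  qed
  moreover have "psb 0 (Suc j) (a(j := x)) (b(j := y'))"
    using xl y'l \<open>sform n x y' = 1\<close> ox oy oz by (intro psb_extend[OF Q]) (auto simp: y'_def)
  ultimately show ?thesis using xl y'l xa by blast
qed

text \<open>Replacing the \<open>j\<close>-th pair by its lift keeps the whole frame symplectic
  modulo \<open>p\<close>, so the step can be repeated.\<close>

lemma psb_lift:
  assumes P: "psb (int p) k a b" and Q: "psb 0 j a b" and jk: "j \<le> k"
  shows "\<exists>a' b'. psb 0 k a' b' \<and> (\<forall>i<k. a' i - a i \<in> pl \<and> b' i - b i \<in> pl) \<and> (\<forall>i<j. a' i = a i \<and> b' i = b i)"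
  using assms
proof (induction "k - j" arbitrary: j a b)
  case 0
  then have "psb 0 k a b" by simp
  moreover have "a i - a i \<in> pl" "b i - b i \<in> pl" for i
    using subgrpD(1)[OF subgrp_pl] by (simp_all only: diff_self)
  ultimately show ?case by blast
next
  case (Suc r)
  then have jk: "j < k" by simp
  obtain x y where xy: "x \<in> \<Lambda>" "y \<in> \<Lambda>" "x - a j \<in> pl" "y - b j \<in> pl" "psb 0 (Suc j) (a(j := x)) (b(j := y))"
    using psb_lift_step[OF Suc.prems(1,2) jk] by blast
  have P': "psb (int p) k (a(j := x)) (b(j := y))"
    using xy psb_lat[OF Suc.prems(1)] subgrpD(1)[OF subgrp_pl] by (intro psb_cong[OF Suc.prems(1)]) auto
  have "r = k - Suc j" "Suc j \<le> k" using Suc.hyps(2) jk by simp_all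
  then obtain a' b' where ab: "psb 0 k a' b'" "\<forall>i<k. a' i - (a(j := x)) i \<in> pl \<and> b' i - (b(j := y)) i \<in> pl"
    "\<forall>i<Suc j. a' i = (a(j := x)) i \<and> b' i = (b(j := y)) i"
    using Suc.hyps(1)[OF _ P' xy(5)] by blast
  have "a' i - a i \<in> pl \<and> b' i - b i \<in> pl" if "i < k" for i
    using ab(2,3) that xy(3,4) by (cases "i = j") auto
  then show ?case using ab by (intro exI[of _ a'] exI[of _ b']) auto
qed

end

subsection \<open>The congruence group and transitivity\<close>

context symp
begin

text \<open>The principal congruence subgroup as maps of the lattice. Invertibility is derived in
  \<open>congruence_maps_inverse\<close>; \<open>Gamma_congruence\<close> and
  \<open>congruence_Gamma\<close> give the passage to matrices.\<close>

definition congruence_maps where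
  "congruence_maps = {g. (\<forall>x\<in>\<Lambda>. g x \<in> \<Lambda>) \<and> (\<forall>x\<in>\<Lambda>. \<forall>y\<in>\<Lambda>. g (x + y) = g x + g y) \<and>
     (\<forall>x\<in>\<Lambda>. \<forall>y\<in>\<Lambda>. sform n (g x) (g y) = sform n x y) \<and> (\<forall>x\<in>\<Lambda>. g x - x \<in> pl)}"

lemma congruence_mapsD:
  assumes "g \<in> congruence_maps"
  shows "x \<in> \<Lambda> \<Longrightarrow> g x \<in> \<Lambda>" "x \<in> \<Lambda> \<Longrightarrow> y \<in> \<Lambda> \<Longrightarrow> g (x + y) = g x + g y"
    "x \<in> \<Lambda> \<Longrightarrow> y \<in> \<Lambda> \<Longrightarrow> sform n (g x) (g y) = sform n x y" "x \<in> \<Lambda> \<Longrightarrow> g x - x \<in> pl"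
  using assms by (auto simp: congruence_maps_def)

lemma congruence_maps_linear:
  assumes g: "g \<in> congruence_maps"
  shows "g 0 = 0" "x \<in> \<Lambda> \<Longrightarrow> g (- x) = - g x" "x \<in> \<Lambda> \<Longrightarrow> y \<in> \<Lambda> \<Longrightarrow> g (x - y) = g x - g y"
    "x \<in> \<Lambda> \<Longrightarrow> g (c *\<^sub>Z x) = c *\<^sub>Z g x"
proof -
  note add = congruence_mapsD(2)[OF g]
  show z: "g 0 = 0" using add[of 0 0] by simp
  show m: "g (- x) = - g x" if "x \<in> \<Lambda>" for x
    using add[of x "- x"] that z by (simp add: eq_neg_iff_add_eq_0 add.commute)
  show "g (x - y) = g x - g y" if "x \<in> \<Lambda>" "y \<in> \<Lambda>" for x y
    using add[of x "- y"] m[of y] that by simp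
  have nat: "g (int k *\<^sub>Z x) = int k *\<^sub>Z g x" if "x \<in> \<Lambda>" for k x
    using that by (induction k) (simp_all add: z smul_add_left add)
  show "g (c *\<^sub>Z x) = c *\<^sub>Z g x" if "x \<in> \<Lambda>" for x
  proof (cases "c \<ge> 0")
    case True
    then show ?thesis using nat[OF that, of "nat c"] by simp
  next
    case False
    then have "c *\<^sub>Z y = - (int (nat (- c)) *\<^sub>Z y)" for y by (simp add: fun_eq_iff)
    then show ?thesis using nat[OF that, of "nat (- c)"] m[of "int (nat (- c)) *\<^sub>Z x"] that by simp
  qed
qed

lemma congruence_maps_sum:
  assumes g: "g \<in> congruence_maps" and "\<And>i. i \<in> A \<Longrightarrow> f i \<in> \<Lambda>"
  shows "g (\<Sum>i\<in>A. f i) = (\<Sum>i\<in>A. g (f i))"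
  using assms(2)
  by (induction A rule: infinite_finite_induct)
    (simp_all add: congruence_maps_linear[OF g] congruence_mapsD[OF g] lat_sum)

lemma psb_image:
  assumes g: "g \<in> congruence_maps" and P: "psb 0 k a b"
  shows "psb 0 k (\<lambda>i. g (a i)) (\<lambda>i. g (b i))"
  using P congruence_mapsD[OF g] by (simp add: psb_def)

text \<open>The linear map sending the symplectic basis \<open>a\<close>, \<open>b\<close> to
  \<open>a'\<close>, \<open>b'\<close>; the coefficients are those of
  \<open>psb_full_expand\<close>.\<close>

definition transfer where
  "transfer a b a' b' x = (\<Sum>i<n. sform n x (b i) *\<^sub>Z a' i - sform n x (a i) *\<^sub>Z b' i)"

lemma transfer_basis:
  assumes P: "psb 0 n a b" and j: "j < n"
  shows "transfer a b a' b' (a j) = a' j" "transfer a b a' b' (b j) = b' j"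
proof -
  have "transfer a b a' b' (a j) = (\<Sum>i<n. if i = j then a' j else 0)"
    unfolding transfer_def using psb_exact[OF P j] by (intro sum.cong) auto
  then show "transfer a b a' b' (a j) = a' j" using j by simp
  have "transfer a b a' b' (b j) = (\<Sum>i<n. if i = j then b' j else 0)"
    unfolding transfer_def using psb_exact[OF P j] by (intro sum.cong) auto
  then show "transfer a b a' b' (b j) = b' j" using j by simp
qed

text \<open>Corresponding vectors have equal coordinates in the two symplectic bases, which
  preserves the form. The displacement is a combination of differences of basis vectors, hence in
  \<open>pl\<close>.\<close>

lemma transfer_congruence:
  assumes P: "psb 0 n a b" and Q: "psb 0 n a' b'"
    and c: "\<And>i. i < n \<Longrightarrow> a' i - a i \<in> pl \<and> b' i - b i \<in> pl"
  shows "transfer a b a' b' \<in> congruence_maps"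
proof -
  let ?T = "transfer a b a' b'"
  have Ta: "sform n (?T x) (a' j) = sform n x (a j)" and Tb: "sform n (?T x) (b' j) = sform n x (b j)"
    if j: "j < n" for x j
  proof -
    have "sform n (?T x) (a' j) = (\<Sum>i<n. sform n x (a i) * (if i = j then 1 else 0))"
      unfolding transfer_def using psb_exact[OF Q _ j] by (simp add: sform_sum) (intro sum.cong, auto)
    then show "sform n (?T x) (a' j) = sform n x (a j)" using sum_delta_lt[OF j] by simp
    have "sform n (?T x) (b' j) = (\<Sum>i<n. sform n x (b i) * (if i = j then 1 else 0))"
      unfolding transfer_def using psb_exact[OF Q _ j] by (simp add: sform_sum)
    then show "sform n (?T x) (b' j) = sform n x (b j)" using sum_delta_lt[OF j] by simp
  qed
  have "sform n (?T x) (?T y) = sform n x y" if "x \<in> \<Lambda>" "y \<in> \<Lambda>" for x y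
  proof -
    have "sform n (?T x) (?T y) = (\<Sum>i<n. sform n y (b i) * sform n x (a i) - sform n y (a i) * sform n x (b i))"
      by (subst (2) transfer_def) (simp add: sform_sum Ta Tb)
    also have "\<dots> = sform n x (\<Sum>i<n. sform n y (b i) *\<^sub>Z a i - sform n y (a i) *\<^sub>Z b i)"
      by (simp add: sform_sum)
    also have "\<dots> = sform n x y" using psb_full_expand[OF P that(2)] by simp
    finally show ?thesis .
  qed
  moreover have "?T x \<in> \<Lambda>" for x
    unfolding transfer_def using psb_lat[OF Q] by (intro lat_sum lat_simps) auto
  moreover have "?T (x + y) = ?T x + ?T y" for x y
    unfolding transfer_def by (simp add: smul_add_left sum.distrib[symmetric] algebra_simps)
  moreover have "?T x - x \<in> pl" if "x \<in> \<Lambda>" for x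
  proof -
    have "?T x - x = ?T x - (\<Sum>i<n. sform n x (b i) *\<^sub>Z a i - sform n x (a i) *\<^sub>Z b i)"
      using psb_full_expand[OF P that] by simp
    also have "\<dots> = (\<Sum>i<n. sform n x (b i) *\<^sub>Z (a' i - a i) - sform n x (a i) *\<^sub>Z (b' i - b i))"
      unfolding transfer_def by (simp add: smul_diff_right sum_subtractf algebra_simps)
    also have "\<dots> \<in> pl"
    proof (rule subgrp_sum[OF subgrp_pl])
      fix i assume "i \<in> {..<n}"
      then have "a' i - a i \<in> pl" "b' i - b i \<in> pl" using c by auto
      then show "sform n x (b i) *\<^sub>Z (a' i - a i) - sform n x (a i) *\<^sub>Z (b' i - b i) \<in> pl"
        by (rule subgrpD(2)[OF subgrp_pl subgrpD(5)[OF subgrp_pl] subgrpD(5)[OF subgrp_pl]])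
    qed
    finally show ?thesis .
  qed
  ultimately show ?thesis unfolding congruence_maps_def by blast
qed

lemma full_psb_exists: "\<exists>a b. psb 0 n a b"
proof -
  have "psb 0 0 (\<lambda>_. 0) (\<lambda>_. 0)" by (simp add: psb_def)
  then show ?thesis using psb_extend_full by blast
qed

text \<open>A symplectic basis is mapped to a symplectic basis, and transferring the latter back
  inverts \<open>g\<close>.\<close>

lemma congruence_maps_inverse:
  assumes g: "g \<in> congruence_maps"
  shows "\<exists>h\<in>congruence_maps. \<forall>x\<in>\<Lambda>. h (g x) = x \<and> g (h x) = x"
proof -
  obtain a b where P: "psb 0 n a b" using full_psb_exists by blast
  note l = psb_lat[OF P]
  let ?a = "\<lambda>i. g (a i)" and ?b = "\<lambda>i. g (b i)"
  have Q: "psb 0 n ?a ?b" by (rule psb_image[OF g P])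
  let ?h = "transfer ?a ?b a b"
  have neg: "x - y \<in> pl" if "y - x \<in> pl" for x y :: "nat \<Rightarrow> int"
    using subgrpD(3)[OF subgrp_pl that] by simp
  have "?h \<in> congruence_maps"
    by (rule transfer_congruence[OF Q P]) (use l neg congruence_mapsD(4)[OF g] in blast)
  moreover have "?h (g x) = x" if "x \<in> \<Lambda>" for x
  proof -
    have "?h (g x) = (\<Sum>i<n. sform n x (b i) *\<^sub>Z a i - sform n x (a i) *\<^sub>Z b i)"
      unfolding transfer_def by (intro sum.cong refl)
        (simp add: congruence_mapsD(3)[OF g that l(1)] congruence_mapsD(3)[OF g that l(2)])
    then show ?thesis using psb_full_expand[OF P that] by simp
  qed
  moreover have "g (?h x) = x" if "x \<in> \<Lambda>" for x
  proof -
    have "g (?h x) = (\<Sum>i<n. g (sform n x (?b i) *\<^sub>Z a i - sform n x (?a i) *\<^sub>Z b i))"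
      unfolding transfer_def by (rule congruence_maps_sum[OF g]) (use l in simp)
    also have "\<dots> = (\<Sum>i<n. sform n x (?b i) *\<^sub>Z ?a i - sform n x (?a i) *\<^sub>Z ?b i)"
      by (intro sum.cong) (use l congruence_maps_linear[OF g] in auto)
    also have "\<dots> = x" using psb_full_expand[OF Q that] by (rule sym)
    finally show ?thesis .
  qed
  ultimately show ?thesis by blast
qed

lemma id_congruence: "(\<lambda>x. x) \<in> congruence_maps"
  using subgrpD(1)[OF subgrp_pl] unfolding congruence_maps_def by (simp del: fun_diff_def)

lemma congruence_comp:
  assumes g: "g \<in> congruence_maps" and h: "h \<in> congruence_maps"
  shows "(\<lambda>x. g (h x)) \<in> congruence_maps"
proof -
  have "g (h x) - x \<in> pl" if "x \<in> \<Lambda>" for x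
  proof -
    have "g (h x) - x = (g (h x) - h x) + (h x - x)" by simp
    then show ?thesis
      using subgrpD(4)[OF subgrp_pl congruence_mapsD(4)[OF g congruence_mapsD(1)[OF h that]]
          congruence_mapsD(4)[OF h that]] by (simp only:)
  qed
  then show ?thesis
    unfolding congruence_maps_def using congruence_mapsD[OF g] congruence_mapsD[OF h] by simp
qed

lemma pl_trans: "x - y \<in> pl \<Longrightarrow> y - z \<in> pl \<Longrightarrow> x - z \<in> pl"
  using subgrpD(4)[OF subgrp_pl, of "x - y" "y - z"] by simp

lemma pl_sym: "x - y \<in> pl \<Longrightarrow> y - x \<in> pl"
  using subgrpD(3)[OF subgrp_pl, of "x - y"] by simp

lemma pl_refl: "x - x \<in> pl" using subgrpD(1)[OF subgrp_pl] by (simp only: diff_self)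

lemma smul_pl: "int p dvd c \<Longrightarrow> x \<in> \<Lambda> \<Longrightarrow> c *\<^sub>Z x \<in> pl" by (auto simp: pl_def)

text \<open>The given duals \<open>c\<close> of \<open>u'\<close> need not be congruent to
  \<open>v\<close>. Each \<open>v k\<close> is corrected by elements of \<open>pl\<close> until it
  pairs correctly with \<open>u'\<close> and is orthogonal to the duals already found.\<close>

lemma adjust_duals:
  assumes P: "psb 0 d u v" and Q: "psb 0 d u' c" and e: "\<And>i. i < d \<Longrightarrow> u' i - u i \<in> pl"
  shows "\<exists>b. psb 0 d u' b \<and> (\<forall>i<d. b i - v i \<in> pl)"
proof -
  have "\<exists>b. (\<forall>i<k. b i \<in> \<Lambda> \<and> b i - v i \<in> pl \<and> (\<forall>l<d. sform n (u' l) (b i) = (if l = i then 1 else 0)) \<and>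
      (\<forall>j<k. sform n (b i) (b j) = 0))" if "k \<le> d" for k
    using that
  proof (induction k)
    case 0
    show ?case by simp
  next
    case (Suc k)
    then obtain b where b: "\<And>i. i < k \<Longrightarrow> b i \<in> \<Lambda>" "\<And>i. i < k \<Longrightarrow> b i - v i \<in> pl"
      "\<And>i l. i < k \<Longrightarrow> l < d \<Longrightarrow> sform n (u' l) (b i) = (if l = i then 1 else 0)"
      "\<And>i j. i < k \<Longrightarrow> j < k \<Longrightarrow> sform n (b i) (b j) = 0" by fastforce
    have kd: "k < d" using Suc.prems by simp
    define \<epsilon> where "\<epsilon> l = sform n (u' l) (v k) - (if l = k then 1 else 0)" for l
    \<comment> \<open>The vectors \<open>c\<close> remove the pairing errors
      \<open>\<epsilon>\<close>, which are divisible by \<open>p\<close>.\<close>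
    define x where "x = v k - (\<Sum>l<d. \<epsilon> l *\<^sub>Z c l)"
    have vk: "v k \<in> \<Lambda>" using psb_lat(2)[OF P kd] .
    have xl: "x \<in> \<Lambda>" unfolding x_def using vk psb_lat(2)[OF Q] by (intro lat_simps lat_sum) auto
    have dv: "int p dvd \<epsilon> l" if "l < d" for l
      using sform_cong[OF e[OF that] pl_refl, of "v k"] psb_exact(3)[OF P that kd] by (simp add: \<epsilon>_def)
    have xv: "x - v k \<in> pl"
    proof -
      have "(\<Sum>l<d. \<epsilon> l *\<^sub>Z c l) \<in> pl"
        using dv psb_lat(2)[OF Q] by (intro subgrp_sum subgrp_pl smul_pl) auto
      then have "- (\<Sum>l<d. \<epsilon> l *\<^sub>Z c l) \<in> pl" by (rule subgrpD(3)[OF subgrp_pl])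
      then show ?thesis by (simp add: x_def)
    qed
    have ux: "sform n (u' l) x = (if l = k then 1 else 0)" if "l < d" for l
    proof -
      have "sform n (u' l) (\<Sum>j<d. \<epsilon> j *\<^sub>Z c j) = (\<Sum>j<d. \<epsilon> j * (if j = l then 1 else 0))"
        using psb_exact(3)[OF Q that] by (simp add: sform_sum) (intro sum.cong, auto)
      also have "\<dots> = \<epsilon> l" by (rule sum_delta_lt[OF that])
      finally show ?thesis by (simp add: x_def \<epsilon>_def)
    qed
    \<comment> \<open>Multiples of the isotropic frame \<open>u'\<close> make \<open>y\<close>
      orthogonal to the earlier duals and leave its pairings with \<open>u'\<close>
      unchanged.\<close>
    define y where "y = x - (\<Sum>j<k. sform n x (b j) *\<^sub>Z u' j)"
    have ul: "u' j \<in> \<Lambda>" if "j < k" for j using psb_lat(1)[OF Q] that kd by simp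
    have yl: "y \<in> \<Lambda>" unfolding y_def using xl ul by (intro lat_simps lat_sum) auto
    have "int p dvd sform n x (b j)" if "j < k" for j
      using sform_cong[OF xv b(2)[OF that]] psb_exact(2)[OF P kd, of j] that kd by simp
    then have "(\<Sum>j<k. sform n x (b j) *\<^sub>Z u' j) \<in> pl"
      using ul by (intro subgrp_sum subgrp_pl smul_pl) auto
    then have "x - y \<in> pl" by (simp add: y_def)
    then have yv: "y - v k \<in> pl" using pl_trans[OF pl_sym xv] by blast
    have uy: "sform n (u' l) y = (if l = k then 1 else 0)" if "l < d" for l
      using ux[OF that] psb_exact(1)[OF Q that] kd by (simp add: y_def sform_sum)
    have yb: "sform n y (b j) = 0" if j: "j < k" for j
    proof -
      have "sform n (\<Sum>i<k. sform n x (b i) *\<^sub>Z u' i) (b j) = (\<Sum>i<k. sform n x (b i) * (if i = j then 1 else 0))"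
        using b(3)[OF j] kd by (simp add: sform_sum)
      also have "\<dots> = sform n x (b j)" by (rule sum_delta_lt[OF j])
      finally show ?thesis by (simp add: y_def)
    qed
    have yb': "sform n (b j) y = 0" if "j < k" for j using yb[OF that] sform_commute[of n "b j" y] by simp
    let ?b = "b(k := y)"
    have "?b i \<in> \<Lambda> \<and> ?b i - v i \<in> pl \<and> (\<forall>l<d. sform n (u' l) (?b i) = (if l = i then 1 else 0)) \<and>
        (\<forall>j<Suc k. sform n (?b i) (?b j) = 0)" if "i < Suc k" for i
    proof (cases "i = k")
      case True
      then show ?thesis using yl yv uy yb by (simp add: less_Suc_eq)
    next
      case False
      then have "i < k" using that by simp
      then show ?thesis using False b(1,2,3)[of i] b(4)[of i] yb'[of i] by (simp add: less_Suc_eq)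
    qed
    then show ?case by blast
  qed
  then obtain b where b: "\<And>i. i < d \<Longrightarrow> b i \<in> \<Lambda> \<and> b i - v i \<in> pl \<and>
      (\<forall>l<d. sform n (u' l) (b i) = (if l = i then 1 else 0)) \<and> (\<forall>j<d. sform n (b i) (b j) = 0)"
    by blast
  then have "psb 0 d u' b"
    using psb_lat(1)[OF Q] psb_exact(1)[OF Q] by (auto simp: psb_def)
  then show ?thesis using b by blast
qed

text \<open>A symplectic basis extending the first frame, reduced modulo \<open>p\<close>, is lifted to one extending the
  second.\<close>

theorem congruence_transitive:
  assumes P: "psb 0 d u v" and Q: "psb 0 d u' c" and e: "\<And>i. i < d \<Longrightarrow> u' i - u i \<in> pl"
  shows "\<exists>g\<in>congruence_maps. \<forall>i<d. g (u i) = u' i"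
proof -
  obtain b where b: "psb 0 d u' b" "\<forall>i<d. b i - v i \<in> pl" using adjust_duals[OF P Q e] by blast
  have dn: "d \<le> n" using psb_exact_le[OF P] .
  obtain A B where AB: "psb 0 n A B" "\<forall>i<d. A i = u i \<and> B i = v i" using psb_extend_full[OF P] by blast
  \<comment> \<open>The initial part is exchanged within its residue classes, so the full frame
    stays symplectic modulo \<open>p\<close>, while its first \<open>d\<close> pairs are
    exact.\<close>
  define A' where "A' i = (if i < d then u' i else A i)" for i
  define B' where "B' i = (if i < d then b i else B i)" for i
  have AA: "A' i - A i \<in> pl \<and> B' i - B i \<in> pl" for i
    using e b(2) AB(2) pl_refl by (simp add: A'_def B'_def del: diff_self)
  have "psb (int p) n A B" using psb_dvd[OF AB(1)] by simp
  then have P': "psb (int p) n A' B'"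
    by (rule psb_cong) (use AA psb_lat[OF AB(1)] psb_lat[OF b(1)] in \<open>auto simp: A'_def B'_def\<close>)
  have Q': "psb 0 d A' B'" by (rule psb_change[OF b(1)]) (auto simp: A'_def B'_def)
  obtain C D where CD: "psb 0 n C D" "\<forall>i<n. C i - A' i \<in> pl \<and> D i - B' i \<in> pl" "\<forall>i<d. C i = A' i \<and> D i = B' i"
    using psb_lift[OF P' Q' dn] by blast
  have "transfer A B C D \<in> congruence_maps"
    by (rule transfer_congruence[OF AB(1) CD(1)]) (use CD(2) AA pl_trans in blast)
  moreover have "transfer A B C D (u i) = u' i" if "i < d" for i
    using transfer_basis(1)[OF AB(1), of i C D] that dn AB(2) CD(3) by (simp add: A'_def)
  ultimately show ?thesis by blast
qed

end

subsection \<open>Isotropic lattices and changes of basis\<close>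

definition spanZ :: "nat \<Rightarrow> (nat \<Rightarrow> nat \<Rightarrow> int) \<Rightarrow> (nat \<Rightarrow> int) set" where
  "spanZ d a = {\<Sum>i<d. c i *\<^sub>Z a i | c. True}"

lemma subgrp_spanZ: "subgrp (spanZ d a)"
  unfolding subgrp_def
proof (intro conjI ballI)
  show "0 \<in> spanZ d a" unfolding spanZ_def by (intro CollectI exI[of _ "\<lambda>_. 0"]) simp
  fix x y assume "x \<in> spanZ d a" "y \<in> spanZ d a"
  then obtain c e where "x = (\<Sum>i<d. c i *\<^sub>Z a i)" "y = (\<Sum>i<d. e i *\<^sub>Z a i)"
    by (auto simp: spanZ_def)
  then have "x - y = (\<Sum>i<d. (c i - e i) *\<^sub>Z a i)" by (simp add: smul_diff_left sum_subtractf)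
  then show "x - y \<in> spanZ d a" unfolding spanZ_def by (intro CollectI exI[of _ "\<lambda>i. c i - e i"]) simp
qed

lemma spanZ_base: "i < d \<Longrightarrow> a i \<in> spanZ d a"
proof -
  assume i: "i < d"
  have "(\<Sum>j<d. (if j = i then 1 else 0) *\<^sub>Z a j) = (\<Sum>j<d. if j = i then a i else 0)"
    by (intro sum.cong) auto
  also have "\<dots> = a i" using i by simp
  finally show ?thesis unfolding spanZ_def by (intro CollectI exI[of _ "\<lambda>j. if j = i then 1 else 0"]) simp
qed

lemma spanZ_least: "subgrp V \<Longrightarrow> (\<And>i. i < d \<Longrightarrow> a i \<in> V) \<Longrightarrow> spanZ d a \<subseteq> V"
  unfolding spanZ_def by (auto intro!: subgrp_sum subgrpD(5))

lemma spanZ_mono: "e \<le> d \<Longrightarrow> spanZ e a \<subseteq> spanZ d a"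
  by (rule spanZ_least[OF subgrp_spanZ]) (auto intro: spanZ_base)

lemma spanZ_cong: "(\<And>i. i < d \<Longrightarrow> a i = b i) \<Longrightarrow> spanZ d a = spanZ d b"
  by (simp add: spanZ_def)

context symp
begin

lemma spanZ_coeff:
  assumes P: "psb 0 d a b" and x: "x \<in> spanZ d a"
  shows "x = (\<Sum>i<d. sform n x (b i) *\<^sub>Z a i)"
proof -
  obtain c where c: "x = (\<Sum>i<d. c i *\<^sub>Z a i)" using x by (auto simp: spanZ_def)
  have "sform n x (b j) = c j" if "j < d" for j unfolding c by (rule psb_exact_sform[OF P that])
  then show ?thesis using c by simp
qed

text \<open>These are the intersections of isotropic rational subspaces with the integral lattice;
  the third condition is purity.\<close>

definition iso_lattice where
  "iso_lattice L \<longleftrightarrow> subgrp L \<and> L \<subseteq> \<Lambda> \<and> (\<forall>x\<in>\<Lambda>. \<forall>c. c \<noteq> 0 \<longrightarrow> c *\<^sub>Z x \<in> L \<longrightarrow> x \<in> L) \<and>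
     (\<forall>x\<in>L. \<forall>y\<in>L. sform n x y = 0)"

text \<open>Purity holds because pairing \<open>x\<close> with the dual vectors gives integral
  coefficients for \<open>x\<close> itself whenever a multiple of \<open>x\<close> lies in the
  span.\<close>

lemma spanZ_lattice:
  assumes P: "psb 0 d a b"
  shows "iso_lattice (spanZ d a)"
  unfolding iso_lattice_def
proof (intro conjI ballI allI impI)
  show sl: "spanZ d a \<subseteq> \<Lambda>" by (rule spanZ_least[OF subgrp_lat psb_lat(1)[OF P]])
  fix x y assume x: "x \<in> spanZ d a" and y: "y \<in> spanZ d a"
  show "sform n x y = 0"
    by (subst spanZ_coeff[OF P x], subst spanZ_coeff[OF P y]) (simp add: sform_sum psb_exact[OF P])
next
  fix x c assume x: "x \<in> \<Lambda>" "c \<noteq> 0" "c *\<^sub>Z x \<in> spanZ d a"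
  have "c *\<^sub>Z x = c *\<^sub>Z (\<Sum>i<d. sform n x (b i) *\<^sub>Z a i)"
    using spanZ_coeff[OF P x(3)] by (simp add: fun_eq_iff sum_fun_apply sum_distrib_left mult.assoc)
  then have "x = (\<Sum>i<d. sform n x (b i) *\<^sub>Z a i)" using x(2) by (simp add: fun_eq_iff)
  then show "x \<in> spanZ d a" unfolding spanZ_def by (intro CollectI exI[of _ "\<lambda>i. sform n x (b i)"]) simp
qed (rule subgrp_spanZ)

text \<open>\<open>psb_greedy\<close> with \<open>m = 0\<close>; primitive vectors stay in
  \<open>L\<close> by purity. Keeping the given initial part allows bases to be aligned along a
  chain.\<close>

lemma lattice_basis:
  assumes L: "iso_lattice L" and P: "psb 0 k a b" "\<And>i. i < k \<Longrightarrow> a i \<in> L"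
  shows "\<exists>d a' b'. k \<le> d \<and> psb 0 d a' b' \<and> (\<forall>i<k. a' i = a i) \<and> L = spanZ d a'"
proof -
  have sL: "subgrp L" "L \<subseteq> \<Lambda>" using L by (auto simp: iso_lattice_def)
  have "\<exists>d a' b'. k \<le> d \<and> psb 0 d a' b' \<and> (\<forall>i<k. a' i = a i \<and> b' i = b i) \<and> (\<forall>i<d. a' i \<in> L) \<and>
    (\<forall>x\<in>L. \<forall>t. 0 dvd (x - (\<Sum>i<d. sform n x (b' i) *\<^sub>Z a' i)) t)"
  proof (rule psb_greedy[OF sL _ _ _ P])
    show "0 dvd sform n x y" if "x \<in> L" "y \<in> L" for x y using that L by (simp add: iso_lattice_def)
    fix x assume x: "x \<in> L" "\<not> (\<forall>i. 0 dvd x i)"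
    then have "x \<noteq> 0" by auto
    moreover have "x \<in> \<Lambda>" using x sL by blast
    ultimately obtain g x0 y where g: "x = g *\<^sub>Z x0" "g \<noteq> 0" "x0 \<in> \<Lambda>" "y \<in> \<Lambda>" "sform n x0 y = 1"
      using primitive_part by blast
    have "x0 \<in> L" using L g x(1) unfolding iso_lattice_def by blast
    moreover have "0 dvd sform n x0 z" if "0 dvd sform n x z" for z using that g by simp
    ultimately show "\<exists>x'\<in>L. \<exists>y\<in>\<Lambda>. 0 dvd sform n x' y - 1 \<and> (\<forall>z. 0 dvd sform n x z \<longrightarrow> 0 dvd sform n x' z)"
      using g(4,5) by auto
  qed auto
  then obtain d a' b' where d: "k \<le> d" "psb 0 d a' b'" "\<forall>i<k. a' i = a i" "\<forall>i<d. a' i \<in> L"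
    "\<forall>x\<in>L. \<forall>t. (x - (\<Sum>i<d. sform n x (b' i) *\<^sub>Z a' i)) t = 0" by auto
  have "L \<subseteq> spanZ d a'"
  proof
    fix x assume "x \<in> L"
    then have "x = (\<Sum>i<d. sform n x (b' i) *\<^sub>Z a' i)" using d(5) by (simp add: fun_eq_iff)
    then show "x \<in> spanZ d a'" unfolding spanZ_def by (intro CollectI exI[of _ "\<lambda>i. sform n x (b' i)"]) simp
  qed
  moreover have "spanZ d a' \<subseteq> L" using d(4) by (intro spanZ_least sL) auto
  ultimately show ?thesis using d by blast
qed

lemma lattice_basis0: "iso_lattice L \<Longrightarrow> \<exists>d a b. psb 0 d a b \<and> L = spanZ d a"
  using lattice_basis[of L 0 "\<lambda>_. 0" "\<lambda>_. 0"] by (auto simp: psb_def)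

text \<open>The reduction of \<open>L\<close> modulo \<open>p\<close>, again represented by its
  preimage in the lattice.\<close>

definition redL where "redL L = {x + y | x y. x \<in> L \<and> y \<in> pl}"

lemma subsp_redL: "subgrp L \<Longrightarrow> L \<subseteq> \<Lambda> \<Longrightarrow> subsp (redL L)"
proof -
  assume L: "subgrp L" "L \<subseteq> \<Lambda>"
  have "subgrp (redL L)"
    unfolding subgrp_def
  proof (intro conjI ballI)
    have "(0::nat \<Rightarrow> int) = 0 + 0" by simp
    then show "0 \<in> redL L" unfolding redL_def using subgrpD(1)[OF L(1)] subgrpD(1)[OF subgrp_pl] by blast
    fix x y assume "x \<in> redL L" "y \<in> redL L"
    then obtain a b c e where "x = a + b" "y = c + e" "a \<in> L" "c \<in> L" "b \<in> pl" "e \<in> pl"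
      by (auto simp: redL_def)
    moreover have "a + b - (c + e) = (a - c) + (b - e)" by simp
    ultimately show "x - y \<in> redL L"
      unfolding redL_def using subgrpD(2)[OF L(1)] subgrpD(2)[OF subgrp_pl] by blast
  qed
  moreover have "redL L \<subseteq> \<Lambda>" using L(2) by (auto simp: redL_def pl_def)
  moreover have "y = 0 + y" for y :: "nat \<Rightarrow> int" by simp
  then have "pl \<subseteq> redL L" unfolding redL_def using subgrpD(1)[OF L(1)] by blast
  ultimately show ?thesis by (simp add: subsp_def)
qed

lemma redL_ge: "L \<subseteq> redL L"
proof
  fix x assume "x \<in> L"
  moreover have "x = x + 0" by simp
  ultimately show "x \<in> redL L" unfolding redL_def using subgrpD(1)[OF subgrp_pl] by blast
qed

lemma redL_le: "subsp V \<Longrightarrow> L \<subseteq> V \<Longrightarrow> redL L \<subseteq> V"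
  by (auto simp: redL_def subset_iff intro: subsp_closed subspD)

lemma redL_iff: "subgrp L \<Longrightarrow> x \<in> redL L \<longleftrightarrow> (\<exists>y\<in>L. x - y \<in> pl)"
proof
  assume "\<exists>y\<in>L. x - y \<in> pl"
  then obtain y where y: "y \<in> L" "x - y \<in> pl" by blast
  have "x = y + (x - y)" by simp
  then show "x \<in> redL L" unfolding redL_def using y by blast
next
  assume "x \<in> redL L"
  then obtain a b where "x = a + b" "a \<in> L" "b \<in> pl" by (auto simp: redL_def)
  then show "\<exists>y\<in>L. x - y \<in> pl" by (intro bexI[of _ a]) (simp_all del: fun_diff_def)
qed

lemma redL_mono: "L \<subseteq> L' \<Longrightarrow> redL L \<subseteq> redL L'" by (auto simp: redL_def)

lemma redL_span:
  assumes P: "psb 0 d a b"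
  shows "isotropic (redL (spanZ d a))" "dm (redL (spanZ d a)) = d"
proof -
  obtain V where V: "isotropic V" "dm V = d" "\<forall>i<d. a i \<in> V" "\<And>W. subsp W \<Longrightarrow> (\<forall>i<d. a i \<in> W) \<Longrightarrow> V \<subseteq> W"
    using psb_isotropic[of d a b] psb_dvd[OF P] by auto
  have sV: "subsp V" using V(1) isotropic_subsp by blast
  have L: "iso_lattice (spanZ d a)" by (rule spanZ_lattice[OF P])
  then have s: "subsp (redL (spanZ d a))" by (intro subsp_redL) (auto simp: iso_lattice_def)
  have "V \<subseteq> redL (spanZ d a)" using V(4)[OF s] spanZ_base redL_ge by blast
  moreover have "redL (spanZ d a) \<subseteq> V"
    by (rule redL_le[OF sV spanZ_least[OF subspD(1)[OF sV]]]) (use V(3) in blast)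
  ultimately have "redL (spanZ d a) = V" by blast
  then show "isotropic (redL (spanZ d a))" "dm (redL (spanZ d a)) = d" using V by auto
qed

lemma redL_isotropic: "iso_lattice L \<Longrightarrow> isotropic (redL L)"
  using lattice_basis0 redL_span by blast

text \<open>A basis of \<open>L\<close> extends to one of \<open>M\<close>, and equal reductions
  force both to have the same length.\<close>

lemma redL_inj:
  assumes L: "iso_lattice L" "iso_lattice M" and sub: "L \<subseteq> M" and eq: "redL L = redL M"
  shows "L = M"
proof -
  obtain d a b where a: "psb 0 d a b" "L = spanZ d a" using lattice_basis0[OF L(1)] by blast
  then have "a i \<in> M" if "i < d" for i using that spanZ_base sub by blast
  then obtain e c f where c: "d \<le> e" "psb 0 e c f" "\<forall>i<d. c i = a i" "M = spanZ e c"
    using lattice_basis[OF L(2) a(1)] by blast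
  have "e = d" using redL_span(2)[OF a(1)] redL_span(2)[OF c(2)] eq a(2) c(4) by simp
  then show ?thesis using a(2) c spanZ_cong[of d c a] by simp
qed

text \<open>Adding multiples of the other vectors to \<open>l k\<close> is compensated on the dual
  side by subtracting multiples of \<open>b k\<close> from the other duals.\<close>

lemma row_operation:
  fixes c :: "nat \<Rightarrow> int"
  assumes P: "psb 0 d l b" and k: "k < d"
  defines "l' \<equiv> l(k := l k + (\<Sum>i\<in>{..<d} - {k}. c i *\<^sub>Z l i))"
    and "b' \<equiv> \<lambda>i. if i = k then b k else b i - c i *\<^sub>Z b k"
  shows "psb 0 d l' b'" "spanZ d l' = spanZ d l"
proof -
  note E = psb_exact[OF P] and l = psb_lat[OF P]
  let ?s = "\<Sum>i\<in>{..<d} - {k}. c i *\<^sub>Z l i"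
  have s0: "sform n ?s (l j) = 0" "sform n (l j) ?s = 0" if "j < d" for j
    using E(1) that by (auto simp: sform_sum)
  have sk: "sform n ?s (b k) = 0" using E(3) k by (auto simp: sform_sum)
  have sj: "sform n ?s (b j) = c j" if "j < d" "j \<noteq> k" for j
  proof -
    have "sform n ?s (b j) = (\<Sum>i\<in>{..<d} - {k}. c i * (if i = j then 1 else 0))"
      using E(3) that by (simp add: sform_sum)
    also have "\<dots> = c j" using that by (subst sum.remove[of _ j]) auto
    finally show ?thesis .
  qed
  show "psb 0 d l' b'"
    unfolding psb_def
  proof (intro conjI allI impI)
    fix i j assume ij: "i < d" "j < d"
    show "0 dvd sform n (l' i) (l' j)" using E(1) s0 ij k by (simp add: l'_def)
    show "0 dvd sform n (b' i) (b' j)" using E(2) ij k by (simp add: b'_def)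
    show "0 dvd sform n (l' i) (b' j) - (if i = j then 1 else 0)"
      using E(3) sk sj[of j] ij k by (simp add: l'_def b'_def)
  next
    fix i assume "i < d"
    moreover have "?s \<in> \<Lambda>" using l by (intro lat_sum) auto
    ultimately show "l' i \<in> \<Lambda>" "b' i \<in> \<Lambda>" using l k by (auto simp: l'_def b'_def)
  qed
  have s1: "?s \<in> spanZ d l"
    by (intro subgrp_sum subgrp_spanZ subgrpD(5)[OF subgrp_spanZ]) (auto intro: spanZ_base)
  have "c i *\<^sub>Z l i \<in> spanZ d l'" if "i \<in> {..<d} - {k}" for i
    using subgrpD(5)[OF subgrp_spanZ spanZ_base[of i d l']] that by (simp add: l'_def)
  then have s2: "?s \<in> spanZ d l'" by (rule subgrp_sum[OF subgrp_spanZ])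
  show "spanZ d l' = spanZ d l"
  proof
    show "spanZ d l' \<subseteq> spanZ d l"
      using s1 spanZ_base[of _ d l] k by (intro spanZ_least subgrp_spanZ) (auto simp: l'_def intro!: subgrpD(4)[OF subgrp_spanZ])
    have "l' k - ?s \<in> spanZ d l'" by (rule subgrpD(2)[OF subgrp_spanZ spanZ_base[OF k] s2])
    moreover have "l k = l' k - ?s" by (simp add: l'_def)
    ultimately have "l k \<in> spanZ d l'" by (simp only:)
    then have "l i \<in> spanZ d l'" if "i < d" for i
      using that spanZ_base[OF that, of l'] by (cases "i = k") (auto simp: l'_def)
    then show "spanZ d l \<subseteq> spanZ d l'" by (rule spanZ_least[OF subgrp_spanZ])
  qed
qed

lemma negate_last:
  assumes P: "psb 0 (Suc r) l b"
  shows "psb 0 (Suc r) (l(r := - l r)) (b(r := - b r))" "spanZ (Suc r) (l(r := - l r)) = spanZ (Suc r) l"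
proof -
  show "psb 0 (Suc r) (l(r := - l r)) (b(r := - b r))" using P by (auto simp: psb_def less_Suc_eq)
  let ?l = "l(r := - l r)"
  have "l i \<in> spanZ (Suc r) ?l" if "i < Suc r" for i
    using spanZ_base[OF that, of ?l] subgrpD(3)[OF subgrp_spanZ, of "- l r"] that by (cases "i = r") auto
  moreover have "?l i \<in> spanZ (Suc r) l" if "i < Suc r" for i
    using spanZ_base[OF that, of l] subgrpD(3)[OF subgrp_spanZ] by auto
  ultimately show "spanZ (Suc r) ?l = spanZ (Suc r) l"
    by (intro equalityI spanZ_least subgrp_spanZ) auto
qed

text \<open>The last index is excluded because integral row operations preserve the determinant up to sign.\<close>

lemma row_step:
  assumes P: "psb 0 d l b" and w: "w \<in> spanZ d l" and k: "Suc k < d"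
    and j: "k \<le> j" "j < d" "\<not> int p dvd sform n w (b j)"
  shows "\<exists>l' b'. psb 0 d l' b' \<and> spanZ d l' = spanZ d l \<and> (\<forall>i<k. l' i = l i) \<and> w - l' k \<in> pl"
proof -
  have main: "\<exists>l' b'. psb 0 d l' b' \<and> spanZ d l' = spanZ d l \<and> (\<forall>i<k. l' i = l i) \<and> w - l' k \<in> pl"
    if P: "psb 0 d l b" and w: "w \<in> spanZ d l" and j: "k < j" "j < d" "\<not> int p dvd sform n w (b j)" for l b j
  proof -
    have kd: "k < d" using k by simp
    \<comment> \<open>The nonzero coefficient at \<open>j > k\<close> is used to make the
      coefficient at \<open>k\<close> congruent to 1.\<close>
    obtain t where t: "int p dvd (sform n w (b k) - 1) - t * sform n w (b j)" using solve_mod[OF j(3)] by blast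
    define l1 where "l1 = l(j := l j + (\<Sum>i\<in>{..<d} - {j}. (if i = k then t else 0) *\<^sub>Z l i))"
    define b1 where "b1 i = (if i = j then b j else b i - (if i = k then t else 0) *\<^sub>Z b j)" for i
    have P1: "psb 0 d l1 b1" and s1: "spanZ d l1 = spanZ d l"
      unfolding l1_def b1_def using row_operation[OF P j(2), of "\<lambda>i. if i = k then t else 0"] by auto
    have w1: "w \<in> spanZ d l1" using w s1 by simp
    have wk: "int p dvd sform n w (b1 k) - 1" using t j(1) by (simp add: b1_def algebra_simps)
    \<comment> \<open>With coefficient 1 at \<open>k\<close>, all other terms of \<open>w\<close>
      can be absorbed into the \<open>k\<close>-th basis vector.\<close>
    define l2 where "l2 = l1(k := l1 k + (\<Sum>i\<in>{..<d} - {k}. sform n w (b1 i) *\<^sub>Z l1 i))"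
    have ex: "\<exists>b2. psb 0 d l2 b2" and s2: "spanZ d l2 = spanZ d l1"
      unfolding l2_def using row_operation[OF P1 kd, of "\<lambda>i. sform n w (b1 i)"] by auto
    have "w = (\<Sum>i<d. sform n w (b1 i) *\<^sub>Z l1 i)" by (rule spanZ_coeff[OF P1 w1])
    also have "\<dots> = sform n w (b1 k) *\<^sub>Z l1 k + (\<Sum>i\<in>{..<d} - {k}. sform n w (b1 i) *\<^sub>Z l1 i)"
      using kd by (subst sum.remove[of _ k]) auto
    finally have "w - l2 k = (sform n w (b1 k) - 1) *\<^sub>Z l1 k"
      by (simp add: l2_def smul_diff_left algebra_simps)
    then have "w - l2 k \<in> pl" using smul_pl[OF wk psb_lat(1)[OF P1 kd]] by simp
    moreover have "l2 i = l i" if "i < k" for i using that j(1) by (simp add: l2_def l1_def)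
    ultimately show ?thesis using ex s1 s2 by blast
  qed
  show ?thesis
  proof (cases "\<exists>j. k < j \<and> j < d \<and> \<not> int p dvd sform n w (b j)")
    case True
    then show ?thesis using main[OF P w] by blast
  next
    case False
    then have "j = k" using j by (metis le_neq_implies_less)
    then have wk: "\<not> int p dvd sform n w (b k)" using j by simp
    have wSk: "int p dvd sform n w (b (Suc k))" using False k by blast
    have kd: "k < d" using k by simp
    \<comment> \<open>From \<open>k\<close> on, only the coefficient at \<open>k\<close> is nonzero
      modulo \<open>p\<close>; this operation copies it to \<open>Suc k\<close>, where the case
      above applies.\<close>
    let ?c = "\<lambda>i. if i = Suc k then -1 else (0::int)"
    define l0 where "l0 = l(k := l k + (\<Sum>i\<in>{..<d} - {k}. ?c i *\<^sub>Z l i))"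
    define b0 where "b0 i = (if i = k then b k else b i - ?c i *\<^sub>Z b k)" for i
    have P0: "psb 0 d l0 b0" and s0: "spanZ d l0 = spanZ d l"
      unfolding l0_def b0_def using row_operation[OF P kd, of ?c] by auto
    have "\<not> int p dvd sform n w (b0 (Suc k))"
      using wk wSk by (simp add: b0_def dvd_add_right_iff)
    then obtain l' b' where "psb 0 d l' b'" "spanZ d l' = spanZ d l0" "\<forall>i<k. l' i = l0 i" "w - l' k \<in> pl"
      using main[OF P0 _ _ k] w s0 by blast
    moreover have "l0 i = l i" if "i < k" for i using that by (simp add: l0_def)
    ultimately show ?thesis using s0 by (intro exI[of _ l'] exI[of _ b']) auto
  qed
qed

text \<open>If all coefficients from \<open>e\<close> on vanished modulo \<open>p\<close>,
  \<open>w e\<close> would be a combination of the \<open>l j\<close> with \<open>j < e\<close>,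
  which pair with \<open>v e\<close> like \<open>w j\<close>, that is, to 0.\<close>

lemma coefficient_nonzero:
  assumes P: "psb 0 d l b" and w: "w e \<in> spanZ d l"
    and dual: "\<And>i. i \<le> e \<Longrightarrow> int p dvd sform n (w i) (v e) - (if i = e then 1 else 0)"
    and agree: "\<And>i. i < e \<Longrightarrow> w i - l i \<in> pl"
  shows "\<exists>j\<ge>e. j < d \<and> \<not> int p dvd sform n (w e) (b j)"
proof (rule ccontr)
  assume neg: "\<not> ?thesis"
  have "int p dvd sform n (w e) (b j) * sform n (l j) (v e)" if "j < d" for j
  proof (cases "j < e")
    case True
    have "int p dvd sform n (w j) (v e)" using dual[of j] True by simp
    then have "int p dvd sform n (w j) (v e) - (sform n (w j) (v e) - sform n (l j) (v e))"
      by (rule dvd_diff[OF _ sform_cong[OF agree[OF True] pl_refl]])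
    then show ?thesis by simp
  next
    case False
    then show ?thesis using neg that by (auto intro: dvd_mult2)
  qed
  then have "int p dvd (\<Sum>j<d. sform n (w e) (b j) * sform n (l j) (v e))"
    by (intro dvd_sum) simp
  moreover have "sform n (w e) (v e) = (\<Sum>j<d. sform n (w e) (b j) * sform n (l j) (v e))"
    by (subst spanZ_coeff[OF P w]) (simp add: sform_sum)
  ultimately have "int p dvd sform n (w e) (v e)" by (simp only:)
  moreover have "int p dvd sform n (w e) (v e) - 1" using dual[of e] by simp
  ultimately have "int p dvd sform n (w e) (v e) - (sform n (w e) (v e) - 1)" by (rule dvd_diff)
  then show False using p_gt1 by simp
qed

text \<open>\<open>row_step\<close> repeated. The bound \<open>k < d\<close> keeps an index in
  reserve, since the step at \<open>e\<close> requires \<open>Suc e < d\<close>.\<close>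

lemma adapt_basis:
  assumes P: "psb 0 d l b" and w: "\<And>i. i < k \<Longrightarrow> w i \<in> spanZ d l" and k: "k < d" "e \<le> k"
    and dual: "\<And>i j. i < k \<Longrightarrow> j < k \<Longrightarrow> int p dvd sform n (w i) (v j) - (if i = j then 1 else 0)"
    and agree: "\<And>i. i < e \<Longrightarrow> w i - l i \<in> pl"
  shows "\<exists>l' b'. psb 0 d l' b' \<and> spanZ d l' = spanZ d l \<and> (\<forall>i<e. l' i = l i) \<and> (\<forall>i<k. w i - l' i \<in> pl)"
  using assms
proof (induction "k - e" arbitrary: e l b)
  case 0
  then show ?case by (intro exI[of _ l] exI[of _ b]) auto
next
  case (Suc r)
  then have ek: "e < k" by simp
  have we: "w e \<in> spanZ d l" using Suc.prems(2) ek by blast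
  have "\<exists>j\<ge>e. j < d \<and> \<not> int p dvd sform n (w e) (b j)"
  proof (rule coefficient_nonzero[where w = w and v = v, OF Suc.prems(1) we])
    show "int p dvd sform n (w i) (v e) - (if i = e then 1 else 0)" if "i \<le> e" for i
      using Suc.prems(5)[of i e] that ek by simp
  qed (rule Suc.prems(6))
  then obtain j where j: "e \<le> j" "j < d" "\<not> int p dvd sform n (w e) (b j)" by blast
  obtain l' b' where l': "psb 0 d l' b'" "spanZ d l' = spanZ d l" "\<forall>i<e. l' i = l i" "w e - l' e \<in> pl"
    using row_step[OF Suc.prems(1) we _ j] ek Suc.prems(3) by auto
  have "\<exists>l2 b2. psb 0 d l2 b2 \<and> spanZ d l2 = spanZ d l' \<and> (\<forall>i<Suc e. l2 i = l' i) \<and> (\<forall>i<k. w i - l2 i \<in> pl)"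
  proof (rule Suc.hyps(1)[OF _ l'(1)])
    show "r = k - Suc e" "Suc e \<le> k" using Suc.hyps(2) by simp_all
    show "w i \<in> spanZ d l'" if "i < k" for i using Suc.prems(2)[OF that] l'(2) by simp
    show "w i - l' i \<in> pl" if "i < Suc e" for i
      using that l'(3,4) Suc.prems(6) by (cases "i = e") auto
  qed (use Suc.prems(3,5) in auto)
  then obtain l2 b2 where l2: "psb 0 d l2 b2" "spanZ d l2 = spanZ d l'" "\<forall>i<Suc e. l2 i = l' i"
    "\<forall>i<k. w i - l2 i \<in> pl" by blast
  have "spanZ d l2 = spanZ d l" using l2(2) l'(2) by simp
  moreover have "\<forall>i<e. l2 i = l i" using l2(3) l'(3) by simp
  ultimately show ?case using l2(1,4) by blast
qed

text \<open>No index is left over for the last vector, so it is matched only up to a factor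
  \<open>c\<close> prime to \<open>p\<close>.\<close>

lemma adapt_last:
  assumes P: "psb 0 (Suc r) l b" and w: "w r \<in> spanZ (Suc r) l"
    and dual: "\<And>i. i \<le> r \<Longrightarrow> int p dvd sform n (w i) (v r) - (if i = r then 1 else 0)"
    and agree: "\<And>i. i < r \<Longrightarrow> w i - l i \<in> pl"
  shows "\<exists>l' b' c. psb 0 (Suc r) l' b' \<and> spanZ (Suc r) l' = spanZ (Suc r) l \<and> (\<forall>i<r. l' i = l i) \<and>
    \<not> int p dvd c \<and> w r - c *\<^sub>Z l' r \<in> pl"
proof -
  obtain j where j: "j \<ge> r" "j < Suc r" "\<not> int p dvd sform n (w r) (b j)"
    using coefficient_nonzero[where w = w and e = r and v = v, OF P w dual agree] by blast
  then have "j = r" by simp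
  then have nz: "\<not> int p dvd sform n (w r) (b r)" using j(3) by simp
  let ?c = "sform n (w r) (b r)"
  obtain t where t: "int p dvd 1 - t * ?c" using solve_mod[OF nz, of 1] by blast
  \<comment> \<open>\<open>t\<close> inverts \<open>?c\<close> modulo \<open>p\<close>, so in the
    difference below the lower terms acquire the factor \<open>1 - t * ?c\<close>.\<close>
  define l' where "l' = l(r := l r + (\<Sum>i\<in>{..<Suc r} - {r}. (t * sform n (w r) (b i)) *\<^sub>Z l i))"
  have ex: "\<exists>b'. psb 0 (Suc r) l' b'"
    unfolding l'_def by (rule exI, rule row_operation(1)[OF P lessI])
  have s: "spanZ (Suc r) l' = spanZ (Suc r) l"
    unfolding l'_def by (rule row_operation(2)[OF P lessI])
  have "{..<Suc r} - {r} = {..<r}" by auto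
  then have l'r: "l' r = l r + (\<Sum>i<r. (t * sform n (w r) (b i)) *\<^sub>Z l i)" by (simp add: l'_def)
  have "w r = (\<Sum>i<r. sform n (w r) (b i) *\<^sub>Z l i) + ?c *\<^sub>Z l r"
    using spanZ_coeff[OF P w] by simp
  then have "w r - ?c *\<^sub>Z l' r = (\<Sum>i<r. ((1 - t * ?c) * sform n (w r) (b i)) *\<^sub>Z l i)"
    unfolding l'r
    by (simp add: fun_eq_iff sum_fun_apply algebra_simps sum_distrib_left sum_subtractf)
  also have "\<dots> \<in> pl"
    using t psb_lat(1)[OF P] by (intro subgrp_sum subgrp_pl smul_pl) auto
  finally have "w r - ?c *\<^sub>Z l' r \<in> pl" .
  moreover have "\<forall>i<r. l' i = l i" by (simp add: l'_def)
  ultimately show ?thesis using ex s nz by blast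
qed

end

text \<open>Term by term in the Leibniz formula.\<close>

lemma det_cong:
  fixes A B :: "int mat"
  assumes "A \<in> carrier_mat d d" "B \<in> carrier_mat d d"
    and "\<And>i j. i < d \<Longrightarrow> j < d \<Longrightarrow> m dvd A $$ (i, j) - B $$ (i, j)"
  shows "m dvd Determinant.det A - Determinant.det B"
proof -
  have "[A $$ (i, \<pi> i) = B $$ (i, \<pi> i)] (mod m)" if "\<pi> permutes {0..<d}" "i \<in> {0..<d}" for \<pi> i
    using assms(3)[of i "\<pi> i"] that permutes_in_image[OF that(1), of i] by (simp add: cong_iff_dvd_diff)
  then have "[Determinant.det A = Determinant.det B] (mod m)"
    unfolding Determinant.det_def'[OF assms(1)] Determinant.det_def'[OF assms(2)]
    by (intro cong_sum cong_mult cong_prod) auto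
  then show ?thesis by (simp add: cong_iff_dvd_diff)
qed

context symp
begin

text \<open>The change of basis has determinant \<open>\<pm>1\<close>, and modulo \<open>p\<close> it is diagonal with entries
  \<open>1, \<dots>, 1, c\<close>.\<close>

lemma last_coefficient_unit:
  assumes P: "psb 0 (Suc r) l b" and Q: "psb 0 (Suc r) w v" and eq: "spanZ (Suc r) w = spanZ (Suc r) l"
    and agree: "\<And>i. i < r \<Longrightarrow> w i - l i \<in> pl" and last: "w r - c *\<^sub>Z l r \<in> pl"
  shows "int p dvd c - 1 \<or> int p dvd c + 1"
proof -
  let ?d = "Suc r"
  define M where "M = mat ?d ?d (\<lambda>(i, j). sform n (w i) (b j))"
  define N where "N = mat ?d ?d (\<lambda>(i, j). sform n (l i) (v j))"
  define D where "D = mat ?d ?d (\<lambda>(i, j). if i = j then if i = r then c else 1 else (0::int))"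
  have car: "M \<in> carrier_mat ?d ?d" "N \<in> carrier_mat ?d ?d" "D \<in> carrier_mat ?d ?d"
    by (auto simp: M_def N_def D_def)
  \<comment> \<open>\<open>M\<close> and \<open>N\<close> express two bases of the same lattice in
    each other, so their determinants are units of the integers.\<close>
  have "M * N = 1\<^sub>m ?d"
  proof (rule eq_matI)
    fix i j assume "i < dim_row (1\<^sub>m ?d)" "j < dim_col (1\<^sub>m ?d)"
    then have ij: "i < ?d" "j < ?d" by auto
    have wi: "w i \<in> spanZ ?d l" using spanZ_base[OF ij(1), of w] eq by simp
    have "(M * N) $$ (i, j) = (\<Sum>k<?d. sform n (w i) (b k) * sform n (l k) (v j))"
      using ij by (simp add: M_def N_def scalar_prod_def lessThan_atLeast0)
    also have "\<dots> = sform n (w i) (v j)"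
      by (subst (2) spanZ_coeff[OF P wi]) (simp add: sform_sum)
    also have "\<dots> = (if i = j then 1 else 0)" using psb_exact(3)[OF Q ij] .
    finally show "(M * N) $$ (i, j) = 1\<^sub>m ?d $$ (i, j)" using ij by simp
  qed (use car in auto)
  then have "Determinant.det M * Determinant.det N = 1"
    using det_mult[OF car(1,2)] by simp
  then have M1: "Determinant.det M = 1 \<or> Determinant.det M = -1"
    using zmult_eq_1_iff by blast
  have "int p dvd M $$ (i, j) - D $$ (i, j)" if ij: "i < ?d" "j < ?d" for i j
  proof (cases "i = r")
    case True
    have "int p dvd sform n (w r) (b j) - sform n (c *\<^sub>Z l r) (b j)" by (rule sform_cong[OF last pl_refl])
    then show ?thesis using True ij psb_exact(3)[OF P, of r j] by (auto simp: M_def D_def)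
  next
    case False
    then have "int p dvd sform n (w i) (b j) - sform n (l i) (b j)"
      using ij by (intro sform_cong[OF agree pl_refl]) simp
    then show ?thesis using False ij psb_exact(3)[OF P ij] by (auto simp: M_def D_def)
  qed
  then have d: "int p dvd Determinant.det M - Determinant.det D" by (rule det_cong[OF car(1,3)])
  have "upper_triangular D" by (auto simp: D_def)
  then have "Determinant.det D = prod_list (diag_mat D)" by (rule det_upper_triangular[OF _ car(3)])
  also have "diag_mat D = map (\<lambda>i. if i = r then c else 1) [0..<?d]"
    by (auto simp: diag_mat_def D_def)
  also have "prod_list \<dots> = (\<Prod>i\<in>set [0..<?d]. if i = r then c else 1)"
    by (rule prod.distinct_set_conv_list[symmetric]) simp
  also have "\<dots> = c" by simp
  finally have dc: "int p dvd Determinant.det M - c" using d by simp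
  show ?thesis
    using M1
  proof
    assume "Determinant.det M = 1"
    then have "int p dvd - (c - 1)" using dc by simp
    then show ?thesis unfolding dvd_minus_iff by blast
  next
    assume "Determinant.det M = -1"
    moreover have "-1 - c = - (c + 1)" by simp
    ultimately have "int p dvd - (c + 1)" using dc by (simp only:)
    then show ?thesis unfolding dvd_minus_iff by blast
  qed
qed

text \<open>After \<open>adapt_basis\<close> and \<open>adapt_last\<close> the remaining factor is 1
  or -1 modulo \<open>p\<close>, because both bases span the same lattice; negating the last vector
  settles the sign. As \<open>e < d\<close>, that vector is not among those to be kept.\<close>

lemma match_basis:
  assumes P: "psb 0 d l b" and Q: "psb 0 d w v" and eq: "spanZ d w = spanZ d l"
    and e: "e < d" and agree: "\<And>i. i < e \<Longrightarrow> w i - l i \<in> pl"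
  shows "\<exists>l' b'. psb 0 d l' b' \<and> spanZ d l' = spanZ d l \<and> (\<forall>i<e. l' i = l i) \<and> (\<forall>i<d. w i - l' i \<in> pl)"
proof -
  obtain r where d: "d = Suc r" using e by (cases d) auto
  have wl: "w i \<in> spanZ d l" if "i < d" for i using spanZ_base[OF that, of w] eq by simp
  have dual: "int p dvd sform n (w i) (v j) - (if i = j then 1 else 0)" if "i < d" "j < d" for i j
    using psb_exact(3)[OF Q that] by simp
  have "\<exists>l1 b1. psb 0 d l1 b1 \<and> spanZ d l1 = spanZ d l \<and> (\<forall>i<e. l1 i = l i) \<and> (\<forall>i<r. w i - l1 i \<in> pl)"
    by (rule adapt_basis[OF P, where v = v]) (use wl dual agree e d in auto)
  then obtain l1 b1 where l1: "psb 0 d l1 b1" "spanZ d l1 = spanZ d l" "\<forall>i<e. l1 i = l i" "\<forall>i<r. w i - l1 i \<in> pl"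
    by blast
  have "\<exists>l' b' c. psb 0 d l' b' \<and> spanZ d l' = spanZ d l1 \<and> (\<forall>i<r. l' i = l1 i) \<and>
    \<not> int p dvd c \<and> w r - c *\<^sub>Z l' r \<in> pl"
    unfolding d by (rule adapt_last[where v = v]) (use l1 wl dual d in auto)
  then obtain l2 b2 c where l2: "psb 0 d l2 b2" "spanZ d l2 = spanZ d l1" "\<forall>i<r. l2 i = l1 i" "w r - c *\<^sub>Z l2 r \<in> pl"
    by blast
  have a2: "w i - l2 i \<in> pl" if "i < r" for i using that l1(4) l2(3) by simp
  have c: "int p dvd c - 1 \<or> int p dvd c + 1"
    using last_coefficient_unit[of r l2 b2 w v c] l1(2) l2 Q eq a2 unfolding d by simp
  have l2r: "l2 r \<in> \<Lambda>" using psb_lat(1)[OF l2(1)] d by simp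
  have e2: "l2 i = l i" if "i < e" for i using that l1(3) l2(3) e d by simp
  show ?thesis
    using c
  proof
    assume "int p dvd c - 1"
    then have "c *\<^sub>Z l2 r - l2 r \<in> pl" using smul_pl[OF _ l2r, of "c - 1"] by (simp add: smul_diff_left)
    then have "w r - l2 r \<in> pl" using pl_trans[OF l2(4)] by blast
    then have "\<forall>i<d. w i - l2 i \<in> pl" using a2 d by (simp add: less_Suc_eq)
    then show ?thesis using l2(1,2) l1(2) e2 by metis
  next
    assume "int p dvd c + 1"
    let ?l = "l2(r := - l2 r)"
    have "c *\<^sub>Z l2 r - (- l2 r) \<in> pl"
      using smul_pl[OF \<open>int p dvd c + 1\<close> l2r] by (simp add: smul_add_left)
    then have "w r - (- l2 r) \<in> pl" by (rule pl_trans[OF l2(4)])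
    then have "\<forall>i<d. w i - ?l i \<in> pl" using a2 d by (simp add: less_Suc_eq)
    moreover have "\<forall>i<e. ?l i = l i" using e2 e d by simp
    moreover have "spanZ d ?l = spanZ d l" using negate_last(2)[of r l2 b2] l2(1,2) l1(2) d by simp
    ultimately show ?thesis using negate_last(1)[of r l2 b2] l2(1) d by blast
  qed
qed

subsection \<open>Orbits of chains of isotropic lattices\<close>

definition lat_equiv where "lat_equiv L M \<longleftrightarrow> (\<exists>g\<in>congruence_maps. g ` L = M)"

lemma image_lattice:
  assumes g: "g \<in> congruence_maps" and P: "psb 0 d a b"
  shows "g ` spanZ d a = spanZ d (\<lambda>i. g (a i))"
proof -
  have "g (\<Sum>i<d. c i *\<^sub>Z a i) = (\<Sum>i<d. c i *\<^sub>Z g (a i))" for c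
    using congruence_maps_sum[OF g, of "{..<d}" "\<lambda>i. c i *\<^sub>Z a i"] psb_lat(1)[OF P] congruence_maps_linear(4)[OF g]
    by simp
  then show ?thesis unfolding spanZ_def by (auto simp: image_iff) metis+
qed

lemma image_iso_lattice: "g \<in> congruence_maps \<Longrightarrow> iso_lattice L \<Longrightarrow> iso_lattice (g ` L)"
  using lattice_basis0 image_lattice psb_image spanZ_lattice by metis

lemma redL_image:
  assumes g: "g \<in> congruence_maps" and L: "iso_lattice L"
  shows "redL (g ` L) = redL L"
proof -
  have L\<Lambda>: "L \<subseteq> \<Lambda>" "subgrp L" using L by (auto simp: iso_lattice_def)
  have L': "iso_lattice (g ` L)" by (rule image_iso_lattice[OF assms])
  then have L'': "g ` L \<subseteq> \<Lambda>" "subgrp (g ` L)" by (auto simp: iso_lattice_def)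
  have 1: "g x - x \<in> pl" "x - g x \<in> pl" if "x \<in> L" for x
    using congruence_mapsD(4)[OF g, of x] pl_sym that L\<Lambda> by blast+
  have "g ` L \<subseteq> redL L" using 1(1) redL_iff[OF L\<Lambda>(2)] by blast
  moreover have "L \<subseteq> redL (g ` L)" using 1(2) redL_iff[OF L''(2)] by blast
  ultimately show ?thesis
    using redL_le[OF subsp_redL[OF L\<Lambda>(2,1)]] redL_le[OF subsp_redL[OF L''(2,1)]] by blast
qed

lemma lat_equiv_redL: "lat_equiv L M \<Longrightarrow> iso_lattice L \<Longrightarrow> redL M = redL L"
  using redL_image by (auto simp: lat_equiv_def)

lemma lat_equiv_refl: "lat_equiv L L"
  unfolding lat_equiv_def using id_congruence by (intro bexI[of _ "\<lambda>x. x"]) auto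

lemma span_equiv:
  assumes "psb 0 d u v" "psb 0 d u' v'" "\<And>i. i < d \<Longrightarrow> u' i - u i \<in> pl"
  shows "lat_equiv (spanZ d u) (spanZ d u')"
proof -
  have "\<exists>g\<in>congruence_maps. \<forall>i<d. g (u i) = u' i" by (rule congruence_transitive[OF assms])
  then obtain g where g: "g \<in> congruence_maps" "\<forall>i<d. g (u i) = u' i" by blast
  have "spanZ d (\<lambda>i. g (u i)) = spanZ d u'" by (rule spanZ_cong) (simp add: g(2))
  then have "g ` spanZ d u = spanZ d u'" using image_lattice[OF g(1) assms(1)] by simp
  then show ?thesis using g(1) by (auto simp: lat_equiv_def)
qed

text \<open>Vectors of \<open>L2\<close> congruent to a basis of \<open>L1\<close> can be matched
  modulo \<open>p\<close> by the initial part of a basis of \<open>L2\<close>, and this part spans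
  the wanted lattice. Strictness gives \<open>d < e\<close>, as \<open>adapt_basis\<close>
  requires.\<close>

lemma lift_into:
  assumes L: "iso_lattice L1" "iso_lattice L2" and sub: "redL L1 \<subset> redL L2"
  shows "\<exists>L. iso_lattice L \<and> lat_equiv L1 L \<and> L \<subset> L2"
proof -
  obtain d u v where u: "psb 0 d u v" "L1 = spanZ d u" using lattice_basis0[OF L(1)] by blast
  obtain e l b where l: "psb 0 e l b" "L2 = spanZ e l" using lattice_basis0[OF L(2)] by blast
  have de: "d < e"
    using dm_psubset[of "redL L1" "redL L2"] redL_span[OF u(1)] redL_span[OF l(1)] sub u l isotropic_subsp by metis
  have sL2: "subgrp L2" using L(2) by (simp add: iso_lattice_def)
  have "\<exists>y\<in>L2. u i - y \<in> pl" if "i < d" for i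
  proof -
    have "u i \<in> redL L1" using spanZ_base[OF that] redL_ge u(2) by blast
    then show ?thesis using sub redL_iff[OF sL2] by blast
  qed
  then obtain w where w: "\<And>i. i < d \<Longrightarrow> w i \<in> L2 \<and> u i - w i \<in> pl" by metis
  have "\<exists>l' b'. psb 0 e l' b' \<and> spanZ e l' = spanZ e l \<and> (\<forall>i<0. l' i = l i) \<and> (\<forall>i<d. w i - l' i \<in> pl)"
  proof (rule adapt_basis[OF l(1), where v = v])
    show "int p dvd sform n (w i) (v j) - (if i = j then 1 else 0)" if "i < d" "j < d" for i j
      using sform_cong[of "w i" "u i" "v j" "v j"] pl_sym w[OF that(1)] pl_refl psb_exact(3)[OF u(1) that] by simp
  qed (use w l(2) de in auto)
  then obtain l' b' where l': "psb 0 e l' b'" "spanZ e l' = L2" "\<forall>i<d. w i - l' i \<in> pl"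
    using l(2) by blast
  have P: "psb 0 d l' b'" using psb_prefix[OF l'(1)] de by simp
  have "lat_equiv L1 (spanZ d l')"
    unfolding u(2) by (rule span_equiv[OF u(1) P]) (use w l'(3) pl_trans pl_sym in blast)
  moreover have "spanZ d l' \<subseteq> L2" using spanZ_mono[of d e l'] l'(2) de by simp
  moreover have "spanZ d l' \<noteq> L2"
    using redL_span(2)[OF P] redL_span(2)[OF l'(1)] l'(2) de by auto
  ultimately show ?thesis using spanZ_lattice[OF P] by blast
qed

text \<open>Induction removing the largest member \<open>M\<close>. Frames for the rest extend to
  bases of \<open>M\<close> and \<open>f M\<close>. The basis of \<open>f M\<close> is compared with
  the image of that of \<open>M\<close> under a congruence map, and \<open>match_basis\<close>
  alters it beyond the common initial part until both agree modulo \<open>p\<close>.\<close>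

lemma chain_frames:
  assumes "finite \<sigma>" "\<sigma> \<noteq> {}" "\<And>L. L \<in> \<sigma> \<Longrightarrow> iso_lattice L" "\<And>L M. L \<in> \<sigma> \<Longrightarrow> M \<in> \<sigma> \<Longrightarrow> L \<subseteq> M \<or> M \<subseteq> L"
    and "\<And>L. L \<in> \<sigma> \<Longrightarrow> lat_equiv L (f L)" "\<And>L M. L \<in> \<sigma> \<Longrightarrow> M \<in> \<sigma> \<Longrightarrow> L \<subset> M \<Longrightarrow> f L \<subset> f M"
  shows "\<exists>d u v u' v'. psb 0 d u v \<and> psb 0 d u' v' \<and> (\<forall>i<d. u' i - u i \<in> pl) \<and>
    (\<forall>L\<in>\<sigma>. \<exists>e\<le>d. L = spanZ e u \<and> f L = spanZ e u') \<and> (\<exists>M\<in>\<sigma>. M = spanZ d u \<and> f M = spanZ d u')"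
  using assms
proof (induction "card \<sigma>" arbitrary: \<sigma>)
  case 0
  then show ?case by simp
next
  case (Suc k)
  have "\<exists>M\<in>\<sigma>. \<forall>L\<in>\<sigma>. M \<subseteq> L \<longrightarrow> M = L" using finite_has_maximal[OF Suc.prems(1,2)] by blast
  then obtain M where M: "M \<in> \<sigma>" "\<And>L. L \<in> \<sigma> \<Longrightarrow> L \<subseteq> M" using Suc.prems(4) by metis
  have iM: "iso_lattice M" using Suc.prems(3) M(1) .
  obtain g where g: "g \<in> congruence_maps" "g ` M = f M" using Suc.prems(5)[OF M(1)] by (auto simp: lat_equiv_def)
  show ?case
  proof (cases "\<sigma> = {M}")
    case True
    obtain d u v where u: "psb 0 d u v" "M = spanZ d u" using lattice_basis0[OF iM] by blast
    have "psb 0 d (\<lambda>i. g (u i)) (\<lambda>i. g (v i))" by (rule psb_image[OF g(1) u(1)])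
    moreover have "f M = spanZ d (\<lambda>i. g (u i))" using g image_lattice[OF g(1) u(1)] u(2) by simp
    moreover have "\<forall>i<d. g (u i) - u i \<in> pl" using congruence_mapsD(4)[OF g(1)] psb_lat(1)[OF u(1)] by blast
    ultimately show ?thesis using u True by blast
  next
    case False
    let ?\<tau> = "\<sigma> - {M}"
    have \<tau>: "k = card ?\<tau>" "finite ?\<tau>" "?\<tau> \<noteq> {}" using Suc.hyps(2) Suc.prems(1) M(1) False by auto
    have "\<exists>d u v u' v'. psb 0 d u v \<and> psb 0 d u' v' \<and> (\<forall>i<d. u' i - u i \<in> pl) \<and>
      (\<forall>L\<in>?\<tau>. \<exists>e\<le>d. L = spanZ e u \<and> f L = spanZ e u') \<and> (\<exists>K\<in>?\<tau>. K = spanZ d u \<and> f K = spanZ d u')"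
      using Suc.prems(3-6) by (intro Suc.hyps(1)[OF \<tau>]) simp_all
    then obtain d u v u' v' K where ih: "psb 0 d u v" "psb 0 d u' v'" "\<forall>i<d. u' i - u i \<in> pl"
      "\<forall>L\<in>?\<tau>. \<exists>e\<le>d. L = spanZ e u \<and> f L = spanZ e u'" "K \<in> ?\<tau>" "K = spanZ d u" "f K = spanZ d u'"
      by (elim exE conjE bexE)
    have K\<sigma>: "K \<in> \<sigma>" "K \<noteq> M" using ih(5) by simp_all
    then have KM1: "K \<subset> M" using M(2)[OF K\<sigma>(1)] by (simp add: psubset_eq)
    note KM = KM1 Suc.prems(6)[OF K\<sigma>(1) M(1) KM1]
    have ifM: "iso_lattice (f M)" using image_iso_lattice[OF g(1) iM] g(2) by simp
    have "\<And>i. i < d \<Longrightarrow> u i \<in> M" using spanZ_base[of _ d u] ih(6) KM by blast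
    then obtain e a b where a: "d \<le> e" "psb 0 e a b" "\<forall>i<d. a i = u i" "M = spanZ e a"
      using lattice_basis[OF iM ih(1)] by blast
    have "\<And>i. i < d \<Longrightarrow> u' i \<in> f M" using spanZ_base[of _ d u'] ih(7) KM by blast
    then obtain e' l c where l: "d \<le> e'" "psb 0 e' l c" "\<forall>i<d. l i = u' i" "f M = spanZ e' l"
      using lattice_basis[OF ifM ih(2)] by blast
    have "e' = e" using redL_span(2)[OF a(2)] redL_span(2)[OF l(2)] redL_image[OF g(1) iM] g(2) a(4) l(4) by simp
    note l = l[unfolded this]
    \<comment> \<open>Strict inclusion leaves an index beyond the initial part, as
      \<open>match_basis\<close> needs.\<close>
    have "d \<noteq> e" using KM(1) ih(6) a(3,4) spanZ_cong[of d a u] by auto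
    then have de: "d < e" using a(1) by simp
    define w where "w i = g (a i)" for i
    have Q: "psb 0 e w (\<lambda>i. g (b i))" unfolding w_def by (rule psb_image[OF g(1) a(2)])
    have sw: "spanZ e w = spanZ e l" unfolding w_def using image_lattice[OF g(1) a(2)] g(2) a(4) l(4) by simp
    have wa: "w i - a i \<in> pl" if "i < e" for i
      using congruence_mapsD(4)[OF g(1) psb_lat(1)[OF a(2) that]] by (simp add: w_def)
    have "w i - l i \<in> pl" if "i < d" for i
    proof -
      have "a i - l i \<in> pl" using pl_sym ih(3) a(3) l(3) that by simp
      then show ?thesis using pl_trans wa[of i] that de by simp
    qed
    then obtain l' c' where l': "psb 0 e l' c'" "spanZ e l' = spanZ e l" "\<forall>i<d. l' i = l i" "\<forall>i<e. w i - l' i \<in> pl"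
      using match_basis[OF l(2) Q sw de] by blast
    have C: "l' i - a i \<in> pl" if "i < e" for i using pl_trans[OF pl_sym wa] l'(4) that by blast
    have S: "spanZ j a = spanZ j u" "spanZ j l' = spanZ j u'" if "j \<le> d" for j
      using that a(3) l(3) l'(3) by (auto intro!: spanZ_cong)
    have M': "M = spanZ e a" "f M = spanZ e l'" using a(4) l(4) l'(2) by simp_all
    have D: "\<exists>j\<le>e. L = spanZ j a \<and> f L = spanZ j l'" if "L \<in> \<sigma>" for L
    proof (cases "L = M")
      case True
      have "e \<le> e \<and> L = spanZ e a \<and> f L = spanZ e l'" using True M' by simp
      then show ?thesis by (rule exI[of _ e])
    next
      case False
      then have "\<exists>j\<le>d. L = spanZ j u \<and> f L = spanZ j u'" using ih(4) that by simp
      then obtain j where j: "j \<le> d" "L = spanZ j u" "f L = spanZ j u'" by (elim exE conjE)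
      have "j \<le> e \<and> L = spanZ j a \<and> f L = spanZ j l'" using j(1) de S[OF j(1)] j(2,3) by simp
      then show ?thesis ..
    qed
    have "psb 0 e a b \<and> psb 0 e l' c' \<and> (\<forall>i<e. l' i - a i \<in> pl) \<and>
      (\<forall>L\<in>\<sigma>. \<exists>j\<le>e. L = spanZ j a \<and> f L = spanZ j l') \<and> (\<exists>M\<in>\<sigma>. M = spanZ e a \<and> f M = spanZ e l')"
      by (intro conjI allI impI ballI bexI[of _ M] a(2) l'(1) C D M' M(1))
    then show ?thesis by (intro exI)
  qed
qed

text \<open>The congruent frames of the two chains are carried into each other by one map, by
  \<open>congruence_transitive\<close>.\<close>

theorem chain_equiv:
  assumes "finite \<sigma>" "\<sigma> \<noteq> {}" "\<And>L. L \<in> \<sigma> \<Longrightarrow> iso_lattice L" "\<And>L M. L \<in> \<sigma> \<Longrightarrow> M \<in> \<sigma> \<Longrightarrow> L \<subseteq> M \<or> M \<subseteq> L"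
    and "\<And>L. L \<in> \<sigma> \<Longrightarrow> lat_equiv L (f L)" "\<And>L M. L \<in> \<sigma> \<Longrightarrow> M \<in> \<sigma> \<Longrightarrow> L \<subset> M \<Longrightarrow> f L \<subset> f M"
  shows "\<exists>g\<in>congruence_maps. \<forall>L\<in>\<sigma>. g ` L = f L"
proof -
  have "\<exists>d u v u' v'. psb 0 d u v \<and> psb 0 d u' v' \<and> (\<forall>i<d. u' i - u i \<in> pl) \<and>
    (\<forall>L\<in>\<sigma>. \<exists>e\<le>d. L = spanZ e u \<and> f L = spanZ e u') \<and> (\<exists>M\<in>\<sigma>. M = spanZ d u \<and> f M = spanZ d u')"
    by (rule chain_frames[OF assms])
  then obtain d u v u' v' where u: "psb 0 d u v" "psb 0 d u' v'" "\<forall>i<d. u' i - u i \<in> pl"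
    "\<forall>L\<in>\<sigma>. \<exists>e\<le>d. L = spanZ e u \<and> f L = spanZ e u'" "\<exists>M\<in>\<sigma>. M = spanZ d u \<and> f M = spanZ d u'"
    by (elim exE conjE)
  have "\<exists>g\<in>congruence_maps. \<forall>i<d. g (u i) = u' i" by (rule congruence_transitive[OF u(1,2)]) (simp add: u(3))
  then obtain g where g: "g \<in> congruence_maps" "\<forall>i<d. g (u i) = u' i" by blast
  have "g ` L = f L" if L: "L \<in> \<sigma>" for L
  proof -
    obtain e where e: "e \<le> d" "L = spanZ e u" "f L = spanZ e u'" using u(4)[rule_format, OF L] by (elim exE conjE)
    then show ?thesis using image_lattice[OF g(1) psb_prefix[OF u(1) e(1)]] g(2) spanZ_cong[of e "\<lambda>i. g (u i)" u'] by simp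
  qed
  then show ?thesis by (intro bexI[OF _ g(1)] ballI)
qed

end

context symp
begin

subsection \<open>Orbits over a fixed reduction\<close>

text \<open>\<open>psb_greedy\<close> modulo \<open>p\<close>, where every nonzero vector has a dual
  after scaling. As \<open>V\<close> is nonzero there is a last vector, of index \<open>r\<close>,
  which will carry the scale.\<close>

lemma isotropic_basis:
  assumes V: "isotropic V" "pl \<subset> V"
  shows "\<exists>r a b. psb (int p) (Suc r) a b \<and> (\<forall>i<Suc r. a i \<in> V) \<and> dm V = Suc r \<and>
    (\<forall>W. subsp W \<longrightarrow> (\<forall>i<Suc r. a i \<in> W) \<longrightarrow> V \<subseteq> W)"
proof -
  have sV: "subsp V" using V(1) by (rule isotropic_subsp)
  have V\<Lambda>: "subgrp V" "V \<subseteq> \<Lambda>" using sV by (auto simp: subsp_def)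
  have "\<exists>d a' b'. 0 \<le> d \<and> psb (int p) d a' b' \<and> (\<forall>i<0. a' i = (0::nat \<Rightarrow> nat \<Rightarrow> int) i \<and> b' i = (0::nat \<Rightarrow> nat \<Rightarrow> int) i) \<and>
    (\<forall>i<d. a' i \<in> V) \<and> (\<forall>x\<in>V. \<forall>t. int p dvd (x - (\<Sum>i<d. sform n x (b' i) *\<^sub>Z a' i)) t)"
  proof (rule psb_greedy[OF V\<Lambda>])
    show "int p dvd sform n x y" if "x \<in> V" "y \<in> V" for x y
      using V(1) that by (auto simp: isotropic_def perp_def)
    show "\<exists>x'\<in>V. \<exists>y\<in>\<Lambda>. int p dvd sform n x' y - 1 \<and> (\<forall>z. int p dvd sform n x z \<longrightarrow> int p dvd sform n x' z)"
      if x: "x \<in> V" "\<not> (\<forall>i. int p dvd x i)" for x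
    proof -
      have "x \<notin> pl" using x(2) by (auto simp: pl_def)
      then obtain y where y: "y \<in> \<Lambda>" "\<not> int p dvd sform n x y" using nondegenerate[of x] x(1) V\<Lambda> by blast
      obtain t where t: "int p dvd 1 - t * sform n x y" using solve_mod[OF y(2), of 1] by blast
      have "int p dvd sform n x (t *\<^sub>Z y) - 1" using t by (simp add: dvd_diff_commute)
      moreover have "t *\<^sub>Z y \<in> \<Lambda>" using y(1) by simp
      ultimately show ?thesis using x(1) by blast
    qed
  qed (simp_all add: psb_def)
  then obtain d a b where d: "psb (int p) d a b" "\<forall>i<d. a i \<in> V"
    "\<And>x t. x \<in> V \<Longrightarrow> int p dvd (x - (\<Sum>i<d. sform n x (b i) *\<^sub>Z a i)) t" by metis
  obtain V' where V': "isotropic V'" "dm V' = d" "\<forall>i<d. a i \<in> V'" "\<forall>W. subsp W \<longrightarrow> (\<forall>i<d. a i \<in> W) \<longrightarrow> V' \<subseteq> W"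
    using psb_isotropic[OF d(1)] by (elim exE conjE)
  have sV': "subsp V'" using V'(1) by (rule isotropic_subsp)
  have "V \<subseteq> V'"
  proof
    fix x assume x: "x \<in> V"
    let ?s = "\<Sum>i<d. sform n x (b i) *\<^sub>Z a i"
    have s: "?s \<in> V'" using V'(3) subsp_closed(5)[OF sV'] by (intro subgrp_sum[OF subspD(1)[OF sV']]) simp
    have "x - ?s \<in> \<Lambda>" using x s V\<Lambda> subspD(2)[OF sV'] by (intro lat_simps) blast+
    then have "x - ?s \<in> pl" using d(3)[OF x] by (simp add: pl_def)
    then have "(x - ?s) + ?s \<in> V'" using s subsp_closed(4)[OF sV'] subspD(3)[OF sV'] by blast
    then show "x \<in> V'" by simp
  qed
  moreover have "V' \<subseteq> V" using V'(4) sV d(2) by simp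
  ultimately have VV: "V' = V" by (rule subset_antisym[rotated])
  have "0 < dm V" using dm_psubset[OF subsp_pl sV V(2)] by simp
  then obtain r where r: "d = Suc r" using V'(2) VV not0_implies_Suc by (metis less_numeral_extra(3))
  have "psb (int p) (Suc r) a b \<and> (\<forall>i<Suc r. a i \<in> V) \<and> dm V = Suc r \<and>
    (\<forall>W. subsp W \<longrightarrow> (\<forall>i<Suc r. a i \<in> W) \<longrightarrow> V \<subseteq> W)"
    using d(1,2) V'(2,4) VV r by simp
  then show ?thesis by (intro exI)
qed

text \<open>\<open>L\<close> has scale \<open>c\<close> relative to the basis \<open>a\<close> of its reduction if some basis of \<open>L\<close> reduces to
  \<open>a\<^sub>0, \<dots>, c a\<^sub>r\<close>: the determinant of \<open>L\<close> relative to \<open>a\<close>, which is only defined up to sign.\<close>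

definition scale where
  "scale r a L c \<longleftrightarrow> (\<exists>l b. psb 0 (Suc r) l b \<and> L = spanZ (Suc r) l \<and>
     (\<forall>i<r. l i - a i \<in> pl) \<and> l r - c *\<^sub>Z a r \<in> pl)"

lemma pl_smul_diff: "x - y \<in> pl \<Longrightarrow> c *\<^sub>Z x - c *\<^sub>Z y \<in> pl"
  using subgrpD(5)[OF subgrp_pl] by (simp add: smul_diff_right[symmetric])

lemma pl_smul_cong: "int p dvd c - c' \<Longrightarrow> x \<in> \<Lambda> \<Longrightarrow> c *\<^sub>Z x - c' *\<^sub>Z x \<in> pl"
  unfolding smul_diff_left[symmetric] by (rule smul_pl)

text \<open>\<open>adapt_basis\<close> and \<open>adapt_last\<close> match representatives of
  \<open>a\<close> with a basis of \<open>L\<close> up to a factor at the last vector; the inverse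
  of that factor is the scale.\<close>

lemma scale_exists:
  assumes P: "psb (int p) (Suc r) a b" and L: "iso_lattice L" "dm (redL L) = Suc r"
    and a: "\<And>i. i < Suc r \<Longrightarrow> a i \<in> redL L"
  shows "\<exists>c. \<not> int p dvd c \<and> scale r a L c"
proof -
  obtain d l b0 where l: "psb 0 d l b0" "L = spanZ d l" using lattice_basis0[OF L(1)] by blast
  have d: "d = Suc r" using redL_span(2)[OF l(1)] L(2) l(2) by simp
  note l = l[unfolded d]
  have sL: "subgrp L" using L(1) by (simp add: iso_lattice_def)
  have "\<forall>i<Suc r. \<exists>y. y \<in> L \<and> a i - y \<in> pl" using a redL_iff[OF sL] by blast
  then obtain w where w: "\<And>i. i < Suc r \<Longrightarrow> w i \<in> L" "\<And>i. i < Suc r \<Longrightarrow> a i - w i \<in> pl" by metis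
  have dual: "int p dvd sform n (w i) (b j) - (if i = j then 1 else 0)" if "i < Suc r" "j < Suc r" for i j
  proof -
    have "int p dvd sform n (w i) (b j) - sform n (a i) (b j)"
      by (rule sform_cong[OF pl_sym[OF w(2)[OF that(1)]] pl_refl])
    then have "int p dvd (sform n (w i) (b j) - sform n (a i) (b j)) + (sform n (a i) (b j) - (if i = j then 1 else 0))"
      using psbD(3)[OF P that] by (rule dvd_add)
    then show ?thesis by simp
  qed
  have "\<exists>l' b'. psb 0 (Suc r) l' b' \<and> spanZ (Suc r) l' = spanZ (Suc r) l \<and> (\<forall>i<0. l' i = l i) \<and> (\<forall>i<r. w i - l' i \<in> pl)"
    by (rule adapt_basis[OF l(1), where v = b]) (use w(1) l(2) dual in auto)
  then obtain l1 b1 where l1: "psb 0 (Suc r) l1 b1" "spanZ (Suc r) l1 = L" "\<forall>i<r. w i - l1 i \<in> pl"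
    using l(2) by blast
  have "\<exists>l' b' c. psb 0 (Suc r) l' b' \<and> spanZ (Suc r) l' = spanZ (Suc r) l1 \<and> (\<forall>i<r. l' i = l1 i) \<and>
    \<not> int p dvd c \<and> w r - c *\<^sub>Z l' r \<in> pl"
    by (rule adapt_last[OF l1(1), where v = b]) (use w(1) l1 dual in auto)
  then obtain l' b' c where l': "psb 0 (Suc r) l' b'" "spanZ (Suc r) l' = spanZ (Suc r) l1" "\<forall>i<r. l' i = l1 i"
    "\<not> int p dvd c" "w r - c *\<^sub>Z l' r \<in> pl" by (elim exE conjE)
  obtain t where t: "int p dvd 1 - t * c" using solve_mod[OF l'(4), of 1] by blast
  have nt: "\<not> int p dvd t"
  proof
    assume "int p dvd t"
    then have "int p dvd (1 - t * c) + t * c" using t by (intro dvd_add) auto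
    then show False using p_gt1 by simp
  qed
  have "t *\<^sub>Z w r - (t * c) *\<^sub>Z l' r \<in> pl" using pl_smul_diff[OF l'(5), of t] by (simp add: smul_smul)
  moreover have "1 *\<^sub>Z l' r - (t * c) *\<^sub>Z l' r \<in> pl" by (rule pl_smul_cong[OF t psb_lat(1)[OF l'(1)]]) simp
  ultimately have "l' r - t *\<^sub>Z w r \<in> pl" using pl_trans pl_sym by (metis smul_simps(2))
  moreover have "t *\<^sub>Z w r - t *\<^sub>Z a r \<in> pl" by (rule pl_smul_diff[OF pl_sym[OF w(2)]]) simp
  ultimately have last: "l' r - t *\<^sub>Z a r \<in> pl" by (rule pl_trans)
  have init: "l' i - a i \<in> pl" if "i < r" for i
  proof -
    have "l' i - w i \<in> pl" using pl_sym l1(3) l'(3) that by simp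
    moreover have "w i - a i \<in> pl" using pl_sym[OF w(2)] that by simp
    ultimately show ?thesis by (rule pl_trans)
  qed
  have "scale r a L t" unfolding scale_def
    by (intro exI[of _ l'] exI[of _ b'] conjI allI impI l'(1) last init) (simp_all add: l'(2) l1(2))
  then show ?thesis using nt by blast
qed

lemma scale_neg: "scale r a L c \<Longrightarrow> scale r a L (- c)"
proof -
  assume "scale r a L c"
  then obtain l b where l: "psb 0 (Suc r) l b" "L = spanZ (Suc r) l" "\<forall>i<r. l i - a i \<in> pl" "l r - c *\<^sub>Z a r \<in> pl"
    unfolding scale_def by (elim exE conjE)
  have "- (l r - c *\<^sub>Z a r) \<in> pl" using l(4) subgrpD(3)[OF subgrp_pl] by blast
  moreover have "- (l r - c *\<^sub>Z a r) = - l r - (- c) *\<^sub>Z a r" by (simp add: fun_eq_iff)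
  ultimately have "- l r - (- c) *\<^sub>Z a r \<in> pl" by (simp only:)
  then show ?thesis unfolding scale_def using negate_last[OF l(1)] l(2,3)
    by (intro exI[of _ "l(r := - l r)"] exI[of _ "b(r := - b r)"]) simp
qed

lemma scale_cong:
  assumes "scale r a L c" "int p dvd c - c'" "a r \<in> \<Lambda>"
  shows "scale r a L c'"
proof -
  obtain l b where l: "psb 0 (Suc r) l b" "L = spanZ (Suc r) l" "\<forall>i<r. l i - a i \<in> pl" "l r - c *\<^sub>Z a r \<in> pl"
    using assms(1) unfolding scale_def by (elim exE conjE)
  have "l r - c' *\<^sub>Z a r \<in> pl" by (rule pl_trans[OF l(4) pl_smul_cong[OF assms(2,3)]])
  then show ?thesis unfolding scale_def using l by blast
qed

lemma scale_equiv: "scale r a L c \<Longrightarrow> scale r a L' c \<Longrightarrow> lat_equiv L L'"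
proof -
  assume "scale r a L c" "scale r a L' c"
  then obtain l b l' b' where l: "psb 0 (Suc r) l b" "L = spanZ (Suc r) l" "\<forall>i<r. l i - a i \<in> pl" "l r - c *\<^sub>Z a r \<in> pl"
    and l': "psb 0 (Suc r) l' b'" "L' = spanZ (Suc r) l'" "\<forall>i<r. l' i - a i \<in> pl" "l' r - c *\<^sub>Z a r \<in> pl"
    unfolding scale_def by (elim exE conjE)
  have "l' i - l i \<in> pl" if i: "i < Suc r" for i
  proof (cases "i = r")
    case True then show ?thesis using pl_trans[OF l'(4) pl_sym[OF l(4)]] by simp
  next
    case False
    then have "i < r" using i by simp
    then show ?thesis using pl_trans[OF l'(3)[rule_format] pl_sym[OF l(3)[rule_format]]] by blast
  qed
  then show ?thesis unfolding l(2) l'(2) by (rule span_equiv[OF l(1) l'(1)])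
qed

text \<open>The map carries a basis of \<open>L\<close> to one of \<open>L'\<close> without changing
  residues, so \<open>last_coefficient_unit\<close> makes the quotient of the scales 1 or
  -1.\<close>

lemma scale_unique:
  assumes "lat_equiv L L'" "scale r a L c" "scale r a L' c'" "\<not> int p dvd c'"
  shows "int p dvd c - c' \<or> int p dvd c + c'"
proof -
  obtain l b where l: "psb 0 (Suc r) l b" "L = spanZ (Suc r) l" "\<forall>i<r. l i - a i \<in> pl" "l r - c *\<^sub>Z a r \<in> pl"
    using assms(2) unfolding scale_def by (elim exE conjE)
  obtain l' b' where l': "psb 0 (Suc r) l' b'" "L' = spanZ (Suc r) l'" "\<forall>i<r. l' i - a i \<in> pl" "l' r - c' *\<^sub>Z a r \<in> pl"
    using assms(3) unfolding scale_def by (elim exE conjE)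
  obtain g where g: "g \<in> congruence_maps" "g ` L = L'" using assms(1) by (auto simp: lat_equiv_def)
  \<comment> \<open>\<open>e\<close> is the quotient of the two scales modulo
    \<open>p\<close>.\<close>
  obtain e where e: "int p dvd c - e * c'" using solve_mod[OF assms(4), of c] by blast
  define w where "w i = g (l i)" for i
  have Q: "psb 0 (Suc r) w (\<lambda>i. g (b i))" unfolding w_def by (rule psb_image[OF g(1) l(1)])
  have sw: "spanZ (Suc r) w = spanZ (Suc r) l'" unfolding w_def using image_lattice[OF g(1) l(1)] g(2) l(2) l'(2) by simp
  have wl: "w i - l i \<in> pl" if "i < Suc r" for i
    using congruence_mapsD(4)[OF g(1) psb_lat(1)[OF l(1) that]] by (simp add: w_def)
  have agree: "w i - l' i \<in> pl" if "i < r" for i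
  proof -
    have "l i - l' i \<in> pl" by (rule pl_trans[OF l(3)[rule_format, OF that] pl_sym[OF l'(3)[rule_format, OF that]]])
    then show ?thesis using pl_trans[OF wl] that by simp
  qed
  have 1: "w r - c *\<^sub>Z a r \<in> pl" using pl_trans[OF wl l(4)] by simp
  show ?thesis
  proof (cases "a r \<in> \<Lambda>")
    case True
    have 2: "c *\<^sub>Z a r - (e * c') *\<^sub>Z a r \<in> pl" by (rule pl_smul_cong[OF e True])
    have 3: "(e * c') *\<^sub>Z a r - e *\<^sub>Z l' r \<in> pl"
      using pl_smul_diff[OF pl_sym[OF l'(4)], of e] by (simp add: smul_smul)
    have "w r - e *\<^sub>Z l' r \<in> pl" by (rule pl_trans[OF 1 pl_trans[OF 2 3]])
    then have "int p dvd e - 1 \<or> int p dvd e + 1" using last_coefficient_unit[OF l'(1) Q sw agree] by blast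
    then show ?thesis
    proof
      assume "int p dvd e - 1"
      then have "int p dvd (c - e * c') + (e - 1) * c'" using e by (intro dvd_add) auto
      then show ?thesis by (simp add: algebra_simps)
    next
      assume "int p dvd e + 1"
      then have "int p dvd (c - e * c') + (e + 1) * c'" using e by (intro dvd_add) auto
      then show ?thesis by (simp add: algebra_simps)
    qed
  next
    case False
    \<comment> \<open>This case is impossible: a nonzero multiple of \<open>a r\<close> lies in the
      lattice, hence so does \<open>a r\<close>.\<close>
    have "l' r \<in> \<Lambda>" using psb_lat(1)[OF l'(1)] by simp
    have "l' r - c' *\<^sub>Z a r \<in> \<Lambda>" using l'(4) by (simp add: pl_def)
    then have ca: "c' *\<^sub>Z a r \<in> \<Lambda>" using \<open>l' r \<in> \<Lambda>\<close> lat_simps(2)[of "l' r" _ "l' r - c' *\<^sub>Z a r"] by simp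
    have "c' \<noteq> 0" using assms(4) by auto
    then have "a r \<in> \<Lambda>" using ca by (simp add: lat_def)
    then show ?thesis using False by simp
  qed
qed

text \<open>Scaling \<open>a r\<close> by \<open>c\<close> and its dual by the inverse
  \<open>t\<close> gives a symplectic frame modulo \<open>p\<close> again; an integral lift of it
  spans the wanted lattice.\<close>

lemma scale_realized:
  assumes P: "psb (int p) (Suc r) a b" and V: "subsp V" "dm V = Suc r" "\<And>i. i < Suc r \<Longrightarrow> a i \<in> V"
    and c: "\<not> int p dvd c"
  shows "\<exists>L. iso_lattice L \<and> redL L = V \<and> scale r a L c"
proof -
  obtain t where t: "int p dvd 1 - t * c" using solve_mod[OF c, of 1] by blast
  define a' b' where "a' = a(r := c *\<^sub>Z a r)" and "b' = b(r := t *\<^sub>Z b r)"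
  have ra: "a r \<in> \<Lambda>" "b r \<in> \<Lambda>" using psb_lat[OF P] by simp_all
  have "psb (int p) (Suc r) a' b'" unfolding psb_def
  proof (intro conjI allI impI)
    fix i j assume i: "i < Suc r" and j: "j < Suc r"
    show "a' i \<in> \<Lambda>" "b' i \<in> \<Lambda>" using psb_lat[OF P i] ra by (simp_all add: a'_def b'_def)
    show "int p dvd sform n (a' i) (a' j)" "int p dvd sform n (b' i) (b' j)"
      using psbD(1,2)[OF P] i j by (simp_all add: a'_def b'_def)
    have s: "int p dvd sform n (a i) (b j) - (if i = j then 1 else 0)" by (rule psbD(3)[OF P i j])
    show "int p dvd sform n (a' i) (b' j) - (if i = j then 1 else 0)"
    proof (cases "i = j")
      case True
      show ?thesis
      proof (cases "i = r")
        case ir: True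
        have "int p dvd sform n (a r) (b r) - 1" using s True ir by simp
        then have "int p dvd (t * c) * (sform n (a r) (b r) - 1) - (1 - t * c)"
          by (rule dvd_diff[OF dvd_mult t])
        then show ?thesis using True ir by (simp add: a'_def b'_def algebra_simps)
      next
        case False then show ?thesis using s True by (simp add: a'_def b'_def)
      qed
    next
      case False
      then show ?thesis using s by (auto simp: a'_def b'_def)
    qed
  qed
  then have "\<exists>l b''. psb 0 (Suc r) l b'' \<and> (\<forall>i<Suc r. l i - a' i \<in> pl \<and> b'' i - b' i \<in> pl) \<and> (\<forall>i<0. l i = a' i \<and> b'' i = b' i)"
    by (rule psb_lift) (simp_all add: psb_def)
  then obtain l b'' where l: "psb 0 (Suc r) l b''" "\<forall>i<Suc r. l i - a' i \<in> pl \<and> b'' i - b' i \<in> pl" by (elim exE conjE)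
  define L where "L = spanZ (Suc r) l"
  have L: "iso_lattice L" unfolding L_def by (rule spanZ_lattice[OF l(1)])
  have sL: "subsp (redL L)" using redL_isotropic[OF L] by (rule isotropic_subsp)
  have lV: "l i \<in> V" if i: "i < Suc r" for i
  proof -
    have "a' i \<in> V" using V(3)[OF i] V(3)[of r] subsp_closed(5)[OF V(1)] by (simp add: a'_def)
    moreover have "l i - a' i \<in> V" by (rule subspD(3)[OF V(1)]) (simp add: l(2) i)
    ultimately have "(l i - a' i) + a' i \<in> V" using subsp_closed(4)[OF V(1)] by blast
    then show ?thesis by simp
  qed
  have "L \<subseteq> V" unfolding L_def by (rule spanZ_least[OF subspD(1)[OF V(1)] lV])
  then have "redL L \<subseteq> V" by (rule redL_le[OF V(1)])
  then have "redL L = V" using dm_eq_imp_eq[OF sL V(1)] redL_span(2)[OF l(1)] V(2) by (simp add: L_def)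
  moreover have "scale r a L c" unfolding scale_def
  proof (rule exI[of _ l], rule exI[of _ b''], intro conjI allI impI l(1))
    show "L = spanZ (Suc r) l" by (simp add: L_def)
    show "l r - c *\<^sub>Z a r \<in> pl" using l(2) by (auto simp: a'_def)
    fix i assume "i < r"
    then show "l i - a i \<in> pl" using l(2)[rule_format, of i] by (simp add: a'_def)
  qed
  ultimately show ?thesis using L by blast
qed

text \<open>Up to sign every unit modulo \<open>p\<close> is one of \<open>1, ..., m\<close>; the
  index \<open>k\<close> stands for \<open>k + 1\<close>, so that labels start at 0.\<close>

lemma sign_representative:
  assumes m: "p = 2 * m + 1" and c: "\<not> int p dvd c"
  shows "\<exists>k<m. int p dvd c - (int k + 1) \<or> int p dvd c + (int k + 1)"
proof -
  define d where "d = c mod int p"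
  have d: "0 < d" "d < int p" using c p_gt1 pos_mod_bound[of "int p" c] pos_mod_sign[of "int p" c]
    by (auto simp: d_def dvd_eq_mod_eq_0 less_le)
  have cd: "int p dvd c - d" by (simp add: d_def mod_eq_dvd_iff[symmetric])
  show ?thesis
  proof (cases "d \<le> int m")
    case True
    have "nat (d - 1) < m" "int (nat (d - 1)) + 1 = d" using d True by auto
    then show ?thesis using cd by (intro exI[of _ "nat (d - 1)"]) simp
  next
    case False
    have "nat (int p - d - 1) < m" "int (nat (int p - d - 1)) + 1 = int p - d" using d False m by auto
    moreover have "int p dvd (c - d) + int p" using cd by (intro dvd_add) auto
    ultimately show ?thesis by (intro exI[of _ "nat (int p - d - 1)"]) (use d in \<open>simp add: algebra_simps\<close>)
  qed
qed

text \<open>Sums and differences of two numbers among \<open>1, ..., m\<close> are smaller than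
  \<open>p\<close> in absolute value.\<close>

lemma sign_unique:
  assumes m: "p = 2 * m + 1" and k: "k < m" "j < m"
    and d: "int p dvd (int k + 1) - (int j + 1) \<or> int p dvd (int k + 1) + (int j + 1)"
  shows "k = j"
proof -
  have "\<not> int p dvd (int k + 1) + (int j + 1)" using k m by (intro zdvd_not_zless) auto
  then have "int p dvd int k - int j" using d by simp
  moreover have "\<not> int p dvd int k - int j" if "j < k" using k m that by (intro zdvd_not_zless) auto
  moreover have "\<not> int p dvd int j - int k" if "k < j" using k m that by (intro zdvd_not_zless) auto
  ultimately show ?thesis using dvd_diff_commute[of "int p" "int k" "int j"] by (metis nat_neq_iff)
qed

text \<open>The label is the scale up to sign, numbered from 0. It depends on the chosen basis of
  \<open>V\<close>, but its fibres do not: they are the orbits.\<close>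

lemma label_over:
  assumes m: "p = 2 * m + 1" and V: "isotropic V" "pl \<subset> V"
  shows "\<exists>lab. (\<forall>L. iso_lattice L \<longrightarrow> redL L = V \<longrightarrow> lab L < m) \<and>
    (\<forall>L M. iso_lattice L \<longrightarrow> redL L = V \<longrightarrow> iso_lattice M \<longrightarrow> redL M = V \<longrightarrow> (lab L = lab M \<longleftrightarrow> lat_equiv L M)) \<and>
    (\<forall>c<m. \<exists>L. iso_lattice L \<and> redL L = V \<and> lab L = c)"
proof -
  obtain r a b where a: "psb (int p) (Suc r) a b" "\<forall>i<Suc r. a i \<in> V" "dm V = Suc r"
    using isotropic_basis[OF V] by (elim exE conjE)
  have ar: "a r \<in> \<Lambda>" using psb_lat(1)[OF a(1)] by simp
  define lab where "lab L = (SOME k. k < m \<and> scale r a L (int k + 1))" for L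
  have nd: "\<not> int p dvd int k + 1" if "k < m" for k using that m by (intro zdvd_not_zless) auto
  have lab: "lab L < m \<and> scale r a L (int (lab L) + 1)" if L: "iso_lattice L" "redL L = V" for L
  proof -
    obtain c where c: "\<not> int p dvd c" "scale r a L c"
      using scale_exists[OF a(1) L(1)] a(2,3) L(2) by auto
    obtain k where k: "k < m" "int p dvd c - (int k + 1) \<or> int p dvd c + (int k + 1)"
      using sign_representative[OF m c(1)] by (elim exE conjE)
    have "scale r a L (int k + 1)" using k(2)
    proof
      assume "int p dvd c - (int k + 1)" then show ?thesis by (rule scale_cong[OF c(2) _ ar])
    next
      assume "int p dvd c + (int k + 1)"
      then have "int p dvd - (c + (int k + 1))" by (simp only: dvd_minus_iff)
      moreover have "- (c + (int k + 1)) = (- c) - (int k + 1)" by simp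
      ultimately have "int p dvd (- c) - (int k + 1)" by (simp only:)
      then show ?thesis by (rule scale_cong[OF scale_neg[OF c(2)] _ ar])
    qed
    then have "\<exists>k. k < m \<and> scale r a L (int k + 1)" using k(1) by blast
    then show ?thesis unfolding lab_def by (rule someI_ex)
  qed
  have "lab L = lab M \<longleftrightarrow> lat_equiv L M"
    if L: "iso_lattice L" "redL L = V" and M: "iso_lattice M" "redL M = V" for L M
  proof
    assume "lab L = lab M" then show "lat_equiv L M" using scale_equiv lab[OF L] lab[OF M] by metis
  next
    assume "lat_equiv L M"
    then have "int p dvd (int (lab L) + 1) - (int (lab M) + 1) \<or> int p dvd (int (lab L) + 1) + (int (lab M) + 1)"
      using scale_unique lab[OF L] lab[OF M] nd by blast
    then show "lab L = lab M" using sign_unique[OF m] lab[OF L] lab[OF M] by blast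
  qed
  moreover have "\<exists>L. iso_lattice L \<and> redL L = V \<and> lab L = c" if c: "c < m" for c
  proof -
    have sV: "subsp V" using V(1) by (rule isotropic_subsp)
    obtain L where L: "iso_lattice L" "redL L = V" "scale r a L (int c + 1)"
      using scale_realized[OF a(1) sV a(3) _ nd[OF c]] a(2) by blast
    have "int p dvd (int (lab L) + 1) - (int c + 1) \<or> int p dvd (int (lab L) + 1) + (int c + 1)"
      using scale_unique[OF lat_equiv_refl _ L(3) nd[OF c]] lab[OF L(1,2)] by blast
    then have "lab L = c" using sign_unique[OF m _ c] lab[OF L(1,2)] by blast
    then show ?thesis using L by blast
  qed
  ultimately show ?thesis using lab by (intro exI[of _ lab]) simp
qed

lemma zero_lattice: "iso_lattice {0}" "redL {0} = pl"
proof -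
  have "psb 0 0 (\<lambda>_. 0) (\<lambda>_. 0)" by (simp add: psb_def)
  then have "iso_lattice (spanZ 0 (\<lambda>_. 0))" by (rule spanZ_lattice)
  moreover have "spanZ 0 (\<lambda>_. 0) = {0 :: nat \<Rightarrow> int}" by (auto simp: spanZ_def)
  ultimately show "iso_lattice {0}" by simp
  show "redL {0} = pl" by (auto simp: redL_def)
qed

lemma redL_nonzero: "iso_lattice L \<Longrightarrow> L \<noteq> {0} \<longleftrightarrow> redL L \<in> isotropic_above pl"
proof -
  assume L: "iso_lattice L"
  have "{0} \<subseteq> L" using L subgrpD(1) by (auto simp: iso_lattice_def)
  then have "L = {0} \<longleftrightarrow> redL L = pl" using redL_inj[OF zero_lattice(1) L] zero_lattice(2) by auto
  moreover have "pl \<subseteq> redL L" using subspD(3)[OF isotropic_subsp[OF redL_isotropic[OF L]]] by blast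
  ultimately show ?thesis using redL_isotropic[OF L] by (auto simp: isotropic_above_def)
qed

text \<open>Label functions for different reductions are chosen independently of each other; chains
  are classified member by member.\<close>

lemma labels_exist:
  assumes m: "p = 2 * m + 1"
  obtains lab where "\<And>L. iso_lattice L \<Longrightarrow> L \<noteq> {0} \<Longrightarrow> lab L < m"
    "\<And>L M. iso_lattice L \<Longrightarrow> L \<noteq> {0} \<Longrightarrow> iso_lattice M \<Longrightarrow> redL L = redL M \<Longrightarrow> lab L = lab M \<longleftrightarrow> lat_equiv L M"
    "\<And>V c. V \<in> isotropic_above pl \<Longrightarrow> c < m \<Longrightarrow> \<exists>L. iso_lattice L \<and> redL L = V \<and> lab L = c"
proof -
  define Pr where "Pr V lab \<longleftrightarrow> (\<forall>L. iso_lattice L \<longrightarrow> redL L = V \<longrightarrow> lab L < m) \<and>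
    (\<forall>L M. iso_lattice L \<longrightarrow> redL L = V \<longrightarrow> iso_lattice M \<longrightarrow> redL M = V \<longrightarrow> (lab L = lab M \<longleftrightarrow> lat_equiv L M)) \<and>
    (\<forall>c<m. \<exists>L. iso_lattice L \<and> redL L = V \<and> lab L = c)" for V lab
  define l where "l V = (SOME lab. Pr V lab)" for V
  have l: "(\<forall>L. iso_lattice L \<longrightarrow> redL L = V \<longrightarrow> l V L < m) \<and>
    (\<forall>L M. iso_lattice L \<longrightarrow> redL L = V \<longrightarrow> iso_lattice M \<longrightarrow> redL M = V \<longrightarrow> (l V L = l V M \<longleftrightarrow> lat_equiv L M)) \<and>
    (\<forall>c<m. \<exists>L. iso_lattice L \<and> redL L = V \<and> l V L = c)" if "V \<in> isotropic_above pl" for V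
  proof -
    have "\<exists>lab. Pr V lab" unfolding Pr_def by (rule label_over[OF m isotropic_aboveD(1,2)[OF that]])
    then have "Pr V (l V)" unfolding l_def by (rule someI_ex)
    then show ?thesis unfolding Pr_def .
  qed
  show ?thesis
  proof (rule that[of "\<lambda>L. l (redL L) L"])
    fix L assume L: "iso_lattice L" "L \<noteq> {0}"
    then have V: "redL L \<in> isotropic_above pl" using redL_nonzero by simp
    show "l (redL L) L < m" using l[OF V] L(1) by simp
    fix M assume M: "iso_lattice M" "redL L = redL M"
    show "l (redL L) L = l (redL M) M \<longleftrightarrow> lat_equiv L M"
      using l[OF V, THEN conjunct2, THEN conjunct1, rule_format, OF L(1) refl M(1) M(2)[symmetric]] M(2) by simp
  next
    fix V c assume V: "V \<in> isotropic_above pl" and c: "c < m"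
    obtain L where L: "iso_lattice L" "redL L = V" "l V L = c"
      using l[OF V, THEN conjunct2, THEN conjunct2, rule_format, OF c] by (elim exE conjE)
    then have "iso_lattice L \<and> redL L = V \<and> l (redL L) L = c" by simp
    then show "\<exists>L. iso_lattice L \<and> redL L = V \<and> l (redL L) L = c" ..
  qed
qed

end

subsection \<open>Quotients of order complexes\<close>

lemma closed_simplexD:
  assumes "x \<in> closed_simplex \<sigma>"
  shows "0 \<le> x v" "x v \<noteq> 0 \<Longrightarrow> v \<in> \<sigma>" "sum x \<sigma> = 1"
  using assms by (auto simp: closed_simplex_def)

lemma realization_map_fibre:
  assumes "finite \<sigma>" "x \<in> closed_simplex \<sigma>"
  shows "realization_map f x w = sum x {v \<in> \<sigma>. f v = w}"
  unfolding realization_map_def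
  using assms closed_simplexD(2)[OF assms(2)] by (intro sum.mono_neutral_left) auto

lemma realization_map_simplex:
  assumes "finite \<sigma>" "x \<in> closed_simplex \<sigma>"
  shows "realization_map f x w = (\<Sum>v\<in>\<sigma>. if f v = w then x v else 0)"
  unfolding realization_map_fibre[OF assms] by (rule sum.inter_filter[OF assms(1)])

lemma realization_map_in_simplex:
  assumes "finite \<sigma>" "x \<in> closed_simplex \<sigma>"
  shows "realization_map f x \<in> closed_simplex (f ` \<sigma>)"
  unfolding closed_simplex_def
proof (intro CollectI conjI allI subsetI)
  note R = realization_map_fibre[OF assms]
  show "0 \<le> realization_map f x w" for w unfolding R using closed_simplexD(1)[OF assms(2)] by (intro sum_nonneg) simp
  fix w assume w: "w \<in> {w. realization_map f x w \<noteq> 0}"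
  show "w \<in> f ` \<sigma>"
  proof (rule ccontr)
    assume "w \<notin> f ` \<sigma>"
    then have e: "{v \<in> \<sigma>. f v = w} = {}" by auto
    have "realization_map f x w = 0" unfolding R e by simp
    then show False using w by simp
  qed
next
  have "sum (realization_map f x) (f ` \<sigma>) = (\<Sum>w\<in>f ` \<sigma>. sum x {v \<in> \<sigma>. f v = w})"
    by (intro sum.cong refl realization_map_fibre[OF assms])
  also have "\<dots> = sum x \<sigma>" using assms(1) by (intro sum.group) auto
  finally show "sum (realization_map f x) (f ` \<sigma>) = 1" using closed_simplexD(3)[OF assms(2)] by simp
qed

lemma realization_map_comp:
  assumes "finite \<sigma>" "x \<in> closed_simplex \<sigma>"
  shows "realization_map f (realization_map g x) = realization_map (\<lambda>v. f (g v)) x"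
proof
  fix w
  have X: "realization_map g x \<in> closed_simplex (g ` \<sigma>)" by (rule realization_map_in_simplex[OF assms])
  have "realization_map f (realization_map g x) w
      = (\<Sum>u\<in>g ` \<sigma>. if f u = w then sum x {v \<in> \<sigma>. g v = u} else 0)"
    unfolding realization_map_simplex[OF finite_imageI[OF assms(1)] X] by (simp only: realization_map_fibre[OF assms])
  also have "\<dots> = (\<Sum>u\<in>g ` \<sigma>. \<Sum>v\<in>{v \<in> \<sigma>. g v = u}. if f (g v) = w then x v else 0)"
    by (intro sum.cong) auto
  also have "\<dots> = (\<Sum>v\<in>\<sigma>. if f (g v) = w then x v else 0)" using assms(1) by (intro sum.group) auto
  finally show "realization_map f (realization_map g x) w = realization_map (\<lambda>v. f (g v)) x w"
    by (simp only: realization_map_simplex[OF assms])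
qed

lemma realization_map_cong:
  assumes "finite \<sigma>" "x \<in> closed_simplex \<sigma>" "\<And>v. v \<in> \<sigma> \<Longrightarrow> f v = g v"
  shows "realization_map f x = realization_map g x"
  using assms(3) by (intro ext) (simp add: realization_map_simplex[OF assms(1,2)] cong: sum.cong if_cong)

lemma realization_map_inj:
  assumes "finite \<sigma>" "x \<in> closed_simplex \<sigma>" "inj_on f \<sigma>" "v \<in> \<sigma>"
  shows "realization_map f x (f v) = x v"
proof -
  have "(\<Sum>u\<in>\<sigma>. if f u = f v then x u else 0) = (\<Sum>u\<in>\<sigma>. if u = v then x u else 0)"
    using assms(3,4) by (intro sum.cong) (auto dest: inj_onD)
  then show ?thesis using assms(1,4) by (simp add: realization_map_simplex[OF assms(1,2)])
qed

lemma realization_map_ident: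
  assumes "finite \<sigma>" "x \<in> closed_simplex \<sigma>"
  shows "realization_map (\<lambda>v. v) x = x"
proof
  fix v show "realization_map (\<lambda>v. v) x v = x v"
  proof (cases "v \<in> \<sigma>")
    case True
    then show ?thesis using realization_map_inj[OF assms, of "\<lambda>v. v" v] by simp
  next
    case False
    then have "x v = 0" using closed_simplexD(2)[OF assms(2), of v] by blast
    then show ?thesis using assms(1) by (simp add: realization_map_simplex[OF assms] sum.delta)
  qed
qed

lemma order_complexD:
  assumes "\<sigma> \<in> order_complex P"
  shows "finite \<sigma>" "\<sigma> \<noteq> {}" "\<sigma> \<subseteq> P" "U \<in> \<sigma> \<Longrightarrow> V \<in> \<sigma> \<Longrightarrow> U \<subseteq> V \<or> V \<subseteq> U"
  using assms by (auto simp: order_complex_def subset.chain_def)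

lemma order_complexI:
  assumes "finite \<sigma>" "\<sigma> \<noteq> {}" "\<sigma> \<subseteq> P" "\<And>U V. U \<in> \<sigma> \<Longrightarrow> V \<in> \<sigma> \<Longrightarrow> U \<subseteq> V \<or> V \<subseteq> U"
  shows "\<sigma> \<in> order_complex P"
  unfolding order_complex_def subset_chain_def using assms by (intro CollectI conjI ballI) (assumption | rule assms)+

text \<open>Equal fibres let each of the two quotient maps factor through the other.\<close>

lemma quotient_homeomorphic:
  assumes f: "quotient_map X Y f" and q: "quotient_map X Z q"
    and fib: "\<And>x y. x \<in> topspace X \<Longrightarrow> y \<in> topspace X \<Longrightarrow> q x = q y \<longleftrightarrow> f x = f y"
  shows "Z homeomorphic_space Y"
proof -
  obtain g where g: "continuous_map Y Z g" "\<And>x. x \<in> topspace X \<Longrightarrow> g (f x) = q x"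
    using quotient_map_lift_exists[OF f quotient_imp_continuous_map[OF q]] fib by metis
  obtain h where h: "continuous_map Z Y h" "\<And>x. x \<in> topspace X \<Longrightarrow> h (q x) = f x"
    using quotient_map_lift_exists[OF q quotient_imp_continuous_map[OF f]] fib by metis
  have "homeomorphic_maps Z Y h g" unfolding homeomorphic_maps_def
    using g h quotient_imp_surjective_map[OF f] quotient_imp_surjective_map[OF q] by force
  then show ?thesis by (auto simp: homeomorphic_space_def)
qed

text \<open>An order complex mapping onto a finite flag complex: strict monotonicity embeds every
  chain as a clique, and \<open>lift\<close> provides a chain over every clique.\<close>

locale chain_quotient =
  fixes P :: "'a set set" and Q :: "'w set" and R :: "'w \<Rightarrow> 'w \<Rightarrow> bool" and \<phi> :: "'a set \<Rightarrow> 'w"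
  assumes finite_Q: "finite Q" and asym: "R x y \<Longrightarrow> \<not> R y x" and \<phi>_Q: "U \<in> P \<Longrightarrow> \<phi> U \<in> Q"
    and \<phi>_mono: "U \<in> P \<Longrightarrow> V \<in> P \<Longrightarrow> U \<subset> V \<Longrightarrow> R (\<phi> U) (\<phi> V)"
    and lift: "C \<subseteq> Q \<Longrightarrow> C \<noteq> {} \<Longrightarrow> (\<And>x y. x \<in> C \<Longrightarrow> y \<in> C \<Longrightarrow> x \<noteq> y \<Longrightarrow> R x y \<or> R y x) \<Longrightarrow>
      \<exists>\<sigma>\<in>order_complex P. \<phi> ` \<sigma> = C"
begin

abbreviation E where "E x y \<equiv> R x y \<or> R y x"

lemma \<phi>_inj:
  assumes "\<sigma> \<in> order_complex P"
  shows "inj_on \<phi> \<sigma>"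
proof (rule inj_onI, rule ccontr)
  fix U V assume U: "U \<in> \<sigma>" "V \<in> \<sigma>" "\<phi> U = \<phi> V" "U \<noteq> V"
  then have P: "U \<in> P" "V \<in> P" using order_complexD(3)[OF assms] by blast+
  have "U \<subset> V \<or> V \<subset> U" using order_complexD(4)[OF assms U(1,2)] U(4) by (simp add: psubset_eq)
  then have "R (\<phi> U) (\<phi> V) \<or> R (\<phi> V) (\<phi> U)" using \<phi>_mono[OF P] \<phi>_mono[OF P(2,1)] by (elim disjE) simp_all
  then show False using U(3) asym[of "\<phi> V" "\<phi> V"] by simp
qed

lemma clique_image:
  assumes \<sigma>: "\<sigma> \<in> order_complex P" and "x \<in> \<phi> ` \<sigma>" "y \<in> \<phi> ` \<sigma>" "x \<noteq> y"
  shows "E x y"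
proof -
  obtain U V where U: "U \<in> \<sigma>" "V \<in> \<sigma>" "x = \<phi> U" "y = \<phi> V" using assms by blast
  then have P: "U \<in> P" "V \<in> P" using order_complexD(3)[OF \<sigma>] by blast+
  have "U \<subset> V \<or> V \<subset> U" using order_complexD(4)[OF \<sigma> U(1,2)] U assms(4) by (auto simp: psubset_eq)
  then show ?thesis using \<phi>_mono[OF P] \<phi>_mono[OF P(2,1)] U(3,4) by (elim disjE) simp_all
qed

definition cliques where
  "cliques = {C. C \<subseteq> Q \<and> C \<noteq> {} \<and> (\<forall>x\<in>C. \<forall>y\<in>C. x \<noteq> y \<longrightarrow> E x y)}"

lemma finite_cliques: "finite cliques"
  by (rule finite_subset[of _ "Pow Q"]) (auto simp: cliques_def finite_Q)

lemma simplex_image_clique: "\<sigma> \<in> order_complex P \<Longrightarrow> \<phi> ` \<sigma> \<in> cliques"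
  using order_complexD(2,3)[of \<sigma> P] \<phi>_Q clique_image[of \<sigma>] by (auto simp: cliques_def)

lemma geo_eq_cliques: "geo E Q = (\<Union>C\<in>cliques. closed_simplex C)"
proof
  show "geo E Q \<subseteq> (\<Union>C\<in>cliques. closed_simplex C)"
  proof
    fix x assume x: "x \<in> geo E Q"
    let ?C = "{v. x v \<noteq> 0}"
    have C: "?C \<subseteq> Q" using x by (auto simp: geo_def)
    have "sum x Q = sum x ?C" by (rule sum.mono_neutral_right[OF finite_Q C]) simp
    then have s: "sum x ?C = 1" using x by (simp add: geo_def)
    have "?C \<noteq> {}"
    proof
      assume e: "?C = {}" show False using s unfolding e by simp
    qed
    moreover have "\<forall>u\<in>?C. \<forall>v\<in>?C. u \<noteq> v \<longrightarrow> E u v" using x unfolding geo_def by simp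
    ultimately have "?C \<in> cliques" using C unfolding cliques_def by simp
    moreover have "x \<in> closed_simplex ?C" using s x unfolding closed_simplex_def geo_def by simp
    ultimately show "x \<in> (\<Union>C\<in>cliques. closed_simplex C)" by blast
  qed
  show "(\<Union>C\<in>cliques. closed_simplex C) \<subseteq> geo E Q"
  proof
    fix x assume "x \<in> (\<Union>C\<in>cliques. closed_simplex C)"
    then obtain C where C: "C \<in> cliques" "x \<in> closed_simplex C" by blast
    have "sum x Q = sum x C" using C closed_simplexD(2)[OF C(2)] finite_Q
      by (intro sum.mono_neutral_right) (auto simp: cliques_def)
    then have "sum x Q = 1" using closed_simplexD(3)[OF C(2)] by simp
    moreover have "v \<in> Q" if "x v \<noteq> 0" for v using closed_simplexD(2)[OF C(2) that] C(1) by (auto simp: cliques_def)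
    moreover have "E u v" if "x u \<noteq> 0" "x v \<noteq> 0" "u \<noteq> v" for u v
      using closed_simplexD(2)[OF C(2)] that C(1) unfolding cliques_def by simp
    ultimately show "x \<in> geo E Q" using closed_simplexD(1)[OF C(2)] unfolding geo_def by simp
  qed
qed

lemma closedin_clique:
  assumes "C \<in> cliques"
  shows "closedin (top_of_set (geo E Q)) (closed_simplex C)"
proof -
  have "closed {x :: 'w \<Rightarrow> real. x v = 0}" for v
    using closed_Collect_eq[OF continuous_on_product_coordinates continuous_on_const] .
  then have "closed (\<Inter>v\<in>- C. {x :: 'w \<Rightarrow> real. x v = 0})" by blast
  moreover have "closed_simplex C = geo E Q \<inter> (\<Inter>v\<in>- C. {x. x v = 0})"
  proof
    show "closed_simplex C \<subseteq> geo E Q \<inter> (\<Inter>v\<in>- C. {x. x v = 0})"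
      using assms unfolding geo_eq_cliques by (auto simp: closed_simplex_def)
    show "geo E Q \<inter> (\<Inter>v\<in>- C. {x. x v = 0}) \<subseteq> closed_simplex C"
    proof
      fix x assume x: "x \<in> geo E Q \<inter> (\<Inter>v\<in>- C. {x. x v = 0})"
      then have "sum x Q = sum x C" using assms finite_Q by (intro sum.mono_neutral_right) (auto simp: cliques_def)
      then show "x \<in> closed_simplex C" using x by (auto simp: closed_simplex_def geo_def)
    qed
  qed
  ultimately show ?thesis unfolding closedin_closed by blast
qed

lemma continuous_on_simplex:
  assumes "\<sigma> \<in> order_complex P"
  shows "continuous_on (closed_simplex \<sigma>) (realization_map \<phi>)"
proof (rule continuous_on_coordinatewise_then_product)
  fix w
  have "continuous_on (closed_simplex \<sigma>) (\<lambda>x. \<Sum>v\<in>\<sigma>. if \<phi> v = w then x v else (0::real))"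
  proof (rule continuous_on_sum)
    fix v
    have "continuous_on (closed_simplex \<sigma>) (\<lambda>x. x v :: real)"
      using continuous_on_subset[OF continuous_on_product_coordinates subset_UNIV] .
    then show "continuous_on (closed_simplex \<sigma>) (\<lambda>x. if \<phi> v = w then x v else (0::real))"
      by (cases "\<phi> v = w") simp_all
  qed
  then show "continuous_on (closed_simplex \<sigma>) (\<lambda>x. realization_map \<phi> x w)"
    by (rule continuous_on_eq) (rule realization_map_simplex[OF order_complexD(1)[OF assms], symmetric])
qed

text \<open>\<open>\<phi>\<close> is injective on a chain, so barycentric coordinates can be pulled
  back along it.\<close>

lemma clique_section:
  assumes \<sigma>: "\<sigma> \<in> order_complex P" and y: "y \<in> closed_simplex (\<phi> ` \<sigma>)"
  defines "x \<equiv> \<lambda>v. if v \<in> \<sigma> then y (\<phi> v) else 0"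
  shows "x \<in> closed_simplex \<sigma>" "realization_map \<phi> x = y"
proof -
  note fin = order_complexD(1)[OF \<sigma>] and inj = \<phi>_inj[OF \<sigma>]
  have "sum x \<sigma> = (\<Sum>v\<in>\<sigma>. y (\<phi> v))" unfolding x_def by simp
  also have "\<dots> = sum y (\<phi> ` \<sigma>)" using inj by (simp add: sum.reindex)
  finally show X: "x \<in> closed_simplex \<sigma>" using closed_simplexD(1,3)[OF y] by (auto simp: closed_simplex_def x_def)
  show "realization_map \<phi> x = y"
  proof
    fix w show "realization_map \<phi> x w = y w"
    proof (cases "w \<in> \<phi> ` \<sigma>")
      case True
      then obtain v where v: "v \<in> \<sigma>" "w = \<phi> v" by blast
      then show ?thesis using realization_map_inj[OF fin X inj v(1)] by (simp add: x_def)
    next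
      case False
      then show ?thesis
        using closed_simplexD(2)[OF y] closed_simplexD(2)[OF realization_map_in_simplex[OF fin X, of \<phi>]] by metis
    qed
  qed
qed

text \<open>In the weak topology continuity is a matter of single simplices. Conversely, the
  complement of \<open>U\<close> is a union of pieces, each closed in its simplex by means of
  \<open>clique_section\<close>; finiteness of \<open>Q\<close> makes the union closed.\<close>

theorem quotient_map_realization:
  "quotient_map (realization (order_complex P)) (top_of_set (geo E Q)) (realization_map \<phi>)"
  (is "quotient_map ?X ?Y ?f")
proof -
  let ?K = "order_complex P"
  have into: "?f x \<in> geo E Q" if "\<sigma> \<in> ?K" "x \<in> closed_simplex \<sigma>" for \<sigma> x
    unfolding geo_eq_cliques
    by (rule UN_I, rule simplex_image_clique[OF that(1)],
      rule realization_map_in_simplex[OF order_complexD(1)[OF that(1)] that(2)])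
  have onto: "geo E Q \<subseteq> ?f ` topspace ?X"
  proof
    fix y assume "y \<in> geo E Q"
    then obtain C where C: "C \<in> cliques" "y \<in> closed_simplex C" unfolding geo_eq_cliques by (rule UN_E)
    have "\<exists>\<sigma>\<in>?K. \<phi> ` \<sigma> = C" by (rule lift) (use C(1) in \<open>auto simp: cliques_def\<close>)
    then obtain \<sigma> where \<sigma>: "\<sigma> \<in> ?K" "\<phi> ` \<sigma> = C" by blast
    note S = clique_section[OF \<sigma>(1), of y, unfolded \<sigma>(2), OF C(2)]
    show "y \<in> ?f ` topspace ?X" unfolding topspace_realization
      by (rule image_eqI, rule S(2)[symmetric], rule UN_I, rule \<sigma>(1), rule S(1))
  qed
  have "?f ` topspace ?X \<subseteq> geo E Q"
    unfolding topspace_realization by (intro image_subsetI, elim UN_E) (rule into)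
  then have surj: "?f ` topspace ?X = topspace ?Y" using onto by simp
  have op: "openin ?X {x \<in> topspace ?X. ?f x \<in> U} \<longleftrightarrow> openin ?Y U" if U: "U \<subseteq> topspace ?Y" for U
  proof
    assume "openin ?Y U"
    then obtain T where T: "open T" "U = geo E Q \<inter> T" unfolding openin_open by blast
    show "openin ?X {x \<in> topspace ?X. ?f x \<in> U}" unfolding openin_realization topspace_realization
    proof (intro conjI ballI)
      fix \<sigma> assume \<sigma>: "\<sigma> \<in> ?K"
      have "closed_simplex \<sigma> \<inter> {x \<in> \<Union> (closed_simplex ` ?K). ?f x \<in> U} = closed_simplex \<sigma> \<inter> ?f -` T"
      proof
        show "closed_simplex \<sigma> \<inter> {x \<in> \<Union> (closed_simplex ` ?K). ?f x \<in> U} \<subseteq> closed_simplex \<sigma> \<inter> ?f -` T"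
          unfolding T(2) by blast
        show "closed_simplex \<sigma> \<inter> ?f -` T \<subseteq> closed_simplex \<sigma> \<inter> {x \<in> \<Union> (closed_simplex ` ?K). ?f x \<in> U}"
          unfolding T(2) using into[OF \<sigma>] \<sigma> by blast
      qed
      then show "openin (top_of_set (closed_simplex \<sigma>)) (closed_simplex \<sigma> \<inter> {x \<in> \<Union> (closed_simplex ` ?K). ?f x \<in> U})"
        using continuous_openin_preimage_gen[OF continuous_on_simplex[OF \<sigma>] T(1)] by (simp only:)
    qed blast
  next
    assume op: "openin ?X {x \<in> topspace ?X. ?f x \<in> U}"
    have piece: "closedin ?Y (closed_simplex C - U)" if C: "C \<in> cliques" for C
    proof -
      have "\<exists>\<sigma>\<in>?K. \<phi> ` \<sigma> = C" by (rule lift) (use C in \<open>auto simp: cliques_def\<close>)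
      then obtain \<sigma> where \<sigma>: "\<sigma> \<in> ?K" "\<phi> ` \<sigma> = C" by blast
      let ?g = "\<lambda>y v. if v \<in> \<sigma> then y (\<phi> v) else (0::real)"
      note S = clique_section[OF \<sigma>(1), unfolded \<sigma>(2)]
      have "openin (top_of_set (closed_simplex \<sigma>)) (closed_simplex \<sigma> \<inter> {x \<in> topspace ?X. ?f x \<in> U})"
        using op \<sigma>(1) unfolding openin_realization by blast
      then obtain T where T: "open T" "closed_simplex \<sigma> \<inter> {x \<in> topspace ?X. ?f x \<in> U} = closed_simplex \<sigma> \<inter> T"
        unfolding openin_open by blast
      have c: "continuous_on (closed_simplex C) ?g"
      proof (rule continuous_on_coordinatewise_then_product)
        fix v show "continuous_on (closed_simplex C) (\<lambda>y. ?g y v)"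
        proof (cases "v \<in> \<sigma>")
          case True
          have "continuous_on (closed_simplex C) (\<lambda>y. y (\<phi> v) :: real)"
            using continuous_on_subset[OF continuous_on_product_coordinates subset_UNIV] .
          then show ?thesis using True by simp
        qed simp
      qed
      have "y \<in> U \<longleftrightarrow> ?g y \<in> T" if y: "y \<in> closed_simplex C" for y
      proof -
        have "?g y \<in> topspace ?X" using S(1)[OF y] \<sigma>(1) unfolding topspace_realization by blast
        then have "?g y \<in> closed_simplex \<sigma> \<inter> {x \<in> topspace ?X. ?f x \<in> U} \<longleftrightarrow> y \<in> U" using S[OF y] by simp
        then show ?thesis unfolding T(2) using S(1)[OF y] by simp
      qed
      then have "closed_simplex C \<inter> U = closed_simplex C \<inter> ?g -` T" by auto
      then have "openin (top_of_set (closed_simplex C)) (closed_simplex C \<inter> U)"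
        using continuous_openin_preimage_gen[OF c T(1)] by simp
      then have "closedin (top_of_set (closed_simplex C)) (closed_simplex C - U)"
        by (simp add: closedin_def Diff_Diff_Int)
      then show ?thesis using closedin_trans closedin_clique[OF C] by blast
    qed
    have "closedin ?Y (\<Union>C\<in>cliques. closed_simplex C - U)"
      using piece finite_cliques by (intro closedin_Union) auto
    moreover have "(\<Union>C\<in>cliques. closed_simplex C - U) = topspace ?Y - U" unfolding topspace_euclidean_subtopology geo_eq_cliques by blast
    ultimately show "openin ?Y U" using U by (simp add: closedin_def double_diff)
  qed
  show ?thesis unfolding quotient_map_def using surj op by simp
qed

end

text \<open>The elements of \<open>G\<close> are maps that behave like a group only on
  \<open>P\<close>. \<open>G_chain\<close> is the decisive assumption: a strictly monotone map on a
  chain that preserves \<open>\<phi>\<close> is realized by a single element.\<close>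

locale chain_orbits = chain_quotient +
  fixes G :: "('a set \<Rightarrow> 'a set) set"
  assumes G_id: "\<exists>e\<in>G. \<forall>U\<in>P. e U = U"
    and G_comp: "g \<in> G \<Longrightarrow> h \<in> G \<Longrightarrow> \<exists>k\<in>G. \<forall>U\<in>P. k U = g (h U)"
    and G_inv: "g \<in> G \<Longrightarrow> \<exists>h\<in>G. \<forall>U\<in>P. h (g U) = U"
    and G_\<phi>: "g \<in> G \<Longrightarrow> U \<in> P \<Longrightarrow> \<phi> (g U) = \<phi> U"
    and G_chain: "\<sigma> \<in> order_complex P \<Longrightarrow> h ` \<sigma> \<subseteq> P \<Longrightarrow> (\<And>U. U \<in> \<sigma> \<Longrightarrow> \<phi> (h U) = \<phi> U) \<Longrightarrow>
      (\<And>U V. U \<in> \<sigma> \<Longrightarrow> V \<in> \<sigma> \<Longrightarrow> U \<subset> V \<Longrightarrow> h U \<subset> h V) \<Longrightarrow> \<exists>g\<in>G. \<forall>U\<in>\<sigma>. g U = h U"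
begin

definition orbit where "orbit x = {realization_map g x | g. g \<in> G}"

lemma orbit_imp_fibre:
  assumes \<sigma>: "\<sigma> \<in> order_complex P" "x \<in> closed_simplex \<sigma>" and g: "g \<in> G"
  shows "realization_map \<phi> (realization_map g x) = realization_map \<phi> x"
  unfolding realization_map_comp[OF order_complexD(1)[OF \<sigma>(1)] \<sigma>(2)]
  using order_complexD(3)[OF \<sigma>(1)] G_\<phi>[OF g]
  by (intro realization_map_cong[OF order_complexD(1)[OF \<sigma>(1)] \<sigma>(2)]) blast

lemma orbit_self:
  assumes \<sigma>: "\<sigma> \<in> order_complex P" "x \<in> closed_simplex \<sigma>"
  shows "x \<in> orbit x"
proof -
  obtain e where e: "e \<in> G" "\<forall>U\<in>P. e U = U" using G_id by blast
  have "realization_map e x = realization_map (\<lambda>v. v) x"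
    using order_complexD(3)[OF \<sigma>(1)] e(2)
    by (intro realization_map_cong[OF order_complexD(1)[OF \<sigma>(1)] \<sigma>(2)]) blast
  then have "realization_map e x = x" using realization_map_ident[OF order_complexD(1)[OF \<sigma>(1)] \<sigma>(2)] by simp
  then show ?thesis unfolding orbit_def using e(1) by force
qed

lemma orbit_le:
  assumes \<sigma>: "\<sigma> \<in> order_complex P" "x \<in> closed_simplex \<sigma>" and g: "g \<in> G"
  shows "orbit (realization_map g x) \<subseteq> orbit x"
proof
  note fin = order_complexD(1)[OF \<sigma>(1)]
  fix y assume "y \<in> orbit (realization_map g x)"
  then obtain h where h: "h \<in> G" "y = realization_map h (realization_map g x)" by (auto simp: orbit_def)
  obtain k where k: "k \<in> G" "\<forall>U\<in>P. k U = h (g U)" using G_comp[OF h(1) g] by blast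
  have "y = realization_map k x" unfolding h(2) realization_map_comp[OF fin \<sigma>(2)]
    using k(2) order_complexD(3)[OF \<sigma>(1)] by (intro realization_map_cong[OF fin \<sigma>(2)]) (metis subsetD)
  then show "y \<in> orbit x" unfolding orbit_def using k(1) by blast
qed

lemma orbit_eq:
  assumes \<sigma>: "\<sigma> \<in> order_complex P" "x \<in> closed_simplex \<sigma>" and g: "g \<in> G"
    and \<tau>: "\<tau> \<in> order_complex P" "realization_map g x \<in> closed_simplex \<tau>"
  shows "orbit (realization_map g x) = orbit x"
proof
  note fin = order_complexD(1)[OF \<sigma>(1)]
  show "orbit (realization_map g x) \<subseteq> orbit x" by (rule orbit_le[OF \<sigma> g])
  obtain h where h: "h \<in> G" "\<forall>U\<in>P. h (g U) = U" using G_inv[OF g] by blast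
  have "realization_map h (realization_map g x) = realization_map (\<lambda>v. v) x"
    unfolding realization_map_comp[OF fin \<sigma>(2)]
    using h(2) order_complexD(3)[OF \<sigma>(1)] by (intro realization_map_cong[OF fin \<sigma>(2)]) blast
  then have "realization_map h (realization_map g x) = x" using realization_map_ident[OF fin \<sigma>(2)] by simp
  then show "orbit x \<subseteq> orbit (realization_map g x)" using orbit_le[OF \<tau> h(1)] by simp
qed

text \<open>Vertices in the support of \<open>x\<close> correspond via \<open>\<phi>\<close> to
  vertices in the support of \<open>y\<close> with the same coordinates. Asymmetry of
  \<open>R\<close> makes this correspondence monotone, and \<open>G_chain\<close> realizes
  it.\<close>

lemma fibre_imp_orbit:
  assumes \<sigma>: "\<sigma> \<in> order_complex P" "x \<in> closed_simplex \<sigma>" and \<tau>: "\<tau> \<in> order_complex P" "y \<in> closed_simplex \<tau>"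
    and eq: "realization_map \<phi> x = realization_map \<phi> y"
  shows "\<exists>g\<in>G. realization_map g x = y"
proof -
  note fin\<sigma> = order_complexD(1)[OF \<sigma>(1)] and fin\<tau> = order_complexD(1)[OF \<tau>(1)]
  \<comment> \<open>Only vertices with a nonzero coordinate have partners in \<open>\<tau>\<close>,
    so the chain is cut down to the support.\<close>
  define s where "s = {v. x v \<noteq> 0}"
  have s: "s \<subseteq> \<sigma>" using closed_simplexD(2)[OF \<sigma>(2)] by (auto simp: s_def)
  have ss: "sum x s = 1" using sum.mono_neutral_right[OF fin\<sigma> s, of x] closed_simplexD(3)[OF \<sigma>(2)] by (simp add: s_def)
  have s0: "s \<noteq> {}" using ss by (intro notI) simp
  have sK: "s \<in> order_complex P"
  proof (rule order_complexI[OF finite_subset[OF s fin\<sigma>] s0])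
    show "s \<subseteq> P" using s order_complexD(3)[OF \<sigma>(1)] by (rule subset_trans)
    show "U \<subseteq> V \<or> V \<subseteq> U" if "U \<in> s" "V \<in> s" for U V
      by (rule order_complexD(4)[OF \<sigma>(1)]) (use s that in blast)+
  qed
  have xs: "x \<in> closed_simplex s" using ss closed_simplexD(1)[OF \<sigma>(2)] unfolding closed_simplex_def s_def by simp
  have "\<exists>W. W \<in> \<tau> \<and> \<phi> W = \<phi> U \<and> y W = x U" if U: "U \<in> s" for U
  proof -
    have "U \<in> \<sigma>" using U s by blast
    then have yU: "realization_map \<phi> y (\<phi> U) = x U"
      using realization_map_inj[OF fin\<sigma> \<sigma>(2) \<phi>_inj[OF \<sigma>(1)]] eq by simp
    have "x U \<noteq> 0" using U by (simp add: s_def)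
    with yU have "\<phi> U \<in> \<phi> ` \<tau>" using closed_simplexD(2)[OF realization_map_in_simplex[OF fin\<tau> \<tau>(2), of \<phi>], of "\<phi> U"] by simp
    then obtain W where W: "W \<in> \<tau>" "\<phi> W = \<phi> U" by auto
    then show ?thesis using realization_map_inj[OF fin\<tau> \<tau>(2) \<phi>_inj[OF \<tau>(1)] W(1)] yU by auto
  qed
  then obtain h where h: "\<And>U. U \<in> s \<Longrightarrow> h U \<in> \<tau>" "\<And>U. U \<in> s \<Longrightarrow> \<phi> (h U) = \<phi> U" "\<And>U. U \<in> s \<Longrightarrow> y (h U) = x U"
    by metis
  have sP: "s \<subseteq> P" using order_complexD(3)[OF sK] .
  have hP: "h U \<in> P" if "U \<in> s" for U using h(1)[OF that] order_complexD(3)[OF \<tau>(1)] by blast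
  have mono: "h U \<subset> h V" if U: "U \<in> s" and V: "V \<in> s" and UV: "U \<subset> V" for U V
  proof -
    have R: "R (\<phi> U) (\<phi> V)" using \<phi>_mono U V UV sP by (meson subsetD)
    have "h U \<subseteq> h V \<or> h V \<subseteq> h U" using order_complexD(4)[OF \<tau>(1) h(1)[OF U] h(1)[OF V]] .
    moreover have "\<not> h V \<subseteq> h U"
    proof
      assume "h V \<subseteq> h U"
      then have "h V \<subset> h U \<or> h V = h U" by (simp add: psubset_eq)
      then have "R (\<phi> V) (\<phi> U) \<or> \<phi> V = \<phi> U"
        using \<phi>_mono[OF hP[OF V] hP[OF U]] h(2)[OF U] h(2)[OF V] by metis
      then show False using asym[OF R] R by metis
    qed
    ultimately show ?thesis by (elim disjE) (simp_all add: psubset_eq)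
  qed
  have "\<exists>g\<in>G. \<forall>U\<in>s. g U = h U" by (rule G_chain[OF sK]) (use hP h(2) mono in auto)
  then obtain g where g: "g \<in> G" "\<forall>U\<in>s. g U = h U" by blast
  have fs: "finite s" using order_complexD(1)[OF sK] .
  have hinj: "inj_on h s"
  proof (rule inj_onI)
    fix U V assume U: "U \<in> s" "V \<in> s" "h U = h V"
    then have "\<phi> U = \<phi> V" using h(2)[OF U(1)] h(2)[OF U(2)] by simp
    then show "U = V" by (rule inj_onD[OF \<phi>_inj[OF sK] _ U(1,2)])
  qed
  have "realization_map g x = realization_map h x" using g(2) by (intro realization_map_cong[OF fs xs]) simp
  also have "\<dots> = y"
  proof
    fix w
    show "realization_map h x w = y w"
    proof (cases "w \<in> h ` s")
      case True
      then show ?thesis using realization_map_inj[OF fs xs hinj] h(3) by auto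
    next
      case False
      then have "realization_map h x w = 0"
        using closed_simplexD(2)[OF realization_map_in_simplex[OF fs xs, of h]] by metis
      moreover have "y w = 0"
      proof (rule ccontr)
        assume yw: "y w \<noteq> 0"
        then have w: "w \<in> \<tau>" using closed_simplexD(2)[OF \<tau>(2)] by blast
        have "realization_map \<phi> x (\<phi> w) = y w"
          using realization_map_inj[OF fin\<tau> \<tau>(2) \<phi>_inj[OF \<tau>(1)] w] eq by simp
        then have "\<phi> w \<in> \<phi> ` s" using yw closed_simplexD(2)[OF realization_map_in_simplex[OF fs xs, of \<phi>], of "\<phi> w"] by simp
        then obtain U where U: "U \<in> s" "\<phi> w = \<phi> U" by blast
        then have "w = h U" using inj_onD[OF \<phi>_inj[OF \<tau>(1)] _ w h(1)[OF U(1)]] h(2) by simp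
        then show False using False U(1) by blast
      qed
      ultimately show ?thesis by simp
    qed
  qed
  finally show ?thesis using g(1) by blast
qed

theorem quotient_homeomorphic_geo:
  "quotient_topology (realization (order_complex P)) orbit homeomorphic_space top_of_set (geo E Q)"
proof (rule quotient_homeomorphic[OF quotient_map_realization quotient_map_quotient_topology])
  fix x y assume "x \<in> topspace (realization (order_complex P))" "y \<in> topspace (realization (order_complex P))"
  then obtain \<sigma> \<tau> where \<sigma>: "\<sigma> \<in> order_complex P" "x \<in> closed_simplex \<sigma>" and \<tau>: "\<tau> \<in> order_complex P" "y \<in> closed_simplex \<tau>"
    unfolding topspace_realization by blast
  show "orbit x = orbit y \<longleftrightarrow> realization_map \<phi> x = realization_map \<phi> y"
  proof
    assume "orbit x = orbit y"
    then obtain g where "g \<in> G" "x = realization_map g y" using orbit_self[OF \<sigma>] by (auto simp: orbit_def)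
    then show "realization_map \<phi> x = realization_map \<phi> y" using orbit_imp_fibre[OF \<tau>] by simp
  next
    assume "realization_map \<phi> x = realization_map \<phi> y"
    then obtain g where g: "g \<in> G" "realization_map g x = y" using fibre_imp_orbit[OF \<sigma> \<tau>] by blast
    then show "orbit x = orbit y" using orbit_eq[OF \<sigma> g(1) \<tau>(1)] \<tau>(2) by simp
  qed
qed

end

subsection \<open>Rational subspaces and integer lattices\<close>

text \<open>Generic in the ring: the same lattice vector is needed over the integers for
  \<open>Sp\<close> and over the rationals for the building.\<close>

definition coord_vec :: "nat \<Rightarrow> (nat \<Rightarrow> int) \<Rightarrow> 'a :: comm_ring_1 Matrix.vec" where
  "coord_vec N x = Matrix.vec N (\<lambda>i. of_int (x i))"

lemma coord_vec_simps [simp]: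
  "dim_vec (coord_vec N x) = N" "coord_vec N x \<in> carrier_vec N"
  "i < N \<Longrightarrow> coord_vec N x $ i = of_int (x i)"
  by (auto simp: coord_vec_def)

lemma coord_vec_linear:
  "coord_vec N (x + y) = coord_vec N x + coord_vec N y" "coord_vec N 0 = 0\<^sub>v N"
  "coord_vec N (c *\<^sub>Z x) = of_int c \<cdot>\<^sub>v coord_vec N x"
  by (auto simp: coord_vec_def)

lemma coord_vec_inj:
  assumes "x \<in> lat N" "y \<in> lat N" "coord_vec N x = (coord_vec N y :: 'a :: {comm_ring_1, ring_char_0} Matrix.vec)"
  shows "x = y"
proof
  fix i
  show "x i = y i"
  proof (cases "i < N")
    case True
    then have "(of_int (x i) :: 'a) = of_int (y i)" using arg_cong[OF assms(3), of "\<lambda>v. v $ i"] by simp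
    then show ?thesis by simp
  qed (use assms(1,2) in \<open>simp add: lat_def\<close>)
qed

lemma symp_form_coord: "symp_form n (coord_vec (2 * n) x) (coord_vec (2 * n) y) = of_int (sform n x y)"
  by (simp add: symp_form_def sform_def)

lemma symp_form_smult:
  assumes "v \<in> carrier_vec (2 * n)" "w \<in> carrier_vec (2 * n)"
  shows "symp_form n (a \<cdot>\<^sub>v v) (b \<cdot>\<^sub>v w) = a * b * symp_form n v w"
  using assms by (simp add: symp_form_def sum_distrib_left algebra_simps)

lemma clear_denominators:
  fixes v :: "rat Matrix.vec"
  assumes v: "v \<in> carrier_vec N"
  obtains c x where "c > 0" "x \<in> lat N" "coord_vec N x = of_int c \<cdot>\<^sub>v v"
proof -
  define d where "d i = snd (quotient_of (v $ i))" for i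
  define c where "c = (\<Prod>i<N. d i)"
  have d: "d i > 0" for i using quotient_of_denom_pos'[of "v $ i"] by (simp add: d_def)
  have c: "c > 0" unfolding c_def using d by (intro prod_pos) simp
  have "\<exists>a. of_int a = of_int c * v $ i" if i: "i < N" for i
  proof -
    have q: "v $ i = of_int (fst (quotient_of (v $ i))) / of_int (d i)"
      unfolding d_def by (rule quotient_of_div) simp
    have "c = d i * (\<Prod>j\<in>{..<N} - {i}. d j)" unfolding c_def using i by (intro prod.remove) auto
    then have "of_int c * v $ i = of_int (fst (quotient_of (v $ i)) * (\<Prod>j\<in>{..<N} - {i}. d j))"
      using d[of i] by (subst q) (simp add: field_simps)
    then show ?thesis by metis
  qed
  then obtain a where a: "\<And>i. i < N \<Longrightarrow> of_int (a i) = of_int c * v $ i" by metis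
  define x where "x i = (if i < N then a i else 0)" for i
  have "coord_vec N x = of_int c \<cdot>\<^sub>v v" using v a by (intro eq_vecI) (simp_all add: x_def)
  moreover have "x \<in> lat N" by (simp add: lat_def x_def)
  ultimately show ?thesis using c that by blast
qed

definition rational_subspace :: "nat \<Rightarrow> rat Matrix.vec set \<Rightarrow> bool" where
  "rational_subspace N U \<longleftrightarrow> U \<subseteq> carrier_vec N \<and> 0\<^sub>v N \<in> U \<and> (\<forall>v\<in>U. \<forall>w\<in>U. v + w \<in> U) \<and> (\<forall>c. \<forall>v\<in>U. c \<cdot>\<^sub>v v \<in> U)"

lemma rational_subspace_iff:
  "VectorSpace.subspace class_ring U (module_vec TYPE(rat) N) \<longleftrightarrow> rational_subspace N U"
proof -
  have "LinearCombinations.submodule class_ring U (module_vec TYPE(rat) N) \<longleftrightarrow> rational_subspace N U"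
    unfolding LinearCombinations.submodule_def rational_subspace_def module_vec_simps
    using vec_module[where 'a = rat] by (auto simp: class_ring_simps)
  then show ?thesis unfolding VectorSpace.subspace_def using vec_vs[where 'a = rat] by auto
qed

definition lattice_of :: "nat \<Rightarrow> rat Matrix.vec set \<Rightarrow> (nat \<Rightarrow> int) set" where
  "lattice_of N U = {x \<in> lat N. coord_vec N x \<in> U}"

lemma rational_subspaceD:
  assumes "rational_subspace N U"
  shows "v \<in> U \<Longrightarrow> v \<in> carrier_vec N" "0\<^sub>v N \<in> U" "v \<in> U \<Longrightarrow> w \<in> U \<Longrightarrow> v + w \<in> U" "v \<in> U \<Longrightarrow> c \<cdot>\<^sub>v v \<in> U"
  using assms by (auto simp: rational_subspace_def)

lemma smult_cancel:
  assumes U: "rational_subspace N U" and v: "c \<cdot>\<^sub>v v \<in> U" "c \<noteq> 0"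
  shows "v \<in> U"
proof -
  have "inverse c \<cdot>\<^sub>v (c \<cdot>\<^sub>v v) \<in> U" using rational_subspaceD(4)[OF U v(1)] .
  then show ?thesis using v(2) by (simp add: smult_smult_assoc)
qed

text \<open>Every rational vector has a nonzero integral multiple, so a subspace is determined by
  its integral points.\<close>

lemma lattice_of_mono:
  assumes U: "rational_subspace N U" and V: "rational_subspace N V"
  shows "lattice_of N U \<subseteq> lattice_of N V \<longleftrightarrow> U \<subseteq> V"
proof
  assume sub: "lattice_of N U \<subseteq> lattice_of N V"
  show "U \<subseteq> V"
  proof
    fix v assume v: "v \<in> U"
    obtain c x where c: "c > 0" "x \<in> lat N" "coord_vec N x = of_int c \<cdot>\<^sub>v v"
      using clear_denominators[OF rational_subspaceD(1)[OF U v]] by blast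
    have "x \<in> lattice_of N U" using c(2,3) rational_subspaceD(4)[OF U v] by (simp add: lattice_of_def)
    then have "of_int c \<cdot>\<^sub>v v \<in> V" using sub c(3) by (auto simp: lattice_of_def)
    then show "v \<in> V" by (rule smult_cancel[OF V]) (use c(1) in simp)
  qed
qed (auto simp: lattice_of_def)

lemma lattice_of_inj:
  "rational_subspace N U \<Longrightarrow> rational_subspace N V \<Longrightarrow> lattice_of N U = lattice_of N V \<Longrightarrow> U = V"
  using lattice_of_mono[of N U V] lattice_of_mono[of N V U] by simp

lemma lattice_of_psubset:
  "rational_subspace N U \<Longrightarrow> rational_subspace N V \<Longrightarrow> lattice_of N U \<subset> lattice_of N V \<longleftrightarrow> U \<subset> V"
  using lattice_of_mono[of N U V] lattice_of_mono[of N V U] by (simp add: less_le_not_le)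

lemma lattice_of_zero: "lattice_of N {0\<^sub>v N} = {0}"
proof -
  have "x = 0" if "x \<in> lat N" "coord_vec N x = (0\<^sub>v N :: rat Matrix.vec)" for x
    by (rule coord_vec_inj[OF that(1), where 'a = rat]) (simp_all add: that(2) coord_vec_linear)
  moreover have "coord_vec N 0 = (0\<^sub>v N :: rat Matrix.vec)" by (rule coord_vec_linear)
  ultimately show ?thesis unfolding lattice_of_def by auto
qed

lemma rational_subspace_zero: "rational_subspace N {0\<^sub>v N}"
  by (auto simp: rational_subspace_def)

lemma rational_subspaceI:
  assumes "\<And>v. v \<in> U \<Longrightarrow> v \<in> carrier_vec N" "0\<^sub>v N \<in> U" "\<And>v w. v \<in> U \<Longrightarrow> w \<in> U \<Longrightarrow> v + w \<in> U"
    "\<And>c v. v \<in> U \<Longrightarrow> c \<cdot>\<^sub>v v \<in> U"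
  shows "rational_subspace N U"
  unfolding rational_subspace_def using assms by blast

lemma sum_unit_row: "i < (N::nat) \<Longrightarrow> (\<Sum>j<N. (if i = j then 1 else 0) * x j) = (x i :: int)"
proof -
  assume "i < N"
  moreover have "(\<Sum>j<N. (if i = j then 1 else 0) * x j) = (\<Sum>j<N. if i = j then x j else 0)"
    by (intro sum.cong) auto
  ultimately show ?thesis by simp
qed

context symp
begin

lemma lattice_of_subgrp: "rational_subspace (2 * n) U \<Longrightarrow> subgrp (lattice_of (2 * n) U)"
proof -
  assume U: "rational_subspace (2 * n) U"
  have "coord_vec (2 * n) (x - y) = coord_vec (2 * n) x + (- 1) \<cdot>\<^sub>v (coord_vec (2 * n) y :: rat Matrix.vec)" for x y
    by (intro eq_vecI) auto
  then show ?thesis using rational_subspaceD[OF U]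
    by (auto simp: subgrp_def lattice_of_def coord_vec_linear)
qed

lemma lattice_of_pure:
  assumes U: "rational_subspace (2 * n) U" and x: "x \<in> \<Lambda>" "c \<noteq> 0" "c *\<^sub>Z x \<in> lattice_of (2 * n) U"
  shows "x \<in> lattice_of (2 * n) U"
proof -
  have "of_int c \<cdot>\<^sub>v coord_vec (2 * n) x \<in> U" using x(3) by (simp add: lattice_of_def coord_vec_linear)
  then have "coord_vec (2 * n) x \<in> U" by (rule smult_cancel[OF U]) (use x(2) in simp)
  then show ?thesis using x(1) by (simp add: lattice_of_def)
qed

text \<open>Clearing denominators transfers isotropy from integral to rational vectors. Properness
  follows: on the whole space the form would vanish, and so would all coordinates, being values of
  the form.\<close>

lemma isotropic_subspaces_iff:
  "U \<in> isotropic_subspaces n \<longleftrightarrow>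
    rational_subspace (2 * n) U \<and> iso_lattice (lattice_of (2 * n) U) \<and> lattice_of (2 * n) U \<noteq> {0}"
proof (intro iffI conjI)
  assume "U \<in> isotropic_subspaces n"
  then have U: "rational_subspace (2 * n) U" "U \<noteq> {0\<^sub>v (2 * n)}" "\<forall>v\<in>U. \<forall>w\<in>U. symp_form n v w = 0"
    by (simp_all add: isotropic_subspaces_def rational_subspace_iff)
  show "rational_subspace (2 * n) U" by fact
  have "sform n x y = 0" if "x \<in> lattice_of (2 * n) U" "y \<in> lattice_of (2 * n) U" for x y
  proof -
    have "symp_form n (coord_vec (2 * n) x) (coord_vec (2 * n) y) = (0::rat)"
      using U(3) that by (simp add: lattice_of_def)
    then show ?thesis unfolding symp_form_coord by simp
  qed
  then show "iso_lattice (lattice_of (2 * n) U)"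
    unfolding iso_lattice_def using lattice_of_subgrp[OF U(1)] lattice_of_pure[OF U(1)]
    by (auto simp: lattice_of_def)
  show "lattice_of (2 * n) U \<noteq> {0}"
    using U(2) lattice_of_inj[OF U(1) rational_subspace_zero] by (auto simp: lattice_of_zero)
next
  assume A: "rational_subspace (2 * n) U \<and> iso_lattice (lattice_of (2 * n) U) \<and> lattice_of (2 * n) U \<noteq> {0}"
  then have U: "rational_subspace (2 * n) U" by simp
  have form: "symp_form n v w = 0" if v: "v \<in> U" and w: "w \<in> U" for v w
  proof -
    obtain c x where c: "c > 0" "x \<in> \<Lambda>" "coord_vec (2 * n) x = of_int c \<cdot>\<^sub>v v"
      using clear_denominators[OF rational_subspaceD(1)[OF U v]] by blast
    obtain d y where d: "d > 0" "y \<in> \<Lambda>" "coord_vec (2 * n) y = of_int d \<cdot>\<^sub>v w"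
      using clear_denominators[OF rational_subspaceD(1)[OF U w]] by blast
    have "x \<in> lattice_of (2 * n) U" "y \<in> lattice_of (2 * n) U"
      using c d rational_subspaceD(4)[OF U] v w by (simp_all add: lattice_of_def)
    then have "sform n x y = 0" using A by (simp add: iso_lattice_def)
    then have "symp_form n (of_int c \<cdot>\<^sub>v v) (of_int d \<cdot>\<^sub>v w) = 0"
      using symp_form_coord[of n x y, where 'a = rat] c(3) d(3) by simp
    then have "rat_of_int c * rat_of_int d * symp_form n v w = 0"
      unfolding symp_form_smult[OF rational_subspaceD(1)[OF U v] rational_subspaceD(1)[OF U w]] .
    then show ?thesis using c(1) d(1) by simp
  qed
  have "U \<noteq> {0\<^sub>v (2 * n)}" using A lattice_of_zero by auto
  moreover have "U \<noteq> carrier_vec (2 * n)"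
  proof
    assume e: "U = carrier_vec (2 * n)"
    have all: "lattice_of (2 * n) U = \<Lambda>" unfolding e lattice_of_def by simp
    have "x = 0" if x: "x \<in> \<Lambda>" for x
    proof
      fix i
      have z: "sform n x y = 0" if "y \<in> \<Lambda>" for y
        using A x that all by (simp add: iso_lattice_def)
      show "x i = 0 i" using coord_sform[OF x, of i] z[OF unitv_lat, of "n + i"] z[OF unitv_lat, of "i - n"]
        by (auto split: if_splits)
    qed
    then have "\<Lambda> = {0}" using lat_simps(1) by blast
    then show False using A all by simp
  qed
  ultimately show "U \<in> isotropic_subspaces n"
    unfolding isotropic_subspaces_def rational_subspace_iff using U form by simp
qed

text \<open>\<open>U\<close> is the rational span of \<open>L\<close>, written as the vectors with a
  nonzero multiple in \<open>L\<close>; purity gives back \<open>L\<close>.\<close>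

lemma lattice_of_surj:
  assumes L: "iso_lattice L" "L \<noteq> {0}"
  shows "\<exists>U\<in>isotropic_subspaces n. lattice_of (2 * n) U = L"
proof -
  have sL: "subgrp L" "L \<subseteq> \<Lambda>" using L by (auto simp: iso_lattice_def)
  define U where "U = {v \<in> carrier_vec (2 * n). \<exists>c x. c \<noteq> 0 \<and> x \<in> L \<and> of_int c \<cdot>\<^sub>v v = (coord_vec (2 * n) x :: rat Matrix.vec)}"
  have U: "rational_subspace (2 * n) U" unfolding rational_subspace_def
  proof (intro conjI ballI allI)
    show "U \<subseteq> carrier_vec (2 * n)" by (auto simp: U_def)
    show "0\<^sub>v (2 * n) \<in> U" unfolding U_def using subgrpD(1)[OF sL(1)]
      by (intro CollectI conjI exI[of _ 1] exI[of _ 0]) (simp_all add: coord_vec_linear)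
    fix v assume "v \<in> U"
    then obtain c x where v: "v \<in> carrier_vec (2 * n)" "c \<noteq> 0" "x \<in> L" "of_int c \<cdot>\<^sub>v v = coord_vec (2 * n) x"
      unfolding U_def by blast
    show "a \<cdot>\<^sub>v v \<in> U" for a
    proof -
      obtain r s where a: "quotient_of a = (r, s)" by fastforce
      have s: "s > 0" "a = of_int r / of_int s" using quotient_of_denom_pos[OF a] quotient_of_div[OF a] by auto
      have "of_int (s * c) \<cdot>\<^sub>v (a \<cdot>\<^sub>v v) = of_int r \<cdot>\<^sub>v (of_int c \<cdot>\<^sub>v v)"
        using s v(1) by (intro eq_vecI) (simp_all add: field_simps)
      also have "\<dots> = coord_vec (2 * n) (r *\<^sub>Z x)" unfolding v(4) coord_vec_linear ..
      finally show ?thesis unfolding U_def using v s(1) subgrpD(5)[OF sL(1) v(3)]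
        by (intro CollectI conjI exI[of _ "s * c"] exI[of _ "r *\<^sub>Z x"]) simp_all
    qed
    fix w assume "w \<in> U"
    then obtain d y where w: "w \<in> carrier_vec (2 * n)" "d \<noteq> 0" "y \<in> L" "of_int d \<cdot>\<^sub>v w = coord_vec (2 * n) y"
      unfolding U_def by blast
    have "of_int (c * d) \<cdot>\<^sub>v (v + w) = of_int d \<cdot>\<^sub>v (of_int c \<cdot>\<^sub>v v) + of_int c \<cdot>\<^sub>v (of_int d \<cdot>\<^sub>v w)"
      using v(1) w(1) by (intro eq_vecI) (simp_all add: algebra_simps)
    also have "\<dots> = coord_vec (2 * n) (d *\<^sub>Z x + c *\<^sub>Z y)" unfolding v(4) w(4) coord_vec_linear ..
    finally show "v + w \<in> U" unfolding U_def using v w subgrpD(4)[OF sL(1) subgrpD(5)[OF sL(1) v(3)] subgrpD(5)[OF sL(1) w(3)]]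
      by (intro CollectI conjI exI[of _ "c * d"] exI[of _ "d *\<^sub>Z x + c *\<^sub>Z y"]) simp_all
  qed
  have E: "lattice_of (2 * n) U = L"
  proof
    show "L \<subseteq> lattice_of (2 * n) U"
    proof
      fix x assume x: "x \<in> L"
      have "of_int 1 \<cdot>\<^sub>v coord_vec (2 * n) x = (coord_vec (2 * n) x :: rat Matrix.vec)" by simp
      then have "coord_vec (2 * n) x \<in> U" unfolding U_def using x by (intro CollectI conjI exI[of _ 1] exI[of _ x]) simp_all
      then show "x \<in> lattice_of (2 * n) U" using x sL(2) by (auto simp: lattice_of_def)
    qed
    show "lattice_of (2 * n) U \<subseteq> L"
    proof
      fix y assume y: "y \<in> lattice_of (2 * n) U"
      then obtain c x where c: "c \<noteq> 0" "x \<in> L" "of_int c \<cdot>\<^sub>v coord_vec (2 * n) y = (coord_vec (2 * n) x :: rat Matrix.vec)"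
        and y\<Lambda>: "y \<in> \<Lambda>" unfolding lattice_of_def U_def by blast
      have "coord_vec (2 * n) (c *\<^sub>Z y) = (coord_vec (2 * n) x :: rat Matrix.vec)" using c(3) by (simp add: coord_vec_linear)
      then have "c *\<^sub>Z y = x" by (rule coord_vec_inj[rotated 2]) (use y\<Lambda> c(2) sL(2) in auto)
      then show "y \<in> L" using L(1) c y\<Lambda> unfolding iso_lattice_def by blast
    qed
  qed
  have "U \<in> isotropic_subspaces n" unfolding isotropic_subspaces_iff E using U L by simp
  then show ?thesis using E by (rule bexI[rotated])
qed

section \<open>Matrices of the congruence group as maps of the lattice\<close>

definition matrix_map :: "int mat \<Rightarrow> (nat \<Rightarrow> int) \<Rightarrow> nat \<Rightarrow> int" where
  "matrix_map A x = (\<lambda>i. if i < 2 * n then \<Sum>j<2 * n. A $$ (i, j) * x j else 0)"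

lemma matrix_map_lat: "matrix_map A x \<in> \<Lambda>"
  by (simp add: matrix_map_def lat_def)

lemma matrix_map_vec:
  assumes "A \<in> carrier_mat (2 * n) (2 * n)"
  shows "map_mat of_int A *\<^sub>v coord_vec (2 * n) x = (coord_vec (2 * n) (matrix_map A x) :: 'a :: comm_ring_1 Matrix.vec)"
  using assms by (intro eq_vecI) (auto simp: matrix_map_def scalar_prod_def lessThan_atLeast0)

lemma matrix_map_vec_int:
  assumes "A \<in> carrier_mat (2 * n) (2 * n)"
  shows "A *\<^sub>v coord_vec (2 * n) x = coord_vec (2 * n) (matrix_map A x)"
  using assms by (intro eq_vecI) (auto simp: matrix_map_def scalar_prod_def lessThan_atLeast0)

lemma Gamma_congruence:
  assumes A: "A \<in> Gamma_omega n p"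
  shows "matrix_map A \<in> congruence_maps"
proof -
  have C: "A \<in> carrier_mat (2 * n) (2 * n)" using A by (simp add: Gamma_omega_def Sp_def)
  have M: "A *\<^sub>v coord_vec (2 * n) x = coord_vec (2 * n) (matrix_map A x)" for x by (rule matrix_map_vec_int[OF C])
  have e: "int p dvd A $$ (i, j) - (if i = j then 1 else 0)" if "i < 2 * n" "j < 2 * n" for i j
  proof -
    have "map_mat (\<lambda>a. a mod int p) A $$ (i, j) = map_mat (\<lambda>a. a mod int p) (1\<^sub>m (2 * n)) $$ (i, j)"
      using A by (simp add: Gamma_omega_def)
    then show ?thesis using C that by (simp add: mod_eq_dvd_iff split: if_splits)
  qed
  show ?thesis unfolding congruence_maps_def
  proof (intro CollectI conjI ballI)
    fix x y :: "nat \<Rightarrow> int" assume x: "x \<in> \<Lambda>" and y: "y \<in> \<Lambda>"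
    show "matrix_map A x \<in> \<Lambda>" by (rule matrix_map_lat)
    show "matrix_map A (x + y) = matrix_map A x + matrix_map A y"
      by (auto simp: matrix_map_def fun_eq_iff algebra_simps sum.distrib)
    have "symp_form n (A *\<^sub>v coord_vec (2 * n) x) (A *\<^sub>v coord_vec (2 * n) y) = symp_form n (coord_vec (2 * n) x) (coord_vec (2 * n) y)"
      using A by (simp add: Gamma_omega_def Sp_def)
    then show "sform n (matrix_map A x) (matrix_map A y) = sform n x y" unfolding M symp_form_coord by simp
    have "int p dvd (matrix_map A x - x) i" for i
    proof (cases "i < 2 * n")
      case True
      have "(matrix_map A x - x) i = (\<Sum>j<2 * n. A $$ (i, j) * x j) - (\<Sum>j<2 * n. (if i = j then 1 else 0) * x j)"
        using True sum_unit_row[OF True, of x] by (simp add: matrix_map_def)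
      also have "\<dots> = (\<Sum>j<2 * n. (A $$ (i, j) - (if i = j then 1 else 0)) * x j)"
        unfolding sum_subtractf[symmetric] left_diff_distrib ..
      also have "int p dvd \<dots>" using e[OF True] by (intro dvd_sum dvd_mult2) simp
      finally show ?thesis .
    next
      case False
      then show ?thesis using x by (simp add: matrix_map_def lat_def)
    qed
    then show "matrix_map A x - x \<in> pl" using lat_simps(2)[OF matrix_map_lat x] by (simp add: pl_def)
  qed
qed

lemma unitv_expand:
  assumes "x \<in> lat N"
  shows "x = (\<Sum>j<N. x j *\<^sub>Z unitv j)"
proof
  fix i
  have "(\<Sum>j<N. x j *\<^sub>Z unitv j) i = (\<Sum>j<N. (if i = j then 1 else 0) * x j)"
    unfolding sum_fun_apply by (intro sum.cong) (auto simp: unitv_def)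
  also have "\<dots> = x i"
  proof (cases "i < N")
    case True
    then show ?thesis by (rule sum_unit_row)
  next
    case False
    then have "(\<Sum>j<N. (if i = j then 1 else 0) * x j) = 0" by (intro sum.neutral) auto
    then show ?thesis using False assms by (simp add: lat_def)
  qed
  finally show "x i = (\<Sum>j<N. x j *\<^sub>Z unitv j) i" ..
qed

text \<open>The columns are the images of the unit vectors; additivity makes the map agree with its
  matrix.\<close>

lemma congruence_Gamma:
  assumes g: "g \<in> congruence_maps"
  shows "\<exists>A\<in>Gamma_omega n p. \<forall>x\<in>\<Lambda>. matrix_map A x = g x"
proof -
  note gD = congruence_mapsD[OF g]
  define A where "A = Matrix.mat (2 * n) (2 * n) (\<lambda>(i, j). g (unitv j) i)"
  have C: "A \<in> carrier_mat (2 * n) (2 * n)" by (simp add: A_def)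
  have eq: "matrix_map A x = g x" if x: "x \<in> \<Lambda>" for x
  proof
    fix i
    have "g x = (\<Sum>j<2 * n. x j *\<^sub>Z g (unitv j))"
    proof -
      have "g x = g (\<Sum>j<2 * n. x j *\<^sub>Z unitv j)" by (rule arg_cong[OF unitv_expand[OF x]])
      also have "\<dots> = (\<Sum>j<2 * n. g (x j *\<^sub>Z unitv j))"
        by (rule congruence_maps_sum[OF g]) (simp add: unitv_lat)
      also have "\<dots> = (\<Sum>j<2 * n. x j *\<^sub>Z g (unitv j))"
        by (intro sum.cong refl congruence_maps_linear(4)[OF g]) (simp add: unitv_lat)
      finally show ?thesis .
    qed
    then have gi: "g x i = (\<Sum>j<2 * n. x j * g (unitv j) i)" by (simp add: sum_fun_apply)
    show "matrix_map A x i = g x i"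
    proof (cases "i < 2 * n")
      case True
      then show ?thesis unfolding gi by (auto simp: matrix_map_def A_def intro!: sum.cong)
    next
      case False
      then show ?thesis using gD(1)[OF x] by (simp add: matrix_map_def lat_def)
    qed
  qed
  have M: "A *\<^sub>v coord_vec (2 * n) x = coord_vec (2 * n) (matrix_map A x)" for x by (rule matrix_map_vec_int[OF C])
  have "symp_form n (A *\<^sub>v v) (A *\<^sub>v w) = symp_form n v w"
    if vw: "v \<in> carrier_vec (2 * n)" "w \<in> carrier_vec (2 * n)" for v w
  proof -
    have *: "\<exists>x\<in>\<Lambda>. v = coord_vec (2 * n) x" if "v \<in> carrier_vec (2 * n)" for v :: "int Matrix.vec"
      using that by (intro bexI[of _ "\<lambda>i. if i < 2 * n then v $ i else 0"]) (auto simp: lat_def intro!: eq_vecI)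
    obtain x y where x: "x \<in> \<Lambda>" "v = coord_vec (2 * n) x" "y \<in> \<Lambda>" "w = coord_vec (2 * n) y"
      using *[OF vw(1)] *[OF vw(2)] by blast
    show ?thesis unfolding x(2,4) M symp_form_coord eq[OF x(1)] eq[OF x(3)] gD(3)[OF x(1,3)] ..
  qed
  moreover have "map_mat (\<lambda>a. a mod int p) A = map_mat (\<lambda>a. a mod int p) (1\<^sub>m (2 * n))"
  proof (rule eq_matI)
    fix i j assume "i < dim_row (map_mat (\<lambda>a. a mod int p) (1\<^sub>m (2 * n)))" "j < dim_col (map_mat (\<lambda>a. a mod int p) (1\<^sub>m (2 * n)))"
    then have ij: "i < 2 * n" "j < 2 * n" by auto
    have "g (unitv j) - unitv j \<in> pl" using gD(4)[OF unitv_lat[OF ij(2)]] .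
    then have "int p dvd g (unitv j) i - unitv j i" by (simp add: pl_def)
    then show "map_mat (\<lambda>a. a mod int p) A $$ (i, j) = map_mat (\<lambda>a. a mod int p) (1\<^sub>m (2 * n)) $$ (i, j)"
      using ij by (simp add: A_def unitv_def mod_eq_dvd_iff)
  qed (auto simp: A_def)
  ultimately have "A \<in> Gamma_omega n p" using C by (simp add: Gamma_omega_def Sp_def)
  then show ?thesis using eq by blast
qed

text \<open>An integral vector of the image must have an integral preimage: denominators of the
  rational preimage are cleared, the inverse congruence map is applied, and purity removes the
  denominator.\<close>

lemma lattice_of_act:
  assumes A: "A \<in> Gamma_omega n p" and U: "rational_subspace (2 * n) U"
  shows "rational_subspace (2 * n) (act_subspace A U)"
    "lattice_of (2 * n) (act_subspace A U) = matrix_map A ` lattice_of (2 * n) U"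
proof -
  let ?B = "map_mat rat_of_int A"
  have C: "A \<in> carrier_mat (2 * n) (2 * n)" using A by (simp add: Gamma_omega_def Sp_def)
  then have B: "?B \<in> carrier_mat (2 * n) (2 * n)" by simp
  note UD = rational_subspaceD[OF U]
  have mem: "\<exists>v'\<in>U. v = ?B *\<^sub>v v'" if "v \<in> act_subspace A U" for v using that by (auto simp: act_subspace_def)
  have img: "?B *\<^sub>v v \<in> act_subspace A U" if "v \<in> U" for v unfolding act_subspace_def using that by (rule imageI)
  show S: "rational_subspace (2 * n) (act_subspace A U)"
  proof (rule rational_subspaceI)
    show "v \<in> carrier_vec (2 * n)" if "v \<in> act_subspace A U" for v using mem[OF that] B UD(1) by auto
    have "matrix_map A 0 = 0" by (simp add: matrix_map_def fun_eq_iff)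
    then have "?B *\<^sub>v 0\<^sub>v (2 * n) = 0\<^sub>v (2 * n)"
      using matrix_map_vec[OF C, of 0, where 'a = rat] by (simp only: coord_vec_linear)
    then show "0\<^sub>v (2 * n) \<in> act_subspace A U" using img[OF UD(2)] by simp
    show "v + w \<in> act_subspace A U" if v: "v \<in> act_subspace A U" and w: "w \<in> act_subspace A U" for v w
    proof -
      obtain v' w' where v': "v' \<in> U" "v = ?B *\<^sub>v v'" and w': "w' \<in> U" "w = ?B *\<^sub>v w'" using mem[OF v] mem[OF w] by blast
      have "v + w = ?B *\<^sub>v (v' + w')" unfolding v'(2) w'(2)
        by (rule mult_add_distrib_mat_vec[OF B UD(1)[OF v'(1)] UD(1)[OF w'(1)], symmetric])
      then show ?thesis using img[OF UD(3)[OF v'(1) w'(1)]] by simp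
    qed
    show "c \<cdot>\<^sub>v v \<in> act_subspace A U" if v: "v \<in> act_subspace A U" for c v
    proof -
      obtain v' where v': "v' \<in> U" "v = ?B *\<^sub>v v'" using mem[OF v] by blast
      have "c \<cdot>\<^sub>v v = ?B *\<^sub>v (c \<cdot>\<^sub>v v')" unfolding v'(2) by (rule mult_mat_vec[OF B UD(1)[OF v'(1)], symmetric])
      then show ?thesis using img[OF UD(4)[OF v'(1)]] by simp
    qed
  qed
  have g: "matrix_map A \<in> congruence_maps" by (rule Gamma_congruence[OF A])
  obtain h where h: "h \<in> congruence_maps" "\<forall>x\<in>\<Lambda>. h (matrix_map A x) = x \<and> matrix_map A (h x) = x"
    using congruence_maps_inverse[OF g] by blast
  have M: "?B *\<^sub>v coord_vec (2 * n) x = coord_vec (2 * n) (matrix_map A x)" for x by (rule matrix_map_vec[OF C])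
  show "lattice_of (2 * n) (act_subspace A U) = matrix_map A ` lattice_of (2 * n) U"
  proof
    show "matrix_map A ` lattice_of (2 * n) U \<subseteq> lattice_of (2 * n) (act_subspace A U)"
    proof (rule image_subsetI)
      fix x assume "x \<in> lattice_of (2 * n) U"
      then have "?B *\<^sub>v coord_vec (2 * n) x \<in> act_subspace A U" by (intro img) (simp add: lattice_of_def)
      then show "matrix_map A x \<in> lattice_of (2 * n) (act_subspace A U)"
        unfolding M lattice_of_def using matrix_map_lat by simp
    qed
    show "lattice_of (2 * n) (act_subspace A U) \<subseteq> matrix_map A ` lattice_of (2 * n) U"
    proof
      fix y assume "y \<in> lattice_of (2 * n) (act_subspace A U)"
      then obtain v where v: "v \<in> U" "coord_vec (2 * n) y = ?B *\<^sub>v v" and y: "y \<in> \<Lambda>"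
        unfolding lattice_of_def act_subspace_def by blast
      obtain c x where c: "c > 0" "x \<in> \<Lambda>" "coord_vec (2 * n) x = of_int c \<cdot>\<^sub>v v"
        using clear_denominators[OF UD(1)[OF v(1)]] by blast
      have xU: "x \<in> lattice_of (2 * n) U" using c(2,3) UD(4)[OF v(1)] by (simp add: lattice_of_def)
      have "coord_vec (2 * n) (matrix_map A x) = ?B *\<^sub>v (of_int c \<cdot>\<^sub>v v)" unfolding M[symmetric] c(3) ..
      also have "\<dots> = of_int c \<cdot>\<^sub>v (?B *\<^sub>v v)" by (rule mult_mat_vec[OF B UD(1)[OF v(1)]])
      also have "\<dots> = coord_vec (2 * n) (c *\<^sub>Z y)" unfolding v(2)[symmetric] coord_vec_linear ..
      finally have "matrix_map A x = c *\<^sub>Z y" by (rule coord_vec_inj[rotated 2]) (simp_all add: matrix_map_lat y)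
      then have "h (matrix_map A x) = c *\<^sub>Z h y" using congruence_maps_linear(4)[OF h(1) y] by simp
      then have "x = c *\<^sub>Z h y" using h(2) c(2) by simp
      then have "h y \<in> lattice_of (2 * n) U"
        using lattice_of_pure[OF U congruence_mapsD(1)[OF h(1) y], of c] c(1) xU by simp
      then have "matrix_map A (h y) \<in> matrix_map A ` lattice_of (2 * n) U" by (rule imageI)
      then show "y \<in> matrix_map A ` lattice_of (2 * n) U" using h(2) y by simp
    qed
  qed
qed

lemma act_isotropic:
  assumes A: "A \<in> Gamma_omega n p" and U: "U \<in> isotropic_subspaces n"
  shows "act_subspace A U \<in> isotropic_subspaces n"
proof -
  have U': "rational_subspace (2 * n) U" "iso_lattice (lattice_of (2 * n) U)" "lattice_of (2 * n) U \<noteq> {0}"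
    using U by (simp_all add: isotropic_subspaces_iff)
  note L = lattice_of_act[OF A U'(1)] and g = Gamma_congruence[OF A]
  have i: "iso_lattice (lattice_of (2 * n) (act_subspace A U))" unfolding L(2) by (rule image_iso_lattice[OF g U'(2)])
  have "redL (lattice_of (2 * n) (act_subspace A U)) = redL (lattice_of (2 * n) U)"
    unfolding L(2) by (rule redL_image[OF g U'(2)])
  then have "lattice_of (2 * n) (act_subspace A U) \<noteq> {0}" using redL_nonzero[OF i] redL_nonzero[OF U'(2)] U'(3) by simp
  then show ?thesis using L(1) i by (simp add: isotropic_subspaces_iff)
qed

end

section \<open>Types of isotropic lattices and the quotient of the building\<close>

locale labelled = symp +
  fixes m :: nat and lab :: "(nat \<Rightarrow> int) set \<Rightarrow> nat"
  assumes lab_less: "iso_lattice L \<Longrightarrow> L \<noteq> {0} \<Longrightarrow> lab L < m"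
    and lab_eq: "iso_lattice L \<Longrightarrow> L \<noteq> {0} \<Longrightarrow> iso_lattice M \<Longrightarrow> redL L = redL M \<Longrightarrow> lab L = lab M \<longleftrightarrow> lat_equiv L M"
    and lab_surj: "V \<in> isotropic_above pl \<Longrightarrow> c < m \<Longrightarrow> \<exists>L. iso_lattice L \<and> redL L = V \<and> lab L = c"
begin

abbreviation type where "type L \<equiv> (redL L, lab L)"

lemma type_surj:
  assumes "a \<in> isotropic_above pl \<times> {..<m}"
  shows "\<exists>L. iso_lattice L \<and> L \<noteq> {0} \<and> type L = a"
proof -
  obtain V c where a: "a = (V, c)" "V \<in> isotropic_above pl" "c < m" using assms by auto
  obtain L where L: "iso_lattice L" "redL L = V" "lab L = c" using lab_surj[OF a(2,3)] by blast
  then have "iso_lattice L \<and> L \<noteq> {0} \<and> type L = a" using redL_nonzero[OF L(1)] a by simp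
  then show ?thesis ..
qed

lemma lat_equiv_type:
  assumes L: "iso_lattice L" "L \<noteq> {0}" and M: "iso_lattice M" and e: "lat_equiv L M"
  shows "M \<noteq> {0}" "type M = type L"
proof -
  have r: "redL M = redL L" by (rule lat_equiv_redL[OF e L(1)])
  then show "M \<noteq> {0}" using redL_nonzero[OF L(1)] redL_nonzero[OF M] L(2) by simp
  show "type M = type L" using lab_eq[OF L M r[symmetric]] e r by simp
qed

text \<open>Lifting goes from large to small: the smallest member of \<open>C\<close> is split off,
  the rest is lifted, and \<open>lift_into\<close> places a lattice of the missing type inside the
  smallest lattice obtained.\<close>

lemma lift_chain:
  assumes "finite C" "C \<noteq> {}" "C \<subseteq> isotropic_above pl \<times> {..<m}"
    and "\<And>x y. x \<in> C \<Longrightarrow> y \<in> C \<Longrightarrow> x \<noteq> y \<Longrightarrow> fst x \<subset> fst y \<or> fst y \<subset> fst x"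
  shows "\<exists>\<sigma>. finite \<sigma> \<and> \<sigma> \<noteq> {} \<and> (\<forall>L\<in>\<sigma>. iso_lattice L \<and> L \<noteq> {0}) \<and> (\<forall>L\<in>\<sigma>. \<forall>M\<in>\<sigma>. L \<subseteq> M \<or> M \<subseteq> L) \<and> type ` \<sigma> = C"
  using assms
proof (induction "card C" arbitrary: C)
  case 0
  then show ?case by simp
next
  case (Suc k)
  have "\<exists>V\<in>fst ` C. \<forall>W\<in>fst ` C. W \<subseteq> V \<longrightarrow> V = W"
    by (rule finite_has_minimal) (use Suc.prems(1,2) in simp_all)
  then obtain V where V: "V \<in> fst ` C" "\<forall>W\<in>fst ` C. W \<subseteq> V \<longrightarrow> V = W" by (rule bexE)
  obtain a where a: "a \<in> C" "V = fst a" using V(1) by (rule imageE)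
  have below: "fst a \<subset> fst y" if y: "y \<in> C" "y \<noteq> a" for y
  proof -
    have "fst a \<subset> fst y \<or> fst y \<subset> fst a" using Suc.prems(4)[OF a(1) y(1)] y(2) by simp
    moreover have "\<not> fst y \<subset> fst a" using V(2)[rule_format, OF imageI[OF y(1)]] by (simp add: a(2) psubset_eq) metis
    ultimately show ?thesis by simp
  qed
  have aQ: "a \<in> isotropic_above pl \<times> {..<m}" using a(1) Suc.prems(3) by blast
  obtain L1 where L1: "iso_lattice L1" "L1 \<noteq> {0}" "type L1 = a" using type_surj[OF aQ] by blast
  show ?case
  proof (cases "C = {a}")
    case True
    then show ?thesis using L1 by (intro exI[of _ "{L1}"]) simp
  next
    case False
    let ?C = "C - {a}"
    have C: "k = card ?C" "finite ?C" "?C \<noteq> {}" "?C \<subseteq> isotropic_above pl \<times> {..<m}"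
      using Suc.hyps(2) Suc.prems a(1) False by auto
    have "\<exists>\<sigma>. finite \<sigma> \<and> \<sigma> \<noteq> {} \<and> (\<forall>L\<in>\<sigma>. iso_lattice L \<and> L \<noteq> {0}) \<and> (\<forall>L\<in>\<sigma>. \<forall>M\<in>\<sigma>. L \<subseteq> M \<or> M \<subseteq> L) \<and> type ` \<sigma> = ?C"
      using Suc.prems(4) by (intro Suc.hyps(1)[OF C]) simp
    then obtain \<sigma> where \<sigma>: "finite \<sigma>" "\<sigma> \<noteq> {}" "\<forall>L\<in>\<sigma>. iso_lattice L \<and> L \<noteq> {0}"
      "\<forall>L\<in>\<sigma>. \<forall>M\<in>\<sigma>. L \<subseteq> M \<or> M \<subseteq> L" "type ` \<sigma> = ?C" by (elim exE conjE)
    have "\<exists>K\<in>\<sigma>. \<forall>L\<in>\<sigma>. L \<subseteq> K \<longrightarrow> K = L" by (rule finite_has_minimal[OF \<sigma>(1,2)])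
    then obtain K where K: "K \<in> \<sigma>" "\<forall>L\<in>\<sigma>. L \<subseteq> K \<longrightarrow> K = L" by (rule bexE)
    have Kmin: "K \<subseteq> L" if L: "L \<in> \<sigma>" for L
      using \<sigma>(4)[rule_format, OF K(1) L] K(2)[rule_format, OF L] by (elim disjE) simp_all
    have "type K \<in> ?C" using K(1) unfolding \<sigma>(5)[symmetric] by (rule imageI)
    then have "fst a \<subset> fst (type K)" by (intro below) simp_all
    then have "redL L1 \<subset> redL K" using L1(3) by auto
    then obtain L where L: "iso_lattice L" "lat_equiv L1 L" "L \<subset> K"
      using lift_into[OF L1(1)] \<sigma>(3) K(1) by blast
    note T = lat_equiv_type[OF L1(1,2) L(1,2)]
    have LM: "L \<subseteq> M" if "M \<in> \<sigma>" for M using L(3) Kmin[OF that] by simp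
    show ?thesis
    proof (intro exI[of _ "insert L \<sigma>"] conjI)
      show "\<forall>L\<in>insert L \<sigma>. iso_lattice L \<and> L \<noteq> {0}" using \<sigma>(3) L(1) T(1) by simp
      show "\<forall>K\<in>insert L \<sigma>. \<forall>M\<in>insert L \<sigma>. K \<subseteq> M \<or> M \<subseteq> K" using \<sigma>(4) LM by simp
      show "type ` insert L \<sigma> = C" using \<sigma>(5) T(2) L1(3) a(1) by auto
    qed (use \<sigma>(1) in simp_all)
  qed
qed

abbreviation building_type where "building_type U \<equiv> type (lattice_of (2 * n) U)"

lemma lattice_of_order:
  assumes "U \<in> isotropic_subspaces n" "W \<in> isotropic_subspaces n"
  shows "lattice_of (2 * n) U \<subset> lattice_of (2 * n) W \<longleftrightarrow> U \<subset> W"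
    "lattice_of (2 * n) U \<subseteq> lattice_of (2 * n) W \<longleftrightarrow> U \<subseteq> W"
    "lattice_of (2 * n) U = lattice_of (2 * n) W \<longleftrightarrow> U = W"
  using assms lattice_of_psubset[of "2 * n" U W] lattice_of_mono[of "2 * n" U W] lattice_of_inj[of "2 * n" U W]
  by (auto simp only: isotropic_subspaces_iff)

lemma isotropic_lattice:
  assumes "U \<in> isotropic_subspaces n"
  shows "iso_lattice (lattice_of (2 * n) U)" "lattice_of (2 * n) U \<noteq> {0}"
  using assms by (simp_all add: isotropic_subspaces_iff)

lemma act_eqI:
  assumes A: "A \<in> Gamma_omega n p" and U: "U \<in> isotropic_subspaces n" and W: "W \<in> isotropic_subspaces n"
    and eq: "matrix_map A ` lattice_of (2 * n) U = lattice_of (2 * n) W"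
  shows "act_subspace A U = W"
proof -
  have "rational_subspace (2 * n) U" using U by (simp add: isotropic_subspaces_iff)
  then have "lattice_of (2 * n) (act_subspace A U) = lattice_of (2 * n) W" using lattice_of_act(2)[OF A] eq by simp
  then show ?thesis using lattice_of_order(3)[OF act_isotropic[OF A U] W] by simp
qed

lemma act_lattice:
  assumes "A \<in> Gamma_omega n p" "U \<in> isotropic_subspaces n"
  shows "lattice_of (2 * n) (act_subspace A U) = matrix_map A ` lattice_of (2 * n) U"
  using lattice_of_act(2)[OF assms(1)] assms(2) by (simp add: isotropic_subspaces_iff)

lemma congruence_act:
  assumes g: "g \<in> congruence_maps"
  obtains A where "A \<in> Gamma_omega n p"
    "\<And>U. U \<in> isotropic_subspaces n \<Longrightarrow> matrix_map A ` lattice_of (2 * n) U = g ` lattice_of (2 * n) U"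
proof -
  obtain A where A: "A \<in> Gamma_omega n p" "\<forall>x\<in>\<Lambda>. matrix_map A x = g x" using congruence_Gamma[OF g] by blast
  have "matrix_map A ` lattice_of (2 * n) U = g ` lattice_of (2 * n) U" for U
    using A(2) by (intro image_cong) (auto simp: lattice_of_def)
  then show ?thesis using that A(1) by blast
qed

text \<open>An instance of \<open>chain_orbits\<close> with the type as vertex map:
  \<open>lift_chain\<close> lifts cliques, and \<open>chain_equiv\<close> supplies one group element
  for a whole chain.\<close>

theorem building_homeomorphic:
  "building_quotient n p homeomorphic_space top_of_set (geo inflated_incident (isotropic_above pl \<times> {..<m}))"
proof -
  let ?P = "isotropic_subspaces n" and ?Q = "isotropic_above pl \<times> {..<m}"
  let ?R = "\<lambda>x y :: (nat \<Rightarrow> int) set \<times> nat. fst x \<subset> fst y" and ?G = "act_subspace ` Gamma_omega n p"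
  let ?l = "lattice_of (2 * n)"
  interpret chain_orbits ?P ?Q ?R building_type ?G
  proof
    show "finite ?Q" using finite_isotropic_above by simp
    show "\<not> fst y \<subset> fst x" if "fst x \<subset> fst y" for x y :: "(nat \<Rightarrow> int) set \<times> nat" using that by (rule less_not_sym)
    show "building_type U \<in> ?Q" if "U \<in> ?P" for U
      using isotropic_lattice[OF that] redL_nonzero lab_less by simp
    show "fst (building_type U) \<subset> fst (building_type W)" if U: "U \<in> ?P" and W: "W \<in> ?P" and "U \<subset> W" for U W
    proof -
      have s: "?l U \<subset> ?l W" using lattice_of_order(1)[OF U W] \<open>U \<subset> W\<close> by simp
      then have "redL (?l U) \<subseteq> redL (?l W)" by (intro redL_mono) (rule psubset_imp_subset)
      moreover have "redL (?l U) \<noteq> redL (?l W)"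
        using redL_inj[OF isotropic_lattice(1)[OF U] isotropic_lattice(1)[OF W]] s by (metis psubset_eq)
      ultimately show ?thesis by (simp add: psubset_eq)
    qed
    show "\<exists>\<sigma>\<in>order_complex ?P. building_type ` \<sigma> = C"
      if C: "C \<subseteq> ?Q" "C \<noteq> {}" "\<And>x y. x \<in> C \<Longrightarrow> y \<in> C \<Longrightarrow> x \<noteq> y \<Longrightarrow> ?R x y \<or> ?R y x" for C
    proof -
      have "finite C" using C(1) finite_isotropic_above finite_subset by blast
      then have "\<exists>\<sigma>. finite \<sigma> \<and> \<sigma> \<noteq> {} \<and> (\<forall>L\<in>\<sigma>. iso_lattice L \<and> L \<noteq> {0}) \<and> (\<forall>L\<in>\<sigma>. \<forall>M\<in>\<sigma>. L \<subseteq> M \<or> M \<subseteq> L) \<and> type ` \<sigma> = C"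
        using C(2,1,3) by (rule lift_chain)
      then obtain \<sigma> where \<sigma>: "finite \<sigma>" "\<sigma> \<noteq> {}" "\<forall>L\<in>\<sigma>. iso_lattice L \<and> L \<noteq> {0}"
        "\<forall>L\<in>\<sigma>. \<forall>M\<in>\<sigma>. L \<subseteq> M \<or> M \<subseteq> L" "type ` \<sigma> = C" by (elim exE conjE)
      have "\<forall>L\<in>\<sigma>. \<exists>U. U \<in> ?P \<and> ?l U = L" using lattice_of_surj \<sigma>(3) by blast
      then obtain u where u: "\<And>L. L \<in> \<sigma> \<Longrightarrow> u L \<in> ?P" "\<And>L. L \<in> \<sigma> \<Longrightarrow> ?l (u L) = L" by metis
      have "u ` \<sigma> \<in> order_complex ?P"
      proof (rule order_complexI)
        show "U \<subseteq> W \<or> W \<subseteq> U" if UW: "U \<in> u ` \<sigma>" "W \<in> u ` \<sigma>" for U W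
        proof -
          obtain L M where L: "L \<in> \<sigma>" "U = u L" "M \<in> \<sigma>" "W = u M" using UW by blast
          have "?l U \<subseteq> ?l W \<or> ?l W \<subseteq> ?l U" unfolding L(2,4) u(2)[OF L(1)] u(2)[OF L(3)]
            using \<sigma>(4) L(1,3) by simp
          then show ?thesis unfolding L(2,4) by (simp only: lattice_of_order(2)[OF u(1)[OF L(1)] u(1)[OF L(3)]]
              lattice_of_order(2)[OF u(1)[OF L(3)] u(1)[OF L(1)]])
        qed
      qed (use \<sigma>(1,2) u(1) in auto)
      moreover have "building_type ` (u ` \<sigma>) = C"
        unfolding image_image \<sigma>(5)[symmetric] using u(2) by (intro image_cong) simp_all
      ultimately show ?thesis by (rule bexI[rotated])
    qed
    show "\<exists>e\<in>?G. \<forall>U\<in>?P. e U = U"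
    proof -
      obtain A where A: "A \<in> Gamma_omega n p" "\<And>U. U \<in> ?P \<Longrightarrow> matrix_map A ` ?l U = (\<lambda>x. x) ` ?l U"
        using congruence_act[OF id_congruence] by blast
      have "\<forall>U\<in>?P. act_subspace A U = U" using A by (intro ballI act_eqI) simp_all
      then show ?thesis using A(1) by (intro bexI[of _ "act_subspace A"] imageI) simp_all
    qed
    show "\<exists>k\<in>?G. \<forall>U\<in>?P. k U = g (h U)" if gh: "g \<in> ?G" "h \<in> ?G" for g h
    proof -
      obtain A B where A: "A \<in> Gamma_omega n p" "g = act_subspace A" and B: "B \<in> Gamma_omega n p" "h = act_subspace B"
        using gh by blast
      obtain D where D: "D \<in> Gamma_omega n p" "\<And>U. U \<in> ?P \<Longrightarrow> matrix_map D ` ?l U = (\<lambda>x. matrix_map A (matrix_map B x)) ` ?l U"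
        using congruence_act[OF congruence_comp[OF Gamma_congruence[OF A(1)] Gamma_congruence[OF B(1)]]] by blast
      have "act_subspace D U = g (h U)" if U: "U \<in> ?P" for U
      proof (rule act_eqI[OF D(1) U])
        have hU: "act_subspace B U \<in> ?P" by (rule act_isotropic[OF B(1) U])
        show "g (h U) \<in> ?P" unfolding A(2) B(2) by (rule act_isotropic[OF A(1) hU])
        show "matrix_map D ` ?l U = ?l (g (h U))"
          unfolding A(2) B(2) act_lattice[OF A(1) hU] act_lattice[OF B(1) U] D(2)[OF U] image_image ..
      qed
      then show ?thesis using D(1) by (intro bexI[of _ "act_subspace D"] imageI) simp_all
    qed
    show "\<exists>h\<in>?G. \<forall>U\<in>?P. h (g U) = U" if gG: "g \<in> ?G" for g
    proof -
      obtain A where A: "A \<in> Gamma_omega n p" "g = act_subspace A" using gG by blast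
      obtain h where h: "h \<in> congruence_maps" "\<forall>x\<in>\<Lambda>. h (matrix_map A x) = x \<and> matrix_map A (h x) = x"
        using congruence_maps_inverse[OF Gamma_congruence[OF A(1)]] by blast
      obtain B where B: "B \<in> Gamma_omega n p" "\<And>U. U \<in> ?P \<Longrightarrow> matrix_map B ` ?l U = h ` ?l U"
        using congruence_act[OF h(1)] by blast
      have "act_subspace B (g U) = U" if U: "U \<in> ?P" for U
      proof (rule act_eqI[OF B(1) _ U])
        show gU: "g U \<in> ?P" unfolding A(2) by (rule act_isotropic[OF A(1) U])
        have "matrix_map B ` ?l (g U) = (\<lambda>x. h (matrix_map A x)) ` ?l U"
          unfolding B(2)[OF gU] unfolding A(2) act_lattice[OF A(1) U] image_image ..
        also have "\<dots> = (\<lambda>x. x) ` ?l U" using h(2) by (intro image_cong) (simp_all add: lattice_of_def)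
        finally show "matrix_map B ` ?l (g U) = ?l U" by simp
      qed
      then show ?thesis using B(1) by (intro bexI[of _ "act_subspace B"] imageI) simp_all
    qed
    show "building_type (g U) = building_type U" if gG: "g \<in> ?G" and U: "U \<in> ?P" for g U
    proof -
      obtain A where A: "A \<in> Gamma_omega n p" "g = act_subspace A" using gG by blast
      have "lat_equiv (?l U) (?l (g U))" unfolding A(2) act_lattice[OF A(1) U] lat_equiv_def
        using Gamma_congruence[OF A(1)] by (intro bexI) simp_all
      then show ?thesis
        using lat_equiv_type(2)[OF isotropic_lattice[OF U] isotropic_lattice(1)[OF act_isotropic[OF A(1) U]]]
        by (simp only: A(2))
    qed
    show "\<exists>g\<in>?G. \<forall>U\<in>\<sigma>. g U = h U"
      if \<sigma>: "\<sigma> \<in> order_complex ?P" and h: "h ` \<sigma> \<subseteq> ?P" and t: "\<And>U. U \<in> \<sigma> \<Longrightarrow> building_type (h U) = building_type U"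
        and mono: "\<And>U W. U \<in> \<sigma> \<Longrightarrow> W \<in> \<sigma> \<Longrightarrow> U \<subset> W \<Longrightarrow> h U \<subset> h W" for \<sigma> h
    proof -
      have \<sigma>P: "U \<in> ?P" "h U \<in> ?P" if "U \<in> \<sigma>" for U using order_complexD(3)[OF \<sigma>] h that by blast+
      have inj: "inj_on ?l \<sigma>" using lattice_of_order(3) \<sigma>P(1) by (intro inj_onI) simp
      \<comment> \<open>\<open>chain_equiv\<close> speaks of lattices, so \<open>h\<close> is
        transported along the injection \<open>?l\<close>.\<close>
      define f where "f L = ?l (h (the_inv_into \<sigma> ?l L))" for L
      have f: "f (?l U) = ?l (h U)" if "U \<in> \<sigma>" for U using the_inv_into_f_f[OF inj that] by (simp add: f_def)
      have "\<exists>g\<in>congruence_maps. \<forall>L\<in>?l ` \<sigma>. g ` L = f L"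
      proof (rule chain_equiv)
        show "finite (?l ` \<sigma>)" "?l ` \<sigma> \<noteq> {}" using order_complexD(1,2)[OF \<sigma>] by simp_all
        fix L assume "L \<in> ?l ` \<sigma>"
        then obtain U where U: "U \<in> \<sigma>" "L = ?l U" by blast
        show iL: "iso_lattice L" unfolding U(2) by (rule isotropic_lattice(1)[OF \<sigma>P(1)[OF U(1)]])
        show "lat_equiv L (f L)" unfolding U(2) f[OF U(1)]
          using lab_eq[OF isotropic_lattice[OF \<sigma>P(1)[OF U(1)]] isotropic_lattice(1)[OF \<sigma>P(2)[OF U(1)]]] t[OF U(1)] by simp
        fix M assume "M \<in> ?l ` \<sigma>"
        then obtain W where W: "W \<in> \<sigma>" "M = ?l W" by blast
        show "L \<subseteq> M \<or> M \<subseteq> L" unfolding U(2) W(2) lattice_of_order(2)[OF \<sigma>P(1)[OF U(1)] \<sigma>P(1)[OF W(1)]]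
            lattice_of_order(2)[OF \<sigma>P(1)[OF W(1)] \<sigma>P(1)[OF U(1)]] by (rule order_complexD(4)[OF \<sigma> U(1) W(1)])
        show "f L \<subset> f M" if "L \<subset> M"
          using that mono[OF U(1) W(1)] unfolding U(2) W(2) f[OF U(1)] f[OF W(1)]
          by (simp only: lattice_of_order(1)[OF \<sigma>P(1)[OF U(1)] \<sigma>P(1)[OF W(1)]] lattice_of_order(1)[OF \<sigma>P(2)[OF U(1)] \<sigma>P(2)[OF W(1)]])
      qed
      then obtain g where g: "g \<in> congruence_maps" "\<forall>U\<in>\<sigma>. g ` ?l U = ?l (h U)" using f by auto
      obtain A where A: "A \<in> Gamma_omega n p" "\<And>U. U \<in> ?P \<Longrightarrow> matrix_map A ` ?l U = g ` ?l U"
        using congruence_act[OF g(1)] by blast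
      have "act_subspace A U = h U" if U: "U \<in> \<sigma>" for U
        using g(2) U A(2)[OF \<sigma>P(1)[OF U]] by (intro act_eqI[OF A(1) \<sigma>P(1)[OF U] \<sigma>P(2)[OF U]]) simp
      then show ?thesis using A(1) by (intro bexI[of _ "act_subspace A"] imageI) simp_all
    qed
  qed
  have "orbit = Gamma_orbit n p" unfolding orbit_def Gamma_orbit_def by (intro ext) blast
  moreover have "E = inflated_incident" by (intro ext) (simp add: incident_def)
  ultimately show ?thesis
    using quotient_homeomorphic_geo unfolding building_quotient_def tits_building_def by simp
qed

end

subsection \<open>The rank as a sum over index sequences\<close>

text \<open>The contribution of the inflated interval below the last member. One factor
  \<open>s\<close> belongs to that member itself, hence the exponent
  \<open>length ms - 1\<close>.\<close>

definition chain_weight :: "nat \<Rightarrow> real \<Rightarrow> nat list \<Rightarrow> real" where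
  "chain_weight p s ms = (\<Prod>i<length ms - 1. real p ^ ((ms ! (i + 1) - ms ! i) choose 2) *
     (\<Prod>j<ms ! i. (real p ^ (ms ! (i + 1) - j) - 1) / (real p ^ (ms ! i - j) - 1))) *
     real p ^ (hd ms choose 2) * s ^ (length ms - 1)"

definition seqs_to :: "nat \<Rightarrow> nat list set" where
  "seqs_to M = {ms. sorted_wrt (<) (0 # ms) \<and> ms \<noteq> [] \<and> last ms = M}"

lemma seqs_to_subset: "seqs_to M \<subseteq> index_seqs M"
  by (auto simp: seqs_to_def index_seqs_def)

lemma finite_seqs_to: "finite (seqs_to M)"
  by (rule finite_subset[OF seqs_to_subset finite_index_seqs])

lemma index_seqs_decomp: "index_seqs n = insert [] (\<Union>M\<in>{1..n}. seqs_to M)"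
proof (intro subset_antisym subsetI)
  fix ms assume ms: "ms \<in> index_seqs n"
  show "ms \<in> insert [] (\<Union>M\<in>{1..n}. seqs_to M)"
  proof (cases "ms = []")
    case False
    then have "last ms \<in> set ms" by simp
    then have "0 < last ms" using ms by (auto simp: index_seqs_def)
    moreover have "last ms \<le> n" using ms False by (simp add: index_seqs_def)
    ultimately have "last ms \<in> {1..n}" by simp
    moreover have "ms \<in> seqs_to (last ms)" using ms False by (simp add: index_seqs_def seqs_to_def)
    ultimately show ?thesis by blast
  qed simp
qed (auto simp: index_seqs_def seqs_to_def)

lemma seqs_to_decomp:
  assumes "M \<ge> 1"
  shows "seqs_to M = insert [M] (\<Union>i\<in>{1..<M}. (\<lambda>ms. ms @ [M]) ` seqs_to i)"
proof (intro subset_antisym subsetI)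
  fix ms assume ms: "ms \<in> seqs_to M"
  then obtain xs where xs: "ms = xs @ [M]" by (cases ms rule: rev_cases) (auto simp: seqs_to_def)
  show "ms \<in> insert [M] (\<Union>i\<in>{1..<M}. (\<lambda>ms. ms @ [M]) ` seqs_to i)"
  proof (cases "xs = []")
    case False
    then have l: "last xs \<in> set xs" by simp
    have s: "sorted_wrt (<) (0 # xs)" "\<forall>x\<in>set xs. x < M" using ms unfolding xs by (auto simp: seqs_to_def sorted_wrt_append)
    then have "last xs \<in> {1..<M}" using l by auto
    moreover have "xs \<in> seqs_to (last xs)" using s False by (simp add: seqs_to_def)
    ultimately show ?thesis unfolding xs by blast
  qed (simp add: xs)
next
  fix ms assume "ms \<in> insert [M] (\<Union>i\<in>{1..<M}. (\<lambda>ms. ms @ [M]) ` seqs_to i)"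
  then consider "ms = [M]" | i xs where "i \<in> {1..<M}" "xs \<in> seqs_to i" "ms = xs @ [M]" by blast
  then show "ms \<in> seqs_to M"
  proof cases
    case 1
    then show ?thesis using assms by (simp add: seqs_to_def)
  next
    case 2
    have "sorted_wrt (<) xs" "xs \<noteq> []" "last xs = i" "\<forall>x\<in>set xs. 0 < x" using 2(2) by (auto simp: seqs_to_def)
    moreover have "x \<le> i" if "x \<in> set xs" for x
      using calculation that by (cases xs rule: rev_cases) (auto simp: sorted_wrt_append)
    ultimately show ?thesis using 2(1,3) by (fastforce simp: seqs_to_def sorted_wrt_append)
  qed
qed

text \<open>The new last member adds a Gaussian binomial, a factor \<open>s\<close> and a power of
  \<open>p\<close>, which is the shape of a summand of \<open>inflated_rank\<close>.\<close>

lemma chain_weight_append: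
  assumes "xs \<noteq> []" "last xs = i"
  shows "chain_weight p s (xs @ [M]) = gauss_binomial p M i * s * chain_weight p s xs * real p ^ ((M - i) choose 2)"
proof -
  define F where "F ms i = real p ^ ((ms ! (i + 1) - ms ! i) choose 2) *
     (\<Prod>j<ms ! i. (real p ^ (ms ! (i + 1) - j) - 1) / (real p ^ (ms ! i - j) - 1))" for ms :: "nat list" and i
  obtain r where r: "length xs = Suc r" using assms(1) by (cases xs) auto
  have li: "xs ! r = i" using assms r by (simp add: last_conv_nth)
  have "(\<Prod>i<length (xs @ [M]) - 1. F (xs @ [M]) i) = (\<Prod>i<r. F (xs @ [M]) i) * F (xs @ [M]) r" by (simp add: r)
  also have "(\<Prod>i<r. F (xs @ [M]) i) = (\<Prod>i<length xs - 1. F xs i)" unfolding r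
    by (intro prod.cong) (simp_all add: F_def nth_append r)
  also have "F (xs @ [M]) r = real p ^ ((M - i) choose 2) * gauss_binomial p M i"
    by (simp add: F_def nth_append r li gauss_binomial_def)
  finally have "(\<Prod>i<length (xs @ [M]) - 1. F (xs @ [M]) i) =
    (\<Prod>i<length xs - 1. F xs i) * (real p ^ ((M - i) choose 2) * gauss_binomial p M i)" .
  then show ?thesis using assms(1) by (simp add: chain_weight_def F_def r)
qed

text \<open>Both sides satisfy the same recursion: removing the last member \<open>M\<close> leaves
  nothing or a sequence ending in some \<open>i < M\<close>.\<close>

lemma chain_weight_sum:
  assumes "M \<ge> 1"
  shows "(\<Sum>ms\<in>seqs_to M. chain_weight p s ms) = inflated_rank p s M"
  using assms
proof (induction M rule: less_induct)
  case (less M)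
  let ?w = "chain_weight p s"
  have last: "ms \<noteq> [] \<and> last ms = i" if "ms \<in> seqs_to i" for ms i using that by (simp add: seqs_to_def)
  have "(\<Sum>ms\<in>seqs_to M. ?w ms) = ?w [M] + (\<Sum>ms\<in>(\<Union>i\<in>{1..<M}. (\<lambda>ms. ms @ [M]) ` seqs_to i). ?w ms)"
    unfolding seqs_to_decomp[OF less.prems]
    by (rule sum.insert) (auto simp: finite_seqs_to dest: last)
  also have "(\<Sum>ms\<in>(\<Union>i\<in>{1..<M}. (\<lambda>ms. ms @ [M]) ` seqs_to i). ?w ms) = (\<Sum>i\<in>{1..<M}. \<Sum>ms\<in>(\<lambda>ms. ms @ [M]) ` seqs_to i. ?w ms)"
    by (rule sum.UNION_disjoint) (auto simp: finite_seqs_to dest: last)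
  also have "\<dots> = (\<Sum>i\<in>{1..<M}. gauss_binomial p M i * s * inflated_rank p s i * real p ^ ((M - i) choose 2))"
  proof (rule sum.cong)
    fix i assume i: "i \<in> {1..<M}"
    have "(\<Sum>ms\<in>(\<lambda>ms. ms @ [M]) ` seqs_to i. ?w ms) = (\<Sum>ms\<in>seqs_to i. ?w (ms @ [M]))"
      by (rule sum.reindex_cong[of "\<lambda>ms. ms @ [M]"]) (auto simp: inj_on_def)
    also have "\<dots> = (\<Sum>ms\<in>seqs_to i. (gauss_binomial p M i * s * real p ^ ((M - i) choose 2)) * ?w ms)"
      using last by (intro sum.cong) (simp_all add: chain_weight_append)
    also have "\<dots> = (gauss_binomial p M i * s * real p ^ ((M - i) choose 2)) * inflated_rank p s i"
      using less.IH[of i] i by (simp only: sum_distrib_left[symmetric]) simp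
    finally show "(\<Sum>ms\<in>(\<lambda>ms. ms @ [M]) ` seqs_to i. ?w ms) =
      gauss_binomial p M i * s * inflated_rank p s i * real p ^ ((M - i) choose 2)" by simp
  qed simp
  finally show ?case by (subst inflated_rank.simps) (simp add: chain_weight_def)
qed

lemma index_seqs_sum:
  "(\<Sum>ms\<in>index_seqs n. f ms) = f [] + (\<Sum>M\<in>{1..n}. \<Sum>ms\<in>seqs_to M. (f ms :: real))"
proof -
  have "(\<Sum>ms\<in>index_seqs n. f ms) = f [] + (\<Sum>ms\<in>(\<Union>M\<in>{1..n}. seqs_to M). f ms)"
    unfolding index_seqs_decomp by (rule sum.insert) (auto simp: finite_seqs_to, auto simp: seqs_to_def)
  also have "(\<Sum>ms\<in>(\<Union>M\<in>{1..n}. seqs_to M). f ms) = (\<Sum>M\<in>{1..n}. \<Sum>ms\<in>seqs_to M. f ms)"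
    by (rule sum.UNION_disjoint) (auto simp: finite_seqs_to, auto simp: seqs_to_def)
  finally show ?thesis .
qed

lemma (in symp) t_omega_spherical:
  assumes m: "p = 2 * m + 1" "m \<ge> 1" and n: "n \<ge> 1"
  shows "\<exists>k. t_omega n p = enat k \<and> real k = real p ^ (n\<^sup>2) +
    (\<Sum>i\<in>{1..n}. isotropic_count p n i * (real m - 1) * inflated_rank p (real m - 1) i * real p ^ ((n - i)\<^sup>2))"
proof (rule labels_exist[OF m(1)])
  fix lab assume lab: "\<And>L. iso_lattice L \<Longrightarrow> L \<noteq> {0} \<Longrightarrow> lab L < m"
    "\<And>L M. iso_lattice L \<Longrightarrow> L \<noteq> {0} \<Longrightarrow> iso_lattice M \<Longrightarrow> redL L = redL M \<Longrightarrow> lab L = lab M \<longleftrightarrow> lat_equiv L M"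
    "\<And>V c. V \<in> isotropic_above pl \<Longrightarrow> c < m \<Longrightarrow> \<exists>L. iso_lattice L \<and> redL L = V \<and> lab L = c"
  let ?Q = "isotropic_above pl \<times> {..<m}"
  interpret labelled n p m lab by unfold_locales (rule lab; assumption)+
  obtain k where k: "spherical inflated_incident ?Q n k" "real k = real p ^ (n\<^sup>2) +
    (\<Sum>i\<in>{1..n}. isotropic_count p n i * (real m - 1) * inflated_rank p (real m - 1) i * real p ^ ((n - i)\<^sup>2))"
    using spherical_inflated_isotropic[OF n m(2)] by (elim exE conjE)
  \<comment> \<open>An empty complex would have index 0, against \<open>n \<ge> 1\<close>.\<close>
  have "?Q \<noteq> {}" using spherical_empty[OF k(1)] n by auto
  moreover have "inflated_incident y x" if "inflated_incident x y" for x y :: "(nat \<Rightarrow> int) set \<times> nat"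
    using that unfolding incident_def by (rule disj_commute[THEN iffD1])
  ultimately have "reduced_homology_group (int n - 1) (top_of_set (geo inflated_incident ?Q)) \<cong> free_Abelian_group {..<k}"
    using spherical_homology[OF _ k(1)] by blast
  then have "reduced_homology_group (int n - 1) (building_quotient n p) \<cong> free_Abelian_group {..<k}"
    using homeomorphic_space_imp_isomorphic_reduced_homology_groups[OF building_homeomorphic] iso_trans by blast
  then have "t_omega n p = enat k" unfolding t_omega_def by (rule abelian_rank_eq[OF comm_group_reduced_homology])
  then show ?thesis using k(2) by blast
qed

theorem theorem1:
  fixes n p :: nat
  assumes "prime p" and "p \<ge> 3" and "n \<ge> 1"
  shows "ereal_of_enat (t_omega n p) = ereal
    (\<Sum>ms \<in> index_seqs n.
      (\<Prod>i < length ms - 1.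
         real p ^ ((ms ! (i + 1) - ms ! i) choose 2) *
         (\<Prod>j < ms ! i.
            (real p ^ (ms ! (i + 1) - j) - 1) / (real p ^ (ms ! i - j) - 1))) *
      (\<Prod>i < last (0 # ms).
         (real p ^ (2 * n - 2 * i) - 1) / (real p ^ (last (0 # ms) - i) - 1)) *
      real p ^ (((if ms = [] then 0 else hd ms) choose 2) + (n - last (0 # ms)) ^ 2) *
      ((real p - 3) / 2) ^ length ms)"
proof -
  interpret symp n p by unfold_locales (rule assms(1))
  have "odd p" using assms(1,2) prime_odd_nat by simp
  then obtain m where m: "p = 2 * m + 1" by (rule oddE)
  then have m1: "m \<ge> 1" using assms(2) by simp
  \<comment> \<open>The number of labels other than 0, equal to (p - 3) / 2.\<close>
  define s where "s = real m - 1"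
  have s: "(real p - 3) / 2 = s" by (simp add: s_def m)
  obtain k where k: "t_omega n p = enat k" "real k = real p ^ (n\<^sup>2) +
    (\<Sum>i\<in>{1..n}. isotropic_count p n i * s * inflated_rank p s i * real p ^ ((n - i)\<^sup>2))"
    using t_omega_spherical[OF m m1 assms(3)] unfolding s_def by (elim exE conjE)
  let ?f = "\<lambda>ms. (\<Prod>i < length ms - 1.
         real p ^ ((ms ! (i + 1) - ms ! i) choose 2) *
         (\<Prod>j < ms ! i.
            (real p ^ (ms ! (i + 1) - j) - 1) / (real p ^ (ms ! i - j) - 1))) *
      (\<Prod>i < last (0 # ms).
         (real p ^ (2 * n - 2 * i) - 1) / (real p ^ (last (0 # ms) - i) - 1)) *
      real p ^ (((if ms = [] then 0 else hd ms) choose 2) + (n - last (0 # ms)) ^ 2) *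
      ((real p - 3) / 2) ^ length ms"
  have "(\<Sum>ms\<in>seqs_to M. ?f ms) = isotropic_count p n M * s * inflated_rank p s M * real p ^ ((n - M)\<^sup>2)"
    if M: "M \<in> {1..n}" for M
  proof -
    have "?f ms = (isotropic_count p n M * s * real p ^ ((n - M)\<^sup>2)) * chain_weight p s ms" if ms: "ms \<in> seqs_to M" for ms
    proof -
      have l: "ms \<noteq> []" "last ms = M" using ms by (auto simp: seqs_to_def)
      \<comment> \<open>One factor belongs to the top subspace, as in
        \<open>spherical_inflated_isotropic\<close>; the others are in
        \<open>chain_weight\<close>.\<close>
      then have "s ^ length ms = s * s ^ (length ms - 1)" by (cases ms) simp_all
      then show ?thesis unfolding s using l
        by (simp add: chain_weight_def isotropic_count_def power_add del: power_Suc)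
    qed
    then have "(\<Sum>ms\<in>seqs_to M. ?f ms) = (\<Sum>ms\<in>seqs_to M. (isotropic_count p n M * s * real p ^ ((n - M)\<^sup>2)) * chain_weight p s ms)"
      by (intro sum.cong refl)
    also have "\<dots> = (isotropic_count p n M * s * real p ^ ((n - M)\<^sup>2)) * inflated_rank p s M"
      using chain_weight_sum[of M p s] M by (simp only: sum_distrib_left[symmetric]) simp
    finally show ?thesis by simp
  qed
  \<comment> \<open>The empty sequence accounts for the rank of the building without extra
    labels.\<close>
  then have "(\<Sum>ms\<in>index_seqs n. ?f ms) = real k" unfolding index_seqs_sum k(2) by (simp add: numeral_2_eq_2)
  then show ?thesis by (simp add: k(1))
qed

end
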